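(* Let $R>0$, $\gamma>1$, $\mu>0$, $\kappa>0$ be constants. Consider the boundary layer problem for $(V,U,\Theta)(\xi)$, $\xi\ge 0$, $$ \begin{cases} -\sigma_-V_\xi-U_\xi=0,\\ -\sigma_-U_\xi+P_\xi=\mu\left(\dfrac{U_\xi}{V}\right)_\xi,\qquad \xi>0,\\ -\sigma_-\left(\dfrac{R\Theta}{\gamma-1}+\dfrac{U^2}{2}\right)_\xi+(PU)_\xi=\kappa\left(\dfrac{\Theta_\xi}{V}\right)_\xi+\mu\left(\dfrac{UU_\xi}{V}\right)_\xi,\\ (V,U,\Theta)(0)=(v_-,u_-,\theta_-),\qquad (V,U,\Theta)(+\infty)=(v_+,u_+,\theta_+), \end{cases}\qquad (\mathrm{BL}) $$ where $P=\frac{R\Theta}{V}$ and $\sigma_-=-\frac{u_-}{v_-}$, with $v_\pm>0$, $u_->0$, $\theta_\pm>0$ (inflow problem). Then the following holds. - If $u_+\le 0$, then there is no boundary layer solution to (BL). - If $u_+>0$, set $M_+:=\frac{|u_+|}{\sqrt{R\gamma\theta_+}}$. **Case I** (supersonic, $M_+>1$). There is no boundary layer solution to (BL). **Case II** (transonic, $M_+=1$). There exists a unique curve $\Sigma$ in the $(u,\theta)$-plane such that: (1) $\Sigma$ is monotone in $(u,\theta)$-space, with $0<u<u_+$ and $0<\theta_+<\theta$ on it. (2) $\Sigma$ is tangent to the straight line $(\gamma-1)u_+(u-u_+)+R\gamma(\theta-\theta_+)=0$ at the point $(u_+,\theta_+)$. (3) A boundary layer solution $(V,U,\Theta)(\xi)$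 to (BL) exists if and only if $(u_-,\theta_-)\in\Sigma$ and $\frac{u_-}{v_-}=\frac{u_+}{v_+}$. Moreover, the solution is monotone with $V'>0$, $U'>0$, $\Theta'<0$, and for every $n=0,1,2,\dots$ it satisfies $$\left|\frac{d^n}{d\xi^n}(V-v_+,U-u_+,\Theta-\theta_+)\right|\le \frac{C}{(1+\xi)^{n+1}},\qquad \forall\,\xi>0,$$ for some positive constant $C$ (which may depend on $n$). **Case III** (subsonic, $0<M_+<1$). There exists a unique piecewise smooth curve in the $(u,\theta)$-plane consisting of two segments $\Gamma_1$ and $\Gamma_2$ such that: (1) Both $\Gamma_1$ and $\Gamma_2$ are monotone in $(u,\theta)$-space; $\Gamma_1$ is defined on $0<u<u_+$, and $\Gamma_2$ is defined on $\max\{0,\alpha_2\theta_+\}<\theta<\theta_+$, where $$\alpha_2:=1-\frac{2(1-M_+^2)(M_+^2\gamma+1)(\gamma-1)}{M_+^2(\gamma+1)^2}.$$ (2) Both $\Gamma_1$ and $\Gamma_2$ are tangent to the straight line $$u_+^2(u-u_+)+M_+^2\gamma\kappa\left(\frac{Ru_+}{\kappa(\gamma-1)}-\lambda_2\right)(\theta-\theta_+)=0$$ at the point $(u_+,\theta_+)$, where $\lambda_2$ is the negative eigenvalue of the matrix $$A=\begin{pmatrix}\dfrac{(M_+^2\gamma-1)u_+}{M_+^2\gamma\mu} & \dfrac{R}{\mu}\\[3mm] \dfrac{u_+^2}{M_+^2\gamma\kappa} & \dfrac{Ru_+}{\kappa(\gamma-1)}\end{pmatrix}.$$ (3) A boundary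 layer solution $(V,U,\Theta)(\xi)$ to (BL) exists if and only if $(u_-,\theta_-)\in\Gamma_1\cup\Gamma_2$ and $\frac{u_-}{v_-}=\frac{u_+}{v_+}$. The solution is monotone, with $V'>0$, $U'>0$, $\Theta'<0$ if $(u_-,\theta_-)\in\Gamma_1$, and $V'<0$, $U'<0$, $\Theta'>0$ if $(u_-,\theta_-)\in\Gamma_2$. Moreover, for every $n=0,1,2,\dots$, $$\left|\frac{d^n}{d\xi^n}(V-v_+,U-u_+,\Theta-\theta_+)\right|\le Ce^{-c\xi},\qquad \forall\,\xi>0,$$ for some positive constants $C$ and $c$ ($C$ may depend on $n$).
   Context: Here (BL) is the stationary problem on the half line $\xi>0$ for the one-dimensional full compressible Navier–Stokes equations of an ideal polytropic gas in Lagrangian coordinates, with $V$ the specific volume, $U$ the velocity, $\Theta$ the absolute temperature, $R$ the gas constant, $\gamma$ the adiabatic exponent, $\mu$ the viscosity and $\kappa$ the heat conductivity. A boundary layer solution to (BL) means a smooth nonconstant solution on $[0,+\infty)$ with $V(\xi)>0$, $U(\xi)>0$ and $\Theta(\xi)>0$ for all $\xi\in[0,+\infty)$. The condition $(V,U,\Theta)(+\infty)=(v_+,u_+,\theta_+)$ means convergence as $\xi\to+\infty$. The prime denotes $\frac{d}{d\xi}$. The right state $(v_+,u_+,\theta_+)$ and the constants $R,\gamma,\mu,\kappa$ are regarded as given, and the curves $\Sigma$, $\Gamma_1$, $\Gamma_2$ are determined by them. These curves have $(u_+,\theta_+)$ as a (non-included) endpoint, and tangency at $(u_+,\theta_+)$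 is understood as tangency at this endpoint. When $0<M_+<1$ the matrix $A$ has two real eigenvalues of opposite signs. *)

theory Defs
  imports "HOL-Analysis.Analysis" "Jordan_Normal_Form.Char_Poly"
begin

text \<open>
  Iterated derivatives relative to a set; on the half line \<open>{0..}\<close> the derivatives at \<open>0\<close> are
  one-sided, so values of \<open>f\<close> outside \<open>S\<close> are irrelevant. Only meaningful where \<open>smooth_within\<close>
  holds.
\<close>

primrec nderiv_within :: "real set \<Rightarrow> nat \<Rightarrow> (real \<Rightarrow> 'a::real_normed_vector) \<Rightarrow> real \<Rightarrow> 'a" where
  "nderiv_within S 0 f = f"
| "nderiv_within S (Suc n) f = (\<lambda>x. vector_derivative (nderiv_within S n f) (at x within S))"

definition smooth_within :: "real set \<Rightarrow> (real \<Rightarrow> 'a::real_normed_vector) \<Rightarrow> bool" where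
  "smooth_within S f \<longleftrightarrow> (\<forall>n. \<forall>x\<in>S. nderiv_within S n f differentiable (at x within S))"

abbreviation d_xi :: "(real \<Rightarrow> real) \<Rightarrow> real \<Rightarrow> real" where
  "d_xi f \<xi> \<equiv> vector_derivative f (at \<xi> within {0..})"

text \<open>
  States are triples (specific volume, velocity, temperature): first the left state (at \<open>\<xi> = 0\<close>),
  then the right state (at infinity).
\<close>

definition boundary_layer_solution ::
    "real \<Rightarrow> real \<Rightarrow> real \<Rightarrow> real \<Rightarrow> real \<times> real \<times> real \<Rightarrow> real \<times> real \<times> real
     \<Rightarrow> (real \<Rightarrow> real) \<Rightarrow> (real \<Rightarrow> real) \<Rightarrow> (real \<Rightarrow> real) \<Rightarrow> bool" where
  "boundary_layer_solution R \<gamma> \<mu> \<kappa> left_state right_state V U \<Theta> \<longleftrightarrow>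
    (let \<sigma> = - (fst (snd left_state) / fst left_state);
         P = (\<lambda>\<xi>. R * \<Theta> \<xi> / V \<xi>)
     in
       smooth_within {0..} V \<and> smooth_within {0..} U \<and> smooth_within {0..} \<Theta> \<and>
       \<not> (\<lambda>\<xi>. (V \<xi>, U \<xi>, \<Theta> \<xi>)) constant_on {0..} \<and>
       (\<forall>\<xi>\<ge>0. V \<xi> > 0 \<and> U \<xi> > 0 \<and> \<Theta> \<xi> > 0) \<and>
       (\<forall>\<xi>>0. - \<sigma> * d_xi V \<xi> - d_xi U \<xi> = 0) \<and>
       (\<forall>\<xi>>0. - \<sigma> * d_xi U \<xi> + d_xi P \<xi> = \<mu> * d_xi (\<lambda>x. d_xi U x / V x) \<xi>) \<and>
       (\<forall>\<xi>>0. - \<sigma> * d_xi (\<lambda>x. R * \<Theta> x / (\<gamma> - 1) + (U x)\<^sup>2 / 2) \<xi> + d_xi (\<lambda>x. P x * U x) \<xi>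
          = \<kappa> * d_xi (\<lambda>x. d_xi \<Theta> x / V x) \<xi> + \<mu> * d_xi (\<lambda>x. U x * d_xi U x / V x) \<xi>) \<and>
       (V 0, U 0, \<Theta> 0) = left_state \<and>
       ((\<lambda>\<xi>. (V \<xi>, U \<xi>, \<Theta> \<xi>)) \<longlongrightarrow> right_state) at_top)"

definition perturbation ::
    "real \<times> real \<times> real \<Rightarrow> (real \<Rightarrow> real) \<Rightarrow> (real \<Rightarrow> real) \<Rightarrow> (real \<Rightarrow> real)
     \<Rightarrow> real \<Rightarrow> real \<times> real \<times> real" where
  "perturbation right_state V U \<Theta> = (\<lambda>\<xi>. (V \<xi>, U \<xi>, \<Theta> \<xi>) - right_state)"

definition mach :: "real \<Rightarrow> real \<Rightarrow> real \<Rightarrow> real \<Rightarrow> real" where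
  "mach R \<gamma> u \<theta> = \<bar>u\<bar> / sqrt (R * \<gamma> * \<theta>)"

definition matrix_A :: "real \<Rightarrow> real \<Rightarrow> real \<Rightarrow> real \<Rightarrow> real \<Rightarrow> real \<Rightarrow> real mat" where
  "matrix_A R \<gamma> \<mu> \<kappa> u \<theta> =
    (let M = mach R \<gamma> u \<theta> in
     mat_of_rows_list 2
       [[(M\<^sup>2 * \<gamma> - 1) * u / (M\<^sup>2 * \<gamma> * \<mu>), R / \<mu>],
        [u\<^sup>2 / (M\<^sup>2 * \<gamma> * \<kappa>), R * u / (\<kappa> * (\<gamma> - 1))]])"

definition lambda2 :: "real \<Rightarrow> real \<Rightarrow> real \<Rightarrow> real \<Rightarrow> real \<Rightarrow> real \<Rightarrow> real" where
  "lambda2 R \<gamma> \<mu> \<kappa> u \<theta> = (THE l. eigenvalue (matrix_A R \<gamma> \<mu> \<kappa> u \<theta>) l \<and> l < 0)"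

definition alpha2 :: "real \<Rightarrow> real \<Rightarrow> real" where
  "alpha2 \<gamma> M = 1 - 2 * (1 - M\<^sup>2) * (M\<^sup>2 * \<gamma> + 1) * (\<gamma> - 1) / (M\<^sup>2 * (\<gamma> + 1)\<^sup>2)"

text \<open>
  A curve in the \<open>(u, \<theta>)\<close>-plane is a point set \<open>\<Gamma>\<close>; \<open>p\<close> is an endpoint not belonging to it.
  A parametrization is regular and injective, smooth on the curve itself and \<open>C\<^sup>1\<close> up to the
  endpoint \<open>p\<close>. The library's \<open>C1_differentiable_on\<close> uses two-sided derivatives, also at the
  parameter \<open>0\<close>; this is no restriction, as \<open>g\<close> may be extended affinely to negative parameters.
\<close>

definition parametrizes_from ::
    "(real \<Rightarrow> real \<times> real) \<Rightarrow> real \<times> real \<Rightarrow> (real \<times> real) set \<Rightarrow> bool" where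
  "parametrizes_from g p \<Gamma> \<longleftrightarrow>
     g 0 = p \<and> g ` {0<..<1} = \<Gamma> \<and> inj_on g {0..<1} \<and>
     smooth_within {0<..<1} g \<and> g C1_differentiable_on {0..<1} \<and>
     (\<forall>t\<in>{0..<1}. vector_derivative g (at t) \<noteq> 0)"

definition smooth_curve_from :: "real \<times> real \<Rightarrow> (real \<times> real) set \<Rightarrow> bool" where
  "smooth_curve_from p \<Gamma> \<longleftrightarrow> (\<exists>g. parametrizes_from g p \<Gamma>)"

definition tangent_at_endpoint ::
    "real \<times> real \<Rightarrow> (real \<times> real) set \<Rightarrow> (real \<times> real) set \<Rightarrow> bool" where
  "tangent_at_endpoint p \<Gamma> L \<longleftrightarrow>
     (\<exists>g. parametrizes_from g p \<Gamma> \<and> L = range (\<lambda>s. p + s *\<^sub>R vector_derivative g (at 0)))"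

text \<open>
  Strict monotonicity, in either sense: along the curve, each coordinate is a strictly increasing
  function of the other, or each is a strictly decreasing function of the other.
\<close>

definition monotone_curve :: "(real \<times> real) set \<Rightarrow> bool" where
  "monotone_curve \<Gamma> \<longleftrightarrow>
     (\<forall>p\<in>\<Gamma>. \<forall>q\<in>\<Gamma>. fst p < fst q \<longleftrightarrow> snd p < snd q) \<or>
     (\<forall>p\<in>\<Gamma>. \<forall>q\<in>\<Gamma>. fst p < fst q \<longleftrightarrow> snd q < snd p)"

end

theory Submission
  imports Defs "HOL-Real_Asymp.Real_Asymp"
begin

text \<open>The three equations are total derivatives. Integrating them from \<open>\<xi>\<close> to infinity shows
\<open>U = u\<^sub>p V / v\<^sub>p\<close> and leaves a planar autonomous system for the scaled deviations \<open>X\<close> of \<open>U\<close> and \<open>Y\<close> of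
\<open>\<Theta>\<close>, so \<open>u\<^sub>p > 0\<close> is necessary and boundary layers are the nonconstant orbits converging to the origin.
Supersonically the origin repels. Otherwise let \<open>p\<close> and \<open>q\<close> be the distances of \<open>Y\<close> to the two
nullclines: \<open>p q\<close> can cross zero only upwards along an orbit and tends to 0, hence it stays negative, so the orbit
runs strictly between the nullclines, on one side of the origin. There, orbits are graphs over \<open>X\<close> solving a
scalar equation that is singular at the origin but contracts away from it; the limit of
solutions started closer and closer to the origin is the only graph that orbits reaching the origin can follow.
Its endpoint slope is found from the ratio in which it divides the gap between the nullclines. The decay
of all derivatives follows recursively from the equations, a transonic orbit obeying \<open>X' \<approx> - c X\<^sup>2\<close>
because the unstable component is slaved to the quadratic terms.\<close>

subsection \<open>One-variable calculus\<close>

text \<open>The obstacle is the transonic case: there the linearisation at the origin has a zero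
  eigenvalue, so a hyperbolic stable manifold argument would not cover it. Orbits sought as graphs
  over \<open>X\<close> are treated alike in both cases; only the decay estimates differ. The case
  is encoded in \<open>e\<close> = 1/M^2 - 1, which is minus the determinant of the linearisation
  divided by \<open>m * n\<close>. The gap between the nullclines is linear at the origin with slope
  \<open>e\<close>, and quadratic when \<open>e = 0\<close>. For \<open>\<sigma> = 1\<close> the
  nullclines meet again at X = 2e/(g + 2). The temperature of this second equilibrium is the origin
  of \<open>alpha2\<close>, and the maximum with 0 in the range of the second curve occurs because
  the temperature may vanish earlier. Positivity of velocity and temperature, X > -1 and Y > -a, is
  what handles the region X \<ge> a, where the sign argument by itself would fail. The ratio
  \<open>zc\<close> in which the endpoint divides the gap solves a quadratic equation. For
  \<open>e > 0\<close> it is the characteristic equation under \<lambda> = - m e zc, which is how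
  \<open>lambda2\<close> enters the tangent line.\<close>

lemma has_real_derivative_interior:
  fixes f :: "real \<Rightarrow> real"
  assumes "(f has_real_derivative D) (at x within S)" "{a..b} \<subseteq> S" "a < x" "x < b"
  shows "(f has_real_derivative D) (at x)"
  using DERIV_subset[OF assms(1,2)] assms(3,4) by (simp add: at_within_Icc_at)

lemma has_real_derivative_imp_continuous_on:
  fixes f :: "real \<Rightarrow> real"
  assumes "\<And>x. x \<in> S \<Longrightarrow> (f has_real_derivative f' x) (at x within S)"
  shows "continuous_on S f"
  using assms DERIV_continuous continuous_on_eq_continuous_within by blast

lemma mono_of_deriv_nonneg:
  fixes f :: "real \<Rightarrow> real"
  assumes "a \<le> b" "{a..b} \<subseteq> S"
    and d: "\<And>x. x \<in> {a..b} \<Longrightarrow> (f has_real_derivative f' x) (at x within S)"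
    and "\<And>x. x \<in> {a..b} \<Longrightarrow> 0 \<le> f' x"
  shows "f a \<le> f b"
proof (rule DERIV_nonneg_imp_increasing_open[OF assms(1)])
  show "continuous_on {a..b} f"
    by (rule has_real_derivative_imp_continuous_on[where f'=f']) (use d assms(2) DERIV_subset in blast)
  show "\<exists>y. (f has_real_derivative y) (at x) \<and> 0 \<le> y" if "a < x" "x < b" for x
    using has_real_derivative_interior[OF d assms(2) that] assms(4)[of x] that by auto
qed

lemma strict_mono_of_deriv_pos:
  fixes f :: "real \<Rightarrow> real"
  assumes "a < b" "{a..b} \<subseteq> S"
    and d: "\<And>x. x \<in> {a..b} \<Longrightarrow> (f has_real_derivative f' x) (at x within S)"
    and "\<And>x. x \<in> {a..b} \<Longrightarrow> 0 < f' x"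
  shows "f a < f b"
proof (rule DERIV_pos_imp_increasing_open[OF assms(1)])
  show "continuous_on {a..b} f"
    by (rule has_real_derivative_imp_continuous_on[where f'=f']) (use d assms(2) DERIV_subset in blast)
  show "\<exists>y. (f has_real_derivative y) (at x) \<and> 0 < y" if "a < x" "x < b" for x
    using has_real_derivative_interior[OF d assms(2) that] assms(4)[of x] that by auto
qed

lemma last_nonneg_time:
  fixes W :: "real \<Rightarrow> real"
  assumes c: "continuous_on {a..b} W" and "a \<le> b" "W a \<ge> 0" "W b < 0"
  obtains s where "a \<le> s" "s < b" "W s = 0" "\<And>t. s < t \<Longrightarrow> t \<le> b \<Longrightarrow> W t < 0"
proof -
  define Z where "Z = {t \<in> {a..b}. W t \<ge> 0}"
  have "closed Z" unfolding Z_def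
    using continuous_closed_preimage[OF c closed_atLeastAtMost closed_atLeast[of 0]]
    by (simp add: vimage_def Int_def conj_commute)
  moreover have "Z \<noteq> {}" "bdd_above Z"
    unfolding Z_def using assms by (auto intro!: bdd_aboveI[of _ b])
  ultimately have sZ: "Sup Z \<in> Z" using closed_contains_Sup by blast
  define s where "s = Sup Z"
  have s: "a \<le> s" "s \<le> b" "W s \<ge> 0" using sZ by (auto simp: s_def Z_def)
  have after: "W t < 0" if "s < t" "t \<le> b" for t
  proof (rule ccontr)
    assume "\<not> W t < 0"
    then have "t \<in> Z" using that s by (auto simp: Z_def)
    then have "t \<le> s" using \<open>bdd_above Z\<close> by (simp add: s_def cSup_upper)
    then show False using that by simp
  qed
  have "s < b" using s assms(4) by (cases "s = b") auto
  moreover have "W s = 0"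
  proof (rule ccontr)
    assume "W s \<noteq> 0"
    then have "W s > 0" using s by simp
    then obtain t where "s \<le> t" "t \<le> b" "W t = 0"
      using IVT2'[of W b 0 s] assms(4) s continuous_on_subset[OF c, of "{s..b}"] by auto
    moreover have "t \<noteq> s" using \<open>W t = 0\<close> \<open>W s \<noteq> 0\<close> by auto
    ultimately show False using after[of t] by simp
  qed
  ultimately show thesis using that s after by blast
qed

text \<open>Barrier principle: the derivative is controlled only at zeros of \<open>W\<close>. If
  \<open>W\<close> became negative, the last zero before that would have smaller values immediately
  to its right, against the positive derivative there; a zero at \<open>b\<close> itself is excluded
  by looking to its left.\<close>

lemma pos_after_nonneg:
  fixes W :: "real \<Rightarrow> real"
  assumes c: "continuous_on {a..b} W" and "a < b" "W a \<ge> 0"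
    and d: "\<And>t. \<lbrakk>a \<le> t; t \<le> b; W t = 0\<rbrakk> \<Longrightarrow> \<exists>D>0. (W has_real_derivative D) (at t within {a..b})"
  shows "W b > 0"
proof -
  have no_neg: "W t \<ge> 0" if at: "a \<le> t" and tb: "t \<le> b" for t
  proof (rule ccontr)
    assume "\<not> W t \<ge> 0"
    then have "W t < 0" by simp
    have "continuous_on {a..t} W" using continuous_on_subset[OF c] that by auto
    then obtain s where s: "a \<le> s" "s < t" "W s = 0" "\<And>r. s < r \<Longrightarrow> r \<le> t \<Longrightarrow> W r < 0"
      using last_nonneg_time[of a t W] at assms(3) \<open>W t < 0\<close> by metis
    obtain D where D: "D > 0" "(W has_real_derivative D) (at s within {a..b})"
      using d[of s] s at tb by auto
    obtain \<delta> where \<delta>: "\<delta> > 0" "\<And>h. h > 0 \<Longrightarrow> s + h \<in> {a..b} \<Longrightarrow> h < \<delta> \<Longrightarrow> W s < W (s + h)"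
      using has_real_derivative_pos_inc_right[OF D(2,1)] by auto
    define h where "h = min (\<delta>/2) (t - s)"
    have "h > 0" "h < \<delta>" "s + h \<le> t" using \<delta>(1) s(2) by (auto simp: h_def)
    then show False using \<delta>(2)[of h] s(1,3) s(4)[of "s+h"] at tb by auto
  qed
  have "W b \<noteq> 0"
  proof
    assume "W b = 0"
    then obtain D where D: "D > 0" "(W has_real_derivative D) (at b within {a..b})"
      using d[of b] assms(2) by auto
    obtain \<delta> where \<delta>: "\<delta> > 0" "\<And>h. h > 0 \<Longrightarrow> b - h \<in> {a..b} \<Longrightarrow> h < \<delta> \<Longrightarrow> W (b - h) < W b"
      using has_real_derivative_pos_inc_left[OF D(2,1)] by auto
    define h where "h = min (\<delta>/2) (b - a)"
    have "h > 0" "h < \<delta>" "b - h \<ge> a" using \<delta>(1) assms(2) by (auto simp: h_def)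
    then show False using \<delta>(2)[of h] no_neg[of "b-h"] \<open>W b = 0\<close> by auto
  qed
  then show ?thesis using no_neg[of b] assms(2) by simp
qed

text \<open>Mean value points \<open>z t\<close> in (t, t + 1) tend to infinity with
  \<open>t\<close>, while \<open>f (t + 1) - f t\<close> tends to 0.\<close>

lemma derivative_limit_zero:
  fixes f :: "real \<Rightarrow> real"
  assumes d: "\<And>t. t \<ge> 0 \<Longrightarrow> (f has_real_derivative f' t) (at t within {0..})"
    and f: "(f \<longlongrightarrow> L) at_top" and f': "(f' \<longlongrightarrow> l) at_top"
  shows "l = 0"
proof -
  have "\<exists>z. t < z \<and> f (t + 1) - f t = f' z" if "t > 0" for t
  proof -
    have "\<exists>z. t < z \<and> z < t + 1 \<and> f (t + 1) - f t = (t + 1 - t) * f' z"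
    proof (rule MVT2)
      fix x assume "t \<le> x" "x \<le> t + 1"
      then show "(f has_real_derivative f' x) (at x)"
        using has_real_derivative_interior[OF d, of x 0 "x+1"] that by auto
    qed simp
    then show ?thesis by auto
  qed
  then obtain z where z: "\<And>t. t > 0 \<Longrightarrow> t < z t \<and> f (t + 1) - f t = f' (z t)" by metis
  have "filterlim z at_top at_top"
  proof (rule filterlim_at_top_mono[OF filterlim_ident])
    show "eventually (\<lambda>t. t \<le> z t) at_top"
      using eventually_gt_at_top[of 0] by eventually_elim (use z in force)
  qed
  then have lim: "((\<lambda>t. f' (z t)) \<longlongrightarrow> l) at_top"
    by (rule filterlim_compose[OF f'])
  have "filterlim (\<lambda>t::real. t + 1) at_top at_top"
    by (rule filterlim_at_top_mono[OF filterlim_ident]) (auto intro!: always_eventually)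
  then have "((\<lambda>t. f (t + 1)) \<longlongrightarrow> L) at_top"
    by (rule filterlim_compose[OF f])
  then have "((\<lambda>t. f (t + 1) - f t) \<longlongrightarrow> L - L) at_top"
    by (intro tendsto_diff f)
  moreover have "\<forall>\<^sub>F t in at_top. f (t + 1) - f t = f' (z t)"
    using eventually_gt_at_top[of 0] by eventually_elim (use z in blast)
  ultimately have "((\<lambda>t. f' (z t)) \<longlongrightarrow> L - L) at_top"
    by (rule Lim_transform_eventually)
  then have "l = L - L"
    using lim tendsto_unique[OF trivial_limit_at_top_linorder] by metis
  then show ?thesis by simp
qed

text \<open>A quantity that would escape at a logarithmic rate towards 0 cannot be bounded.\<close>

lemma below_of_log_escape:
  fixes w :: "real \<Rightarrow> real"
  assumes d: "\<And>x. \<lbrakk>0 < x; x < x1\<rbrakk> \<Longrightarrow> (w has_real_derivative w' x) (at x)"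
    and e: "\<And>x. \<lbrakk>0 < x; x < x1; w x \<ge> \<epsilon>\<rbrakk> \<Longrightarrow> w' x \<le> - \<delta> / x"
    and b: "\<And>x. \<lbrakk>0 < x; x < x1\<rbrakk> \<Longrightarrow> w x \<le> B" and "\<delta> > 0"
    and x: "0 < x" "x < x1"
  shows "w x < \<epsilon>"
proof (rule ccontr)
  assume ge: "\<not> w x < \<epsilon>"
  \<comment> \<open>The level \<epsilon> can only be crossed downwards as the argument grows, so a
    value at or above it at \<open>x\<close> forces the same at all smaller arguments.\<close>
  have above: "w t \<ge> \<epsilon>" if t: "0 < t" "t < x" for t
  proof (rule ccontr)
    assume "\<not> w t \<ge> \<epsilon>"
    have "\<epsilon> - w x > 0"
    proof (rule pos_after_nonneg[of t x "\<lambda>s. \<epsilon> - w s"])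
      show "continuous_on {t..x} (\<lambda>s. \<epsilon> - w s)"
        by (rule has_real_derivative_imp_continuous_on[where f'="\<lambda>s. - w' s"])
          (use t x in \<open>auto intro!: derivative_eq_intros has_field_derivative_at_within[OF d]\<close>)
      fix s assume s: "t \<le> s" "s \<le> x" "\<epsilon> - w s = 0"
      have "\<delta> / s > 0" using s t \<open>\<delta> > 0\<close> by auto
      then have "- w' s > 0" using e[of s] s t x by auto
      moreover have "((\<lambda>s. \<epsilon> - w s) has_real_derivative - w' s) (at s within {t..x})"
        using s t x by (auto intro!: derivative_eq_intros has_field_derivative_at_within[OF d])
      ultimately show "\<exists>D>0. ((\<lambda>s. \<epsilon> - w s) has_real_derivative D) (at s within {t..x})" by blast
    qed (use t \<open>\<not> w t \<ge> \<epsilon>\<close> in auto)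
    then show False using ge by simp
  qed
  \<comment> \<open>Chosen so that the logarithmic gain \<delta> ln(x/t) equals
    \<open>\<bar>B - \<epsilon>\<bar> + 1\<close>, enough to lift \<open>w t\<close> above
    \<open>B\<close>.\<close>
  define t where "t = x * exp (- (\<bar>B - \<epsilon>\<bar> + 1) / \<delta>)"
  have t: "0 < t" "t < x" using x \<open>\<delta> > 0\<close> by (auto simp: t_def divide_neg_pos)
  have "- w t - \<delta> * ln t \<le> - w x - \<delta> * ln x"
  proof (rule mono_of_deriv_nonneg[of t x UNIV "\<lambda>s. - w s - \<delta> * ln s" "\<lambda>s. - w' s - \<delta> / s"])
    fix s assume s: "s \<in> {t..x}"
    then show "((\<lambda>s. - w s - \<delta> * ln s) has_real_derivative - w' s - \<delta> / s) (at s)"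
      using t x by (auto intro!: derivative_eq_intros d)
    show "0 \<le> - w' s - \<delta> / s" using e[of s] above[of s] s t x ge by (cases "s = x") auto
  qed (use t in auto)
  moreover have "ln t = ln x - (\<bar>B - \<epsilon>\<bar> + 1) / \<delta>" using x by (simp add: t_def ln_mult diff_divide_distrib add_divide_distrib)
  then have "\<delta> * ln t = \<delta> * ln x - (\<bar>B - \<epsilon>\<bar> + 1)"
    using \<open>\<delta> > 0\<close> by (simp add: right_diff_distrib)
  ultimately have "w t \<ge> w x + (\<bar>B - \<epsilon>\<bar> + 1)" by linarith
  then show False using b[of t] t x ge by auto
qed

subsection \<open>Picard iteration\<close>

text \<open>The iterates are compared in the weight \<open>exp (2 L x)\<close>, which turns the Volterra operator into a
  contraction with factor 1/2 without restricting the length of the interval.\<close>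

lemma picard_halfline:
  fixes F :: "real \<Rightarrow> real \<Rightarrow> real"
  assumes cont: "continuous_on ({0..} \<times> UNIV) (\<lambda>(t, y). F t y)"
    and lip: "\<And>t y z. t \<ge> 0 \<Longrightarrow> \<bar>F t y - F t z\<bar> \<le> L * \<bar>y - z\<bar>"
  obtains y where "y 0 = y0" "\<And>t. t \<ge> 0 \<Longrightarrow> (y has_real_derivative F t (y t)) (at t within {0..})"
proof -
  define L' where "L' = \<bar>L\<bar> + 1"
  have L': "L' > 0" by (simp add: L'_def)
  have lip': "\<bar>F t y - F t z\<bar> \<le> L' * \<bar>y - z\<bar>" if "t \<ge> 0" for t y z
    using lip[OF that, of y z] mult_right_mono[of L L' "\<bar>y - z\<bar>"] by (auto simp: L'_def intro: order_trans)
  have contF: "continuous_on {0..} (\<lambda>t. F t (f t))" if "continuous_on {0..} f" for f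
  proof -
    have "continuous_on {0..} ((\<lambda>(t, y). F t y) \<circ> (\<lambda>t. (t, f t)))"
      by (rule continuous_on_compose)
        (auto intro!: continuous_intros that continuous_on_subset[OF cont])
    then show ?thesis by (simp add: o_def)
  qed
  define T where "T = (\<lambda>f x. y0 + integral {0..x} (\<lambda>s. F s (f s)))"
  have T_deriv: "(T f has_real_derivative F x (f x)) (at x within {0..})"
    if "continuous_on {0..} f" "x \<ge> 0" for f x
  proof -
    have "((\<lambda>u. integral {0..u} (\<lambda>s. F s (f s))) has_real_derivative F x (f x)) (at x within {0..x+1})"
      by (rule integral_has_real_derivative)
        (use that in \<open>auto intro!: continuous_on_subset[OF contF[OF that(1)]]\<close>)
    then have "(T f has_real_derivative F x (f x)) (at x within {0..x+1})"
      unfolding T_def by (auto intro!: derivative_eq_intros)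
    moreover have "at x within {0..x+1} = at x within {0..}"
      by (rule at_within_nhd[of x "{..<x+1}"]) (use that in auto)
    ultimately show ?thesis by simp
  qed
  have T_cont: "continuous_on {0..} (T f)" if "continuous_on {0..} f" for f
    by (rule has_real_derivative_imp_continuous_on[where f'="\<lambda>x. F x (f x)"]) (simp add: T_deriv that)
  define Y where "Y = rec_nat (\<lambda>_. y0) (\<lambda>_. T)"
  have Y_simps: "Y 0 = (\<lambda>_. y0)" "Y (Suc n) = T (Y n)" for n by (simp_all add: Y_def)
  have Y_cont: "continuous_on {0..} (Y n)" for n
    by (induction n) (simp_all add: Y_simps T_cont)
  \<comment> \<open>The comparison function \<open>K / 2 * exp (2 * L' * x)\<close> has derivative
    \<open>K * L' * exp (2 * L' * x)\<close>, which is exactly the Lipschitz bound on the difference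
    of the integrands.\<close>
  have T_diff: "\<bar>T f x - T h x\<bar> \<le> K / 2 * exp (2 * L' * x)"
    if c: "continuous_on {0..} f" "continuous_on {0..} h" and K: "K \<ge> 0"
      and b: "\<And>s. 0 \<le> s \<Longrightarrow> s \<le> x \<Longrightarrow> \<bar>f s - h s\<bar> \<le> K * exp (2 * L' * s)" and "x \<ge> 0" for f h K x
  proof -
    have *: "\<epsilon> * (T f 0 - T h 0) - K / 2 * exp (2 * L' * 0) \<ge> \<epsilon> * (T f x - T h x) - K / 2 * exp (2 * L' * x)"
      if "\<bar>\<epsilon>\<bar> = 1" for \<epsilon> :: real
    proof -
      have "- (\<epsilon> * (T f 0 - T h 0) - K / 2 * exp (2 * L' * 0)) \<le> - (\<epsilon> * (T f x - T h x) - K / 2 * exp (2 * L' * x))"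
      proof (rule mono_of_deriv_nonneg[of 0 x "{0..}" "\<lambda>s. - (\<epsilon> * (T f s - T h s) - K / 2 * exp (2 * L' * s))"
            "\<lambda>s. - (\<epsilon> * (F s (f s) - F s (h s)) - K * L' * exp (2 * L' * s))"])
        fix s assume s: "s \<in> {0..x}"
        show "((\<lambda>s. - (\<epsilon> * (T f s - T h s) - K / 2 * exp (2 * L' * s))) has_real_derivative
            - (\<epsilon> * (F s (f s) - F s (h s)) - K * L' * exp (2 * L' * s))) (at s within {0..})"
          using s c by (auto intro!: derivative_eq_intros T_deriv simp: algebra_simps)
        have "\<epsilon> * (F s (f s) - F s (h s)) \<le> \<bar>\<epsilon>\<bar> * \<bar>F s (f s) - F s (h s)\<bar>"
          by (metis abs_ge_self abs_mult)
        also have "\<dots> \<le> L' * \<bar>f s - h s\<bar>" using lip'[of s] s that by simp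
        also have "\<dots> \<le> L' * (K * exp (2 * L' * s))" using b[of s] s L' by simp
        finally show "0 \<le> - (\<epsilon> * (F s (f s) - F s (h s)) - K * L' * exp (2 * L' * s))"
          by (simp add: algebra_simps)
      qed (use \<open>x \<ge> 0\<close> in auto)
      then show ?thesis by simp
    qed
    have "T f 0 = T h 0" by (simp add: T_def)
    moreover have "\<bar>1::real\<bar> = 1" "\<bar>- 1::real\<bar> = 1" by simp_all
    note *[OF this(1)] *[OF this(2)]
    ultimately show ?thesis using K unfolding abs_le_iff by simp_all
  qed
  have ulim: "uniform_limit {0..b} Y (\<lambda>x. y0 + (\<Sum>i. Y (Suc i) x - Y i x)) sequentially" if "b \<ge> 0" for b
  proof -
    have "continuous_on {0..b} (\<lambda>s. \<bar>Y 1 s - Y 0 s\<bar>)"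
      by (intro continuous_on_rabs continuous_on_diff continuous_on_subset[OF Y_cont]) auto
    then have "bdd_above ((\<lambda>s. \<bar>Y 1 s - Y 0 s\<bar>) ` {0..b})"
      by (simp add: compact_continuous_image compact_imp_bounded bounded_imp_bdd_above)
    then obtain K where "\<forall>s\<in>{0..b}. \<bar>Y 1 s - Y 0 s\<bar> \<le> K"
      unfolding bdd_above_def by blast
    note K = this[rule_format]
    have K0: "K \<ge> 0" using K[of 0] that by auto
    have step: "\<bar>Y (Suc n) s - Y n s\<bar> \<le> K * (1/2)^n * exp (2 * L' * s)" if "s \<in> {0..b}" for n s
      using that
    proof (induction n arbitrary: s)
      case 0
      have "K * 1 \<le> K * exp (2 * L' * s)"
        by (rule mult_left_mono) (use 0 L' K0 in auto)
      then show ?case using K[OF 0] by simp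
    next
      case (Suc n)
      have "\<bar>T (Y (Suc n)) s - T (Y n) s\<bar> \<le> (K * (1/2)^n) / 2 * exp (2 * L' * s)"
        by (rule T_diff) (use Suc Y_cont K0 in auto)
      then show ?case by (simp add: Y_simps)
    qed
    \<comment> \<open>The iterates are telescoping sums of their increments, so the geometric bound
      gives uniform convergence by the Weierstrass test.\<close>
    have "uniform_limit {0..b} (\<lambda>n x. \<Sum>i<n. Y (Suc i) x - Y i x) (\<lambda>x. \<Sum>i. Y (Suc i) x - Y i x) sequentially"
    proof (rule Weierstrass_m_test)
      show "norm (Y (Suc n) x - Y n x) \<le> K * exp (2 * L' * b) * (1/2)^n" if "x \<in> {0..b}" for n x
      proof -
        have "exp (2 * L' * x) \<le> exp (2 * L' * b)" using that L' by simp
        then have "K * (1/2)^n * exp (2 * L' * x) \<le> K * (1/2)^n * exp (2 * L' * b)"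
          using K0 by (intro mult_left_mono) auto
        then show ?thesis using step[OF that, of n] by (simp add: mult_ac)
      qed
      show "summable (\<lambda>n. K * exp (2 * L' * b) * (1/2)^n :: real)"
        by (intro summable_mult summable_geometric) auto
    qed
    moreover have "(\<Sum>i<n. Y (Suc i) x - Y i x) = Y n x - y0" for n x
      using sum_lessThan_telescope[of "\<lambda>i. Y i x" n] by (simp add: Y_simps(1))
    ultimately have "uniform_limit {0..b} (\<lambda>n x. y0 + (Y n x - y0)) (\<lambda>x. y0 + (\<Sum>i. Y (Suc i) x - Y i x)) sequentially"
      by (intro uniform_limit_intros) simp_all
    then show ?thesis by simp
  qed
  define y where "y = (\<lambda>x. y0 + (\<Sum>i. Y (Suc i) x - Y i x))"
  have y_cont_Icc: "continuous_on {0..b} y" if "b \<ge> 0" for b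
    by (rule uniform_limit_theorem[OF _ ulim[OF that, folded y_def]])
      (auto intro!: always_eventually continuous_on_subset[OF Y_cont])
  have y_cont: "continuous_on {0..} y"
    unfolding continuous_on_eq_continuous_within
  proof
    fix x :: real assume x: "x \<in> {0..}"
    have "continuous (at x within {0..x+1}) y"
      using y_cont_Icc[of "x+1"] x by (simp add: continuous_on_eq_continuous_within)
    moreover have "at x within {0..x+1} = at x within {0..}"
      by (rule at_within_nhd[of x "{..<x+1}"]) (use x in auto)
    ultimately show "continuous (at x within {0..}) y" by (simp add: continuous_within)
  qed
  have fix_y: "y x = T y x" if "x \<ge> 0" for x
  proof -
    have l1: "(\<lambda>n. T (Y n) x) \<longlonglongrightarrow> y x"
    proof -
      have "(\<lambda>n. Y n x) \<longlonglongrightarrow> y x"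
        using tendsto_uniform_limitI[OF ulim[OF that, folded y_def]] that by auto
      then have "(\<lambda>n. Y (Suc n) x) \<longlonglongrightarrow> y x" by (rule LIMSEQ_Suc)
      then show ?thesis by (simp add: Y_simps)
    qed
    have "(\<lambda>n. T (Y n) x) \<longlonglongrightarrow> T y x"
    proof (rule LIMSEQ_I)
      fix r :: real assume "r > 0"
      define K where "K = r / exp (2 * L' * x)"
      have K: "K > 0" using \<open>r > 0\<close> by (simp add: K_def)
      obtain N where N: "\<And>n s. n \<ge> N \<Longrightarrow> s \<in> {0..x} \<Longrightarrow> \<bar>Y n s - y s\<bar> < K"
        using ulim[OF \<open>x \<ge> 0\<close>, folded y_def] K unfolding uniform_limit_iff eventually_sequentially dist_real_def
        by blast
      have "norm (T (Y n) x - T y x) < r" if "n \<ge> N" for n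
      proof -
        have "\<bar>T (Y n) x - T y x\<bar> \<le> K / 2 * exp (2 * L' * x)"
        proof (rule T_diff[OF Y_cont y_cont])
          fix s assume s: "0 \<le> s" "s \<le> x"
          have "K * 1 \<le> K * exp (2 * L' * s)"
            by (rule mult_left_mono) (use s L' K in auto)
          then show "\<bar>Y n s - y s\<bar> \<le> K * exp (2 * L' * s)" using N[OF that, of s] s by simp
        qed (use K \<open>x \<ge> 0\<close> in auto)
        also have "\<dots> < r" using \<open>r > 0\<close> by (simp add: K_def)
        finally show ?thesis by simp
      qed
      then show "\<exists>N. \<forall>n\<ge>N. norm (T (Y n) x - T y x) < r" by blast
    qed
    then show ?thesis using l1 LIMSEQ_unique by blast
  qed
  show thesis
  proof
    show "y 0 = y0" using fix_y[of 0] by (simp add: T_def)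
    fix t :: real assume t: "t \<ge> 0"
    show "(y has_real_derivative F t (y t)) (at t within {0..})"
      by (rule has_field_derivative_transform_within[OF T_deriv[OF y_cont t], where d=1])
        (use fix_y t in auto)
  qed
qed

text \<open>Time is shifted to start at 0 and frozen once it reaches \<open>b\<close>, which reduces
  the interval to the half line.\<close>

lemma picard_interval:
  fixes F :: "real \<Rightarrow> real \<Rightarrow> real"
  assumes ab: "a \<le> b" and cont: "continuous_on ({a..b} \<times> UNIV) (\<lambda>(t, y). F t y)"
    and lip: "\<And>t y z. t \<in> {a..b} \<Longrightarrow> \<bar>F t y - F t z\<bar> \<le> L * \<bar>y - z\<bar>"
  obtains y where "y a = y0" "\<And>t. t \<in> {a..b} \<Longrightarrow> (y has_real_derivative F t (y t)) (at t within {a..b})"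
proof -
  define c where "c = (\<lambda>t. min (a + t) b)"
  have c: "t \<ge> 0 \<Longrightarrow> c t \<in> {a..b}" for t using ab by (auto simp: c_def)
  have "continuous_on ({0..} \<times> UNIV) ((\<lambda>(t, y). F t y) \<circ> (\<lambda>p. (c (fst p), snd p)))"
    using c by (intro continuous_on_compose continuous_on_subset[OF cont])
      (auto simp: c_def intro!: continuous_intros)
  then have "continuous_on ({0..} \<times> UNIV) (\<lambda>(t, y). F (c t) y)"
    by (simp add: o_def case_prod_beta)
  then obtain y where y: "y 0 = y0" "\<And>t. t \<ge> 0 \<Longrightarrow> (y has_real_derivative F (c t) (y t)) (at t within {0..})"
    using picard_halfline[of "\<lambda>t. F (c t)" L y0] lip c by metis
  show thesis
  proof (rule that[of "\<lambda>t. y (t - a)"])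
    show "y (a - a) = y0" using y by simp
    fix t assume t: "t \<in> {a..b}"
    have "(y has_real_derivative F t (y (t - a))) (at (t - a) within {0..})"
      using y(2)[of "t - a"] t by (simp add: c_def)
    then have 1: "(y has_real_derivative F t (y (t - a))) (at (t - a) within (\<lambda>t. t - a) ` {a..b})"
      by (rule DERIV_subset) auto
    have 2: "((\<lambda>t. t - a) has_real_derivative 1) (at t within {a..b})"
      by (auto intro!: derivative_eq_intros)
    show "((\<lambda>t. y (t - a)) has_real_derivative F t (y (t - a))) (at t within {a..b})"
      using DERIV_image_chain[OF 1 2] by (simp add: o_def)
  qed
qed

subsection \<open>Iterated one-sided derivatives\<close>

lemma vector_derivative_within_cong:
  fixes f g :: "real \<Rightarrow> 'a::real_normed_vector"
  assumes "\<And>x. x \<in> S \<Longrightarrow> f x = g x" "x \<in> S"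
  shows "vector_derivative f (at x within S) = vector_derivative g (at x within S)"
proof -
  have "(f has_vector_derivative D) (at x within S) \<longleftrightarrow> (g has_vector_derivative D) (at x within S)" for D
    using has_vector_derivative_transform[of x S f g D] has_vector_derivative_transform[of x S g f D] assms
    by auto
  then show ?thesis by (simp add: vector_derivative_def)
qed

lemma nderiv_within_cong:
  fixes f g :: "real \<Rightarrow> 'a::real_normed_vector"
  assumes "\<And>x. x \<in> S \<Longrightarrow> f x = g x" "x \<in> S"
  shows "nderiv_within S n f x = nderiv_within S n g x"
  using assms(2)
proof (induction n arbitrary: x)
  case (Suc n)
  show ?case using vector_derivative_within_cong[OF Suc.IH Suc.prems] by simp
qed (simp add: assms)

text \<open>Smoothness without computing derivatives: if a class of functions is closed under
  differentiation on \<open>S\<close>, then by induction every iterated derivative of a member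
  agrees on \<open>S\<close> with a member. Nontriviality of \<open>at x within S\<close> makes
  derivatives unique, so that \<open>vector_derivative\<close> picks the right one.\<close>

lemma smooth_within_if_closed_class:
  fixes f :: "real \<Rightarrow> 'a::real_normed_vector"
  assumes closed: "\<And>f. f \<in> A \<Longrightarrow> \<exists>f'\<in>A. \<forall>x\<in>S. (f has_vector_derivative f' x) (at x within S)"
    and lim: "\<And>x. x \<in> S \<Longrightarrow> at x within S \<noteq> bot" and "f \<in> A"
  shows "smooth_within S f"
proof -
  have *: "\<exists>h\<in>A. \<forall>x\<in>S. nderiv_within S n g x = h x" if "g \<in> A" for g n
  proof (induction n)
    case 0
    then show ?case using that by auto
  next
    case (Suc n)
    then obtain h where h: "h \<in> A" "\<And>x. x \<in> S \<Longrightarrow> nderiv_within S n g x = h x" by blast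
    obtain h' where h': "h' \<in> A" "\<And>x. x \<in> S \<Longrightarrow> (h has_vector_derivative h' x) (at x within S)"
      using closed[OF h(1)] by blast
    have "nderiv_within S (Suc n) g x = h' x" if "x \<in> S" for x
    proof -
      have "nderiv_within S (Suc n) g x = vector_derivative h (at x within S)"
        using vector_derivative_within_cong[of S "nderiv_within S n g" h x] h(2) that by simp
      then show ?thesis using vector_derivative_within[OF lim[OF that] h'(2)[OF that]] by simp
    qed
    then show ?case using h'(1) by blast
  qed
  show ?thesis unfolding smooth_within_def
  proof (intro allI ballI)
    fix n x assume x: "x \<in> S"
    obtain h where h: "h \<in> A" "\<And>x. x \<in> S \<Longrightarrow> nderiv_within S n f x = h x" using *[OF \<open>f \<in> A\<close>] by blast
    obtain h' where "\<And>x. x \<in> S \<Longrightarrow> (h has_vector_derivative h' x) (at x within S)"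
      using closed[OF h(1)] by blast
    then have "(nderiv_within S n f has_vector_derivative h' x) (at x within S)"
      using has_vector_derivative_transform[of x S "nderiv_within S n f" h "h' x"] x h(2) by simp
    then show "nderiv_within S n f differentiable (at x within S)" by (rule differentiableI_vector)
  qed
qed

lemma at_within_halfline_neq_bot: "(t::real) \<ge> 0 \<Longrightarrow> at t within {0..} \<noteq> bot"
  using at_le[of "{t<..}" "{0::real..}" t] trivial_limit_at_right_real[of t] by (auto simp: bot_unique subset_iff)

subsection \<open>Decay of all derivatives\<close>

text \<open>The order index grows by one with each derivative, which is the pattern of algebraic
  decay. Derivatives enter as existential witnesses rather than through
  \<open>vector_derivative\<close>, so closure under sums and products only needs the
  differentiation rules.\<close>

primrec decays :: "(nat \<Rightarrow> real \<Rightarrow> real) \<Rightarrow> nat \<Rightarrow> nat \<Rightarrow> (real \<Rightarrow> 'a::real_normed_vector) \<Rightarrow> bool" where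
  "decays w 0 = (\<lambda>k f. \<exists>C\<ge>0. \<forall>t\<ge>0. norm (f t) \<le> C * w k t)"
| "decays w (Suc n) = (\<lambda>k f. (\<exists>C\<ge>0. \<forall>t\<ge>0. norm (f t) \<le> C * w k t) \<and>
     (\<exists>f'. (\<forall>t\<ge>0. (f has_vector_derivative f' t) (at t within {0..})) \<and> decays w n (Suc k) f'))"

lemma decays_bound: "decays w n k f \<Longrightarrow> \<exists>C\<ge>0. \<forall>t\<ge>0. norm (f t) \<le> C * w k t"
  by (cases n) auto

lemma decays_Suc_imp: "decays w (Suc n) k f \<Longrightarrow> decays w n k f"
proof (induction n arbitrary: k f)
  case (Suc n)
  obtain f' where f': "\<forall>t\<ge>0. (f has_vector_derivative f' t) (at t within {0..})"
    "decays w (Suc n) (Suc k) f'" using Suc.prems unfolding decays.simps(2)[of w "Suc n"] by blast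
  show ?case
    unfolding decays.simps(2) using decays_bound[OF Suc.prems] f'(1) Suc.IH[OF f'(2)] by blast
qed simp

lemma decays_cong:
  assumes "\<And>t. t \<ge> 0 \<Longrightarrow> f t = g t" "decays w n k f"
  shows "decays w n k g"
proof (cases n)
  case 0
  then show ?thesis using assms by auto
next
  case (Suc m)
  then obtain f' where f': "\<forall>t\<ge>0. (f has_vector_derivative f' t) (at t within {0..})" "decays w m (Suc k) f'"
    using assms(2) by auto
  have "(g has_vector_derivative f' t) (at t within {0..})" if "t \<ge> 0" for t
    using has_vector_derivative_transform[of t "{0..}" g f "f' t"] f' that assms(1) by auto
  then show ?thesis using Suc f' assms decays_bound[OF assms(2)] by auto
qed

lemma decays_weaken:
  assumes "\<And>j t. t \<ge> 0 \<Longrightarrow> w (k + j) t \<le> w (l + j) t" "decays w n k f"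
  shows "decays w n l f"
  using assms
proof (induction n arbitrary: k l f)
  case 0
  then obtain C where C: "C \<ge> 0" "\<forall>t\<ge>0. norm (f t) \<le> C * w k t" by auto
  have "norm (f t) \<le> C * w l t" if "t \<ge> 0" for t
    using C that mult_left_mono[OF 0(1)[of t 0] C(1)] by (auto intro: order_trans)
  then show ?case using C(1) by auto
next
  case (Suc n)
  then obtain C where C: "C \<ge> 0" "\<forall>t\<ge>0. norm (f t) \<le> C * w k t" by auto
  have b: "norm (f t) \<le> C * w l t" if "t \<ge> 0" for t
    using C that mult_left_mono[OF Suc.prems(1)[of t 0] C(1)] by (auto intro: order_trans)
  obtain f' where f': "\<forall>t\<ge>0. (f has_vector_derivative f' t) (at t within {0..})" "decays w n (Suc k) f'"
    using Suc.prems(2) by auto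
  have "decays w n (Suc l) f'"
    by (rule Suc.IH[OF _ f'(2)]) (use Suc.prems(1)[of _ "Suc _"] in auto)
  then show ?case using b C(1) f'(1) by auto
qed

lemma smooth_within_if_decays:
  assumes "\<And>n. decays w n k f"
  shows "smooth_within {0..} f"
proof (rule smooth_within_if_closed_class[where A="{f. \<exists>k. \<forall>n. decays w n k f}"])
  fix f :: "real \<Rightarrow> 'a" assume "f \<in> {f. \<exists>k. \<forall>n. decays w n k f}"
  then obtain k where k: "\<And>n. decays w n k f" by auto
  from k[of 1] obtain f' where f': "\<forall>t\<ge>0. (f has_vector_derivative f' t) (at t within {0..})" by auto
  \<comment> \<open>For different \<open>n\<close> the assumption may supply different derivatives;
    uniqueness of one-sided derivatives identifies them on the half line.\<close>
  have "decays w n (Suc k) f'" for n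
  proof -
    from k[of "Suc n"] obtain f'' where f'': "\<forall>t\<ge>0. (f has_vector_derivative f'' t) (at t within {0..})"
      "decays w n (Suc k) f''" by auto
    have "f'' t = f' t" if "t \<ge> 0" for t
      using vector_derivative_within[OF at_within_halfline_neq_bot[OF that]] f' f'' that by metis
    then show ?thesis using decays_cong f'' by metis
  qed
  then show "\<exists>f'\<in>{f. \<exists>k. \<forall>n. decays w n k f}. \<forall>t\<in>{0..}. (f has_vector_derivative f' t) (at t within {0..})"
    using f' by (intro bexI[of _ f']) auto
qed (use assms at_within_halfline_neq_bot in auto)

lemma decays_add:
  assumes "decays w n k f" "decays w n k g"
  shows "decays w n k (\<lambda>t. f t + g t)"
proof -
  have bnd: "\<exists>C\<ge>0. \<forall>t\<ge>0. norm (f t + g t) \<le> C * w k t" if fg: "decays w n k f" "decays w n k g"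
    for n k and f g :: "real \<Rightarrow> 'a"
  proof -
    obtain C where C: "C \<ge> 0" "\<forall>t\<ge>0. norm (f t) \<le> C * w k t" using decays_bound[OF fg(1)] by auto
    obtain D where D: "D \<ge> 0" "\<forall>t\<ge>0. norm (g t) \<le> D * w k t" using decays_bound[OF fg(2)] by auto
    have "norm (f t + g t) \<le> (C + D) * w k t" if "t \<ge> 0" for t
      using norm_triangle_ineq[of "f t" "g t"] C(2)[rule_format, OF that] D(2)[rule_format, OF that]
      by (simp add: distrib_right)
    then show ?thesis using C D by (intro exI[of _ "C + D"]) auto
  qed
  show ?thesis using assms
  proof (induction n arbitrary: k f g)
    case 0
    then show ?case using bnd[OF 0] by simp
  next
    case (Suc n)
    obtain f' where f': "\<forall>t\<ge>0. (f has_vector_derivative f' t) (at t within {0..})" "decays w n (Suc k) f'"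
      using Suc.prems(1) by auto
    obtain g' where g': "\<forall>t\<ge>0. (g has_vector_derivative g' t) (at t within {0..})" "decays w n (Suc k) g'"
      using Suc.prems(2) by auto
    have "\<forall>t\<ge>0. ((\<lambda>t. f t + g t) has_vector_derivative f' t + g' t) (at t within {0..})"
      using f' g' by (auto intro: has_vector_derivative_add)
    then show ?case using bnd[OF Suc.prems] Suc.IH[OF f'(2) g'(2)] by auto
  qed
qed

text \<open>Constants have order 0 and orders add under products, so polynomial expressions can be
  estimated mechanically. Monotonicity in time serves the estimate of an unstable component, whose
  size depends on the whole future of its forcing.\<close>

locale decay_weight =
  fixes w :: "nat \<Rightarrow> real \<Rightarrow> real"
  assumes weight_0: "t \<ge> 0 \<Longrightarrow> w 0 t = 1"
    and weight_nonneg: "t \<ge> 0 \<Longrightarrow> w k t \<ge> 0"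
    and weight_mult: "t \<ge> 0 \<Longrightarrow> w k t * w l t \<le> w (k + l) t"
    and weight_antimono: "0 \<le> s \<Longrightarrow> s \<le> t \<Longrightarrow> w k t \<le> w k s"
begin

lemma nderiv_within_if_decays:
  assumes "decays w n k f"
  shows "\<exists>C>0. \<forall>t\<ge>0. norm (nderiv_within {0..} n f t) \<le> C * w (k + n) t"
proof -
  \<comment> \<open>\<open>nderiv_within\<close> adds the last derivative on the outside, whereas
    \<open>decays\<close> splits off the first one.\<close>
  have shift: "nderiv_within S (Suc n) g = nderiv_within S n (\<lambda>x. vector_derivative g (at x within S))"
    for S n and g :: "real \<Rightarrow> 'b::real_normed_vector"
    by (induction n) auto
  have "\<exists>C\<ge>0. \<forall>t\<ge>0. norm (nderiv_within {0..} n f t) \<le> C * w (k + n) t"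
    using assms
  proof (induction n arbitrary: k f)
    case (Suc n)
    then obtain f' where f': "\<forall>t\<ge>0. (f has_vector_derivative f' t) (at t within {0..})" "decays w n (Suc k) f'"
      by auto
    have "nderiv_within {0..} (Suc n) f t = nderiv_within {0..} n f' t" if "t \<ge> 0" for t
      unfolding shift
      by (rule nderiv_within_cong) (use that f' in \<open>auto intro!: vector_derivative_within at_within_halfline_neq_bot\<close>)
    then show ?case using Suc.IH[OF f'(2)] by auto
  qed auto
  then obtain C where C: "C \<ge> 0" "\<forall>t\<ge>0. norm (nderiv_within {0..} n f t) \<le> C * w (k + n) t" by blast
  show ?thesis
  proof (intro exI[of _ "C + 1"] conjI allI impI)
    fix t :: real assume "t \<ge> 0"
    then have "norm (nderiv_within {0..} n f t) \<le> C * w (k + n) t" "0 \<le> w (k + n) t"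
      using C weight_nonneg by auto
    then show "norm (nderiv_within {0..} n f t) \<le> (C + 1) * w (k + n) t"
      by (simp add: distrib_right)
  qed (use C in auto)
qed

lemma decays_zero: "decays w n k (\<lambda>_. 0)"
  by (induction n arbitrary: k) (auto intro!: exI[of _ 0] exI[of _ "\<lambda>_. 0"] has_vector_derivative_const)

lemma decays_const: "decays w n 0 (\<lambda>_. c)"
  by (cases n)
    (auto simp: weight_0 intro!: exI[of _ "norm c"] exI[of _ "\<lambda>_. 0"] has_vector_derivative_const decays_zero)

lemma decays_scaleR:
  fixes f :: "real \<Rightarrow> real" and g :: "real \<Rightarrow> 'a::real_normed_vector"
  assumes "decays w n k f" "decays w n l g"
  shows "decays w n (k + l) (\<lambda>t. f t *\<^sub>R g t)"
proof -
  have bnd: "\<exists>C\<ge>0. \<forall>t\<ge>0. norm (f t *\<^sub>R g t) \<le> C * w (k + l) t" if fg: "decays w n k f" "decays w n l g"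
    for n k l f and g :: "real \<Rightarrow> 'a"
  proof -
    obtain C where C: "C \<ge> 0" "\<forall>t\<ge>0. norm (f t) \<le> C * w k t" using decays_bound[OF fg(1)] by auto
    obtain D where D: "D \<ge> 0" "\<forall>t\<ge>0. norm (g t) \<le> D * w l t" using decays_bound[OF fg(2)] by auto
    have "norm (f t *\<^sub>R g t) \<le> (C * D) * w (k + l) t" if "t \<ge> 0" for t
    proof -
      have "norm (f t *\<^sub>R g t) \<le> (C * w k t) * (D * w l t)"
        unfolding norm_scaleR using C D that weight_nonneg by (intro mult_mono) auto
      also have "\<dots> = (C * D) * (w k t * w l t)" by simp
      also have "\<dots> \<le> (C * D) * w (k + l) t" using C D weight_mult[OF that] by (intro mult_left_mono) auto
      finally show ?thesis .
    qed
    then show ?thesis using C D by (intro exI[of _ "C * D"]) auto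
  qed
  show ?thesis using assms
  proof (induction n arbitrary: k l f g)
    case 0
    then show ?case using bnd[OF 0] by simp
  next
    case (Suc n)
    obtain f' where f': "\<forall>t\<ge>0. (f has_vector_derivative f' t) (at t within {0..})" "decays w n (Suc k) f'"
      using Suc.prems(1) by auto
    obtain g' where g': "\<forall>t\<ge>0. (g has_vector_derivative g' t) (at t within {0..})" "decays w n (Suc l) g'"
      using Suc.prems(2) by auto
    have d: "\<forall>t\<ge>0. ((\<lambda>t. f t *\<^sub>R g t) has_vector_derivative f t *\<^sub>R g' t + f' t *\<^sub>R g t) (at t within {0..})"
      using f' g' by (auto intro!: has_vector_derivative_scaleR simp: has_real_derivative_iff_has_vector_derivative)
    have 1: "decays w n (Suc (k + l)) (\<lambda>t. f t *\<^sub>R g' t)"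
      using Suc.IH[OF decays_Suc_imp[OF Suc.prems(1)] g'(2)] by simp
    have 2: "decays w n (Suc (k + l)) (\<lambda>t. f' t *\<^sub>R g t)"
      using Suc.IH[OF f'(2) decays_Suc_imp[OF Suc.prems(2)]] by simp
    show ?case using bnd[OF Suc.prems] d decays_add[OF 1 2] by auto
  qed
qed

lemma decays_mult:
  fixes f g :: "real \<Rightarrow> real"
  assumes "decays w n k f" "decays w n l g"
  shows "decays w n (k + l) (\<lambda>t. f t * g t)"
  using decays_scaleR[OF assms] by simp

lemma decays_cmult:
  fixes f :: "real \<Rightarrow> real"
  assumes "decays w n k f"
  shows "decays w n k (\<lambda>t. c * f t)"
  using decays_mult[OF decays_const assms] by simp

text \<open>The unstable component of a solution is slaved to its forcing term: any excess over the forcing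
  would be amplified exponentially.\<close>

lemma decays_unstable_component:
  fixes N q :: "real \<Rightarrow> real"
  assumes "r > 0"
    and "\<And>t. t \<ge> 0 \<Longrightarrow> (N has_real_derivative r * N t + q t) (at t within {0..})"
    and "decays w n k q" and "\<And>t. t \<ge> 0 \<Longrightarrow> \<bar>N t\<bar> \<le> B"
  shows "decays w n k N"
proof -
  have upper: "N t1 \<le> C / r * w k t1"
    if d: "\<And>t. t \<ge> 0 \<Longrightarrow> (N has_real_derivative r * N t + q t) (at t within {0..})"
      and q: "\<forall>t\<ge>0. norm (q t) \<le> C * w k t" and B: "\<And>t. t \<ge> 0 \<Longrightarrow> \<bar>N t\<bar> \<le> B" and "C \<ge> 0" "t1 \<ge> 0"
    for N q C B k t1
  proof (rule ccontr)
    \<comment> \<open>With this constant the forcing after \<open>t1\<close> cannot overcome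
      \<open>r * c\<close>, because the weight decreases in time; hence \<open>N - c\<close> grows
      at least like \<open>exp (r * t)\<close>.\<close>
    define c where "c = C / r * w k t1"
    define \<delta> where "\<delta> = N t1 - c"
    assume "\<not> N t1 \<le> C / r * w k t1"
    then have "\<delta> > 0" by (simp add: \<delta>_def c_def)
    \<comment> \<open>At this time already the linear lower bound for the exponential pushes
      \<open>N - c\<close> to \<open>\<delta> + \<bar>B - c\<bar>\<close>, beyond what the bound
      \<open>B\<close> allows.\<close>
    define t where "t = t1 + \<bar>B - c\<bar> / (\<delta> * r)"
    have t: "t \<ge> t1" using \<open>\<delta> > 0\<close> \<open>r > 0\<close> by (simp add: t_def)
    have "(N t1 - c) * exp (- r * t1) \<le> (N t - c) * exp (- r * t)"
    proof (rule mono_of_deriv_nonneg[of t1 t "{0..}" "\<lambda>t. (N t - c) * exp (- r * t)"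
          "\<lambda>t. (q t + C * w k t1) * exp (- r * t)"])
      fix s assume s: "s \<in> {t1..t}"
      have "r * c = C * w k t1" using \<open>r > 0\<close> by (simp add: c_def)
      then show "((\<lambda>t. (N t - c) * exp (- r * t)) has_real_derivative (q s + C * w k t1) * exp (- r * s)) (at s within {0..})"
        using s \<open>t1 \<ge> 0\<close> by (auto intro!: derivative_eq_intros d simp: algebra_simps)
      have "C * w k s \<le> C * w k t1" using s \<open>C \<ge> 0\<close> \<open>t1 \<ge> 0\<close> by (auto intro: mult_left_mono weight_antimono)
      then show "0 \<le> (q s + C * w k t1) * exp (- r * s)" using q[rule_format, of s] s \<open>t1 \<ge> 0\<close> by auto
    qed (use t \<open>t1 \<ge> 0\<close> in auto)
    then have "\<delta> * exp (r * (t - t1)) \<le> N t - c"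
      by (simp add: \<delta>_def exp_diff exp_minus right_diff_distrib field_simps)
    moreover have "\<delta> * (1 + r * (t - t1)) \<le> \<delta> * exp (r * (t - t1))"
      using \<open>\<delta> > 0\<close> by (intro mult_left_mono exp_ge_add_one_self) auto
    moreover have "\<delta> * (1 + r * (t - t1)) = \<delta> + \<bar>B - c\<bar>"
      using \<open>\<delta> > 0\<close> \<open>r > 0\<close> by (simp add: t_def field_simps)
    ultimately show False using B[of t] t \<open>t1 \<ge> 0\<close> \<open>\<delta> > 0\<close> by auto
  qed
  have bnd: "\<exists>C\<ge>0. \<forall>t\<ge>0. norm (N t) \<le> C * w k t"
    if d: "\<And>t. t \<ge> 0 \<Longrightarrow> (N has_real_derivative r * N t + q t) (at t within {0..})"
      and q: "decays w n k q" and B: "\<And>t. t \<ge> 0 \<Longrightarrow> \<bar>N t\<bar> \<le> B" for N q B n k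
  proof -
    obtain C where C: "C \<ge> 0" "\<forall>t\<ge>0. norm (q t) \<le> C * w k t" using decays_bound[OF q] by auto
    have "norm (N t) \<le> C / r * w k t" if "t \<ge> 0" for t
    proof -
      have 1: "N t \<le> C / r * w k t" by (rule upper[OF d C(2) B C(1) that])
      have 2: "- N t \<le> C / r * w k t"
      proof (rule upper[where N="\<lambda>t. - N t" and q="\<lambda>t. - q t", OF _ _ _ C(1) that])
        fix s :: real assume "s \<ge> 0"
        show "((\<lambda>t. - N t) has_real_derivative r * - N s + - q s) (at s within {0..})"
          using DERIV_minus[OF d[OF \<open>s \<ge> 0\<close>]] by (simp add: algebra_simps)
      qed (use C B in auto)
      show ?thesis using 1 2 by auto
    qed
    then show ?thesis using C \<open>r > 0\<close> by (intro exI[of _ "C / r"]) auto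
  qed
  show ?thesis using assms(2-)
  proof (induction n arbitrary: k N q B)
    case 0
    then show ?case using bnd[of N q 0 k B] by simp
  next
    case (Suc n)
    obtain q' where q': "\<forall>t\<ge>0. (q has_vector_derivative q' t) (at t within {0..})" "decays w n (Suc k) q'"
      using Suc.prems(2) by auto
    obtain C where C: "C \<ge> 0" "\<forall>t\<ge>0. norm (q t) \<le> C * w k t" using decays_bound[OF Suc.prems(2)] by auto
    \<comment> \<open>The derivative of \<open>N\<close> solves the same equation with forcing
      \<open>q'\<close>, which decays one order faster, so the induction hypothesis applies to
      it.\<close>
    have tail: "decays w n (Suc k) (\<lambda>t. r * N t + q t)"
    proof (rule Suc.IH[OF _ q'(2)])
      fix t :: real assume t: "t \<ge> 0"
      show "((\<lambda>t. r * N t + q t) has_real_derivative r * (r * N t + q t) + q' t) (at t within {0..})"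
        using t q' Suc.prems(1)
        by (auto intro!: derivative_eq_intros simp: has_real_derivative_iff_has_vector_derivative[symmetric])
      have "C * w k t \<le> C * w k 0" using C t by (intro mult_left_mono weight_antimono) auto
      then have "\<bar>q t\<bar> \<le> C * w k 0" using C(2) t by (auto intro: order_trans)
      moreover have "\<bar>r * N t\<bar> \<le> r * B" using Suc.prems(3)[OF t] \<open>r > 0\<close> by (simp add: abs_mult)
      ultimately show "\<bar>r * N t + q t\<bar> \<le> r * B + C * w k 0" by linarith
    qed
    have "\<forall>t\<ge>0. (N has_vector_derivative r * N t + q t) (at t within {0..})"
      using Suc.prems(1) by (simp add: has_real_derivative_iff_has_vector_derivative)
    with tail bnd[OF Suc.prems] show ?case
      unfolding decays.simps(2) by (intro conjI exI[of _ "\<lambda>t. r * N t + q t"])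
  qed
qed

end

text \<open>All positive orders share one weight: differentiation gains nothing for exponential
  decay, and of a product of two decaying factors only one factor is kept.\<close>

lemma decay_weight_exp: "c \<ge> 0 \<Longrightarrow> decay_weight (\<lambda>k t. if k = 0 then 1 else exp (- c * t))"
proof unfold_locales
  fix t s :: real and k l :: nat
  assume c: "c \<ge> 0"
  show "(if k = 0 then 1 else exp (- c * t)) * (if l = 0 then 1 else exp (- c * t))
      \<le> (if k + l = 0 then 1 else exp (- c * t))" if "t \<ge> 0"
  proof -
    have "exp (- c * t) \<le> 1" using c that by simp
    then have "exp (- c * t) * exp (- c * t) \<le> exp (- c * t)" by (intro mult_left_le) auto
    then show ?thesis by simp
  qed
  show "(if k = 0 then 1 else exp (- c * t)) \<le> (if k = 0 then 1 else exp (- c * s))" if "0 \<le> s" "s \<le> t"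
    using mult_left_mono[OF that(2) c] by simp
qed auto

lemma decay_weight_power: "decay_weight (\<lambda>k t. 1 / (1 + t) ^ k)"
proof unfold_locales
  fix t s :: real and k :: nat
  show "1 / (1 + t) ^ k \<le> 1 / (1 + s) ^ k" if "0 \<le> s" "s \<le> t"
    using that by (intro divide_left_mono power_mono mult_pos_pos zero_less_power) auto
qed (auto simp: power_add)

subsection \<open>A graph equation with a singular endpoint\<close>

text \<open>Setting for y' = p (F + D - y) / (y - F) between the graphs \<open>F\<close> and
  \<open>F + D\<close>, which pinch together at 0. \<open>barrier\<close> says that the slope along
  \<open>F + \<eta> * D\<close> is steeper than that graph, so solutions stay above it. Along
  \<open>F + D\<close> the slope is 0 while the graph rises up to \<open>x0\<close>, so solutions
  stay below it there.\<close>

locale singular_graph_ode =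
  fixes p F F' D D' :: "real \<Rightarrow> real" and l \<eta> x0 :: real
  assumes ell_pos: "0 < l"
    and F_deriv: "\<And>x. (F has_real_derivative F' x) (at x)"
    and D_deriv: "\<And>x. (D has_real_derivative D' x) (at x)"
    and F'_cont: "continuous_on UNIV F'" and D'_cont: "continuous_on UNIV D'"
    and p_cont: "continuous_on UNIV p"
    and D_0: "D 0 = 0" and D_pos: "\<And>x. 0 < x \<Longrightarrow> x < l \<Longrightarrow> D x > 0"
    and p_pos: "\<And>x. 0 \<le> x \<Longrightarrow> x < l \<Longrightarrow> p x > 0"
    and eta: "0 < \<eta>" "\<eta> < 1"
    and barrier: "\<And>x. 0 < x \<Longrightarrow> x < l \<Longrightarrow> F' x + \<eta> * D' x < p x * (1 / \<eta> - 1)"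
    and x0: "0 < x0" "x0 \<le> l" and FD'_pos: "\<And>x. 0 < x \<Longrightarrow> x < x0 \<Longrightarrow> F' x + D' x > 0"
begin

text \<open>Between \<open>F + \<eta> D\<close> and \<open>F + D\<close> this is \<open>p (F + D - y) / (y - F)\<close>; the truncations make it
  decreasing and Lipschitz in \<open>y\<close> everywhere.\<close>

definition slope :: "real \<Rightarrow> real \<Rightarrow> real" where
  "slope x y = p x * max 0 (D x / max (y - F x) (\<eta> * D x) - 1)"

lemma F_cont: "continuous_on S F" and D_cont: "continuous_on S D"
  by (intro continuous_at_imp_continuous_on ballI DERIV_isCont[OF F_deriv] DERIV_isCont[OF D_deriv])+

lemma slope_antimono:
  assumes "0 < x" "x < l" "y \<le> z"
  shows "slope x z \<le> slope x y"
proof -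
  have "max (y - F x) (\<eta> * D x) > 0" using D_pos assms eta by (simp add: less_max_iff_disj)
  then have "D x / max (z - F x) (\<eta> * D x) \<le> D x / max (y - F x) (\<eta> * D x)"
    using D_pos[of x] assms by (intro divide_left_mono mult_pos_pos) auto
  then show ?thesis unfolding slope_def using p_pos[of x] assms by (intro mult_left_mono) auto
qed

lemma slope_lipschitz:
  assumes "0 < x" "x < l"
  shows "\<bar>slope x y - slope x z\<bar> \<le> p x / (\<eta>\<^sup>2 * D x) * \<bar>y - z\<bar>"
proof -
  define r where "r = (\<lambda>y. max (y - F x) (\<eta> * D x))"
  have D: "D x > 0" "\<eta> * D x > 0" and p: "p x > 0" using D_pos p_pos assms eta by auto
  have r: "r y \<ge> \<eta> * D x" "r y > 0" for y using D by (auto simp: r_def less_max_iff_disj)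
  have "\<bar>max 0 (D x / r y - 1) - max 0 (D x / r z - 1)\<bar> \<le> \<bar>D x / r y - D x / r z\<bar>"
    by (simp add: max_def abs_if)
  also have "D x / r y - D x / r z = D x * (r z - r y) / (r y * r z)"
    using r(2)[of y] r(2)[of z] by (simp add: field_simps)
  also have "\<bar>\<dots>\<bar> = D x * \<bar>r z - r y\<bar> / (r y * r z)"
    using D r(2)[of y] r(2)[of z] by (simp add: abs_mult abs_of_pos)
  also have "\<dots> \<le> D x * \<bar>y - z\<bar> / (r y * r z)"
    using D r(2)[of y] r(2)[of z] by (intro divide_right_mono mult_left_mono) (auto simp: r_def)
  also have "\<dots> \<le> D x * \<bar>y - z\<bar> / ((\<eta> * D x) * (\<eta> * D x))"
    using D r eta by (intro divide_left_mono mult_mono mult_pos_pos) (auto intro: less_imp_le)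
  also have "\<dots> = \<bar>y - z\<bar> / (\<eta>\<^sup>2 * D x)"
    using D eta by (simp add: power2_eq_square field_simps)
  finally have "p x * \<bar>max 0 (D x / r y - 1) - max 0 (D x / r z - 1)\<bar> \<le> p x * (\<bar>y - z\<bar> / (\<eta>\<^sup>2 * D x))"
    using p by (intro mult_left_mono) auto
  then show ?thesis unfolding slope_def r_def using p by (simp add: abs_mult flip: right_diff_distrib)
qed

lemma slope_lipschitz_on:
  assumes "0 < a" "a \<le> b" "b < l"
  obtains L where "\<And>x y z. x \<in> {a..b} \<Longrightarrow> \<bar>slope x y - slope x z\<bar> \<le> L * \<bar>y - z\<bar>" "L > 0"
proof -
  have "D x \<noteq> 0" if "x \<in> {a..b}" for x using D_pos[of x] that assms by auto
  then have "continuous_on {a..b} (\<lambda>x. p x / (\<eta>\<^sup>2 * D x))"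
    using eta by (intro continuous_on_divide continuous_on_mult continuous_on_const D_cont
        continuous_on_subset[OF p_cont]) auto
  then have "bdd_above ((\<lambda>x. p x / (\<eta>\<^sup>2 * D x)) ` {a..b})"
    by (simp add: compact_continuous_image compact_imp_bounded bounded_imp_bdd_above)
  then obtain L where "\<forall>x\<in>{a..b}. p x / (\<eta>\<^sup>2 * D x) \<le> L"
    unfolding bdd_above_def by blast
  note L = this[rule_format]
  show thesis
  proof
    fix x y z assume x: "x \<in> {a..b}"
    have "\<bar>slope x y - slope x z\<bar> \<le> p x / (\<eta>\<^sup>2 * D x) * \<bar>y - z\<bar>"
      using slope_lipschitz x assms by simp
    also have "\<dots> \<le> (\<bar>L\<bar> + 1) * \<bar>y - z\<bar>"
      using L[OF x] by (intro mult_right_mono) auto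
    finally show "\<bar>slope x y - slope x z\<bar> \<le> (\<bar>L\<bar> + 1) * \<bar>y - z\<bar>" .
  qed simp
qed

lemma slope_cont:
  assumes "0 < a" "b < l"
  shows "continuous_on ({a..b} \<times> UNIV) (\<lambda>(x, y). slope x y)"
proof -
  have 1: "max (y - F x) (\<eta> * D x) \<noteq> 0" if "x \<in> {a..b}" for x y
  proof -
    have "0 < \<eta> * D x" using D_pos[of x] that assms eta by simp
    then show ?thesis by (auto simp: max_def)
  qed
  have c: "continuous_on ({a..b} \<times> UNIV) (\<lambda>q::real \<times> real. f (fst q))" if "continuous_on UNIV f" for f :: "real \<Rightarrow> real"
    by (rule continuous_on_compose2[OF that]) (auto intro!: continuous_intros)
  show ?thesis unfolding slope_def case_prod_beta
    by (intro continuous_on_mult continuous_on_max continuous_on_diff continuous_on_divide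
        continuous_on_const c[OF p_cont] c[OF F_cont] c[OF D_cont] continuous_on_snd continuous_on_id)
      (use 1 in auto)
qed

definition solves_on :: "(real \<Rightarrow> real) \<Rightarrow> real set \<Rightarrow> bool" where
  "solves_on y S \<longleftrightarrow> (\<forall>x\<in>S. (y has_real_derivative slope x (y x)) (at x within S))"

lemma solves_on_subset: "solves_on y S \<Longrightarrow> T \<subseteq> S \<Longrightarrow> solves_on y T"
  unfolding solves_on_def by (auto intro: DERIV_subset)

lemma solves_on_cont: "solves_on y S \<Longrightarrow> continuous_on S y"
  by (rule has_real_derivative_imp_continuous_on[where f'="\<lambda>x. slope x (y x)"]) (simp add: solves_on_def)

text \<open>At a contact with \<open>F + \<eta> * D\<close> the slope equals
  \<open>p x * (1 / \<eta> - 1)\<close>, which \<open>barrier\<close> makes larger than the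
  derivative of the barrier.\<close>

lemma solution_above:
  assumes s: "solves_on y {a..b}" and ab: "0 < a" "a < b" "b < l" and "F a + \<eta> * D a \<le> y a"
  shows "F b + \<eta> * D b < y b"
proof -
  have "y b - F b - \<eta> * D b > 0"
  proof (rule pos_after_nonneg[of a b "\<lambda>x. y x - F x - \<eta> * D x"])
    show "continuous_on {a..b} (\<lambda>x. y x - F x - \<eta> * D x)"
      by (intro continuous_intros F_cont D_cont solves_on_cont[OF s])
    fix x assume x: "a \<le> x" "x \<le> b" and zero: "y x - F x - \<eta> * D x = 0"
    have D: "D x > 0" using D_pos x ab by simp
    have "D x / max (y x - F x) (\<eta> * D x) = 1 / \<eta>" using zero D eta by simp
    then have "slope x (y x) = p x * (1 / \<eta> - 1)" using eta by (simp add: slope_def max_def)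
    then have "slope x (y x) - F' x - \<eta> * D' x > 0" using barrier[of x] x ab by simp
    moreover have "((\<lambda>x. y x - F x - \<eta> * D x) has_real_derivative slope x (y x) - F' x - \<eta> * D' x) (at x within {a..b})"
      using s x unfolding solves_on_def
      by (auto intro!: derivative_eq_intros has_field_derivative_at_within[OF F_deriv]
          has_field_derivative_at_within[OF D_deriv])
    ultimately show "\<exists>d>0. ((\<lambda>x. y x - F x - \<eta> * D x) has_real_derivative d) (at x within {a..b})"
      by blast
  qed (use assms in auto)
  then show ?thesis by simp
qed

text \<open>At a contact with \<open>F + D\<close> the slope is 0, while the upper graph is strictly
  increasing.\<close>

lemma solution_below:
  assumes s: "solves_on y {a..b}" and ab: "0 < a" "a < b" "b < x0" and "y a \<le> F a + D a"
  shows "y b < F b + D b"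
proof -
  have "F b + D b - y b > 0"
  proof (rule pos_after_nonneg[of a b "\<lambda>x. F x + D x - y x"])
    show "continuous_on {a..b} (\<lambda>x. F x + D x - y x)"
      by (intro continuous_intros F_cont D_cont solves_on_cont[OF s])
    fix x assume x: "a \<le> x" "x \<le> b" and zero: "F x + D x - y x = 0"
    have D: "D x > 0" using D_pos x ab x0 by simp
    have "y x - F x = D x" using zero by simp
    moreover have "max (D x) (\<eta> * D x) = D x" using D eta by (simp add: max_def)
    ultimately have "slope x (y x) = 0" using D by (simp add: slope_def)
    moreover have "((\<lambda>x. F x + D x - y x) has_real_derivative F' x + D' x - slope x (y x)) (at x within {a..b})"
      using s x unfolding solves_on_def
      by (auto intro!: derivative_eq_intros has_field_derivative_at_within[OF F_deriv]
          has_field_derivative_at_within[OF D_deriv])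
    ultimately show "\<exists>d>0. ((\<lambda>x. F x + D x - y x) has_real_derivative d) (at x within {a..b})"
      using FD'_pos[of x] x ab by auto
  qed (use assms in auto)
  then show ?thesis by simp
qed

text \<open>The slope decreases in \<open>y\<close>, so the square of the difference of two
  solutions cannot grow with \<open>x\<close>.\<close>

lemma solutions_contract:
  assumes "solves_on y {a..b}" "solves_on z {a..b}" "0 < a" "a \<le> b" "b < l"
  shows "\<bar>y b - z b\<bar> \<le> \<bar>y a - z a\<bar>"
proof -
  have "- ((y a - z a)\<^sup>2) \<le> - ((y b - z b)\<^sup>2)"
  proof (rule mono_of_deriv_nonneg[of a b "{a..b}" "\<lambda>x. - ((y x - z x)\<^sup>2)"
        "\<lambda>x. - (2 * (y x - z x) * (slope x (y x) - slope x (z x)))"])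
    fix x assume x: "x \<in> {a..b}"
    show "((\<lambda>x. - ((y x - z x)\<^sup>2)) has_real_derivative - (2 * (y x - z x) * (slope x (y x) - slope x (z x)))) (at x within {a..b})"
      using assms(1,2) x unfolding solves_on_def by (auto intro!: derivative_eq_intros)
    show "0 \<le> - (2 * (y x - z x) * (slope x (y x) - slope x (z x)))"
    proof (cases "y x \<le> z x")
      case True
      then show ?thesis using slope_antimono[OF _ _ True] x assms
        by (simp add: mult_le_0_iff)
    next
      case False
      then show ?thesis using slope_antimono[of x "z x" "y x"] x assms
        by (simp add: mult_le_0_iff)
    qed
  qed (use assms in auto)
  then show ?thesis by (simp add: abs_le_square_iff)
qed

text \<open>Approximations start on the upper graph at \<open>a n\<close>. All later approximations
  pass that point between the two graphs, within distance \<open>D (a n)\<close>, and contraction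
  preserves this bound to the right. As \<open>D (a n)\<close> tends to 0, the sequence converges
  locally uniformly although the equation is singular at the starting end.\<close>

theorem ex_solution:
  obtains y where "\<And>x. 0 < x \<Longrightarrow> x < l \<Longrightarrow> (y has_real_derivative slope x (y x)) (at x)"
    and "\<And>x. 0 < x \<Longrightarrow> x < l \<Longrightarrow> F x + \<eta> * D x \<le> y x"
    and "\<And>x. 0 < x \<Longrightarrow> x < x0 \<Longrightarrow> y x < F x + D x"
proof -
  \<comment> \<open>The intervals from \<open>a n\<close> to \<open>b n\<close> exhaust the open
    interval; the shift by 3 makes them nondegenerate from \<open>n = 0\<close> on.\<close>
  define a where "a = (\<lambda>n. l / (real n + 3))"
  define b where "b = (\<lambda>n. l - l / (real n + 3))"
  have ab: "0 < a n" "a n < b n" "b n < l" for n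
    using ell_pos by (auto simp: a_def b_def field_simps intro!: add_pos_nonneg add_nonneg_nonneg)
  have a_le: "a m \<le> a n" and b_le: "b n \<le> b m" if "n \<le> m" for n m
    using that ell_pos by (auto simp: a_def b_def intro!: divide_left_mono)
  have a_lim: "a \<longlonglongrightarrow> 0"
    unfolding a_def by real_asymp
  have b_lim: "b \<longlonglongrightarrow> l"
  proof -
    have "b = (\<lambda>n. l - a n)" by (simp add: a_def b_def)
    then show ?thesis using tendsto_diff[OF tendsto_const[of l] a_lim] by simp
  qed
  have "\<exists>y. y (a n) = F (a n) + D (a n) \<and> solves_on y {a n..b n}" for n
  proof -
    obtain L where L: "\<And>x y z. x \<in> {a n..b n} \<Longrightarrow> \<bar>slope x y - slope x z\<bar> \<le> L * \<bar>y - z\<bar>"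
      using slope_lipschitz_on[of "a n" "b n"] ab[of n] less_imp_le by metis
    obtain y where "y (a n) = F (a n) + D (a n)"
      "\<And>t. t \<in> {a n..b n} \<Longrightarrow> (y has_real_derivative slope t (y t)) (at t within {a n..b n})"
      by (rule picard_interval[OF less_imp_le[OF ab(2)[of n]] slope_cont[OF ab(1,3)[of n]] L]) auto
    then show ?thesis unfolding solves_on_def by blast
  qed
  then obtain Y where Y: "\<And>n. Y n (a n) = F (a n) + D (a n)" "\<And>n. solves_on (Y n) {a n..b n}" by metis
  have sol: "solves_on (Y m) {u..v}" if "a m \<le> u" "v \<le> b m" for m u v
    using solves_on_subset[OF Y(2)] that by auto
  have low: "F x + \<eta> * D x \<le> Y m x" if "a m \<le> x" "x \<le> b m" for m x
  proof (cases "x = a m")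
    case True
    have "\<eta> * D x \<le> 1 * D x" using D_pos[of x] ab[of m] eta that by (intro mult_right_mono) (auto intro: less_imp_le)
    then show ?thesis using True Y(1)[of m] by simp
  next
    case False
    have "\<eta> * D (a m) \<le> 1 * D (a m)" using D_pos[of "a m"] ab[of m] eta by (intro mult_right_mono) (auto intro: less_imp_le)
    then show ?thesis using solution_above[OF sol[of m "a m" x]] that False ab[of m] Y(1)[of m] by simp
  qed
  have up: "Y m x \<le> F x + D x" if "a m \<le> x" "x \<le> b m" "x < x0" for m x
  proof (cases "x = a m")
    case False
    then show ?thesis using solution_below[OF sol[of m "a m" x]] that ab[of m] Y(1)[of m] by simp
  qed (use Y in simp)
  obtain n0 where n0: "\<And>n. n \<ge> n0 \<Longrightarrow> a n < x0"
    using order_tendstoD(2)[OF a_lim x0(1)] unfolding eventually_sequentially by blast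
  have diff: "\<bar>Y n x - Y m x\<bar> \<le> D (a n)" if "n0 \<le> n" "n \<le> m" "a n \<le> x" "x \<le> b n" for n m x
  proof -
    have am: "a m \<le> a n" "b n \<le> b m" using a_le b_le that by auto
    have "\<bar>Y n x - Y m x\<bar> \<le> \<bar>Y n (a n) - Y m (a n)\<bar>"
      using solutions_contract[OF sol[of n "a n" x] sol[of m "a n" x]] that am ab[of n] by simp
    also have "\<dots> \<le> D (a n)"
    proof -
      have "a n \<le> b m" using am ab[of n] by simp
      then have "F (a n) + \<eta> * D (a n) \<le> Y m (a n)" "Y m (a n) \<le> F (a n) + D (a n)"
        using low[of m "a n"] up[of m "a n"] am n0[OF that(1)] by auto
      moreover have "0 \<le> \<eta> * D (a n)" using D_pos[of "a n"] ab[of n] eta by simp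
      ultimately show ?thesis unfolding Y(1)[of n] by simp
    qed
    finally show ?thesis .
  qed
  have D_lim: "(\<lambda>n. D (a n)) \<longlonglongrightarrow> 0"
    using isCont_tendsto_compose[OF DERIV_isCont[OF D_deriv] a_lim] D_0 by simp
  have cover: "\<exists>N. \<forall>n\<ge>N. a n < x \<and> x < b n" if "0 < x" "x < l" for x
    using eventually_conj[OF order_tendstoD(2)[OF a_lim that(1)] order_tendstoD(1)[OF b_lim that(2)]]
    unfolding eventually_sequentially .
  have "convergent (\<lambda>n. Y n x)" if x: "0 < x" "x < l" for x
    unfolding Cauchy_convergent_iff[symmetric]
  proof (rule metric_CauchyI)
    fix e :: real assume "e > 0"
    obtain N where N: "\<And>n. n \<ge> N \<Longrightarrow> a n < x \<and> x < b n" using cover[OF x] by blast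
    obtain N' where N': "\<And>n. n \<ge> N' \<Longrightarrow> D (a n) < e / 2"
      using order_tendstoD(2)[OF D_lim, of "e/2"] \<open>e > 0\<close> unfolding eventually_sequentially by auto
    obtain M where M: "n0 \<le> M" "N \<le> M" "N' \<le> M"
      by (metis max.cobounded1 max.cobounded2 order_trans)
    have "\<bar>Y M x - Y m x\<bar> < e / 2" if "m \<ge> M" for m
      using diff[of M m x] N[of M] N'[of M] that M by simp
    then have "dist (Y m x) (Y n x) < e" if "m \<ge> M" "n \<ge> M" for m n
      using that[THEN \<open>\<And>m. m \<ge> M \<Longrightarrow> \<bar>Y M x - Y m x\<bar> < e / 2\<close>] unfolding dist_real_def by linarith
    then show "\<exists>M. \<forall>m\<ge>M. \<forall>n\<ge>M. dist (Y m x) (Y n x) < e" by blast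
  qed
  then obtain y where lim: "\<And>x. 0 < x \<Longrightarrow> x < l \<Longrightarrow> (\<lambda>n. Y n x) \<longlonglongrightarrow> y x"
    unfolding convergent_def by metis
  have rate: "\<bar>Y n x - y x\<bar> \<le> D (a n)" if "n0 \<le> n" "a n \<le> x" "x \<le> b n" for n x
  proof (rule tendsto_upperbound)
    show "(\<lambda>m. \<bar>Y n x - Y m x\<bar>) \<longlonglongrightarrow> \<bar>Y n x - y x\<bar>"
      using lim[of x] that ab[of n] by (intro tendsto_intros) auto
    show "\<forall>\<^sub>F m in sequentially. \<bar>Y n x - Y m x\<bar> \<le> D (a n)"
      using eventually_ge_at_top[of n] by eventually_elim (use diff that in auto)
  qed simp
  have deriv: "(y has_real_derivative slope x (y x)) (at x)" if x: "0 < x" "x < l" for x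
  proof -
    obtain K where K: "K \<ge> n0" "a K < x" "x < b K"
      using cover[OF x] by (metis max.cobounded1 max.cobounded2)
    define S where "S = {a K..b K}"
    obtain L where L: "\<And>x y z. x \<in> S \<Longrightarrow> \<bar>slope x y - slope x z\<bar> \<le> L * \<bar>y - z\<bar>" "L > 0"
      using slope_lipschitz_on[of "a K" "b K"] ab[of K] less_imp_le unfolding S_def by metis
    \<comment> \<open>The uniform rate and the Lipschitz bound on \<open>S\<close> make the slopes
      converge uniformly, so the limit may be differentiated termwise. The shift by \<open>K\<close>
      discards approximations not yet defined on all of \<open>S\<close>.\<close>
    have "\<exists>g. \<forall>u\<in>S. (\<lambda>n. Y (n + K) u) \<longlonglongrightarrow> g u \<and> (g has_derivative (\<lambda>h. slope u (y u) * h)) (at u within S)"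
    proof (rule has_derivative_sequence[where f'="\<lambda>n u h. slope u (Y (n + K) u) * h"])
      show "convex S" by (simp add: S_def)
      fix n u assume u: "u \<in> S"
      have "solves_on (Y (n + K)) S"
        using sol[of "n + K"] a_le[of K "n + K"] b_le[of K "n + K"] by (simp add: S_def)
      then show "(Y (n + K) has_derivative (\<lambda>h. slope u (Y (n + K) u) * h)) (at u within S)"
        using u unfolding solves_on_def has_field_derivative_def by simp
    next
      fix e :: real assume "e > 0"
      then obtain N where N: "\<And>n. n \<ge> N \<Longrightarrow> D (a n) < e / L"
        using order_tendstoD(2)[OF D_lim, of "e/L"] L(2) unfolding eventually_sequentially by auto
      show "\<forall>\<^sub>F n in sequentially. \<forall>u\<in>S. \<forall>h. norm (slope u (Y (n + K) u) * h - slope u (y u) * h) \<le> e * norm h"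
        unfolding eventually_sequentially
      proof (intro exI allI impI ballI)
        fix n u h assume n: "N \<le> n" and u: "u \<in> S"
        have "a (n + K) \<le> u" "u \<le> b (n + K)"
          using u a_le[of K "n + K"] b_le[of K "n + K"] by (auto simp: S_def)
        then have "\<bar>Y (n + K) u - y u\<bar> \<le> e / L"
          using rate[of "n + K" u] N[of "n + K"] n K(1) by simp
        then have "L * \<bar>Y (n + K) u - y u\<bar> \<le> e" using L(2) by (simp add: field_simps)
        then have "\<bar>slope u (Y (n + K) u) - slope u (y u)\<bar> \<le> e"
          using L(1)[OF u, of "Y (n + K) u" "y u"] by simp
        then have "\<bar>slope u (Y (n + K) u) - slope u (y u)\<bar> * \<bar>h\<bar> \<le> e * \<bar>h\<bar>"
          by (intro mult_right_mono) auto
        then show "norm (slope u (Y (n + K) u) * h - slope u (y u) * h) \<le> e * norm h"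
          by (simp add: abs_mult flip: left_diff_distrib)
      qed
    next
      show "x \<in> S" using K by (simp add: S_def)
      show "(\<lambda>n. Y (n + K) x) \<longlonglongrightarrow> y x" using LIMSEQ_ignore_initial_segment[OF lim[OF x]] .
    qed
    then obtain g where g: "\<And>u. u \<in> S \<Longrightarrow> (\<lambda>n. Y (n + K) u) \<longlonglongrightarrow> g u"
      "\<And>u. u \<in> S \<Longrightarrow> (g has_derivative (\<lambda>h. slope u (y u) * h)) (at u within S)" by blast
    have gy: "g u = y u" if "u \<in> S" for u
      using LIMSEQ_unique[OF g(1)[OF that] LIMSEQ_ignore_initial_segment[OF lim]] that ab[of K] by (auto simp: S_def)
    have "(g has_real_derivative slope x (y x)) (at x within S)"
      using g(2)[of x] K by (simp add: has_field_derivative_def S_def)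
    then have "(y has_real_derivative slope x (y x)) (at x within S)"
      by (rule has_field_derivative_transform_within[where d=1]) (use gy K in \<open>auto simp: S_def\<close>)
    then show ?thesis using K by (simp add: S_def at_within_Icc_at)
  qed
  have y_low: "F x + \<eta> * D x \<le> y x" if x: "0 < x" "x < l" for x
  proof (rule tendsto_lowerbound[OF lim[OF x]])
    show "\<forall>\<^sub>F n in sequentially. F x + \<eta> * D x \<le> Y n x"
      using cover[OF x] low unfolding eventually_sequentially by (meson less_imp_le)
  qed simp
  have y_up: "y x \<le> F x + D x" if x: "0 < x" "x < x0" for x
  proof (rule tendsto_upperbound)
    show "(\<lambda>n. Y n x) \<longlonglongrightarrow> y x" using lim x x0 by simp
    show "\<forall>\<^sub>F n in sequentially. Y n x \<le> F x + D x"
      using cover[of x] up x x0 unfolding eventually_sequentially by (meson less_imp_le less_le_trans)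
  qed simp
  show thesis
  proof
    fix x assume x: "0 < x" "x < x0"
    \<comment> \<open>Passing to the limit only gave a weak upper bound; restarting from
      \<open>x / 2\<close> makes it strict.\<close>
    have "solves_on y {x/2..x}" unfolding solves_on_def
      using x x0 by (auto intro!: has_field_derivative_at_within[OF deriv])
    then show "y x < F x + D x" by (rule solution_below) (use x x0 y_up[of "x/2"] in auto)
  qed (use deriv y_low in auto)
qed

text \<open>The ratio \<open>z = (y - F) / D\<close> satisfies \<open>D z' = h(x, z)\<close> with \<open>h\<close> decreasing in \<open>z\<close>, so towards
  the singular endpoint it is repelled from everything but the zero \<open>zc\<close> of \<open>h(0, _)\<close>.\<close>

lemma ratio_limit:
  assumes y: "\<And>x. 0 < x \<Longrightarrow> x < x0 \<Longrightarrow> (y has_real_derivative slope x (y x)) (at x)"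
    and low: "\<And>x. 0 < x \<Longrightarrow> x < x0 \<Longrightarrow> F x + \<eta> * D x \<le> y x"
    and up: "\<And>x. 0 < x \<Longrightarrow> x < x0 \<Longrightarrow> y x < F x + D x"
    and x1: "0 < x1" "x1 \<le> x0" and D'_nonneg: "\<And>x. 0 \<le> x \<Longrightarrow> x < x1 \<Longrightarrow> D' x \<ge> 0"
    and K: "\<And>x. 0 < x \<Longrightarrow> x < x1 \<Longrightarrow> D x \<le> K * x"
    and zc: "0 < zc" "p 0 * (1 / zc - 1) = F' 0 + D' 0 * zc"
  shows "((\<lambda>x. (y x - F x) / D x) \<longlongrightarrow> zc) (at_right 0)"
proof -
  define z where "z = (\<lambda>x. (y x - F x) / D x)"
  define h where "h = (\<lambda>x z. p x * (1 / z - 1) - F' x - D' x * z)"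
  have D: "D x > 0" if "0 < x" "x < x0" for x using D_pos that x0 by simp
  have "0 < K * (x1 / 2)" using K[of "x1/2"] D[of "x1/2"] x1 by simp
  then have Kpos: "K > 0" using x1 by (simp add: zero_less_mult_iff)
  have z: "\<eta> \<le> z x" "z x < 1" if "0 < x" "x < x0" for x
    using low[OF that] up[OF that] D[OF that] by (auto simp: z_def field_simps)
  have z_deriv: "(z has_real_derivative h x (z x) / D x) (at x)" if x: "0 < x" "x < x0" for x
  proof -
    have "D x / max (y x - F x) (\<eta> * D x) = 1 / z x"
      using low[OF x] D[OF x] by (simp add: z_def max_def)
    moreover have "1 / z x > 1" using z[OF x] eta by simp
    ultimately have sl: "slope x (y x) = p x * (1 / z x - 1)" by (simp add: slope_def max_def)
    have "(z has_real_derivative ((slope x (y x) - F' x) * D x - (y x - F x) * D' x) / (D x * D x)) (at x)"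
      unfolding z_def using D[OF x]
      by (auto intro!: derivative_eq_intros y[OF x] F_deriv D_deriv simp: power2_eq_square)
    moreover have "((slope x (y x) - F' x) * D x - (y x - F x) * D' x) / (D x * D x)
        = (slope x (y x) - F' x - z x * D' x) / D x"
      using D[OF x] by (simp add: z_def field_simps)
    ultimately show ?thesis by (simp add: sl h_def mult_ac)
  qed
  have h_mono: "h x u \<le> h x v" if "0 \<le> x" "x < x1" "0 < v" "v \<le> u" for x u v
  proof -
    have "p x * (1 / u - 1) \<le> p x * (1 / v - 1)"
      using p_pos[of x] that x1 x0 by (intro mult_left_mono) (auto simp: frac_le)
    moreover have "D' x * v \<le> D' x * u" using D'_nonneg that by (intro mult_left_mono) auto
    ultimately show ?thesis by (simp add: h_def)
  qed
  have h_strict: "h 0 u < h 0 v" if "0 < v" "v < u" for u v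
  proof -
    have "p 0 * (1 / u - 1) < p 0 * (1 / v - 1)"
      using p_pos[of 0] that ell_pos by (intro mult_strict_left_mono) (auto simp: frac_less2)
    moreover have "D' 0 * v \<le> D' 0 * u" using D'_nonneg[of 0] that x1 by (intro mult_left_mono) auto
    ultimately show ?thesis by (simp add: h_def)
  qed
  have h_zc: "h 0 zc = 0" using zc by (simp add: h_def)
  have h_lim: "((\<lambda>x. h x u) \<longlongrightarrow> h 0 u) (at_right 0)" for u
  proof -
    have "isCont p 0" "isCont F' 0" "isCont D' 0"
      using p_cont F'_cont D'_cont by (auto simp: continuous_on_eq_continuous_at)
    then have "isCont (\<lambda>x. h x u) 0" unfolding h_def by (intro continuous_intros)
    then show ?thesis unfolding isCont_def using tendsto_within_subset[of _ _ 0 UNIV] by blast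
  qed
  have upper: "eventually (\<lambda>x. z x < zc + \<epsilon>) (at_right 0)" if "\<epsilon> > 0" for \<epsilon>
  proof -
    \<comment> \<open>Half of the value at 0, so that by continuity the bound persists near 0; by
      monotonicity in the ratio it then holds for all larger ratios as well.\<close>
    define \<delta> where "\<delta> = - h 0 (zc + \<epsilon>) / 2"
    have d: "\<delta> > 0" using h_strict[of zc "zc + \<epsilon>"] h_zc zc(1) that by (simp add: \<delta>_def)
    have "eventually (\<lambda>x. h x (zc + \<epsilon>) < - \<delta>) (at_right 0)"
      by (rule order_tendstoD(2)[OF h_lim]) (use d in \<open>simp add: \<delta>_def\<close>)
    then obtain \<xi>' where \<xi>': "\<xi>' > 0" "\<And>x. 0 < x \<Longrightarrow> x < \<xi>' \<Longrightarrow> h x (zc + \<epsilon>) < - \<delta>"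
      unfolding eventually_at_right_field by blast
    define \<xi> where "\<xi> = min \<xi>' x1"
    have \<xi>: "\<xi> > 0" "\<xi> \<le> x1" using \<xi>' x1 by (auto simp: \<xi>_def)
    have "z x < zc + \<epsilon>" if "0 < x" "x < \<xi>" for x
    proof (rule below_of_log_escape[where w=z and ?x1.0=\<xi> and w'="\<lambda>x. h x (z x) / D x" and \<delta>="\<delta> / K" and B=1])
      fix u assume u: "0 < u" "u < \<xi>"
      show "(z has_real_derivative h u (z u) / D u) (at u)" using z_deriv u \<xi> x1 by simp
      show "z u \<le> 1" using z[of u] u \<xi> x1 by simp
      assume "z u \<ge> zc + \<epsilon>"
      then have "h u (z u) \<le> h u (zc + \<epsilon>)" using h_mono u \<xi> zc \<open>\<epsilon> > 0\<close> by simp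
      then have "h u (z u) \<le> - \<delta>" using \<xi>'(2)[of u] u by (simp add: \<xi>_def)
      then have "h u (z u) / D u \<le> - \<delta> / D u"
        using D[of u] u \<xi> x1 by (intro divide_right_mono) auto
      \<comment> \<open>The bound \<open>D u \<le> K * u\<close> turns the singular factor into the
        rate 1/u required for logarithmic escape.\<close>
      moreover have "\<delta> / (K * u) \<le> \<delta> / D u"
        using K[of u] D[of u] u \<xi> x1 d Kpos by (intro divide_left_mono mult_pos_pos) auto
      ultimately show "h u (z u) / D u \<le> - (\<delta> / K) / u" by simp
    qed (use that d Kpos in auto)
    then show ?thesis unfolding eventually_at_right_field using \<xi> by blast
  qed
  have lower: "eventually (\<lambda>x. z x > zc - \<epsilon>) (at_right 0)" if "\<epsilon> > 0" "\<epsilon> < zc" for \<epsilon>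
  proof -
    define \<delta> where "\<delta> = h 0 (zc - \<epsilon>) / 2"
    have d: "\<delta> > 0" using h_strict[of "zc - \<epsilon>" zc] h_zc zc(1) that by (simp add: \<delta>_def)
    have "eventually (\<lambda>x. h x (zc - \<epsilon>) > \<delta>) (at_right 0)"
      by (rule order_tendstoD(1)[OF h_lim]) (use d in \<open>simp add: \<delta>_def\<close>)
    then obtain \<xi>' where \<xi>': "\<xi>' > 0" "\<And>x. 0 < x \<Longrightarrow> x < \<xi>' \<Longrightarrow> h x (zc - \<epsilon>) > \<delta>"
      unfolding eventually_at_right_field by blast
    define \<xi> where "\<xi> = min \<xi>' x1"
    have \<xi>: "\<xi> > 0" "\<xi> \<le> x1" using \<xi>' x1 by (auto simp: \<xi>_def)
    have "- z x < - (zc - \<epsilon>)" if "0 < x" "x < \<xi>" for x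
    proof (rule below_of_log_escape[where ?x1.0=\<xi> and w="\<lambda>x. - z x" and w'="\<lambda>x. - (h x (z x) / D x)" and \<delta>="\<delta> / K" and B=0])
      fix u assume u: "0 < u" "u < \<xi>"
      show "((\<lambda>x. - z x) has_real_derivative - (h u (z u) / D u)) (at u)"
        using u \<xi> x1 by (intro DERIV_minus z_deriv) auto
      have zu: "z u > 0" using z[of u] u \<xi> x1 eta by simp
      then show "- z u \<le> 0" by simp
      assume "- z u \<ge> - (zc - \<epsilon>)"
      then have "h u (zc - \<epsilon>) \<le> h u (z u)" using h_mono u \<xi> zu by simp
      then have "\<delta> \<le> h u (z u)" using \<xi>'(2)[of u] u by (simp add: \<xi>_def)
      then have "\<delta> / D u \<le> h u (z u) / D u"
        using D[of u] u \<xi> x1 by (intro divide_right_mono) auto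
      moreover have "\<delta> / (K * u) \<le> \<delta> / D u"
        using K[of u] D[of u] u \<xi> x1 d Kpos by (intro divide_left_mono mult_pos_pos) auto
      ultimately show "- (h u (z u) / D u) \<le> - (\<delta> / K) / u" by simp
    qed (use that d Kpos in auto)
    then show ?thesis unfolding eventually_at_right_field using \<xi> by (intro exI[of _ \<xi>]) force
  qed
  have "((\<lambda>x. z x) \<longlongrightarrow> zc) (at_right 0)"
  proof (rule order_tendstoI)
    fix c assume "c < zc"
    define \<epsilon> where "\<epsilon> = min (zc - c) (zc / 2)"
    have "\<epsilon> > 0" "\<epsilon> < zc" "c \<le> zc - \<epsilon>" using \<open>c < zc\<close> zc by (auto simp: \<epsilon>_def)
    show "eventually (\<lambda>x. c < z x) (at_right 0)"
      using lower[OF \<open>\<epsilon> > 0\<close> \<open>\<epsilon> < zc\<close>] by eventually_elim (use \<open>c \<le> zc - \<epsilon>\<close> in simp)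
  next
    fix c assume "c > zc"
    then show "eventually (\<lambda>x. z x < c) (at_right 0)" using upper[of "c - zc"] by simp
  qed
  then show ?thesis by (simp add: z_def)
qed

end

subsection \<open>The dimensionless planar system\<close>

lemma bounded_if_tendsto_at_top:
  fixes f :: "real \<Rightarrow> real"
  assumes "continuous_on {0..} f" "(f \<longlongrightarrow> l) at_top"
  obtains K where "K > 0" "\<And>t. t \<ge> 0 \<Longrightarrow> \<bar>f t\<bar> \<le> K"
proof -
  have "eventually (\<lambda>t. \<bar>f t - l\<bar> < 1) at_top"
    using tendstoD[OF assms(2), of 1] by (simp add: dist_real_def)
  then obtain T where T: "\<And>t. t \<ge> T \<Longrightarrow> \<bar>f t - l\<bar> < 1" unfolding eventually_at_top_linorder by blast
  have "bounded (f ` {0..\<bar>T\<bar>})"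
    by (intro compact_imp_bounded compact_continuous_image continuous_on_subset[OF assms(1)]) auto
  then obtain B where B: "\<forall>x\<in>{0..\<bar>T\<bar>}. \<bar>f x\<bar> \<le> B" unfolding bounded_iff by auto
  show thesis
  proof
    show "\<bar>B\<bar> + \<bar>l\<bar> + 1 > 0" by simp
    show "\<bar>f t\<bar> \<le> \<bar>B\<bar> + \<bar>l\<bar> + 1" if "t \<ge> 0" for t
    proof (cases "t \<le> \<bar>T\<bar>")
      case True
      then show ?thesis using bspec[OF B, of t] that by auto
    next
      case False
      then have "T \<le> t" by linarith
      then show ?thesis using T[of t] by linarith
    qed
  qed
qed

lemma nonpos_if_mono_tendsto_0:
  fixes f :: "real \<Rightarrow> real"
  assumes "(f \<longlongrightarrow> 0) at_top" "\<And>s. s \<ge> t \<Longrightarrow> f t \<le> f s"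
  shows "f t \<le> 0"
  by (rule tendsto_lowerbound[OF assms(1)]) (auto intro: eventually_mono[OF eventually_ge_at_top[of t]] assms(2))

text \<open>Gronwall for the squared norm \<open>N\<close>: its derivative is at most
  \<open>4 * A * N\<close> in absolute value, so an exponential factor of the appropriate sign makes
  it monotone, and the zero at \<open>s\<close> propagates both backwards and forwards.\<close>

lemma linear_system_zero:
  fixes x y :: "real \<Rightarrow> real"
  assumes x: "\<And>t. t \<ge> 0 \<Longrightarrow> (x has_real_derivative \<alpha> t * x t + \<beta> t * y t) (at t within {0..})"
    and y: "\<And>t. t \<ge> 0 \<Longrightarrow> (y has_real_derivative \<gamma> t * x t + \<delta> t * y t) (at t within {0..})"
    and A: "\<And>t. t \<ge> 0 \<Longrightarrow> \<bar>\<alpha> t\<bar> \<le> A" "\<And>t. t \<ge> 0 \<Longrightarrow> \<bar>\<beta> t\<bar> \<le> A"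
      "\<And>t. t \<ge> 0 \<Longrightarrow> \<bar>\<gamma> t\<bar> \<le> A" "\<And>t. t \<ge> 0 \<Longrightarrow> \<bar>\<delta> t\<bar> \<le> A"
    and s: "s \<ge> 0" "x s = 0" "y s = 0" and t: "t \<ge> 0"
  shows "x t = 0 \<and> y t = 0"
proof -
  define N where "N = (\<lambda>t. (x t)\<^sup>2 + (y t)\<^sup>2)"
  define N' where "N' = (\<lambda>t. 2 * x t * (\<alpha> t * x t + \<beta> t * y t) + 2 * y t * (\<gamma> t * x t + \<delta> t * y t))"
  have N: "(N has_real_derivative N' t) (at t within {0..})" if "t \<ge> 0" for t
    unfolding N_def N'_def by (auto intro!: derivative_eq_intros x y that)
  have N'_le: "\<bar>N' t\<bar> \<le> 4 * A * N t" if "t \<ge> 0" for t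
  proof -
    have xy: "2 * \<bar>x t * y t\<bar> \<le> N t"
      using sum_squares_bound[of "\<bar>x t\<bar>" "\<bar>y t\<bar>"] by (simp add: N_def abs_mult)
    have A0: "A \<ge> 0" using A(1)[OF that] by simp
    have "\<bar>N' t\<bar> \<le> 2 * \<bar>\<alpha> t\<bar> * (x t)\<^sup>2 + \<bar>\<beta> t\<bar> * (2 * \<bar>x t * y t\<bar>) + (\<bar>\<gamma> t\<bar> * (2 * \<bar>x t * y t\<bar>) + 2 * \<bar>\<delta> t\<bar> * (y t)\<^sup>2)"
    proof -
      have "N' t = 2 * \<alpha> t * (x t)\<^sup>2 + \<beta> t * (2 * (x t * y t)) + (\<gamma> t * (2 * (x t * y t)) + 2 * \<delta> t * (y t)\<^sup>2)"
        by (simp add: N'_def power2_eq_square algebra_simps)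
      also have "\<bar>\<dots>\<bar> \<le> (\<bar>2 * \<alpha> t * (x t)\<^sup>2\<bar> + \<bar>\<beta> t * (2 * (x t * y t))\<bar>) + (\<bar>\<gamma> t * (2 * (x t * y t))\<bar> + \<bar>2 * \<delta> t * (y t)\<^sup>2\<bar>)"
        by (intro order_trans[OF abs_triangle_ineq] add_mono abs_triangle_ineq)
      finally show ?thesis by (simp add: abs_mult)
    qed
    also have "\<dots> \<le> 2 * A * (x t)\<^sup>2 + A * N t + (A * N t + 2 * A * (y t)\<^sup>2)"
      using A(1)[OF that] A(2)[OF that] A(3)[OF that] A(4)[OF that] xy A0
      by (intro add_mono mult_mono) auto
    also have "\<dots> = 4 * A * N t" by (simp add: N_def algebra_simps)
    finally show ?thesis .
  qed
  have E: "((\<lambda>t. N t * exp (c * t)) has_real_derivative (N' t + c * N t) * exp (c * t)) (at t within {0..})"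
    if "t \<ge> 0" for t c
    by (auto intro!: derivative_eq_intros N that simp: algebra_simps)
  have "N t \<le> 0"
  proof (cases "t \<le> s")
    case True
    have "N t * exp (4 * A * t) \<le> N s * exp (4 * A * s)"
    proof (rule mono_of_deriv_nonneg[OF True, where S="{0..}" and f="\<lambda>t. N t * exp (4 * A * t)"])
      fix r assume r: "r \<in> {t..s}"
      show "((\<lambda>t. N t * exp (4 * A * t)) has_real_derivative (N' r + 4 * A * N r) * exp (4 * A * r)) (at r within {0..})"
        using r t by (intro E) auto
      show "0 \<le> (N' r + 4 * A * N r) * exp (4 * A * r)" using N'_le[of r] r t by auto
    qed (use t in auto)
    then show ?thesis using s by (simp add: N_def mult_le_0_iff)
  next
    case False
    have "- (N s * exp (- 4 * A * s)) \<le> - (N t * exp (- 4 * A * t))"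
    proof (rule mono_of_deriv_nonneg[where S="{0..}" and f="\<lambda>t. - (N t * exp (- 4 * A * t))"])
      fix r assume r: "r \<in> {s..t}"
      show "((\<lambda>t. - (N t * exp (- 4 * A * t))) has_real_derivative - ((N' r + (- 4 * A) * N r) * exp (- 4 * A * r))) (at r within {0..})"
        using r s by (intro DERIV_minus E) auto
      have "N' r + (- 4 * A) * N r \<le> 0" using N'_le[of r] r s by auto
      then show "0 \<le> - ((N' r + (- 4 * A) * N r) * exp (- 4 * A * r))"
        by (simp add: mult_le_0_iff)
    qed (use s False in auto)
    then show ?thesis using s by (simp add: N_def mult_le_0_iff)
  qed
  then show ?thesis by (simp add: N_def sum_power2_le_zero_iff)
qed

locale planar_system =
  fixes m n a g :: real
  assumes pos: "m > 0" "n > 0" "a > 0" "g > 0"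
begin

definition nullF :: "real \<Rightarrow> real" where "nullF X = - X\<^sup>2 - (1 - a) * X"
definition nullG :: "real \<Rightarrow> real" where "nullG X = g * (X\<^sup>2 / 2 - a * X)"
text \<open>Minus the determinant of the linearisation at the origin, divided by
  \<open>m * n\<close>. The origin is a saddle for \<open>e > 0\<close>, has a zero eigenvalue for
  \<open>e = 0\<close>, and is a source for \<open>e < 0\<close>, where the trace is positive
  because a < 1.\<close>

definition e :: real where "e = (g + 1) * a - 1"

text \<open>The bounds X > -1 and Y > -a express positive velocity and positive temperature in the
  scaled variables.\<close>

definition orbit :: "(real \<Rightarrow> real) \<Rightarrow> (real \<Rightarrow> real) \<Rightarrow> bool" where
  "orbit X Y \<longleftrightarrow>
     (\<forall>t\<ge>0. (X has_real_derivative m * (Y t - nullF (X t))) (at t within {0..})) \<and>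
     (\<forall>t\<ge>0. (Y has_real_derivative n * (1 + X t) * (Y t - nullG (X t))) (at t within {0..})) \<and>
     (\<forall>t\<ge>0. X t > - 1 \<and> Y t > - a) \<and> (X \<longlongrightarrow> 0) at_top \<and> (Y \<longlongrightarrow> 0) at_top"

lemma nullF_deriv: "(nullF has_real_derivative (- 2 * X - (1 - a))) (at X within S)"
  unfolding nullF_def by (auto intro!: derivative_eq_intros)

lemma nullG_deriv: "(nullG has_real_derivative g * (X - a)) (at X within S)"
  unfolding nullG_def by (auto intro!: derivative_eq_intros)

lemma gap_eq: "nullG X - nullF X = X * ((g / 2 + 1) * X - e)"
  by (simp add: nullF_def nullG_def e_def power2_eq_square algebra_simps)

section \<open>Residuals along an orbit\<close>

context
  fixes X Y :: "real \<Rightarrow> real"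
  assumes orb: "orbit X Y"
begin

definition "pp = (\<lambda>t. Y t - nullF (X t))"
definition "qq = (\<lambda>t. Y t - nullG (X t))"

lemma X_deriv: "t \<ge> 0 \<Longrightarrow> (X has_real_derivative m * pp t) (at t within {0..})"
  and Y_deriv: "t \<ge> 0 \<Longrightarrow> (Y has_real_derivative n * (1 + X t) * qq t) (at t within {0..})"
  and X_gt: "t \<ge> 0 \<Longrightarrow> X t > - 1" and Y_gt: "t \<ge> 0 \<Longrightarrow> Y t > - a"
  and X_lim: "(X \<longlongrightarrow> 0) at_top" and Y_lim: "(Y \<longlongrightarrow> 0) at_top"
  using orb by (auto simp: orbit_def pp_def qq_def)

lemma X_cont: "continuous_on {0..} X" and Y_cont: "continuous_on {0..} Y"
  by (rule has_real_derivative_imp_continuous_on[OF X_deriv] has_real_derivative_imp_continuous_on[OF Y_deriv]; simp)+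

text \<open>Differentiating the residuals along the orbit gives a linear system with bounded
  time-dependent coefficients. Both the uniqueness argument and the sign argument are read off from
  it.\<close>

lemma pp_deriv: "t \<ge> 0 \<Longrightarrow>
    (pp has_real_derivative (m * (2 * X t + 1 - a)) * pp t + (n * (1 + X t)) * qq t) (at t within {0..})"
  unfolding pp_def using X_deriv[of t] Y_deriv[of t] unfolding pp_def qq_def
  by (auto intro!: derivative_eq_intros DERIV_chain2[OF nullF_deriv] simp: algebra_simps)

lemma qq_deriv: "t \<ge> 0 \<Longrightarrow>
    (qq has_real_derivative (m * g * (a - X t)) * pp t + (n * (1 + X t)) * qq t) (at t within {0..})"
  unfolding qq_def using X_deriv[of t] Y_deriv[of t] unfolding pp_def qq_def
  by (auto intro!: derivative_eq_intros DERIV_chain2[OF nullG_deriv] simp: algebra_simps)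

lemma pq_cont: "continuous_on {0..} pp" "continuous_on {0..} qq"
  by (rule has_real_derivative_imp_continuous_on[OF pp_deriv] has_real_derivative_imp_continuous_on[OF qq_deriv]; simp)+

text \<open>By uniqueness for the residuals, an orbit meeting an equilibrium is stationary;
  convergence then forces this equilibrium to be the origin, which excludes the second intersection
  of the nullclines.\<close>

lemma zero_if_equilibrium:
  assumes "s \<ge> 0" "pp s = 0" "qq s = 0" "t \<ge> 0"
  shows "X t = 0 \<and> Y t = 0"
proof -
  obtain K where K: "K > 0" "\<And>t. t \<ge> 0 \<Longrightarrow> \<bar>X t\<bar> \<le> K"
    by (rule bounded_if_tendsto_at_top[OF X_cont X_lim]) auto
  define A where "A = m * (2 * K + 1 + a) + n * (1 + K) + m * g * (a + K)"
  have nn: "0 \<le> m * (2 * K + 1 + a)" "0 \<le> n * (1 + K)" "0 \<le> m * g * (a + K)"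
    using pos K by auto
  have b1: "\<bar>m * (2 * X t + 1 - a)\<bar> \<le> A" if "t \<ge> 0" for t
  proof -
    have "\<bar>2 * X t + 1 - a\<bar> \<le> 2 * K + 1 + a" using K(2)[OF that] pos by arith
    then have "m * \<bar>2 * X t + 1 - a\<bar> \<le> m * (2 * K + 1 + a)" using pos by (intro mult_left_mono) auto
    moreover have "\<bar>m * (2 * X t + 1 - a)\<bar> = m * \<bar>2 * X t + 1 - a\<bar>" using pos by (simp add: abs_mult)
    ultimately show ?thesis using nn unfolding A_def by linarith
  qed
  have b2: "\<bar>n * (1 + X t)\<bar> \<le> A" if "t \<ge> 0" for t
  proof -
    have "\<bar>1 + X t\<bar> \<le> 1 + K" using K(2)[OF that] by arith
    then have "n * \<bar>1 + X t\<bar> \<le> n * (1 + K)" using pos by (intro mult_left_mono) auto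
    moreover have "\<bar>n * (1 + X t)\<bar> = n * \<bar>1 + X t\<bar>" using pos by (simp add: abs_mult)
    ultimately show ?thesis using nn unfolding A_def by linarith
  qed
  have b3: "\<bar>m * g * (a - X t)\<bar> \<le> A" if "t \<ge> 0" for t
  proof -
    have "\<bar>a - X t\<bar> \<le> a + K" using K(2)[OF that] pos by arith
    then have "m * g * \<bar>a - X t\<bar> \<le> m * g * (a + K)" using pos by (intro mult_left_mono) auto
    moreover have "\<bar>m * g * (a - X t)\<bar> = m * g * \<bar>a - X t\<bar>" using pos by (simp add: abs_mult)
    ultimately show ?thesis using nn unfolding A_def by linarith
  qed
  have zero: "pp t = 0 \<and> qq t = 0" if "t \<ge> 0" for t
    by (rule linear_system_zero[OF pp_deriv qq_deriv b1 b2 b3 b2 assms(1-3) that])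
  have const: "f t = 0" if f: "\<And>t. t \<ge> 0 \<Longrightarrow> (f has_real_derivative 0) (at t within {0..})" "(f \<longlongrightarrow> 0) at_top" for f
  proof -
    have "f t \<le> 0"
      by (rule nonpos_if_mono_tendsto_0[OF f(2)], rule mono_of_deriv_nonneg[OF _ _ f(1)]) (use assms in auto)
    moreover have "- f t \<le> 0"
    proof (rule nonpos_if_mono_tendsto_0[where f="\<lambda>t. - f t" and t=t])
      show "((\<lambda>t. - f t) \<longlongrightarrow> 0) at_top" using tendsto_minus[OF f(2)] by simp
      show "- f t \<le> - f s" if "s \<ge> t" for s
        by (rule mono_of_deriv_nonneg[OF that, where S="{0..}" and f="\<lambda>t. - f t" and f'="\<lambda>_. 0"])
          (use assms DERIV_minus[OF f(1)] in auto)
    qed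
    ultimately show ?thesis by simp
  qed
  have "X t = 0" by (rule const[OF _ X_lim]) (use X_deriv zero in force)
  moreover have "Y t = 0" by (rule const[OF _ Y_lim]) (use Y_deriv zero in force)
  ultimately show ?thesis by simp
qed

text \<open>For \<open>e < 0\<close> the origin is a source, with \<open>g a X\<^sup>2 / m + Y\<^sup>2 / n\<close> as Lyapunov function.\<close>

lemma trivial_if_source:
  assumes "e < 0" "t \<ge> 0"
  shows "X t = 0 \<and> Y t = 0"
proof -
  \<comment> \<open>\<open>B\<close> collects the coefficients of x^2 in the bounds for the cubic
    terms of the Lyapunov derivative; in a box of size \<epsilon> they are then dominated by the
    quadratic term \<open>- g * a * e * x\<^sup>2\<close>.\<close>
  define B where "B = 2 * g\<^sup>2 * a\<^sup>2 + 2 * g * a + g"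
  have B: "B > 0" using pos by (simp add: B_def add_nonneg_pos)
  define \<epsilon> where "\<epsilon> = min (1 / 2) (g * a * (- e) / B)"
  have eps: "\<epsilon> > 0" "\<epsilon> \<le> 1 / 2" "\<epsilon> * B \<le> g * a * (- e)"
  proof -
    have "0 < g * a * (- e)" using pos assms by (simp add: mult_pos_neg)
    from divide_pos_pos[OF this B] show "\<epsilon> > 0" unfolding \<epsilon>_def min_less_iff_conj by simp
    show "\<epsilon> \<le> 1 / 2" unfolding \<epsilon>_def by (rule min.cobounded1)
    have le: "\<epsilon> \<le> g * a * (- e) / B" unfolding \<epsilon>_def by (rule min.cobounded2)
    then show "\<epsilon> * B \<le> g * a * (- e)" using mult_right_mono[OF le, of B] B by simp
  qed
  have "eventually (\<lambda>t. \<bar>X t\<bar> < \<epsilon> \<and> \<bar>Y t\<bar> < \<epsilon>) at_top"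
    using tendstoD[OF X_lim eps(1)] tendstoD[OF Y_lim eps(1)] by eventually_elim auto
  then obtain T0 where T0: "\<And>t. t \<ge> T0 \<Longrightarrow> \<bar>X t\<bar> < \<epsilon> \<and> \<bar>Y t\<bar> < \<epsilon>"
    unfolding eventually_at_top_linorder by blast
  define T where "T = max T0 0"
  define W where "W = (\<lambda>t. g * a / m * (X t)\<^sup>2 + 1 / n * (Y t)\<^sup>2)"
  define W' where "W' = (\<lambda>t. 2 * (g * a * X t * pp t + (1 + X t) * Y t * qq t))"
  have W_deriv: "(W has_real_derivative W' t) (at t within {0..})" if "t \<ge> 0" for t
    unfolding W_def W'_def using that pos
    by (auto intro!: derivative_eq_intros X_deriv Y_deriv simp: field_simps)
  have W'_nonneg: "W' t \<ge> 0" if "t \<ge> T" for t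
  proof -
    define x y where "x = X t" and "y = Y t"
    have xy: "\<bar>x\<bar> \<le> \<epsilon>" "\<bar>y\<bar> \<le> \<epsilon>" using T0[of t] that by (auto simp: T_def x_def y_def)
    \<comment> \<open>Completing the square in the quadratic part isolates the coefficient
      \<open>- g * a * e\<close>, which is positive here; the last bracket is of third order or
      higher.\<close>
    have "W' t / 2 = (y + g * a * x)\<^sup>2 - g * a * e * x\<^sup>2 + (g * a * (x * x\<^sup>2) + x * y\<^sup>2 + x\<^sup>2 * (y * (g * a - g / 2 - g * x / 2)))"
      unfolding W'_def pp_def qq_def x_def[symmetric] y_def[symmetric] nullF_def nullG_def e_def
      by (simp add: power2_eq_square field_simps)
    moreover have nx: "- \<epsilon> \<le> x" using xy by linarith
    moreover have "x * x\<^sup>2 \<ge> - (\<epsilon> * x\<^sup>2)"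
      using mult_right_mono[OF nx, of "x\<^sup>2"] by simp
    then have "g * a * (x * x\<^sup>2) \<ge> g * a * - (\<epsilon> * x\<^sup>2)" using pos by (intro mult_left_mono) auto
    moreover have "x * y\<^sup>2 \<ge> - (\<epsilon> * (2 * (y + g * a * x)\<^sup>2 + 2 * g\<^sup>2 * a\<^sup>2 * x\<^sup>2))"
    proof -
      have "y\<^sup>2 \<le> 2 * (y + g * a * x)\<^sup>2 + 2 * g\<^sup>2 * a\<^sup>2 * x\<^sup>2"
        using zero_le_power2[of "y + 2 * (g * a * x)"] by (simp add: power2_eq_square algebra_simps)
      then have "\<epsilon> * y\<^sup>2 \<le> \<epsilon> * (2 * (y + g * a * x)\<^sup>2 + 2 * g\<^sup>2 * a\<^sup>2 * x\<^sup>2)"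
        using eps by (intro mult_left_mono) auto
      moreover have "x * y\<^sup>2 \<ge> - (\<epsilon> * y\<^sup>2)"
        using mult_right_mono[OF nx, of "y\<^sup>2"] by simp
      ultimately show ?thesis by linarith
    qed
    moreover have "x\<^sup>2 * (y * (g * a - g / 2 - g * x / 2)) \<ge> - (x\<^sup>2 * (\<epsilon> * (g * a + g)))"
    proof -
      have "\<bar>g * a - g / 2 - g * x / 2\<bar> \<le> g * a + g"
      proof -
        have "\<bar>g * x\<bar> \<le> g * 1" unfolding abs_mult using xy eps pos by (intro mult_mono) auto
        then have "g * x \<le> g" "- (g * x) \<le> g" by (auto simp only: abs_le_iff mult_1_right)
        moreover have "g * a > 0" using pos by simp
        ultimately show ?thesis using pos by (intro abs_leI) linarith+
      qed
      then have "\<bar>y * (g * a - g / 2 - g * x / 2)\<bar> \<le> \<epsilon> * (g * a + g)"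
        unfolding abs_mult using xy eps by (intro mult_mono) auto
      then have "- (\<epsilon> * (g * a + g)) \<le> y * (g * a - g / 2 - g * x / 2)" by linarith
      then have "x\<^sup>2 * - (\<epsilon> * (g * a + g)) \<le> x\<^sup>2 * (y * (g * a - g / 2 - g * x / 2))"
        by (intro mult_left_mono) auto
      then show ?thesis by simp
    qed
    moreover have "2 * \<epsilon> * (y + g * a * x)\<^sup>2 \<le> 1 * (y + g * a * x)\<^sup>2"
      using eps by (intro mult_right_mono) auto
    moreover have "(\<epsilon> * B) * x\<^sup>2 \<le> (g * a * (- e)) * x\<^sup>2" using eps by (intro mult_right_mono) auto
    moreover have "(\<epsilon> * B) * x\<^sup>2 = \<epsilon> * (2 * g\<^sup>2 * a\<^sup>2 * x\<^sup>2) + g * a * (\<epsilon> * x\<^sup>2) + x\<^sup>2 * (\<epsilon> * (g * a + g))"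
      by (simp add: B_def algebra_simps)
    moreover have "\<epsilon> * (2 * (y + g * a * x)\<^sup>2 + 2 * g\<^sup>2 * a\<^sup>2 * x\<^sup>2)
        = 2 * \<epsilon> * (y + g * a * x)\<^sup>2 + \<epsilon> * (2 * g\<^sup>2 * a\<^sup>2 * x\<^sup>2)"
      by (simp add: distrib_left)
    ultimately have "W' t / 2 \<ge> 0" by simp
    then show ?thesis by simp
  qed
  have "W T \<le> 0"
  proof (rule nonpos_if_mono_tendsto_0[where f=W and t=T])
    have "(W \<longlongrightarrow> g * a / m * 0\<^sup>2 + 1 / n * 0\<^sup>2) at_top"
      unfolding W_def by (intro tendsto_intros X_lim Y_lim)
    then show "(W \<longlongrightarrow> 0) at_top" by simp
    show "W T \<le> W s" if "s \<ge> T" for s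
      by (rule mono_of_deriv_nonneg[OF that _ W_deriv W'_nonneg]) (auto simp: T_def)
  qed
  moreover have "g * a / m * (X T)\<^sup>2 \<ge> 0" "1 / n * (Y T)\<^sup>2 \<ge> 0" using pos by auto
  ultimately have "g * a / m * (X T)\<^sup>2 = 0" "1 / n * (Y T)\<^sup>2 = 0" unfolding W_def by linarith+
  then have "X T = 0" "Y T = 0" using pos by auto
  then have "pp T = 0" "qq T = 0" by (auto simp: pp_def qq_def nullF_def nullG_def)
  then show ?thesis using zero_if_equilibrium[of T t] assms by (simp add: T_def)
qed

text \<open>\<open>(X', Y')\<close> obeys a linear system that is cooperative where \<open>X < a\<close>. Hence the product of the
  two residuals can only cross zero upwards, and being positive is incompatible with convergence
  to the origin.\<close>

context
  assumes nontrivial: "\<not> (\<forall>t\<ge>0. X t = 0 \<and> Y t = 0)"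
begin

definition "W = (\<lambda>t. pp t * qq t)"

lemma not_equilibrium: "t \<ge> 0 \<Longrightarrow> pp t \<noteq> 0 \<or> qq t \<noteq> 0"
  using zero_if_equilibrium nontrivial by blast

lemma W_cont: "continuous_on {0..} W"
  unfolding W_def by (intro continuous_intros pq_cont)

text \<open>The diagonal coefficients of the linear system contribute multiples of
  \<open>pp * qq\<close>, which vanish at a zero of \<open>W\<close>; only the squares weighted by
  the off-diagonal coefficients remain.\<close>

lemma W_deriv_at_zero:
  assumes "t \<ge> 0" "W t = 0"
  shows "(W has_real_derivative n * (1 + X t) * (qq t)\<^sup>2 + m * g * (a - X t) * (pp t)\<^sup>2) (at t within {0..})"
proof -
  have z: "pp t * qq t = 0" using assms by (simp add: W_def)
  show ?thesis
  proof (cases "pp t = 0")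
    case True
    then show ?thesis unfolding W_def using assms
      by (auto intro!: derivative_eq_intros pp_deriv qq_deriv simp: power2_eq_square)
  next
    case False
    then have "qq t = 0" using z by simp
    then show ?thesis unfolding W_def using assms
      by (auto intro!: derivative_eq_intros pp_deriv qq_deriv simp: power2_eq_square)
  qed
qed

lemma W_deriv_at_zero_pos:
  assumes "t \<ge> 0" "qq t = 0 \<Longrightarrow> X t < a"
  shows "n * (1 + X t) * (qq t)\<^sup>2 + m * g * (a - X t) * (pp t)\<^sup>2 > 0 \<or> W t \<noteq> 0"
proof (cases "qq t = 0")
  case True
  then have "pp t \<noteq> 0" using not_equilibrium[OF assms(1)] by simp
  then show ?thesis using True assms pos by simp
next
  case False
  then show ?thesis using X_gt[OF assms(1)] pos by (cases "pp t = 0") (auto simp: W_def)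
qed

lemma pp_sign:
  assumes "s \<ge> 0" "\<And>t. t > s \<Longrightarrow> W t \<noteq> 0"
  shows "(\<forall>t>s. pp t > 0) \<or> (\<forall>t>s. pp t < 0)"
proof (rule ccontr)
  have nz: "pp t \<noteq> 0" if "t > s" for t using assms(2)[OF that] by (auto simp: W_def)
  assume "\<not> ?thesis"
  then obtain t r where t: "t > s" "pp t < 0" and r: "r > s" "pp r > 0"
    using nz by (meson linorder_neqE_linordered_idom)
  have "continuous_on {min t r..max t r} pp"
    by (rule continuous_on_subset[OF pq_cont(1)]) (use assms t r in auto)
  then have "\<exists>u. min t r \<le> u \<and> u \<le> max t r \<and> pp u = 0"
    using t r IVT'[of pp t 0 r] IVT2'[of pp t 0 r] by (cases "t \<le> r") (auto simp: max_def min_def)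
  then show False using nz t r by (metis less_le_trans min_less_iff_conj)
qed

text \<open>While \<open>\<sigma> * pp\<close> is nonnegative, \<open>\<sigma> * X\<close>
  increases, and its limit is 0. At the initial time itself the sign follows by continuity from the
  right.\<close>

lemma X_sign_if:
  assumes "s \<ge> 0" "\<sigma> = 1 \<or> \<sigma> = -1" "\<And>t. t > s \<Longrightarrow> \<sigma> * pp t \<ge> 0" "t \<ge> s"
  shows "\<sigma> * X t \<le> 0"
proof (rule nonpos_if_mono_tendsto_0[where f="\<lambda>t. \<sigma> * X t" and t=t])
  show "((\<lambda>t. \<sigma> * X t) \<longlongrightarrow> 0) at_top" using tendsto_mult_left[OF X_lim, of \<sigma>] by simp
  have p: "\<sigma> * pp r \<ge> 0" if "r \<ge> s" for r
  proof (cases "r = s")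
    case True
    have "((\<lambda>t. \<sigma> * pp t) \<longlongrightarrow> \<sigma> * pp s) (at s within {0..})"
      using pq_cont(1) assms(1) by (intro tendsto_intros) (auto simp: continuous_on_def)
    then have "((\<lambda>t. \<sigma> * pp t) \<longlongrightarrow> \<sigma> * pp s) (at_right s)"
      by (rule tendsto_within_subset) (use assms(1) in auto)
    then have "0 \<le> \<sigma> * pp s"
    proof (rule tendsto_lowerbound)
      show "\<forall>\<^sub>F x in at_right s. 0 \<le> \<sigma> * pp x"
        unfolding eventually_at_right_field by (intro exI[of _ "s + 1"]) (use assms(3) in auto)
    qed simp
    then show ?thesis using True by simp
  qed (use that assms(3) in auto)
  fix r assume r: "r \<ge> t"
  show "\<sigma> * X t \<le> \<sigma> * X r"
  proof (rule mono_of_deriv_nonneg[OF r, where S="{0..}" and f="\<lambda>t. \<sigma> * X t" and f'="\<lambda>t. \<sigma> * (m * pp t)"])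
    fix u assume u: "u \<in> {t..r}"
    show "((\<lambda>t. \<sigma> * X t) has_real_derivative \<sigma> * (m * pp u)) (at u within {0..})"
      using u assms by (auto intro!: derivative_eq_intros X_deriv)
    show "0 \<le> \<sigma> * (m * pp u)" using mult_nonneg_nonneg[OF less_imp_le[OF pos(1)] p[of u]] u assms by (simp add: mult_ac)
  qed (use assms in auto)
qed

lemma Y_sign_if:
  assumes "s \<ge> 0" "\<sigma> = 1 \<or> \<sigma> = -1" "\<And>t. t \<ge> s \<Longrightarrow> \<sigma> * qq t \<ge> 0" "t \<ge> s"
  shows "\<sigma> * Y t \<le> 0"
proof (rule nonpos_if_mono_tendsto_0[where f="\<lambda>t. \<sigma> * Y t" and t=t])
  show "((\<lambda>t. \<sigma> * Y t) \<longlongrightarrow> 0) at_top" using tendsto_mult_left[OF Y_lim, of \<sigma>] by simp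
  fix r assume r: "r \<ge> t"
  show "\<sigma> * Y t \<le> \<sigma> * Y r"
  proof (rule mono_of_deriv_nonneg[OF r, where S="{0..}" and f="\<lambda>t. \<sigma> * Y t" and f'="\<lambda>t. \<sigma> * (n * (1 + X t) * qq t)"])
    fix u assume u: "u \<in> {t..r}"
    show "((\<lambda>t. \<sigma> * Y t) has_real_derivative \<sigma> * (n * (1 + X u) * qq u)) (at u within {0..})"
      using u assms by (auto intro!: derivative_eq_intros Y_deriv)
    have "0 \<le> n * (1 + X u)" using pos X_gt[of u] u assms by auto
    from mult_nonneg_nonneg[OF this assms(3)[of u]] show "0 \<le> \<sigma> * (n * (1 + X u) * qq u)"
      using u assms by (simp add: mult_ac)
  qed (use assms in auto)
qed

text \<open>Late enough that X < a, a nonnegative value of \<open>W\<close> makes it positive ever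
  after. Then both residuals keep one common sign \<sigma>, so \<open>\<sigma> * X\<close> and
  \<open>\<sigma> * Y\<close> increase to 0 and are nonpositive; this puts the point on the wrong
  side of the second nullcline.\<close>

lemma W_neg_eventually: "\<exists>T\<ge>0. \<forall>t\<ge>T. W t < 0"
proof -
  have "eventually (\<lambda>t. \<bar>X t\<bar> < a) at_top" using tendstoD[OF X_lim pos(3)] by simp
  then obtain T0 where T0: "\<And>t. t \<ge> T0 \<Longrightarrow> \<bar>X t\<bar> < a" unfolding eventually_at_top_linorder by blast
  define T where "T = max T0 0"
  have "W t1 < 0" if t1: "t1 \<ge> T" for t1
  proof (rule ccontr)
    assume "\<not> W t1 < 0"
    have Wpos: "W t > 0" if "t > t1" for t
    proof (rule pos_after_nonneg[OF _ that])
      show "continuous_on {t1..t} W" by (rule continuous_on_subset[OF W_cont]) (use t1 in \<open>auto simp: T_def\<close>)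
      show "W t1 \<ge> 0" using \<open>\<not> W t1 < 0\<close> by simp
      fix s assume s: "t1 \<le> s" "s \<le> t" "W s = 0"
      have "s \<ge> 0" "X s < a" using s t1 T0[of s] by (auto simp: T_def)
      then have "n * (1 + X s) * (qq s)\<^sup>2 + m * g * (a - X s) * (pp s)\<^sup>2 > 0"
        using W_deriv_at_zero_pos[of s] s by simp
      moreover have "(W has_real_derivative n * (1 + X s) * (qq s)\<^sup>2 + m * g * (a - X s) * (pp s)\<^sup>2) (at s within {t1..t})"
        by (rule DERIV_subset[OF W_deriv_at_zero]) (use s t1 \<open>s \<ge> 0\<close> in \<open>auto simp: T_def\<close>)
      ultimately show "\<exists>D>0. (W has_real_derivative D) (at s within {t1..t})" by blast
    qed
    define \<sigma> :: real where "\<sigma> = (if pp (t1 + 1) > 0 then 1 else - 1)"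
    have \<sigma>: "\<sigma> = 1 \<or> \<sigma> = -1" by (simp add: \<sigma>_def)
    have t0: "t1 \<ge> 0" using t1 by (simp add: T_def)
    have sgn: "\<sigma> * pp t > 0" "\<sigma> * qq t > 0" if "t > t1" for t
    proof -
      have "(\<forall>t>t1. pp t > 0) \<or> (\<forall>t>t1. pp t < 0)" by (rule pp_sign[OF t0]) (use Wpos in force)
      then show p: "\<sigma> * pp t > 0"
      proof
        assume all: "\<forall>t>t1. pp t > 0"
        then have "\<sigma> = 1" by (simp add: \<sigma>_def)
        then show ?thesis using all that by simp
      next
        assume all: "\<forall>t>t1. pp t < 0"
        then have "pp (t1 + 1) < 0" by simp
        then have "\<sigma> = -1" by (simp add: \<sigma>_def)
        then show ?thesis using all that by simp
      qed
      show "\<sigma> * qq t > 0" using p Wpos[OF that] \<sigma> by (auto simp: W_def zero_less_mult_iff)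
    qed
    define s where "s = t1 + 1"
    have s: "s \<ge> 0" "s > t1" "\<bar>X s\<bar> < a" using t0 t1 T0[of s] by (auto simp: s_def T_def)
    have 1: "\<sigma> * X s \<le> 0" by (rule X_sign_if[OF s(1) \<sigma>]) (use sgn s in \<open>auto intro: less_imp_le\<close>)
    have 2: "\<sigma> * Y s \<le> 0" by (rule Y_sign_if[OF s(1) \<sigma>]) (use sgn s in \<open>auto intro: less_imp_le\<close>)
    have "\<sigma> * nullG (X s) \<ge> 0"
    proof -
      have "\<sigma> * nullG (X s) = g / 2 * ((- (\<sigma> * X s)) * (2 * a - X s))"
        by (simp add: nullG_def power2_eq_square algebra_simps)
      moreover have "0 \<le> (- (\<sigma> * X s)) * (2 * a - X s)" using 1 s by (intro mult_nonneg_nonneg) auto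
      then have "0 \<le> g / 2 * ((- (\<sigma> * X s)) * (2 * a - X s))"
        using pos by (intro mult_nonneg_nonneg[of "g / 2"]) auto
      ultimately show ?thesis by simp
    qed
    then show False using sgn(2)[OF s(2)] 2 by (simp add: qq_def right_diff_distrib)
  qed
  then show ?thesis by (intro exI[of _ T]) (auto simp: T_def)
qed

text \<open>Extends the sign back to the initial time, where X < a is not known. The last zero of
  \<open>W\<close> would again be an upward crossing unless \<open>qq\<close> vanishes there with X
  \<ge> a. That exception forces \<open>pp\<close> to be nonpositive and, since \<open>nullF\<close>
  is at most -a there, violates positive temperature.\<close>

lemma W_neg: "t \<ge> 0 \<Longrightarrow> W t < 0"
proof (rule ccontr)
  assume t: "t \<ge> 0" "\<not> W t < 0"
  obtain T0 where T0: "T0 \<ge> 0" "\<And>t. t \<ge> T0 \<Longrightarrow> W t < 0" using W_neg_eventually by blast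
  define T where "T = max T0 t"
  obtain s where s: "t \<le> s" "s < T" "W s = 0" and after: "\<And>r. s < r \<Longrightarrow> r \<le> T \<Longrightarrow> W r < 0"
  proof (rule last_nonneg_time[of t T W])
    show "continuous_on {t..T} W" by (rule continuous_on_subset[OF W_cont]) (use t in auto)
    show "W T < 0" by (rule T0) (simp add: T_def)
  qed (use t in \<open>auto simp: T_def\<close>)
  have s0: "s \<ge> 0" using s t by simp
  have neg: "W r < 0" if "r > s" for r
    using after[OF that] T0(2)[of r] by (cases "r \<le> T") (auto simp: T_def)
  have "X s < a" if q: "qq s = 0"
  proof (rule ccontr)
    assume ge: "\<not> X s < a"
    have "(\<forall>t>s. pp t > 0) \<or> (\<forall>t>s. pp t < 0)" by (rule pp_sign[OF s0]) (use neg in force)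
    then have pneg: "\<forall>t>s. pp t < 0"
    proof
      assume "\<forall>t>s. pp t > 0"
      then have "1 * X s \<le> 0" by (intro X_sign_if[OF s0]) (auto intro: less_imp_le)
      then show ?thesis using ge pos by simp
    qed
    have "(pp \<longlongrightarrow> pp s) (at s within {0..})" using pq_cont(1) s0 by (auto simp: continuous_on_def)
    then have "(pp \<longlongrightarrow> pp s) (at_right s)" by (rule tendsto_within_subset) (use s0 in auto)
    then have "pp s \<le> 0"
    proof (rule tendsto_upperbound)
      show "\<forall>\<^sub>F x in at_right s. pp x \<le> 0"
        unfolding eventually_at_right_field by (intro exI[of _ "s + 1"]) (use pneg in \<open>auto intro: less_imp_le\<close>)
    qed simp
    moreover have "nullF (X s) \<le> - a"
    proof -
      have "a * 1 \<le> X s * (X s + (1 - a))" using ge pos by (intro mult_mono) auto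
      then show ?thesis by (simp add: nullF_def power2_eq_square algebra_simps)
    qed
    ultimately show False using Y_gt[OF s0] by (simp add: pp_def)
  qed
  then have "n * (1 + X s) * (qq s)\<^sup>2 + m * g * (a - X s) * (pp s)\<^sup>2 > 0"
    using W_deriv_at_zero_pos[OF s0] s(3) by blast
  from has_real_derivative_pos_inc_right[OF W_deriv_at_zero[OF s0 s(3)] this]
  obtain d where d: "d > 0" "\<And>h. h > 0 \<Longrightarrow> s + h \<in> {0..} \<Longrightarrow> h < d \<Longrightarrow> W s < W (s + h)" by blast
  show False using d(2)[of "d/2"] d(1) neg[of "s + d/2"] s(3) s0 by auto
qed

text \<open>Opposite signs of the residuals mean that the orbit runs strictly between the
  nullclines. Then \<open>\<sigma> * X\<close> decreases strictly to its limit 0 and is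
  positive.\<close>

lemma orbit_sign: "\<exists>\<sigma>. (\<sigma> = 1 \<or> \<sigma> = -1) \<and> (\<forall>t\<ge>0. \<sigma> * X t > 0 \<and> \<sigma> * pp t < 0 \<and> \<sigma> * qq t > 0)"
proof -
  have "W t \<noteq> 0" if "t > 0" for t using W_neg[of t] that by simp
  then have "(\<forall>t>0. pp t > 0) \<or> (\<forall>t>0. pp t < 0)" by (rule pp_sign[OF order_refl])
  then have "\<exists>\<sigma>. (\<sigma> = 1 \<or> \<sigma> = -1) \<and> (\<forall>t>0. \<sigma> * pp t < 0)"
    by (metis mult_1 mult_minus1 neg_less_0_iff_less)
  then obtain \<sigma> :: real where \<sigma>: "\<sigma> = 1 \<or> \<sigma> = -1" "\<And>t. t > 0 \<Longrightarrow> \<sigma> * pp t < 0" by blast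
  have p: "\<sigma> * pp t < 0" if "t \<ge> 0" for t
  proof (cases "t = 0")
    case True
    have "(pp \<longlongrightarrow> pp 0) (at 0 within {0..})" using pq_cont(1) by (auto simp: continuous_on_def)
    then have "((\<lambda>t. \<sigma> * pp t) \<longlongrightarrow> \<sigma> * pp 0) (at_right 0)"
      by (intro tendsto_mult_left) (rule tendsto_within_subset, auto)
    then have "\<sigma> * pp 0 \<le> 0"
    proof (rule tendsto_upperbound)
      show "\<forall>\<^sub>F x in at_right 0. \<sigma> * pp x \<le> 0"
        unfolding eventually_at_right_field by (intro exI[of _ 1]) (use \<sigma>(2) in \<open>auto intro: less_imp_le\<close>)
    qed simp
    moreover have "pp 0 \<noteq> 0" using W_neg[of 0] by (auto simp: W_def)
    ultimately show ?thesis using True \<sigma>(1) by auto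
  qed (use \<sigma>(2) that in auto)
  have q: "\<sigma> * qq t > 0" if "t \<ge> 0" for t
    using W_neg[OF that] p[OF that] \<sigma>(1) by (auto simp: W_def mult_less_0_iff)
  have x: "\<sigma> * X t > 0" if t: "t \<ge> 0" for t
  proof -
    have "(- \<sigma>) * X (t + 1) \<le> 0" by (rule X_sign_if[of 0]) (use \<sigma>(1) p t in \<open>auto intro: less_imp_le\<close>)
    moreover have "- (\<sigma> * X t) < - (\<sigma> * X (t + 1))"
    proof (rule strict_mono_of_deriv_pos[of t "t + 1" "{0..}" "\<lambda>t. - (\<sigma> * X t)" "\<lambda>t. - (\<sigma> * (m * pp t))"])
      fix u assume u: "u \<in> {t..t + 1}"
      show "((\<lambda>t. - (\<sigma> * X t)) has_real_derivative - (\<sigma> * (m * pp u))) (at u within {0..})"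
        using u t by (auto intro!: derivative_eq_intros X_deriv)
      have "m * (\<sigma> * pp u) < 0" using p[of u] u t pos by (simp add: mult_pos_neg)
      then show "0 < - (\<sigma> * (m * pp u))" by (simp add: mult_ac)
    qed (use t in auto)
    ultimately show ?thesis by simp
  qed
  show ?thesis by (intro exI[of _ \<sigma>] conjI allI impI \<sigma>(1) x p q)
qed

end

end

theorem orbit_classification:
  assumes "orbit X Y" "\<not> (\<forall>t\<ge>0. X t = 0 \<and> Y t = 0)"
  obtains \<sigma> where "\<sigma> = 1 \<or> \<sigma> = -1" "e \<ge> 0" "\<sigma> = 1 \<Longrightarrow> e > 0"
    "\<And>t. t \<ge> 0 \<Longrightarrow> \<sigma> * X t > 0" "\<And>t. t \<ge> 0 \<Longrightarrow> \<sigma> * (Y t - nullF (X t)) < 0"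
    "\<And>t. t \<ge> 0 \<Longrightarrow> \<sigma> * (Y t - nullG (X t)) > 0"
proof -
  obtain \<sigma> where \<sigma>: "\<sigma> = 1 \<or> \<sigma> = -1"
    "\<And>t. t \<ge> 0 \<Longrightarrow> \<sigma> * X t > 0 \<and> \<sigma> * pp X Y t < 0 \<and> \<sigma> * qq X Y t > 0"
    using orbit_sign[OF assms] by blast
  have e0: "e \<ge> 0" using trivial_if_source[OF assms(1)] assms(2) by force
  have "e > 0" if "\<sigma> = 1"
  proof (rule ccontr)
    assume "\<not> e > 0"
    then have "e = 0" using e0 by simp
    \<comment> \<open>When \<open>e = 0\<close> the gap is a positive multiple of X^2, whereas an
      orbit with \<open>\<sigma> = 1\<close> has Y above \<open>nullG\<close> and below
      \<open>nullF\<close>.\<close>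
    then have "nullG (X 0) - nullF (X 0) \<ge> 0" unfolding gap_eq using pos by (simp add: algebra_simps)
    then show False using \<sigma>(2)[of 0] that by (simp add: pp_def[OF assms(1)] qq_def[OF assms(1)])
  qed
  then show thesis using that \<sigma> e0 by (simp add: pp_def[OF assms(1)] qq_def[OF assms(1)])
qed

end

subsection \<open>The invariant branch\<close>

lemma mono_within_lipschitz:
  fixes f :: "real \<Rightarrow> real"
  assumes "a \<le> b" "continuous_on {a..b} f"
    and d: "\<And>x. a < x \<Longrightarrow> x < b \<Longrightarrow> (f has_real_derivative f' x) (at x)"
    and L: "\<And>x. a < x \<Longrightarrow> x < b \<Longrightarrow> \<bar>f' x\<bar> \<le> L"
  shows "\<bar>f b - f a\<bar> \<le> L * (b - a)"
proof (cases "a < b")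
  case True
  obtain l z where z: "a < z" "z < b" "(f has_real_derivative l) (at z)" "f b - f a = (b - a) * l"
    using MVT[OF True assms(2)] d real_differentiable_def by metis
  have "l = f' z" using DERIV_unique[OF z(3) d[OF z(1,2)]] .
  then show ?thesis using z L[OF z(1,2)] True by (simp add: abs_mult mult.commute mult_right_mono)
next
  case False
  then show ?thesis using assms(1) by simp
qed

locale planar_side = planar_system +
  fixes \<sigma> :: real
  assumes e_nonneg: "e \<ge> 0" and side: "\<sigma> = -1 \<or> \<sigma> = 1 \<and> e > 0"
begin

text \<open>On the side \<open>\<sigma>\<close> of the origin we use the coordinates \<open>x = \<sigma> X > 0\<close> and \<open>y = - \<sigma> Y > 0\<close>, in which
  the two nullclines are \<open>low\<close> and \<open>low + gap\<close>.\<close>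

definition low :: "real \<Rightarrow> real" where "low x = \<sigma> * x\<^sup>2 + (1 - a) * x"
definition gap :: "real \<Rightarrow> real" where "gap x = e * x - \<sigma> * (g / 2 + 1) * x\<^sup>2"
definition rate :: "real \<Rightarrow> real" where "rate x = n / m * (1 + \<sigma> * x)"
text \<open>For \<open>\<sigma> = 1\<close> the bound \<open>a\<close> is where the upper nullcline
  stops rising, and \<open>2 * e / (g + 2)\<close> is the second equilibrium, where the gap closes.
  For \<open>\<sigma> = -1\<close> the bound 1 is vanishing velocity.\<close>

definition reach :: real where "reach = (if \<sigma> = 1 then min a (2 * e / (g + 2)) else 1)"

lemma sigma_sq: "\<sigma> * \<sigma> = 1" "\<sigma>\<^sup>2 = 1" "\<sigma> * (\<sigma> * x) = x"
  using side by auto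

lemma low_eq: "low x = - \<sigma> * nullF (\<sigma> * x)"
  using side by (auto simp: low_def nullF_def)

lemma gap_eq': "low x + gap x = - \<sigma> * nullG (\<sigma> * x)"
  using side by (auto simp: low_def gap_def nullG_def e_def power2_eq_square algebra_simps)

lemma low_deriv: "(low has_real_derivative 2 * \<sigma> * x + (1 - a)) (at x within S)"
  unfolding low_def by (auto intro!: derivative_eq_intros)

lemma gap_deriv: "(gap has_real_derivative e - \<sigma> * (g + 2) * x) (at x within S)"
  unfolding gap_def by (auto intro!: derivative_eq_intros simp: algebra_simps)

lemma reach_pos: "reach > 0"
  using side pos by (auto simp: reach_def)

lemma reach_le_1: "\<sigma> = -1 \<Longrightarrow> reach = 1"
  unfolding reach_def by simp

lemma gap_pos: "0 < x \<Longrightarrow> x < reach \<Longrightarrow> gap x > 0"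
proof -
  assume x: "0 < x" "x < reach"
  from side show ?thesis
  proof
    assume "\<sigma> = -1"
    then have "gap x = e * x + (g / 2 + 1) * x\<^sup>2" unfolding gap_def by (simp add: algebra_simps)
    then show ?thesis using x pos e_nonneg by (simp add: add_nonneg_pos)
  next
    assume s: "\<sigma> = 1 \<and> e > 0"
    then have "x < 2 * e / (g + 2)" using x(2) unfolding reach_def by simp
    then have "(g / 2 + 1) * x < e" using pos by (simp add: field_simps)
    then have "0 < x * (e - (g / 2 + 1) * x)" using x by simp
    then show ?thesis unfolding gap_def using s by (simp add: power2_eq_square algebra_simps)
  qed
qed

lemma gap_le: "0 \<le> x \<Longrightarrow> x \<le> reach \<Longrightarrow> gap x \<le> (e + g + 2) * x"
proof -
  assume x: "0 \<le> x" "x \<le> reach"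
  from side show ?thesis
  proof
    assume s: "\<sigma> = -1"
    then have "x * x \<le> 1 * x" using x reach_le_1[OF s] by (intro mult_right_mono) linarith+
    then have "(g / 2 + 1) * (x * x) \<le> (g / 2 + 1) * (1 * x)" using pos by (intro mult_left_mono) auto
    also have "\<dots> \<le> (g + 2) * x" using x pos by (simp add: algebra_simps)
    finally show ?thesis unfolding gap_def using s by (simp add: power2_eq_square algebra_simps)
  next
    assume s: "\<sigma> = 1 \<and> e > 0"
    have "0 \<le> (g / 2 + 1) * x\<^sup>2" "0 \<le> (g + 2) * x" using x pos by auto
    then show ?thesis unfolding gap_def using s by (simp add: distrib_right)
  qed
qed

lemma rate_pos: "0 \<le> x \<Longrightarrow> x < reach \<Longrightarrow> rate x > 0"
  using side pos by (auto simp: rate_def reach_def)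

lemma upper_deriv_pos: "0 < x \<Longrightarrow> x < reach \<Longrightarrow> 2 * \<sigma> * x + (1 - a) + (e - \<sigma> * (g + 2) * x) > 0"
proof -
  assume x: "0 < x" "x < reach"
  have eq: "2 * \<sigma> * x + (1 - a) + (e - \<sigma> * (g + 2) * x) = g * (a - \<sigma> * x)"
    by (simp add: e_def algebra_simps)
  have "a - \<sigma> * x > 0" using side x pos by (auto simp: reach_def)
  then show ?thesis unfolding eq using pos by simp
qed

text \<open>For \<open>\<sigma> = 1\<close> the rate is at least n/m, so a small \<eta> makes the
  right side exceed any bound of the left side. For \<open>\<sigma> = -1\<close> the rate vanishes
  linearly at x = 1, and the left side has to be kept below 2(1 - x) instead.\<close>

lemma ex_barrier:
  obtains \<eta> where "0 < \<eta>" "\<eta> < 1"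
    "\<And>x. 0 < x \<Longrightarrow> x < reach \<Longrightarrow> 2 * \<sigma> * x + (1 - a) + \<eta> * (e - \<sigma> * (g + 2) * x) < rate x * (1 / \<eta> - 1)"
proof (cases "\<sigma> = 1")
  case True
  define c B where "c = n / m" and "B = 2 * reach + 1 + e"
  have c: "c > 0" using pos by (simp add: c_def)
  have B: "B > 0" using reach_pos e_nonneg by (simp add: B_def)
  define \<eta> where "\<eta> = c / (c + B)"
  have eta: "0 < \<eta>" "\<eta> < 1" "c * (1 / \<eta> - 1) = B" using c B by (auto simp: \<eta>_def field_simps)
  show thesis
  proof (rule that[OF eta(1,2)])
    fix x assume x: "0 < x" "x < reach"
    have "\<eta> * (e - \<sigma> * (g + 2) * x) \<le> \<eta> * e" using True x pos eta by (intro mult_left_mono) auto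
    also have "\<dots> \<le> 1 * e" using eta e_nonneg by (intro mult_right_mono) auto
    finally have "2 * \<sigma> * x + (1 - a) + \<eta> * (e - \<sigma> * (g + 2) * x) < B"
      using True x pos by (simp add: B_def)
    also have "B = c * (1 / \<eta> - 1)" using eta by simp
    also have "\<dots> \<le> rate x * (1 / \<eta> - 1)"
    proof (rule mult_right_mono)
      have "0 \<le> n / m * x" using x pos by simp
      then show "c \<le> rate x" unfolding rate_def c_def using True by (simp add: distrib_left)
      show "0 \<le> 1 / \<eta> - 1" using eta by simp
    qed
    finally show "2 * \<sigma> * x + (1 - a) + \<eta> * (e - \<sigma> * (g + 2) * x) < rate x * (1 / \<eta> - 1)" .
  qed
next
  case False
  then have s: "\<sigma> = -1" using side by auto
  define c B where "c = n / m" and "B = e + (g + 2)"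
  have c: "c > 0" using pos by (simp add: c_def)
  have B: "B > 0" using pos e_nonneg by (simp add: B_def)
  \<comment> \<open>The first entry yields \<open>2 \<le> c * (1 / \<eta> - 1)\<close>; the second
    keeps the contribution of the gap below \<open>a\<close>, so that the left side is at most 1 -
    2x.\<close>
  define \<eta> where "\<eta> = min (c / (c + 2)) (a / B)"
  have eta0: "0 < \<eta>" "\<eta> \<le> c / (c + 2)" "\<eta> \<le> a / B" using c B pos by (auto simp: \<eta>_def)
  have eta1: "\<eta> < 1" using eta0(2) c by (smt (verit) divide_less_eq_1_pos)
  have etaB: "\<eta> * B \<le> a" using eta0(3) B by (simp add: pos_le_divide_eq)
  have "2 * \<eta> \<le> c * (1 - \<eta>)" using eta0(2) c by (simp add: pos_le_divide_eq algebra_simps)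
  then have etac: "2 \<le> c * (1 / \<eta> - 1)" using eta0(1) by (simp add: field_simps)
  show thesis
  proof (rule that[OF eta0(1) eta1])
    fix x assume x: "0 < x" "x < reach"
    then have x1: "x < 1" using reach_le_1[OF s] by linarith
    have "\<eta> * (e - \<sigma> * (g + 2) * x) \<le> \<eta> * B"
    proof (rule mult_left_mono)
      have "e - \<sigma> * (g + 2) * x = e + (g + 2) * x" using s by (simp add: algebra_simps)
      moreover have "(g + 2) * x \<le> (g + 2) * 1" using x1 pos by (intro mult_left_mono) auto
      ultimately show "e - \<sigma> * (g + 2) * x \<le> B" by (simp add: B_def)
    qed (use eta0 in simp)
    then have "2 * \<sigma> * x + (1 - a) + \<eta> * (e - \<sigma> * (g + 2) * x) \<le> 1 - 2 * x" using s etaB by simp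
    also have "\<dots> < (1 - x) * 2" by simp
    also have "\<dots> \<le> (1 - x) * (c * (1 / \<eta> - 1))" using x1 etac by (intro mult_left_mono) auto
    also have "\<dots> = rate x * (1 / \<eta> - 1)" unfolding rate_def c_def using s by simp
    finally show "2 * \<sigma> * x + (1 - a) + \<eta> * (e - \<sigma> * (g + 2) * x) < rate x * (1 / \<eta> - 1)" .
  qed
qed

text \<open>Multiplied by \<open>z\<close> the equation becomes quadratic, with value n/m at 0 and
  -g a at 1, so it has a root strictly between them.\<close>

lemma ex_endpoint_ratio:
  obtains zc where "0 < zc" "zc < 1" "rate 0 * (1 / zc - 1) = 1 - a + e * zc"
proof -
  define P where "P = (\<lambda>z. n / m * (1 - z) - (1 - a) * z - e * z\<^sup>2)"
  have "P 0 > 0" using pos by (simp add: P_def)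
  moreover have "P 1 < 0" using pos by (simp add: P_def e_def algebra_simps)
  moreover have "continuous_on {0..1} P" unfolding P_def by (intro continuous_intros)
  ultimately obtain z where z: "0 \<le> z" "z \<le> 1" "P z = 0"
    using IVT2'[of P 1 0 0] by auto
  have "z \<noteq> 0" "z \<noteq> 1" using z \<open>P 0 > 0\<close> \<open>P 1 < 0\<close> by auto
  then have z': "0 < z" "z < 1" using z by auto
  have "z * (rate 0 * (1 / z - 1)) = z * (1 - a + e * z)"
  proof -
    have "z * (rate 0 * (1 / z - 1)) = rate 0 * (1 - z)" using z' by (simp add: field_simps)
    also have "\<dots> = z * (1 - a + e * z)"
      using z(3) by (simp add: P_def rate_def power2_eq_square algebra_simps)
    finally show ?thesis .
  qed
  then show thesis using that[OF z'] z' by simp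
qed

end

locale planar_branch = planar_side +
  fixes \<phi> :: "real \<Rightarrow> real" and \<eta> zc :: real
  assumes phi_deriv: "\<And>x. 0 < x \<Longrightarrow> x < reach \<Longrightarrow>
      (\<phi> has_real_derivative rate x * (gap x / (\<phi> x - low x) - 1)) (at x)"
    and eta: "0 < \<eta>"
    and phi_low: "\<And>x. 0 < x \<Longrightarrow> x < reach \<Longrightarrow> \<eta> * gap x \<le> \<phi> x - low x"
    and phi_up: "\<And>x. 0 < x \<Longrightarrow> x < reach \<Longrightarrow> \<phi> x - low x < gap x"
    and zc: "0 < zc" "zc < 1" "rate 0 * (1 / zc - 1) = 1 - a + e * zc"
    and ratio_lim: "((\<lambda>x. (\<phi> x - low x) / gap x) \<longlongrightarrow> zc) (at_right 0)"

lemma (in planar_side) ex_branch: "\<exists>\<phi> \<eta> zc. planar_branch m n a g \<sigma> \<phi> \<eta> zc"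
proof -
  obtain \<eta> where eta: "0 < \<eta>" "\<eta> < 1"
    "\<And>x. 0 < x \<Longrightarrow> x < reach \<Longrightarrow> 2 * \<sigma> * x + (1 - a) + \<eta> * (e - \<sigma> * (g + 2) * x) < rate x * (1 / \<eta> - 1)"
    using ex_barrier by blast
  interpret S: singular_graph_ode rate low "\<lambda>x. 2 * \<sigma> * x + (1 - a)" gap "\<lambda>x. e - \<sigma> * (g + 2) * x" reach \<eta> reach
  proof
    show "continuous_on UNIV rate" unfolding rate_def by (intro continuous_intros)
    show "gap 0 = 0" by (simp add: gap_def)
  qed (use eta reach_pos low_deriv gap_deriv gap_pos rate_pos upper_deriv_pos in \<open>auto intro!: continuous_intros\<close>)
  obtain \<phi> where phi: "\<And>x. 0 < x \<Longrightarrow> x < reach \<Longrightarrow> (\<phi> has_real_derivative S.slope x (\<phi> x)) (at x)"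
    "\<And>x. 0 < x \<Longrightarrow> x < reach \<Longrightarrow> low x + \<eta> * gap x \<le> \<phi> x"
    "\<And>x. 0 < x \<Longrightarrow> x < reach \<Longrightarrow> \<phi> x < low x + gap x"
    using S.ex_solution by metis
  obtain zc where zc: "0 < zc" "zc < 1" "rate 0 * (1 / zc - 1) = 1 - a + e * zc"
    using ex_endpoint_ratio by blast
  \<comment> \<open>For \<open>\<sigma> = 1\<close> the gap increases only up to e/(g + 2); the
    analysis of the endpoint ratio is confined to that range.\<close>
  define x1 where "x1 = (if \<sigma> = 1 then min reach (e / (g + 2)) else reach)"
  have x1: "0 < x1" "x1 \<le> reach" using reach_pos side pos by (auto simp: x1_def)
  have "((\<lambda>x. (\<phi> x - low x) / gap x) \<longlongrightarrow> zc) (at_right 0)"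
  proof (rule S.ratio_limit[OF phi x1])
    fix x assume x: "0 \<le> x" "x < x1"
    have nn: "0 \<le> (g + 2) * x" using x pos by simp
    from side show "0 \<le> e - \<sigma> * (g + 2) * x"
    proof
      assume "\<sigma> = -1"
      then have "e - \<sigma> * (g + 2) * x = e + (g + 2) * x" by (simp add: algebra_simps)
      then show ?thesis using nn e_nonneg by simp
    next
      assume s: "\<sigma> = 1 \<and> e > 0"
      then have "x < e / (g + 2)" using x(2) unfolding x1_def by simp
      then show ?thesis using s pos by (simp add: pos_less_divide_eq mult.commute)
    qed
  next
    fix x assume "0 < x" "x < x1"
    then show "gap x \<le> (e + g + 2) * x" using x1 by (intro gap_le) auto
  qed (use zc in auto)
  \<comment> \<open>Between the two barriers both truncations in \<open>slope\<close> are inactive,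
    so the constructed graph solves the original equation.\<close>
  moreover have "S.slope x (\<phi> x) = rate x * (gap x / (\<phi> x - low x) - 1)" if x: "0 < x" "x < reach" for x
  proof -
    have "0 < \<eta> * gap x" using gap_pos[OF x] eta by simp
    then have "\<eta> * gap x \<le> \<phi> x - low x" "0 < \<phi> x - low x" "\<phi> x - low x < gap x"
      using phi(2,3)[OF x] by auto
    then have "max (\<phi> x - low x) (\<eta> * gap x) = \<phi> x - low x" "gap x / (\<phi> x - low x) - 1 > 0" by auto
    then show ?thesis unfolding S.slope_def by simp
  qed
  ultimately have "planar_branch m n a g \<sigma> \<phi> \<eta> zc"
    by unfold_locales (use phi zc eta in force)+
  then show ?thesis by blast
qed

section \<open>The branch as an increasing graph that captures all orbits\<close>

context planar_branch
begin

lemma phi_minus_low_pos: "0 < x \<Longrightarrow> x < reach \<Longrightarrow> 0 < \<phi> x - low x"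
  using phi_low[of x] mult_pos_pos[OF eta gap_pos[of x]] by simp

lemma phi_slope_pos: "0 < x \<Longrightarrow> x < reach \<Longrightarrow> rate x * (gap x / (\<phi> x - low x) - 1) > 0"
  using phi_up[of x] phi_minus_low_pos[of x] rate_pos[of x] by (intro mult_pos_pos) auto

lemma phi_strict_mono: "0 < x \<Longrightarrow> x < y \<Longrightarrow> y < reach \<Longrightarrow> \<phi> x < \<phi> y"
  by (rule strict_mono_of_deriv_pos[where S=UNIV and f'="\<lambda>x. rate x * (gap x / (\<phi> x - low x) - 1)"])
    (auto intro: phi_deriv phi_slope_pos)

lemma phi_cont: "continuous_on {0<..<reach} \<phi>"
  by (intro continuous_at_imp_continuous_on ballI DERIV_isCont[OF phi_deriv]) auto

lemma phi_lim: "(\<phi> \<longlongrightarrow> 0) (at_right 0)"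
proof (rule tendsto_sandwich)
  have near: "eventually (\<lambda>x. 0 < x \<and> x < reach) (at_right 0)"
    unfolding eventually_at_right_field using reach_pos by auto
  show "eventually (\<lambda>x. low x \<le> \<phi> x) (at_right 0)"
    using near by eventually_elim (use phi_minus_low_pos in \<open>auto intro: less_imp_le\<close>)
  show "eventually (\<lambda>x. \<phi> x \<le> low x + gap x) (at_right 0)"
    using near by eventually_elim (use phi_up in \<open>auto intro: less_imp_le simp: algebra_simps\<close>)
  have "(low \<longlongrightarrow> low 0) (at_right 0)" "(gap \<longlongrightarrow> gap 0) (at_right 0)"
    using DERIV_continuous[OF low_deriv] DERIV_continuous[OF gap_deriv] by (auto simp: continuous_within)
  moreover have "low 0 = 0" "gap 0 = 0" by (simp_all add: low_def gap_def)
  ultimately have l: "(low \<longlongrightarrow> 0) (at_right 0)" and u: "(gap \<longlongrightarrow> 0) (at_right 0)" by simp_all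
  show "(low \<longlongrightarrow> 0) (at_right 0)" by (rule l)
  show "((\<lambda>x. low x + gap x) \<longlongrightarrow> 0) (at_right 0)" by (rule tendsto_add_zero[OF l u])
qed

lemma phi_pos: "0 < x \<Longrightarrow> x < reach \<Longrightarrow> 0 < \<phi> x"
proof -
  assume x: "0 < x" "x < reach"
  have "0 \<le> \<phi> (x / 2)"
  proof (rule tendsto_upperbound[OF phi_lim])
    show "eventually (\<lambda>u. \<phi> u \<le> \<phi> (x / 2)) (at_right 0)"
      unfolding eventually_at_right_field
      by (intro exI[of _ "x / 2"]) (use x in \<open>auto intro!: less_imp_le[OF phi_strict_mono]\<close>)
  qed simp
  then show ?thesis using phi_strict_mono[of "x / 2" x] x by simp
qed

text \<open>The condition for \<open>\<sigma> = 1\<close> is positive temperature. For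
  \<open>\<sigma> = -1\<close> the temperature on the branch exceeds the right state, and positive
  velocity is already contained in x < 1.\<close>

definition dom :: "real set" where "dom = {x. 0 < x \<and> x < reach \<and> (\<sigma> = 1 \<longrightarrow> \<phi> x < a)}"

definition on_branch :: "(real \<Rightarrow> real) \<Rightarrow> (real \<Rightarrow> real) \<Rightarrow> bool" where
  "on_branch X Y \<longleftrightarrow> (\<forall>t\<ge>0. \<sigma> * X t \<in> dom \<and> - \<sigma> * Y t = \<phi> (\<sigma> * X t))"

text \<open>The squared distance to the branch is nondecreasing along orbits, and tends to 0.\<close>

theorem orbit_on_branch:
  assumes orb: "orbit X Y" and s: "\<And>t. t \<ge> 0 \<Longrightarrow> \<sigma> * X t > 0"
    "\<And>t. t \<ge> 0 \<Longrightarrow> \<sigma> * (Y t - nullF (X t)) < 0" "\<And>t. t \<ge> 0 \<Longrightarrow> \<sigma> * (Y t - nullG (X t)) > 0"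
  shows "on_branch X Y"
proof -
  define x y where "x = (\<lambda>t. \<sigma> * X t)" and "y = (\<lambda>t. - \<sigma> * Y t)"
  have X: "X t = \<sigma> * x t" and Y: "Y t = - \<sigma> * y t" for t
    using sigma_sq by (simp_all add: x_def y_def)
  have x_pos: "x t > 0" and y_low: "y t - low (x t) > 0" and y_up: "y t - low (x t) - gap (x t) < 0"
    if "t \<ge> 0" for t
  proof -
    show "x t > 0" using s(1)[OF that] by (simp add: x_def)
    show "y t - low (x t) > 0" using s(2)[OF that] by (simp add: low_eq X[symmetric] y_def algebra_simps)
    have "y t - (low (x t) + gap (x t)) < 0"
      unfolding gap_eq' X[symmetric] using s(3)[OF that] by (simp add: y_def algebra_simps)
    then show "y t - low (x t) - gap (x t) < 0" by simp
  qed
  have range: "X t > -1" "Y t > - a" if "t \<ge> 0" for t using orb that by (auto simp: orbit_def)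
  have y_lt: "y t < a" if "\<sigma> = 1" "t \<ge> 0" for t using range[OF that(2)] that(1) by (simp add: y_def)
  \<comment> \<open>For \<open>\<sigma> = 1\<close>, x \<ge> a would give low x \<ge> a and hence y
    > a, a negative temperature. Moreover a point strictly between the nullclines needs a positive
    gap, so it lies before the second equilibrium.\<close>
  have x_lt: "x t < reach" if t: "t \<ge> 0" for t
    using side
  proof
    assume m1: "\<sigma> = -1"
    then have "x t < 1" using range[OF t] by (simp add: x_def)
    then show ?thesis unfolding reach_le_1[OF m1] .
  next
    assume s1: "\<sigma> = 1 \<and> e > 0"
    have "x t < a"
    proof (rule ccontr)
      assume ge: "\<not> x t < a"
      then have "a * 1 \<le> x t * (x t + (1 - a))" using pos by (intro mult_mono) auto
      then have "a \<le> low (x t)" unfolding low_def using s1 by (simp add: power2_eq_square algebra_simps)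
      then show False using y_low[OF t] y_lt[OF _ t] s1 by simp
    qed
    moreover have "0 < x t * (e - (g / 2 + 1) * x t)"
      using y_low[OF t] y_up[OF t] s1 unfolding gap_def by (simp add: power2_eq_square algebra_simps)
    then have "0 < e - (g / 2 + 1) * x t" using x_pos[OF t] by (rule zero_less_mult_pos)
    then have "x t < 2 * e / (g + 2)" using pos by (simp add: field_simps)
    ultimately show ?thesis unfolding reach_def using s1 by simp
  qed
  have x_deriv: "(x has_real_derivative - m * (y t - low (x t))) (at t within {0..})" if "t \<ge> 0" for t
  proof -
    have "(x has_real_derivative \<sigma> * (m * (Y t - nullF (X t)))) (at t within {0..})"
      unfolding x_def by (rule DERIV_cmult) (use orb that in \<open>simp add: orbit_def\<close>)
    moreover have "\<sigma> * (m * (Y t - nullF (X t))) = - m * (y t - low (x t))"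
      by (simp add: low_eq X[symmetric] y_def algebra_simps)
    ultimately show ?thesis by simp
  qed
  have y_deriv: "(y has_real_derivative n * (1 + \<sigma> * x t) * (y t - low (x t) - gap (x t))) (at t within {0..})" if "t \<ge> 0" for t
  proof -
    have "(y has_real_derivative - \<sigma> * (n * (1 + X t) * (Y t - nullG (X t)))) (at t within {0..})"
      unfolding y_def by (rule DERIV_cmult) (use orb that in \<open>simp add: orbit_def\<close>)
    moreover have "- \<sigma> * (n * (1 + X t) * (Y t - nullG (X t))) = n * (1 + X t) * (y t - (low (x t) + gap (x t)))"
      unfolding gap_eq' X[symmetric] by (simp add: y_def algebra_simps)
    ultimately show ?thesis by (simp only: X[symmetric] diff_diff_eq)
  qed
  define w where "w = (\<lambda>t. y t - \<phi> (x t))"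
  \<comment> \<open>The deviation \<open>w\<close> from the branch solves the linear equation w' = k
    w with nonnegative \<open>k\<close>. This is repulsion from the branch in forward time, the
    counterpart of contraction in growing \<open>x\<close>, because \<open>x\<close> decreases along
    orbits.\<close>
  define k where "k = (\<lambda>t. n * (1 + \<sigma> * x t) * (gap (x t) / (\<phi> (x t) - low (x t))))"
  have w_deriv: "(w has_real_derivative k t * w t) (at t within {0..})" if t: "t \<ge> 0" for t
  proof -
    note xt = x_pos[OF t] x_lt[OF t]
    have p: "\<phi> (x t) - low (x t) > 0" using phi_minus_low_pos[OF xt] .
    have "(w has_real_derivative n * (1 + \<sigma> * x t) * (y t - low (x t) - gap (x t))
        - rate (x t) * (gap (x t) / (\<phi> (x t) - low (x t)) - 1) * (- m * (y t - low (x t)))) (at t within {0..})"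
      unfolding w_def by (intro DERIV_diff y_deriv[OF t] DERIV_chain2[OF phi_deriv[OF xt] x_deriv[OF t]])
    moreover have "n * (1 + \<sigma> * x t) * (y t - low (x t) - gap (x t))
        - rate (x t) * (gap (x t) / (\<phi> (x t) - low (x t)) - 1) * (- m * (y t - low (x t))) = k t * w t"
    proof -
      define P where "P = \<phi> (x t) - low (x t)"
      have w: "w t = y t - low (x t) - P" by (simp add: w_def P_def)
      have "P > 0" using p by (simp add: P_def)
      have "rate (x t) * (gap (x t) / P - 1) * (- m * (y t - low (x t)))
          = - (n * (1 + \<sigma> * x t)) * (gap (x t) / P - 1) * (y t - low (x t))"
        using pos by (simp add: rate_def)
      then show ?thesis unfolding w k_def P_def[symmetric]
        using \<open>P > 0\<close> by (simp add: field_simps)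
    qed
    ultimately show ?thesis by simp
  qed
  have k_nonneg: "k t \<ge> 0" if t: "t \<ge> 0" for t
  proof -
    note xt = x_pos[OF t] x_lt[OF t]
    have "1 + \<sigma> * x t \<ge> 0" using range[OF t] X[of t] by simp
    then show ?thesis unfolding k_def
      using gap_pos[OF xt] phi_minus_low_pos[OF xt] pos by (intro mult_nonneg_nonneg divide_nonneg_nonneg) auto
  qed
  have lims: "(x \<longlongrightarrow> 0) at_top" "(y \<longlongrightarrow> 0) at_top"
    using orb tendsto_mult_left[of X 0 at_top \<sigma>] tendsto_mult_left[of Y 0 at_top "- \<sigma>"]
    by (auto simp: orbit_def x_def y_def)
  have "eventually (\<lambda>t. x t \<in> {0<..} \<and> x t \<noteq> 0) at_top"
    using eventually_ge_at_top[of 0]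
  proof eventually_elim
    fix t :: real assume "0 \<le> t"
    then show "x t \<in> {0<..} \<and> x t \<noteq> 0" using x_pos[of t] by simp
  qed
  then have "filterlim x (at_right 0) at_top"
    using lims(1) by (simp add: filterlim_at)
  then have "((\<lambda>t. \<phi> (x t)) \<longlongrightarrow> 0) at_top" by (rule filterlim_compose[OF phi_lim])
  then have "(w \<longlongrightarrow> 0 - 0) at_top" unfolding w_def by (intro tendsto_diff lims(2))
  then have w2_lim: "((\<lambda>t. (w t)\<^sup>2) \<longlongrightarrow> 0) at_top" using tendsto_power[of w 0 at_top 2] by simp
  have "w t = 0" if t: "t \<ge> 0" for t
  proof -
    have "(w t)\<^sup>2 \<le> 0"
    proof (rule nonpos_if_mono_tendsto_0[where f="\<lambda>t. (w t)\<^sup>2" and t=t, OF w2_lim])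
      fix r assume r: "r \<ge> t"
      show "(w t)\<^sup>2 \<le> (w r)\<^sup>2"
      proof (rule mono_of_deriv_nonneg[OF r, where S="{0..}" and f="\<lambda>t. (w t)\<^sup>2" and f'="\<lambda>t. 2 * k t * (w t)\<^sup>2"])
        fix u assume u: "u \<in> {t..r}"
        then have u0: "u \<ge> 0" using t by simp
        show "((\<lambda>t. (w t)\<^sup>2) has_real_derivative 2 * k u * (w u)\<^sup>2) (at u within {0..})"
          using w_deriv[OF u0] by (auto intro!: derivative_eq_intros simp: power2_eq_square)
        show "0 \<le> 2 * k u * (w u)\<^sup>2" using k_nonneg[OF u0] by simp
      qed (use t in auto)
    qed
    then show ?thesis by simp
  qed
  then have yp: "y t = \<phi> (x t)" if "t \<ge> 0" for t using that by (simp add: w_def)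
  have "x t \<in> dom" if t: "t \<ge> 0" for t
    using x_pos[OF t] x_lt[OF t] y_lt[OF _ t] yp[OF t] by (auto simp: dom_def)
  then show ?thesis using yp by (simp add: on_branch_def x_def y_def)
qed

end

section \<open>Orbits running along the branch\<close>

context planar_branch
begin

lemma low_deriv_bound: "0 < x \<Longrightarrow> x < reach \<Longrightarrow> \<bar>2 * \<sigma> * x + (1 - a)\<bar> \<le> 2 * reach + 1 + a"
  using side pos by auto

lemma rate_le: "0 < x \<Longrightarrow> x < reach \<Longrightarrow> rate x \<le> n / m * (1 + reach)"
  unfolding rate_def using side pos by (intro mult_left_mono) auto

lemma phi_slope_le: "0 < x \<Longrightarrow> x < reach \<Longrightarrow>
    rate x * (gap x / (\<phi> x - low x) - 1) \<le> n / m * (1 + reach) * (1 / \<eta>)"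
proof -
  assume x: "0 < x" "x < reach"
  have "gap x / (\<phi> x - low x) \<le> 1 / \<eta>"
    using phi_low[OF x] phi_minus_low_pos[OF x] eta by (simp add: field_simps)
  then show ?thesis
    using rate_le[OF x] rate_pos[of x] x phi_slope_pos[OF x] pos reach_pos eta
    by (intro mult_mono) (auto simp: zero_less_mult_iff)
qed

text \<open>The rate at which \<open>x\<close> decreases on the branch, extended by 0 at the origin
  so that a Lipschitz bound up to the endpoint can be stated.\<close>

definition speed :: "real \<Rightarrow> real" where "speed x = (if x \<le> 0 then 0 else m * (\<phi> x - low x))"

lemma speed_pos: "0 < x \<Longrightarrow> x < reach \<Longrightarrow> speed x > 0"
  using phi_minus_low_pos pos by (simp add: speed_def)

lemma speed_le: "0 < x \<Longrightarrow> x < reach \<Longrightarrow> speed x \<le> m * (e + g + 2) * x"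
proof -
  assume x: "0 < x" "x < reach"
  have "\<phi> x - low x \<le> (e + g + 2) * x" using phi_up[OF x] gap_le[of x] x by simp
  from mult_left_mono[OF this less_imp_le[OF pos(1)]] show ?thesis using x by (simp add: speed_def mult.assoc)
qed

definition lip :: real where
  "lip = m * (n / m * (1 + reach) * (1 / \<eta>) + (2 * reach + 1 + a)) + m * (e + g + 2)"

lemma lip_parts: "m * (n / m * (1 + reach) * (1 / \<eta>) + (2 * reach + 1 + a)) \<le> lip" "m * (e + g + 2) \<le> lip" "lip > 0"
proof -
  have "0 \<le> n / m * (1 + reach) * (1 / \<eta>)" using pos reach_pos eta by simp
  then have 1: "0 \<le> m * (n / m * (1 + reach) * (1 / \<eta>) + (2 * reach + 1 + a))"
    using pos reach_pos by (intro mult_nonneg_nonneg) auto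
  have 2: "0 < m * (e + g + 2)" using pos e_nonneg by simp
  show "m * (n / m * (1 + reach) * (1 / \<eta>) + (2 * reach + 1 + a)) \<le> lip" "m * (e + g + 2) \<le> lip" "lip > 0"
    using 1 2 unfolding lip_def by linarith+
qed

lemma speed_lipschitz:
  assumes "0 \<le> x" "x \<le> y" "y < reach"
  shows "\<bar>speed y - speed x\<bar> \<le> lip * (y - x)"
proof (cases "x = 0")
  case True
  show ?thesis
  proof (cases "y = 0")
    case False
    then have y: "0 < y" using assms by simp
    have "m * (e + g + 2) * y \<le> lip * y" using lip_parts(2) y by (intro mult_right_mono) auto
    then show ?thesis using True speed_le[OF y assms(3)] speed_pos[OF y assms(3)] by (simp add: speed_def)
  qed (use True in simp)
next
  case False
  then have x: "0 < x" using assms by simp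
  define s' where "s' = (\<lambda>x. m * (rate x * (gap x / (\<phi> x - low x) - 1) - (2 * \<sigma> * x + (1 - a))))"
  have d: "((\<lambda>x. m * (\<phi> x - low x)) has_real_derivative s' u) (at u)" if "0 < u" "u < reach" for u
    unfolding s'_def by (intro DERIV_cmult DERIV_diff phi_deriv low_deriv that)
  have b: "\<bar>s' u\<bar> \<le> lip" if u: "0 < u" "u < reach" for u
  proof -
    have "\<bar>rate u * (gap u / (\<phi> u - low u) - 1) - (2 * \<sigma> * u + (1 - a))\<bar>
        \<le> n / m * (1 + reach) * (1 / \<eta>) + (2 * reach + 1 + a)"
      using phi_slope_pos[OF u] phi_slope_le[OF u] low_deriv_bound[OF u] by linarith
    from mult_left_mono[OF this less_imp_le[OF pos(1)]] lip_parts(1)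
    have "m * \<bar>rate u * (gap u / (\<phi> u - low u) - 1) - (2 * \<sigma> * u + (1 - a))\<bar> \<le> lip" by linarith
    then show ?thesis using pos by (simp add: s'_def abs_mult)
  qed
  have "\<bar>m * (\<phi> y - low y) - m * (\<phi> x - low x)\<bar> \<le> lip * (y - x)"
  proof (rule mono_within_lipschitz[where f="\<lambda>x. m * (\<phi> x - low x)" and f'=s'])
    show "continuous_on {x..y} (\<lambda>x. m * (\<phi> x - low x))"
      by (intro continuous_at_imp_continuous_on ballI DERIV_isCont[OF d]) (use x assms in auto)
  qed (use x assms d b in auto)
  then show ?thesis using x assms by (simp add: speed_def)
qed

text \<open>The flow restricted to the branch is the scalar equation x' = - speed x. It is solved
  globally for a truncated right side, and the truncation turns out to be inactive because the
  solution stays in (0, x1].\<close>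

theorem ex_orbit_through:
  assumes x1: "x1 \<in> dom"
  obtains X Y where "orbit X Y" "on_branch X Y" "X 0 = \<sigma> * x1" "Y 0 = - \<sigma> * \<phi> x1"
proof -
  have x1': "0 < x1" "x1 < reach" "\<sigma> = 1 \<Longrightarrow> \<phi> x1 < a" using x1 unfolding dom_def by auto
  \<comment> \<open>The speed is frozen beyond \<open>x1\<close> and continued linearly to negative
    arguments. The slope \<open>lip\<close> of the continuation makes
    \<open>k u \<le> lip * u\<close> hold for every \<open>u\<close>, which keeps the solution
    positive.\<close>
  define k where "k = (\<lambda>x. lip * min 0 x + speed (max 0 (min x x1)))"
  have k_lip: "\<bar>k x - k y\<bar> \<le> 2 * lip * \<bar>x - y\<bar>" for x y
  proof -
    have *: "\<bar>k x - k y\<bar> \<le> 2 * lip * \<bar>x - y\<bar>" if "y \<le> x" for x y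
    proof -
      have "\<bar>speed (max 0 (min x x1)) - speed (max 0 (min y x1))\<bar> \<le> lip * (max 0 (min x x1) - max 0 (min y x1))"
        by (rule speed_lipschitz) (use that x1' in auto)
      also have "\<dots> \<le> lip * (x - y)" using lip_parts(3) that by (intro mult_left_mono) auto
      finally have 1: "\<bar>speed (max 0 (min x x1)) - speed (max 0 (min y x1))\<bar> \<le> lip * (x - y)" .
      have "\<bar>min 0 x - min 0 y\<bar> \<le> x - y" using that by auto
      then have 2: "\<bar>lip * min 0 x - lip * min 0 y\<bar> \<le> lip * (x - y)"
        using lip_parts(3) by (simp add: abs_mult flip: right_diff_distrib)
      show ?thesis using 1 2 that unfolding k_def by (simp add: abs_le_iff)
    qed
    show ?thesis using *[of x y] *[of y x] by (cases "y \<le> x") (auto simp: abs_minus_commute)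
  qed
  have "(2 * lip)-lipschitz_on UNIV k"
    using k_lip lip_parts(3) by (auto simp: lipschitz_on_def dist_real_def)
  then have k_cont: "continuous_on UNIV k" by (rule lipschitz_on_continuous_on)
  have "continuous_on ({0..} \<times> UNIV) (\<lambda>q::real \<times> real. - k (snd q))"
    by (intro continuous_on_minus continuous_on_compose2[OF k_cont] continuous_on_snd continuous_on_id) auto
  then have "continuous_on ({0..} \<times> UNIV) (\<lambda>(t::real, y). - k y)" by (simp add: case_prod_beta)
  then obtain x where x: "x 0 = x1" "\<And>t. t \<ge> 0 \<Longrightarrow> (x has_real_derivative - k (x t)) (at t within {0..})"
    using picard_halfline[of "\<lambda>t y. - k y" "2 * lip" x1] k_lip by (auto simp: abs_minus_commute)
  have k_le: "k u \<le> lip * u" for u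
  proof (cases "u \<le> 0")
    case True
    then show ?thesis using x1' by (simp add: k_def speed_def)
  next
    case False
    have "speed (min u x1) \<le> m * (e + g + 2) * min u x1" using False x1' by (intro speed_le) auto
    also have "\<dots> \<le> lip * u"
      using False x1' lip_parts pos e_nonneg by (intro mult_mono) auto
    finally show ?thesis using False x1' by (simp add: k_def)
  qed
  have x_pos: "x t > 0" if t: "t \<ge> 0" for t
  proof -
    have "x 0 * exp (lip * 0) \<le> x t * exp (lip * t)"
    proof (rule mono_of_deriv_nonneg[OF t, where S="{0..}" and f="\<lambda>t. x t * exp (lip * t)" and f'="\<lambda>t. (lip * x t - k (x t)) * exp (lip * t)"])
      fix u assume u: "u \<in> {0..t}"
      show "((\<lambda>t. x t * exp (lip * t)) has_real_derivative (lip * x u - k (x u)) * exp (lip * u)) (at u within {0..})"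
        using u by (auto intro!: derivative_eq_intros x(2) simp: algebra_simps)
      show "0 \<le> (lip * x u - k (x u)) * exp (lip * u)" using k_le[of "x u"] by simp
    qed auto
    then have "0 < x t * exp (lip * t)" using x(1) x1' by simp
    then show ?thesis by (simp add: zero_less_mult_iff)
  qed
  have k_nonneg: "k (x t) \<ge> 0" if t: "t \<ge> 0" for t
  proof -
    have "speed (min (x t) x1) > 0" using x_pos[OF t] x1' by (intro speed_pos) auto
    then show ?thesis using x_pos[OF t] x1' by (simp add: k_def)
  qed
  have x_anti: "x t \<le> x s" if "0 \<le> s" "s \<le> t" for s t
  proof -
    have "- x s \<le> - x t"
    proof (rule mono_of_deriv_nonneg[OF that(2), where S="{0..}" and f="\<lambda>t. - x t" and f'="\<lambda>t. k (x t)"])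
      fix u assume "u \<in> {s..t}"
      then have u: "u \<ge> 0" using that by simp
      show "((\<lambda>t. - x t) has_real_derivative k (x u)) (at u within {0..})" using DERIV_minus[OF x(2)[OF u]] by simp
      show "0 \<le> k (x u)" by (rule k_nonneg[OF u])
    qed (use that in auto)
    then show ?thesis by simp
  qed
  have x_le: "x t \<le> x1" if "t \<ge> 0" for t using x_anti[of 0 t] that x(1) by simp
  have k_eq: "k (x t) = m * (\<phi> (x t) - low (x t))" if "t \<ge> 0" for t
    using x_pos[OF that] x_le[OF that] x1' by (simp add: k_def speed_def min_absorb1)
  have x_deriv: "(x has_real_derivative - m * (\<phi> (x t) - low (x t))) (at t within {0..})" if "t \<ge> 0" for t
    using x(2)[OF that] k_eq[OF that] by simp
  have x_lim: "(x \<longlongrightarrow> 0) at_top"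
  proof (rule order_tendstoI)
    fix c :: real assume "c < 0"
    show "eventually (\<lambda>t. c < x t) at_top"
      using eventually_ge_at_top[of 0]
    proof eventually_elim
      fix t :: real assume "0 \<le> t"
      then show "c < x t" using x_pos[of t] \<open>c < 0\<close> by linarith
    qed
  next
    fix c :: real assume c: "c > 0"
    show "eventually (\<lambda>t. x t < c) at_top"
    proof (rule ccontr)
      assume n: "\<not> eventually (\<lambda>t. x t < c) at_top"
      have ge: "x t \<ge> c" if t: "t \<ge> 0" for t
      proof (rule ccontr)
        assume "\<not> x t \<ge> c"
        then have "\<forall>s\<ge>t. x s < c" using x_anti[of t] t by force
        then have "eventually (\<lambda>s. x s < c) at_top" unfolding eventually_at_top_linorder by blast
        then show False using n by contradiction
      qed
      have "continuous_on {c..x1} gap"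
        by (rule has_real_derivative_imp_continuous_on[OF gap_deriv])
      moreover have "{c..x1} \<noteq> {}" using ge[of 0] x(1) by simp
      ultimately obtain z where z: "z \<in> {c..x1}" "\<And>u. u \<in> {c..x1} \<Longrightarrow> gap z \<le> gap u"
        using continuous_attains_inf[of "{c..x1}" gap] by auto
      \<comment> \<open>A solution staying at or above \<open>c\<close> would decrease at least at
        this rate, the minimum over the compact range, and would reach 0 by time
        \<open>x1 / \<delta>\<close>.\<close>
      define \<delta> where "\<delta> = m * (\<eta> * gap z)"
      have d: "\<delta> > 0" using z(1) c x1' pos eta gap_pos[of z] by (simp add: \<delta>_def)
      define t where "t = x1 / \<delta>"
      have t: "t > 0" using d x1' by (simp add: t_def)
      have "- x 0 - \<delta> * 0 \<le> - x t - \<delta> * t"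
      proof (rule mono_of_deriv_nonneg[OF less_imp_le[OF t], where S="{0..}" and f="\<lambda>t. - x t - \<delta> * t" and f'="\<lambda>t. m * (\<phi> (x t) - low (x t)) - \<delta>"])
        fix u assume u: "u \<in> {0..t}"
        then have u0: "u \<ge> 0" by simp
        show "((\<lambda>t. - x t - \<delta> * t) has_real_derivative m * (\<phi> (x u) - low (x u)) - \<delta>) (at u within {0..})"
          by (auto intro!: derivative_eq_intros x_deriv[OF u0])
        have "\<eta> * gap z \<le> \<eta> * gap (x u)" using z(2)[of "x u"] ge[OF u0] x_le[OF u0] eta by (intro mult_left_mono) auto
        also have "\<dots> \<le> \<phi> (x u) - low (x u)" using x_pos[OF u0] x_le[OF u0] x1' by (intro phi_low) auto
        finally have "m * (\<eta> * gap z) \<le> m * (\<phi> (x u) - low (x u))" using pos by (intro mult_left_mono) auto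
        then show "0 \<le> m * (\<phi> (x u) - low (x u)) - \<delta>" by (simp add: \<delta>_def)
      qed auto
      then show False using x_pos[of t] t d x(1) by (simp add: t_def)
    qed
  qed
  define X Y where "X = (\<lambda>t. \<sigma> * x t)" and "Y = (\<lambda>t. - \<sigma> * \<phi> (x t))"
  have x_dom: "x t \<in> dom" if t: "t \<ge> 0" for t
  proof -
    have "\<phi> (x t) \<le> \<phi> x1" using phi_strict_mono[of "x t" x1] x_pos[OF t] x_le[OF t] x1' by (cases "x t = x1") auto
    then show ?thesis using x_pos[OF t] x_le[OF t] x1' by (auto simp: dom_def)
  qed
  \<comment> \<open>The slope equation for \<phi> is the quotient of the two components of the
    system, so the chain rule returns the second component.\<close>
  have y_deriv: "((\<lambda>t. \<phi> (x t)) has_real_derivative n * (1 + \<sigma> * x t) * (\<phi> (x t) - low (x t) - gap (x t))) (at t within {0..})"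
    if t: "t \<ge> 0" for t
  proof -
    have xt: "0 < x t" "x t < reach" using x_pos[OF t] x_le[OF t] x1' by auto
    have "((\<lambda>t. \<phi> (x t)) has_real_derivative
        rate (x t) * (gap (x t) / (\<phi> (x t) - low (x t)) - 1) * (- m * (\<phi> (x t) - low (x t)))) (at t within {0..})"
      by (rule DERIV_chain2[OF phi_deriv[OF xt] x_deriv[OF t]])
    moreover have "rate (x t) * (gap (x t) / P - 1) * (- m * P) = n * (1 + \<sigma> * x t) * (P - gap (x t))" if "P > 0" for P
      using that pos by (simp add: rate_def field_simps)
    ultimately show ?thesis using phi_minus_low_pos[OF xt] by simp
  qed
  have s3: "\<sigma> * (\<sigma> * u) = u" for u using sigma_sq by simp
  have orb: "orbit X Y"
    unfolding orbit_def
  proof (intro conjI allI impI)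
    fix t :: real assume t: "t \<ge> 0"
    have "(X has_real_derivative \<sigma> * (- m * (\<phi> (x t) - low (x t)))) (at t within {0..})"
      unfolding X_def by (intro DERIV_cmult x_deriv t)
    moreover have "\<sigma> * (- m * (\<phi> (x t) - low (x t))) = m * (Y t - nullF (X t))"
    proof -
      have l: "\<sigma> * low (x t) = - nullF (X t)" by (simp add: low_eq X_def s3)
      have "\<sigma> * (- m * (\<phi> (x t) - low (x t))) = m * (- \<sigma> * \<phi> (x t)) + m * (\<sigma> * low (x t))"
        by (simp add: algebra_simps)
      also have "\<dots> = m * (Y t - nullF (X t))" unfolding l by (simp add: Y_def algebra_simps)
      finally show ?thesis .
    qed
    ultimately show "(X has_real_derivative m * (Y t - nullF (X t))) (at t within {0..})" by simp
    have "(Y has_real_derivative - \<sigma> * (n * (1 + \<sigma> * x t) * (\<phi> (x t) - low (x t) - gap (x t)))) (at t within {0..})"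
      unfolding Y_def by (intro DERIV_cmult y_deriv t)
    moreover have "- \<sigma> * (n * (1 + \<sigma> * x t) * (\<phi> (x t) - low (x t) - gap (x t))) = n * (1 + X t) * (Y t - nullG (X t))"
    proof -
      have "\<sigma> * (low (x t) + gap (x t)) = - nullG (X t)" by (simp add: gap_eq' X_def s3)
      then have z: "\<sigma> * (\<phi> (x t) - low (x t) - gap (x t)) = - (Y t - nullG (X t))" by (simp add: Y_def algebra_simps)
      have "- \<sigma> * (n * (1 + \<sigma> * x t) * (\<phi> (x t) - low (x t) - gap (x t)))
          = - (n * (1 + X t) * (\<sigma> * (\<phi> (x t) - low (x t) - gap (x t))))"
        by (simp add: X_def mult_ac)
      also have "\<dots> = n * (1 + X t) * (Y t - nullG (X t))" unfolding z by (simp only: mult_minus_right minus_minus)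
      finally show ?thesis .
    qed
    ultimately show "(Y has_real_derivative n * (1 + X t) * (Y t - nullG (X t))) (at t within {0..})" by simp
    have xd: "0 < x t" "x t < reach" "\<sigma> = 1 \<Longrightarrow> \<phi> (x t) < a" using x_dom[OF t] unfolding dom_def by auto
    show "X t > -1"
      using side
    proof
      assume s: "\<sigma> = -1"
      then show ?thesis using xd(2) unfolding X_def reach_le_1[OF s] by simp
    next
      assume "\<sigma> = 1 \<and> e > 0"
      then show ?thesis using xd(1) by (simp add: X_def)
    qed
    show "Y t > - a"
      using side
    proof
      assume "\<sigma> = -1"
      then show ?thesis using phi_pos[OF xd(1,2)] pos by (simp add: Y_def)
    next
      assume "\<sigma> = 1 \<and> e > 0"
      then show ?thesis using xd(3) by (simp add: Y_def)
    qed
  next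
    show "(X \<longlongrightarrow> 0) at_top" unfolding X_def using tendsto_mult_left[OF x_lim, of \<sigma>] by simp
    have "eventually (\<lambda>t. x t \<in> {0<..} \<and> x t \<noteq> 0) at_top"
      using eventually_ge_at_top[of 0]
    proof eventually_elim
      fix t :: real assume "0 \<le> t"
      then show "x t \<in> {0<..} \<and> x t \<noteq> 0" using x_pos[of t] by simp
    qed
    then have "filterlim x (at_right 0) at_top"
      using x_lim by (simp add: filterlim_at)
    then have "((\<lambda>t. \<phi> (x t)) \<longlongrightarrow> 0) at_top" by (rule filterlim_compose[OF phi_lim])
    then show "(Y \<longlongrightarrow> 0) at_top" unfolding Y_def using tendsto_mult_left[of "\<lambda>t. \<phi> (x t)" 0 at_top "- \<sigma>"] by simp
  qed
  have "on_branch X Y" unfolding on_branch_def using x_dom by (simp add: X_def Y_def s3)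
  then show thesis using that orb x(1) by (simp add: X_def Y_def)
qed

end

subsection \<open>Decay along the branch\<close>

lemma decays_SucI:
  fixes f :: "real \<Rightarrow> real"
  assumes "decays w 0 k f" "\<And>t. t \<ge> 0 \<Longrightarrow> (f has_real_derivative f' t) (at t within {0..})" "decays w n (Suc k) f'"
  shows "decays w (Suc n) k f"
  unfolding decays.simps(2)
proof (intro conjI exI[of _ f'] allI impI)
  show "\<exists>C\<ge>0. \<forall>t\<ge>0. norm (f t) \<le> C * w k t" using assms(1) by simp
  show "(f has_vector_derivative f' t) (at t within {0..})" if "t \<ge> 0" for t
    using assms(2)[OF that] by (simp add: has_real_derivative_iff_has_vector_derivative)
qed (rule assms(3))

text \<open>Polynomials in the generators \<open>B\<close>. If the derivatives of the generators lie
  in this ring, the sum and product rules close the whole ring under differentiation.\<close>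

inductive_set ring_closure :: "(real \<Rightarrow> real) set \<Rightarrow> (real \<Rightarrow> real) set" for B where
  base: "b \<in> B \<Longrightarrow> b \<in> ring_closure B"
| const: "(\<lambda>_. c) \<in> ring_closure B"
| add: "f \<in> ring_closure B \<Longrightarrow> h \<in> ring_closure B \<Longrightarrow> (\<lambda>x. f x + h x) \<in> ring_closure B"
| mult: "f \<in> ring_closure B \<Longrightarrow> h \<in> ring_closure B \<Longrightarrow> (\<lambda>x. f x * h x) \<in> ring_closure B"

lemma ring_closure_deriv:
  assumes B: "\<And>b. b \<in> B \<Longrightarrow> \<exists>b'\<in>ring_closure B. \<forall>x\<in>S. (b has_real_derivative b' x) (at x within S)"
    and "f \<in> ring_closure B"
  shows "\<exists>f'\<in>ring_closure B. \<forall>x\<in>S. (f has_real_derivative f' x) (at x within S)"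
  using assms(2)
proof induction
  case (base b)
  then show ?case by (rule B)
next
  case (const c)
  show ?case by (rule bexI[OF _ ring_closure.const[of 0]]) simp
next
  case (add f h)
  then obtain f' h' where f': "f' \<in> ring_closure B" "\<forall>x\<in>S. (f has_real_derivative f' x) (at x within S)"
    and h': "h' \<in> ring_closure B" "\<forall>x\<in>S. (h has_real_derivative h' x) (at x within S)" by blast
  show ?case
    by (rule bexI[OF _ ring_closure.add[OF f'(1) h'(1)]]) (use f' h' in \<open>auto intro: DERIV_add\<close>)
next
  case (mult f h)
  then obtain f' h' where f': "f' \<in> ring_closure B" "\<forall>x\<in>S. (f has_real_derivative f' x) (at x within S)"
    and h': "h' \<in> ring_closure B" "\<forall>x\<in>S. (h has_real_derivative h' x) (at x within S)" by blast
  show ?case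
    by (rule bexI[OF _ ring_closure.add[OF ring_closure.mult[OF f'(1) mult.hyps(2)] ring_closure.mult[OF h'(1) mult.hyps(1)]]])
      (use f' h' in \<open>auto intro: DERIV_mult\<close>)
qed

context planar_branch
begin

context
  fixes X Y :: "real \<Rightarrow> real"
  assumes orb: "orbit X Y" and br: "on_branch X Y"
begin

lemma branch_range: "t \<ge> 0 \<Longrightarrow> 0 < \<sigma> * X t" "t \<ge> 0 \<Longrightarrow> \<sigma> * X t < reach"
  using br unfolding on_branch_def dom_def by auto

lemma X_deriv_branch: "t \<ge> 0 \<Longrightarrow> (X has_real_derivative m * (Y t - nullF (X t))) (at t within {0..})"
  and Y_deriv_branch: "t \<ge> 0 \<Longrightarrow> (Y has_real_derivative n * (1 + X t) * (Y t - nullG (X t))) (at t within {0..})"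
  using orb by (auto simp: orbit_def)

lemma branch_x_deriv: "t \<ge> 0 \<Longrightarrow>
    ((\<lambda>t. \<sigma> * X t) has_real_derivative - (m * (\<phi> (\<sigma> * X t) - low (\<sigma> * X t)))) (at t within {0..})"
proof -
  assume t: "t \<ge> 0"
  have y: "- \<sigma> * Y t = \<phi> (\<sigma> * X t)" using br t by (simp add: on_branch_def)
  have "((\<lambda>t. \<sigma> * X t) has_real_derivative \<sigma> * (m * (Y t - nullF (X t)))) (at t within {0..})"
    by (rule DERIV_cmult) (use orb t in \<open>simp add: orbit_def\<close>)
  moreover have "\<sigma> * (m * (Y t - nullF (X t))) = - (m * (\<phi> (\<sigma> * X t) - low (\<sigma> * X t)))"
    unfolding y[symmetric] low_eq sigma_sq by (simp add: algebra_simps)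
  ultimately show ?thesis by simp
qed

lemma branch_x_anti: "t \<ge> 0 \<Longrightarrow> \<sigma> * X t \<le> \<sigma> * X 0"
proof -
  assume t: "t \<ge> 0"
  have "- (\<sigma> * X 0) \<le> - (\<sigma> * X t)"
  proof (rule mono_of_deriv_nonneg[OF t, where S="{0..}" and f="\<lambda>t. - (\<sigma> * X t)" and f'="\<lambda>t. m * (\<phi> (\<sigma> * X t) - low (\<sigma> * X t))"])
    fix u assume u: "u \<in> {0..t}"
    then show "((\<lambda>t. - (\<sigma> * X t)) has_real_derivative m * (\<phi> (\<sigma> * X u) - low (\<sigma> * X u))) (at u within {0..})"
      using DERIV_minus[OF branch_x_deriv[of u]] by simp
    show "0 \<le> m * (\<phi> (\<sigma> * X u) - low (\<sigma> * X u))"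
      using phi_minus_low_pos[OF branch_range[of u]] u pos by simp
  qed auto
  then show ?thesis by simp
qed

text \<open>The branch lies below the upper nullcline, whose height is at most linear in
  \<open>x\<close>; so a bound for \<open>X\<close> controls \<open>Y\<close> as well.\<close>

lemma branch_Y_le: "t \<ge> 0 \<Longrightarrow> \<bar>Y t\<bar> \<le> g * (a + 1) * (\<sigma> * X t)"
proof -
  assume t: "t \<ge> 0"
  define x where "x = \<sigma> * X t"
  have x: "0 < x" "x < reach" using branch_range[OF t] by (auto simp: x_def)
  have y: "- \<sigma> * Y t = \<phi> x" using br t by (simp add: on_branch_def x_def)
  have "\<bar>Y t\<bar> = \<bar>- \<sigma> * Y t\<bar>" using side by (auto simp: abs_mult)
  also have "\<dots> = \<phi> x" unfolding y using phi_pos[OF x] by simp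
  also have "\<dots> \<le> low x + gap x" using phi_up[OF x] by simp
  also have "\<dots> = g * (a * x - \<sigma> * x\<^sup>2 / 2)" by (simp add: low_def gap_def e_def algebra_simps power2_eq_square)
  also have "\<dots> \<le> g * ((a + 1) * x)"
  proof (rule mult_left_mono)
    have "- (\<sigma> * x\<^sup>2 / 2) \<le> x"
      using side
    proof
      assume s: "\<sigma> = -1"
      have "x * x \<le> 1 * x" using x unfolding reach_le_1[OF s] by (intro mult_right_mono) auto
      then show ?thesis using s x by (simp add: power2_eq_square)
    next
      assume "\<sigma> = 1 \<and> e > 0"
      then show ?thesis using x by (simp add: order_trans[of _ 0])
    qed
    then show "a * x - \<sigma> * x\<^sup>2 / 2 \<le> (a + 1) * x" by (simp add: distrib_right)
  qed (use pos in simp)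
  finally show ?thesis by (simp add: x_def mult.assoc)
qed

lemma branch_abs_X: "t \<ge> 0 \<Longrightarrow> \<bar>X t\<bar> = \<sigma> * X t"
  using branch_range(1)[of t] side by auto

lemma decays_0I:
  assumes "C \<ge> 0" "\<And>t. t \<ge> 0 \<Longrightarrow> \<sigma> * X t \<le> C * w 1 t"
  shows "decays w 0 1 X" "decays w 0 1 Y"
proof -
  show "decays w 0 1 X" using assms branch_abs_X by auto
  have "norm (Y t) \<le> (g * (a + 1) * C) * w 1 t" if t: "t \<ge> 0" for t
  proof -
    have "g * (a + 1) * (\<sigma> * X t) \<le> g * (a + 1) * (C * w 1 t)"
      using assms(2)[OF t] pos by (intro mult_left_mono) auto
    then show ?thesis using branch_Y_le[OF t] by (simp add: mult.assoc)
  qed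
  then show "decays w 0 1 Y" using assms(1) pos by (auto intro!: exI[of _ "g * (a + 1) * C"])
qed

text \<open>For \<open>e > 0\<close> the gap is at least a multiple of its argument on the range
  swept by the orbit, and the speed is at least \<open>m * \<eta>\<close> times the gap. Right sides
  of the system are polynomials in \<open>X\<close> and \<open>Y\<close> without constant term, so
  all derivatives inherit the same rate.\<close>

theorem exponential_decay:
  assumes "e > 0"
  shows "\<exists>c>0. \<forall>N. decays (\<lambda>k t. if k = 0 then 1 else exp (- c * t)) N 1 X \<and>
    decays (\<lambda>k t. if k = 0 then 1 else exp (- c * t)) N 1 Y"
proof -
  define x0 where "x0 = \<sigma> * X 0"
  have x0: "0 < x0" "x0 < reach" using branch_range[of 0] by (auto simp: x0_def)
  obtain \<kappa> where k: "\<kappa> > 0" "\<And>u. 0 < u \<Longrightarrow> u \<le> x0 \<Longrightarrow> \<kappa> * u \<le> gap u"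
    using side
  proof
    assume s: "\<sigma> = -1"
    have "e * u \<le> gap u" for u
    proof -
      have "0 \<le> (g / 2 + 1) * u\<^sup>2" using pos by simp
      then show ?thesis unfolding gap_def using s by (simp add: algebra_simps)
    qed
    then show thesis using that assms by blast
  next
    assume s: "\<sigma> = 1 \<and> e > 0"
    \<comment> \<open>Positive because the orbit starts strictly before the second equilibrium; the
      rate obtained on this side depends on the starting point.\<close>
    define \<kappa> where "\<kappa> = e - (g / 2 + 1) * x0"
    have "x0 < 2 * e / (g + 2)" using x0(2) s unfolding reach_def by simp
    then have "\<kappa> > 0" using pos by (simp add: \<kappa>_def field_simps)
    moreover have "\<kappa> * u \<le> gap u" if u: "0 < u" "u \<le> x0" for u
    proof -
      have "(g / 2 + 1) * u * u \<le> (g / 2 + 1) * x0 * u" using u pos by (intro mult_right_mono mult_left_mono) auto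
      then show ?thesis unfolding gap_def using s by (simp add: \<kappa>_def power2_eq_square left_diff_distrib mult.assoc)
    qed
    ultimately show thesis using that by blast
  qed
  define c where "c = m * \<eta> * \<kappa>"
  have c: "c > 0" using pos eta k by (simp add: c_def)
  define w where "w = (\<lambda>(k::nat) t. if k = 0 then 1 else exp (- c * t))"
  interpret w: decay_weight w unfolding w_def by (rule decay_weight_exp) (use c in simp)
  have x_le: "\<sigma> * X t \<le> x0 * w 1 t" if t: "t \<ge> 0" for t
  proof -
    have "- (\<sigma> * X 0 * exp (c * 0)) \<le> - (\<sigma> * X t * exp (c * t))"
    proof (rule mono_of_deriv_nonneg[OF t, where S="{0..}" and f="\<lambda>t. - (\<sigma> * X t * exp (c * t))"
          and f'="\<lambda>t. (m * (\<phi> (\<sigma> * X t) - low (\<sigma> * X t)) - c * (\<sigma> * X t)) * exp (c * t)"])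
      fix u assume u: "u \<in> {0..t}"
      then have u0: "u \<ge> 0" by simp
      show "((\<lambda>t. - (\<sigma> * X t * exp (c * t))) has_real_derivative (m * (\<phi> (\<sigma> * X u) - low (\<sigma> * X u)) - c * (\<sigma> * X u)) * exp (c * u)) (at u within {0..})"
        by (rule derivative_eq_intros branch_x_deriv[OF u0] refl)+ (simp add: algebra_simps)
      note r = branch_range[OF u0]
      have "\<eta> * (\<kappa> * (\<sigma> * X u)) \<le> \<eta> * gap (\<sigma> * X u)"
        using k(2)[OF r(1)] branch_x_anti[OF u0] eta by (intro mult_left_mono) (auto simp: x0_def)
      also have "\<dots> \<le> \<phi> (\<sigma> * X u) - low (\<sigma> * X u)" by (rule phi_low[OF r])
      finally have "m * (\<eta> * (\<kappa> * (\<sigma> * X u))) \<le> m * (\<phi> (\<sigma> * X u) - low (\<sigma> * X u))"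
        using pos by (intro mult_left_mono) auto
      then show "0 \<le> (m * (\<phi> (\<sigma> * X u) - low (\<sigma> * X u)) - c * (\<sigma> * X u)) * exp (c * u)"
        by (simp add: c_def mult.assoc)
    qed auto
    then have "\<sigma> * X t * exp (c * t) \<le> x0" by (simp add: x0_def)
    then show ?thesis by (simp add: w_def exp_minus field_simps)
  qed
  note base = decays_0I[of x0 w, OF less_imp_le[OF x0(1)] x_le]
  \<comment> \<open>All positive orders carry the same exponential weight, so orders may be shifted
    freely.\<close>
  have up: "decays w N 2 f" if "decays w N 1 f" for N and f :: "real \<Rightarrow> real"
    by (rule decays_weaken[OF _ that]) (simp add: w_def)
  have "decays w N 1 X \<and> decays w N 1 Y" for N
  proof (induction N)
    case 0
    then show ?case using base by blast
  next
    case (Suc N)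
    then have X: "decays w N 1 X" and Y: "decays w N 1 Y" by auto
    have XX: "decays w N 2 (\<lambda>t. X t * X t)" using w.decays_mult[OF X X] by (simp add: numeral_2_eq_2)
    have "decays w N 2 (\<lambda>t. m * (Y t + (X t * X t + (1 - a) * X t)))"
      by (intro w.decays_cmult decays_add up[OF Y] XX up[OF X])
    then have X': "decays w N (Suc 1) (\<lambda>t. m * (Y t - nullF (X t)))"
      by (simp add: nullF_def power2_eq_square numeral_2_eq_2 algebra_simps)
    have Q: "decays w N 2 (\<lambda>t. Y t + ((- g / 2) * (X t * X t) + (g * a) * X t))"
      by (intro w.decays_cmult decays_add up[OF Y] XX up[OF X])
    have "decays w N (1 + 2) (\<lambda>t. X t * (Y t + ((- g / 2) * (X t * X t) + (g * a) * X t)))"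
      by (rule w.decays_mult[OF X Q])
    then have "decays w N 2 (\<lambda>t. X t * (Y t + ((- g / 2) * (X t * X t) + (g * a) * X t)))"
      by (rule decays_weaken[rotated]) (simp add: w_def)
    then have "decays w N 2 (\<lambda>t. n * ((Y t + ((- g / 2) * (X t * X t) + (g * a) * X t)) + X t * (Y t + ((- g / 2) * (X t * X t) + (g * a) * X t))))"
      by (intro w.decays_cmult decays_add Q)
    then have "decays w N 2 (\<lambda>t. n * (1 + X t) * (Y t - nullG (X t)))"
      by (rule decays_cong[rotated]) (simp add: nullG_def power2_eq_square algebra_simps)
    then have Y': "decays w N (Suc 1) (\<lambda>t. n * (1 + X t) * (Y t - nullG (X t)))"
      by (simp only: numeral_2_eq_2 One_nat_def)
    show ?case
      using decays_SucI[OF base(1) X_deriv_branch X'] decays_SucI[OF base(2) Y_deriv_branch Y'] by simp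
  qed
  then show ?thesis using c unfolding w_def by blast
qed

text \<open>For \<open>e = 0\<close> the gap is quadratic, so the reciprocal of \<open>x\<close>
  grows at least linearly in time. To gain one order per derivative, X' must be quadratically small,
  although it contains a linear term \<open>N\<close>; that \<open>N\<close> is the unstable
  component and is slaved to quadratic terms.\<close>

theorem algebraic_decay:
  assumes e0: "e = 0"
  shows "decays (\<lambda>k t. 1 / (1 + t) ^ k) N 1 X \<and> decays (\<lambda>k t. 1 / (1 + t) ^ k) N 1 Y"
proof -
  define w where "w = (\<lambda>k (t::real). 1 / (1 + t) ^ k)"
  interpret w: decay_weight w unfolding w_def by (rule decay_weight_power)
  have s: "\<sigma> = -1" using side e0 by auto
  define x where "x = (\<lambda>t. \<sigma> * X t)"
  define c where "c = m * \<eta> * (g / 2 + 1)"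
  have c: "c > 0" using pos eta by (simp add: c_def add_pos_pos)
  \<comment> \<open>Allows \<open>1 / x 0 + c * t\<close> to be bounded below by
    \<open>c' * (1 + t)\<close>, the shape of the weight.\<close>
  define c' where "c' = min (1 / x 0) c"
  have c': "c' > 0" using c branch_range[of 0] by (simp add: c'_def x_def)
  have x_le: "x t \<le> 1 / c' * w 1 t" if t: "t \<ge> 0" for t
  proof -
    have "1 / x 0 - c * 0 \<le> 1 / x t - c * t"
    proof (rule mono_of_deriv_nonneg[OF t, where S="{0..}" and f="\<lambda>t. 1 / x t - c * t"
          and f'="\<lambda>t. m * (\<phi> (x t) - low (x t)) / (x t)\<^sup>2 - c"])
      fix u assume u: "u \<in> {0..t}"
      then have u0: "u \<ge> 0" by simp
      note r = branch_range[OF u0, folded x_def]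
      show "((\<lambda>t. 1 / x t - c * t) has_real_derivative m * (\<phi> (x u) - low (x u)) / (x u)\<^sup>2 - c) (at u within {0..})"
      proof -
        have xd: "(x has_real_derivative - (m * (\<phi> (x u) - low (x u)))) (at u within {0..})"
          unfolding x_def by (rule branch_x_deriv[OF u0])
        have "x u > 0" using branch_range(1)[OF u0] by (simp only: x_def)
        then have "x u \<noteq> 0" by simp
        then show ?thesis
          by - (rule derivative_eq_intros xd refl | assumption | simp add: power2_eq_square)+
      qed
      have "gap (x u) = (g / 2 + 1) * (x u)\<^sup>2" unfolding gap_def using s e0 by (simp add: algebra_simps)
      then have "\<eta> * ((g / 2 + 1) * (x u)\<^sup>2) \<le> \<phi> (x u) - low (x u)" using phi_low[OF branch_range[OF u0]] by (simp add: x_def)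
      then have "m * (\<eta> * ((g / 2 + 1) * (x u)\<^sup>2)) \<le> m * (\<phi> (x u) - low (x u))" using pos by (intro mult_left_mono) auto
      then have "c * (x u)\<^sup>2 \<le> m * (\<phi> (x u) - low (x u))" by (simp add: c_def mult.assoc)
      moreover have "(x u)\<^sup>2 > 0" unfolding x_def by (rule zero_less_power[OF branch_range(1)[OF u0]])
      ultimately show "0 \<le> m * (\<phi> (x u) - low (x u)) / (x u)\<^sup>2 - c" by (simp add: pos_le_divide_eq)
    qed auto
    then have "1 / x 0 + c * t \<le> 1 / x t" by simp
    moreover have "c' * (1 + t) \<le> 1 / x 0 + c * t"
    proof -
      have "c' * t \<le> c * t" using t by (intro mult_right_mono) (auto simp: c'_def)
      moreover have "c' \<le> 1 / x 0" by (simp add: c'_def)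
      ultimately show ?thesis by (simp add: distrib_left)
    qed
    ultimately have "c' * (1 + t) \<le> 1 / x t" by linarith
    moreover have "x t > 0" using branch_range[OF t] by (simp add: x_def)
    ultimately have "c' * (1 + t) * x t \<le> 1" by (simp add: pos_le_divide_eq)
    moreover have "0 < c' * (1 + t)" using c' t by simp
    ultimately have "x t \<le> 1 / (c' * (1 + t))" by (simp add: pos_le_divide_eq mult.commute)
    then show ?thesis by (simp add: w_def)
  qed
  note base = decays_0I[of "1 / c'" w, OF _ x_le[unfolded x_def]]
  have baseX: "decays w 0 1 X" and baseY: "decays w 0 1 Y" using base c' by auto
  \<comment> \<open>For \<open>e = 0\<close> the linearisation is (m N, n N): its kernel is the line
    N = 0, and \<open>N\<close> itself grows with the other eigenvalue \<open>r\<close>, the trace.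
    The forcing \<open>q\<close> collects the quadratic and cubic remainders.\<close>
  define N where "N = (\<lambda>t. Y t + (1 - a) * X t)"
  have baseN: "decays w 0 1 N" unfolding N_def by (intro decays_add w.decays_cmult baseX baseY)
  have ga: "g * a = 1 - a" using e0 by (simp add: e_def algebra_simps)
  define r where "r = n + (1 - a) * m"
  have r: "r > 0" using pos ga[symmetric] by (simp add: r_def add_pos_pos)
  define q where "q = (\<lambda>t. n * (X t * N t) + ((- n * g / 2) * (X t * X t) + ((- n * g / 2) * ((X t * X t) * X t) + ((1 - a) * m) * (X t * X t))))"
  have X_deriv: "(X has_real_derivative m * (N t + X t * X t)) (at t within {0..})" if "t \<ge> 0" for t
  proof -
    have eq: "Y t - nullF (X t) = N t + X t * X t" by (simp add: nullF_def N_def power2_eq_square)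
    show ?thesis using X_deriv_branch[OF that] unfolding eq .
  qed
  have N_deriv: "(N has_real_derivative r * N t + q t) (at t within {0..})" if "t \<ge> 0" for t
  proof -
    have "(N has_real_derivative n * (1 + X t) * (Y t - nullG (X t)) + (1 - a) * (m * (N t + X t * X t))) (at t within {0..})"
      unfolding N_def by (intro DERIV_add DERIV_cmult Y_deriv_branch X_deriv[unfolded N_def] that)
    moreover have "Y t - nullG (X t) = N t - g / 2 * (X t * X t)"
    proof -
      have "nullG (X t) = g / 2 * (X t * X t) - (g * a) * X t" by (simp add: nullG_def power2_eq_square algebra_simps)
      then show ?thesis by (simp add: ga N_def)
    qed
    ultimately show ?thesis by (simp add: r_def q_def algebra_simps add_divide_distrib)
  qed
  obtain C where C: "C \<ge> 0" "\<forall>t\<ge>0. norm (N t) \<le> C * w 1 t" using decays_bound[OF baseN] by blast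
  have N_bound: "\<bar>N t\<bar> \<le> C" if t: "t \<ge> 0" for t
  proof -
    have "C * w 1 t \<le> C * 1" using C t by (intro mult_left_mono) (auto simp: w_def)
    then show ?thesis using C(2)[rule_format, OF t] by simp
  qed
  have main: "decays w k 1 X \<and> decays w k 1 N" for k
  proof (induction k)
    case 0
    then show ?case using baseX baseN by blast
  next
    case (Suc k)
    then have X: "decays w k 1 X" and N: "decays w k 1 N" by auto
    have XX: "decays w k 2 (\<lambda>t. X t * X t)" using w.decays_mult[OF X X] by (simp add: numeral_2_eq_2)
    have XN: "decays w k 2 (\<lambda>t. X t * N t)" using w.decays_mult[OF X N] by (simp add: numeral_2_eq_2)
    have "decays w k (2 + 1) (\<lambda>t. (X t * X t) * X t)" by (rule w.decays_mult[OF XX X])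
    moreover have "w (2 + 1 + j) t \<le> w (2 + j) t" if "t \<ge> 0" for j t
      unfolding w_def using that by (intro divide_left_mono power_increasing mult_pos_pos zero_less_power) auto
    ultimately have XXX: "decays w k 2 (\<lambda>t. (X t * X t) * X t)"
      by (rule decays_weaken[rotated])
    have q: "decays w k 2 q" unfolding q_def by (intro decays_add w.decays_cmult XX XN XXX)
    \<comment> \<open>Here the a priori order 1 of \<open>N\<close> improves to the order 2 of its
      forcing, and with it the order of X'.\<close>
    have N2: "decays w k 2 N" by (rule w.decays_unstable_component[OF r N_deriv q N_bound])
    have "decays w k (Suc 1) (\<lambda>t. m * (N t + X t * X t))"
      using w.decays_cmult[OF decays_add[OF N2 XX], of m] by (simp add: numeral_2_eq_2)
    moreover have "decays w k (Suc 1) (\<lambda>t. r * N t + q t)"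
      using decays_add[OF w.decays_cmult[OF N2, of r] q] by (simp add: numeral_2_eq_2)
    ultimately show ?case
      using decays_SucI[OF baseX X_deriv] decays_SucI[OF baseN N_deriv] by simp
  qed
  have "decays w k 1 Y" for k
  proof -
    have "decays w k 1 (\<lambda>t. N t + (- (1 - a)) * X t)" using main[of k] by (intro decays_add w.decays_cmult) auto
    then show ?thesis by (rule decays_cong[rotated]) (simp add: N_def algebra_simps)
  qed
  then show ?thesis using main unfolding w_def by blast
qed

end

end

subsection \<open>Parametrizing the branch\<close>

context planar_branch
begin

text \<open>The slope \<open>1 - a\<close> of the lower nullcline at 0 plus the fraction
  \<open>zc\<close> of the slope \<open>e\<close> of the gap.\<close>

definition endpoint_slope :: real where "endpoint_slope = 1 - a + e * zc"
definition phi_slope :: "real \<Rightarrow> real" where "phi_slope x = rate x * (gap x / (\<phi> x - low x) - 1)"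

lemma phi_slope_deriv: "0 < x \<Longrightarrow> x < reach \<Longrightarrow> (\<phi> has_real_derivative phi_slope x) (at x)"
  unfolding phi_slope_def by (rule phi_deriv)

lemma near_0: "eventually (\<lambda>x. 0 < x \<and> x < reach) (at_right 0)"
  unfolding eventually_at_right_field using reach_pos by auto

lemma quotient_lim: "((\<lambda>x. \<phi> x / x) \<longlongrightarrow> endpoint_slope) (at_right 0)"
proof -
  have "((\<lambda>x. (\<sigma> * x + (1 - a)) + (e - \<sigma> * (g / 2 + 1) * x) * ((\<phi> x - low x) / gap x))
      \<longlongrightarrow> (\<sigma> * 0 + (1 - a)) + (e - \<sigma> * (g / 2 + 1) * 0) * zc) (at_right 0)"
    by (intro tendsto_intros ratio_lim)
  moreover have "eventually (\<lambda>x. (\<sigma> * x + (1 - a)) + (e - \<sigma> * (g / 2 + 1) * x) * ((\<phi> x - low x) / gap x) = \<phi> x / x) (at_right 0)"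
    using near_0
  proof eventually_elim
    fix x assume x: "0 < x \<and> x < reach"
    have gx: "gap x = x * (e - \<sigma> * (g / 2 + 1) * x)" by (simp add: gap_def power2_eq_square algebra_simps)
    have lx: "low x = x * (\<sigma> * x + (1 - a))" by (simp add: low_def power2_eq_square algebra_simps)
    have "x * (e - \<sigma> * (g / 2 + 1) * x) > 0" using gap_pos[of x] x gx by simp
    then have "e - \<sigma> * (g / 2 + 1) * x > 0" using x zero_less_mult_pos by blast
    then have "(e - \<sigma> * (g / 2 + 1) * x) * ((\<phi> x - low x) / gap x) = (\<phi> x - low x) / x"
      unfolding gx by simp
    also have "\<dots> = \<phi> x / x - (\<sigma> * x + (1 - a))" using x by (simp add: lx diff_divide_distrib)
    finally show "(\<sigma> * x + (1 - a)) + (e - \<sigma> * (g / 2 + 1) * x) * ((\<phi> x - low x) / gap x) = \<phi> x / x" by simp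
  qed
  ultimately have "((\<lambda>x. \<phi> x / x) \<longlongrightarrow> (\<sigma> * 0 + (1 - a)) + (e - \<sigma> * (g / 2 + 1) * 0) * zc) (at_right 0)"
    by (rule Lim_transform_eventually)
  then show ?thesis by (simp add: endpoint_slope_def)
qed

text \<open>The slope depends on the branch only through the ratio in which it divides the gap. The
  equation defining \<open>zc\<close> says that its limit coincides with the limit of the difference
  quotient, so the branch is continuously differentiable up to the endpoint.\<close>

lemma slope_lim: "(phi_slope \<longlongrightarrow> endpoint_slope) (at_right 0)"
proof -
  have "(rate \<longlongrightarrow> rate 0) (at_right 0)" unfolding rate_def by (intro tendsto_intros)
  then have "((\<lambda>x. rate x * (1 / ((\<phi> x - low x) / gap x) - 1)) \<longlongrightarrow> rate 0 * (1 / zc - 1)) (at_right 0)"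
    using zc by (intro tendsto_intros ratio_lim) auto
  then show ?thesis by (simp add: phi_slope_def[abs_def] endpoint_slope_def zc(3))
qed

lemma phi_slope_cont: "continuous_on {0<..<reach} phi_slope"
proof -
  have "continuous_on {0<..<reach} low" "continuous_on {0<..<reach} gap"
    by (rule has_real_derivative_imp_continuous_on[OF low_deriv] has_real_derivative_imp_continuous_on[OF gap_deriv])+
  then show ?thesis unfolding phi_slope_def rate_def
    using phi_minus_low_pos by (intro continuous_intros phi_cont) force+
qed

context
  fixes r :: real
  assumes r: "0 < r" "r \<le> reach"
begin

text \<open>The branch rescaled to the parameter interval; the affine continuation to nonpositive
  parameters supplies the two-sided derivative that the parametrization requires at 0.\<close>

definition height :: "real \<Rightarrow> real" where "height t = (if t > 0 then \<phi> (r * t) else endpoint_slope * r * t)"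
definition height' :: "real \<Rightarrow> real" where "height' t = (if t > 0 then r * phi_slope (r * t) else r * endpoint_slope)"

lemma scale_range:
  assumes "0 < t" "t < 1"
  shows "0 < r * t" "r * t < reach"
proof -
  show "0 < r * t" using r assms by simp
  have "r * t < r * 1" using r assms by (intro mult_strict_left_mono) auto
  then show "r * t < reach" using r by linarith
qed

lemma scale_lim: "filterlim (\<lambda>t. r * t) (at_right 0) (at_right 0)"
proof -
  have "((\<lambda>t. r * t) \<longlongrightarrow> r * 0) (at_right 0)" by (intro tendsto_intros)
  moreover have "eventually (\<lambda>t. r * t \<in> {0<..} \<and> r * t \<noteq> 0) (at_right 0)"
    unfolding eventually_at_right_field using r by (intro exI[of _ 1]) auto
  ultimately show ?thesis by (simp add: filterlim_at)
qed

lemma height_deriv: "t \<in> {0..<1} \<Longrightarrow> (height has_real_derivative height' t) (at t)"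
proof (cases "t = 0")
  case True
  have right: "((\<lambda>y. (height y - height 0) / (y - 0)) \<longlongrightarrow> height' 0) (at_right 0)"
  proof -
    have "((\<lambda>y. r * (\<phi> (r * y) / (r * y))) \<longlongrightarrow> r * endpoint_slope) (at_right 0)"
      by (intro tendsto_mult_left filterlim_compose[OF quotient_lim scale_lim])
    moreover have "eventually (\<lambda>y. r * (\<phi> (r * y) / (r * y)) = (height y - height 0) / (y - 0)) (at_right 0)"
      unfolding eventually_at_right_field using r by (intro exI[of _ 1]) (auto simp: height_def)
    ultimately have "((\<lambda>y. (height y - height 0) / (y - 0)) \<longlongrightarrow> r * endpoint_slope) (at_right 0)"
      by (rule Lim_transform_eventually)
    then show ?thesis by (simp add: height'_def)
  qed
  have left: "((\<lambda>y. (height y - height 0) / (y - 0)) \<longlongrightarrow> height' 0) (at_left 0)"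
  proof (rule Lim_transform_eventually[OF tendsto_const])
    show "eventually (\<lambda>y. height' 0 = (height y - height 0) / (y - 0)) (at_left 0)"
      unfolding eventually_at_left_field by (intro exI[of _ "-1"]) (auto simp: height_def height'_def)
  qed
  show ?thesis unfolding True has_field_derivative_iff using filterlim_split_at[OF left right] by simp
next
  case False
  assume "t \<in> {0..<1}"
  then have t: "0 < t" "t < 1" using False by auto
  have "((\<lambda>t. \<phi> (r * t)) has_real_derivative phi_slope (r * t) * (r * 1)) (at t)"
    by (rule DERIV_chain2[OF phi_slope_deriv[OF scale_range[OF t]] DERIV_cmult[OF DERIV_ident]])
  then have "((\<lambda>t. \<phi> (r * t)) has_real_derivative height' t) (at t)"
    using t by (simp add: height'_def mult.commute)
  then show ?thesis
    by (rule has_field_derivative_transform_within_open[of _ _ _ "{0<..}"]) (use t in \<open>auto simp: height_def\<close>)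
qed

lemma height'_cont: "continuous_on {0..<1} height'"
  unfolding continuous_on_eq_continuous_within
proof
  fix t :: real assume t: "t \<in> {0..<1}"
  show "continuous (at t within {0..<1}) height'"
  proof (cases "t = 0")
    case True
    have "((\<lambda>t. r * phi_slope (r * t)) \<longlongrightarrow> r * endpoint_slope) (at_right 0)"
      by (intro tendsto_mult_left filterlim_compose[OF slope_lim scale_lim])
    moreover have "eventually (\<lambda>t. r * phi_slope (r * t) = height' t) (at_right 0)"
      unfolding eventually_at_right_field by (intro exI[of _ 1]) (auto simp: height'_def)
    ultimately have "(height' \<longlongrightarrow> height' 0) (at_right 0)"
      using Lim_transform_eventually by (fastforce simp: height'_def)
    moreover have "at 0 within {0..<1} \<le> at_right (0::real)"
      unfolding at_within_def by (intro inf_mono order_refl) auto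
    ultimately show ?thesis unfolding True continuous_within using tendsto_mono by blast
  next
    case False
    have "continuous_on {0<..<1} (\<lambda>t. r * phi_slope (r * t))"
      by (intro continuous_on_mult_left continuous_on_compose2[OF phi_slope_cont])
        (use scale_range in \<open>auto intro!: continuous_intros\<close>)
    then have "continuous_on {0<..<1} height'"
      by (rule continuous_on_eq) (simp add: height'_def)
    then have "isCont height' t" using t False by (simp add: continuous_on_eq_continuous_at)
    then show ?thesis by (rule continuous_at_imp_continuous_at_within)
  qed
qed

text \<open>The slope of the branch is rational in the parameter and the height. Adjoining the
  reciprocal \<open>v\<close> of its denominator as a third generator yields a ring closed under
  differentiation, since v' is a multiple of v^2.\<close>

lemma height_smooth:
  fixes A B c d :: real
  shows "smooth_within {0<..<1} (\<lambda>t. (c + A * t, d + B * height t))"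
proof -
  define v where "v = (\<lambda>t. inverse (height t - low (r * t)))"
  define G where "G = {\<lambda>t. t, height, v}"
  define R where "R = ring_closure G"
  note R_const = ring_closure.const[of _ G, folded R_def]
  note R_add = ring_closure.add[of _ G, folded R_def]
  note R_mult = ring_closure.mult[of _ G, folded R_def]
  have R_base: "(\<lambda>t. t) \<in> R" "height \<in> R" "v \<in> R"
    unfolding R_def G_def by (auto intro: ring_closure.base)
  have R_cmult: "(\<lambda>t. k * f t) \<in> R" if "f \<in> R" for k f using R_mult[OF R_const that] by simp
  have R_minus: "(\<lambda>t. f t - h t) \<in> R" if "f \<in> R" "h \<in> R" for f h
    using R_add[OF that(1) R_cmult[OF that(2), of "-1"]] by simp
  have ne: "height t - low (r * t) > 0" if "t \<in> {0<..<1}" for t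
    using phi_minus_low_pos[OF scale_range[of t]] that by (simp add: height_def)
  define h1 where "h1 = (\<lambda>t. r * ((n / m * (1 + (\<sigma> * r) * t)) * (((e * r) * t - (\<sigma> * (g / 2 + 1) * r\<^sup>2) * (t * t)) * v t - 1)))"
  have h1R: "h1 \<in> R" unfolding h1_def by (intro R_cmult R_mult R_add R_minus R_const R_base)
  have h1: "(height has_real_derivative h1 t) (at t within {0<..<1})" if t: "t \<in> {0<..<1}" for t
  proof -
    have g1: "gap (r * t) = (e * r) * t - (\<sigma> * (g / 2 + 1) * r\<^sup>2) * (t * t)"
      by (simp add: gap_def power2_eq_square mult_ac)
    have g2: "rate (r * t) = n / m * (1 + (\<sigma> * r) * t)" by (simp add: rate_def mult.assoc)
    have g3: "\<phi> (r * t) = height t" using t by (simp add: height_def)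
    have "height' t = h1 t"
      unfolding height'_def phi_slope_def h1_def v_def g1[symmetric] g2[symmetric] g3 using t
      by (simp add: divide_inverse)
    then have "(height has_real_derivative h1 t) (at t)" using height_deriv[of t] t by simp
    then show ?thesis by (rule has_field_derivative_at_within)
  qed
  define v1 where "v1 = (\<lambda>t. (-1) * ((h1 t - r * ((2 * \<sigma> * r) * t + (1 - a))) * (v t * v t)))"
  have v1R: "v1 \<in> R" unfolding v1_def by (intro R_cmult R_mult R_add R_minus R_const R_base h1R)
  have v1: "(v has_real_derivative v1 t) (at t within {0<..<1})" if t: "t \<in> {0<..<1}" for t
  proof -
    have "((\<lambda>t. low (r * t)) has_real_derivative (2 * \<sigma> * (r * t) + (1 - a)) * (r * 1)) (at t within {0<..<1})"
      by (rule DERIV_chain2[OF low_deriv DERIV_cmult[OF DERIV_ident]])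
    from DERIV_inverse'[OF DERIV_diff[OF h1[OF t] this]] ne[OF t]
    have "(v has_real_derivative - (v t * (h1 t - (2 * \<sigma> * (r * t) + (1 - a)) * (r * 1)) * v t)) (at t within {0<..<1})"
      by (simp add: v_def)
    moreover have "- (v t * (h1 t - (2 * \<sigma> * (r * t) + (1 - a)) * (r * 1)) * v t) = v1 t"
      by (simp add: v1_def algebra_simps)
    ultimately show ?thesis by simp
  qed
  have gen: "\<exists>b'\<in>R. \<forall>t\<in>{0<..<1}. (b has_real_derivative b' t) (at t within {0<..<1})" if "b \<in> G" for b
  proof -
    have "b = (\<lambda>t. t) \<or> b = height \<or> b = v" using that by (simp add: G_def)
    then show ?thesis
    proof (elim disjE)
      assume "b = (\<lambda>t. t)"
      then show ?thesis by (intro bexI[OF _ R_const[of 1]]) auto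
    next
      assume "b = height"
      then show ?thesis using h1 by (intro bexI[OF _ h1R] ballI) simp
    next
      assume "b = v"
      then show ?thesis using v1 by (intro bexI[OF _ v1R] ballI) simp
    qed
  qed
  have cl: "\<exists>f'\<in>R. \<forall>t\<in>{0<..<1}. (f has_real_derivative f' t) (at t within {0<..<1})" if "f \<in> R" for f
    unfolding R_def by (rule ring_closure_deriv[OF gen[unfolded R_def] that[unfolded R_def]])
  show ?thesis
  proof (rule smooth_within_if_closed_class[where A="{\<lambda>t. (f t, h t) | f h. f \<in> R \<and> h \<in> R}"])
    fix q assume "q \<in> {\<lambda>t. (f t, h t) | f h. f \<in> R \<and> h \<in> R}"
    then obtain f h where q: "q = (\<lambda>t. (f t, h t))" "f \<in> R" "h \<in> R" by blast
    obtain f' h' where f': "f' \<in> R" "\<forall>t\<in>{0<..<1}. (f has_real_derivative f' t) (at t within {0<..<1})"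
      and h': "h' \<in> R" "\<forall>t\<in>{0<..<1}. (h has_real_derivative h' t) (at t within {0<..<1})"
      using cl[OF q(2)] cl[OF q(3)] by blast
    have "\<forall>t\<in>{0<..<1}. (q has_vector_derivative (f' t, h' t)) (at t within {0<..<1})"
      using f' h' unfolding q(1) by (auto intro: has_vector_derivative_Pair simp: has_real_derivative_iff_has_vector_derivative)
    then show "\<exists>q'\<in>{\<lambda>t. (f t, h t) | f h. f \<in> R \<and> h \<in> R}. \<forall>t\<in>{0<..<1}. (q has_vector_derivative q' t) (at t within {0<..<1})"
      by (rule bexI[where x="\<lambda>t. (f' t, h' t)"])
        (intro CollectI exI[of _ f'] exI[of _ h'] conjI refl f'(1) h'(1))
  next
    fix t :: real assume t: "t \<in> {0<..<1}"
    have "at t within {0<..<1} = at t" by (rule at_within_open[OF t]) simp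
    then show "at t within {0<..<1} \<noteq> bot" by simp
  next
    have m1: "(\<lambda>t. c + A * t) \<in> R" by (rule R_add[OF R_const R_cmult[OF R_base(1)]])
    have m2: "(\<lambda>t. d + B * height t) \<in> R" by (rule R_add[OF R_const R_cmult[OF R_base(2)]])
    show "(\<lambda>t. (c + A * t, d + B * height t)) \<in> {\<lambda>t. (f t, h t) | f h. f \<in> R \<and> h \<in> R}"
      by (rule CollectI, rule exI[of _ "\<lambda>t. c + A * t"], rule exI[of _ "\<lambda>t. d + B * height t"], rule conjI[OF refl conjI[OF m1 m2]])
  qed
qed

text \<open>The first component is affine with nonzero slope, which settles injectivity and
  regularity at once. The free constants undo the scaling of the physical variables on either
  side.\<close>

theorem parametrization:
  fixes A B c d :: real
  assumes "A \<noteq> 0"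
  defines "G \<equiv> \<lambda>t. (c + A * t, d + B * height t)"
  shows "parametrizes_from G (c, d) (G ` {0<..<1})"
    and "vector_derivative G (at 0) = (A, B * (r * endpoint_slope))"
proof -
  have der: "(G has_vector_derivative (A, B * height' t)) (at t)" if t: "t \<in> {0..<1}" for t
    unfolding G_def
  proof (rule has_vector_derivative_Pair)
    have "((\<lambda>t. c + A * t) has_real_derivative A) (at t)" by (auto intro!: derivative_eq_intros)
    then show "((\<lambda>t. c + A * t) has_vector_derivative A) (at t)"
      by (simp add: has_real_derivative_iff_has_vector_derivative)
    have "((\<lambda>t. d + B * height t) has_real_derivative B * height' t) (at t)"
      using height_deriv[OF t] by (auto intro!: derivative_eq_intros)
    then show "((\<lambda>t. d + B * height t) has_vector_derivative B * height' t) (at t)"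
      by (simp add: has_real_derivative_iff_has_vector_derivative)
  qed
  have vd: "vector_derivative G (at t) = (A, B * height' t)" if "t \<in> {0..<1}" for t
    using vector_derivative_at[OF der[OF that]] .
  show "vector_derivative G (at 0) = (A, B * (r * endpoint_slope))"
    using vd[of 0] by (simp add: height'_def)
  have "G 0 = (c, d)" by (simp add: G_def height_def)
  moreover have "inj_on G {0..<1}" using assms(1) by (auto simp: inj_on_def G_def)
  moreover have "smooth_within {0<..<1} G" unfolding G_def by (rule height_smooth)
  moreover have "G C1_differentiable_on {0..<1}"
    unfolding C1_differentiable_on_def
    by (intro exI[of _ "\<lambda>t. (A, B * height' t)"] conjI ballI der continuous_on_Pair continuous_on_const
        continuous_on_mult_left height'_cont)
  moreover have "\<forall>t\<in>{0..<1}. vector_derivative G (at t) \<noteq> 0" using vd assms(1) by (auto simp: zero_prod_def)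
  ultimately show "parametrizes_from G (c, d) (G ` {0<..<1})"
    unfolding parametrizes_from_def by simp
qed

end

text \<open>\<phi> is strictly increasing, so it crosses the zero-temperature level \<open>a\<close>
  at most once.\<close>

lemma dom_interval: "\<exists>r. 0 < r \<and> r \<le> reach \<and> dom = {0<..<r}"
proof (cases "\<exists>x. 0 < x \<and> x < reach \<and> \<sigma> = 1 \<and> a \<le> \<phi> x")
  case False
  then have "dom = {0<..<reach}" unfolding dom_def by force
  then show ?thesis using reach_pos by blast
next
  case True
  then obtain x2 where x2: "0 < x2" "x2 < reach" "a \<le> \<phi> x2" and s: "\<sigma> = 1" by blast
  have "eventually (\<lambda>x. \<phi> x < a \<and> 0 < x \<and> x < x2) (at_right 0)"
  proof (intro eventually_conj order_tendstoD(2)[OF phi_lim pos(3)])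
    show "eventually (\<lambda>x. 0 < x) (at_right (0::real))"
      unfolding eventually_at_right_field by (intro exI[of _ 1]) simp
    show "eventually (\<lambda>x. x < x2) (at_right 0)"
      unfolding eventually_at_right_field using x2 by (intro exI[of _ x2]) simp
  qed
  then obtain x1 where x1: "\<phi> x1 < a" "0 < x1" "x1 < x2"
    using eventually_happens[of _ "at_right (0::real)"] trivial_limit_at_right_real by blast
  have "continuous_on {x1..x2} \<phi>" by (rule continuous_on_subset[OF phi_cont]) (use x1 x2 in auto)
  then obtain r where r: "x1 \<le> r" "r \<le> x2" "\<phi> r = a" using IVT'[of \<phi> x1 a x2] x1 x2 by auto
  have "dom = {0<..<r}"
  proof (rule Set.set_eqI)
    fix x
    show "x \<in> dom \<longleftrightarrow> x \<in> {0<..<r}"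
    proof (cases "0 < x \<and> x < reach")
      case True
      have "\<phi> x < a \<longleftrightarrow> x < r"
        using phi_strict_mono[of x r] phi_strict_mono[of r x] r x1 x2 True by (cases x r rule: linorder_cases) auto
      then show ?thesis using True s unfolding dom_def by auto
    next
      case False
      then show ?thesis using r x2 unfolding dom_def by auto
    qed
  qed
  then show ?thesis using r x1 x2 by (intro exI[of _ r]) auto
qed

text \<open>If the second equilibrium \<open>xs\<close> comes no later than \<open>a\<close>, both
  nullclines meet there and squeeze the branch to height \<open>low xs\<close>. Otherwise the lower
  nullcline has already reached \<open>a\<close> at x = a, and the temperature is exhausted
  first.\<close>

lemma phi_image:
  assumes s: "\<sigma> = 1"
  shows "\<phi> ` dom = {0<..<min a (low (2 * e / (g + 2)))}"
proof -
  define xs where "xs = 2 * e / (g + 2)"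
  have xs: "xs > 0" using side s pos by (auto simp: xs_def)
  have reach: "reach = min a xs" unfolding reach_def xs_def using s by simp
  have low_ge: "a \<le> low x" if "x \<ge> a" for x
  proof -
    have "a * 1 \<le> x * (x + (1 - a))" using that pos by (intro mult_mono) auto
    then show ?thesis unfolding low_def using s by (simp add: power2_eq_square algebra_simps)
  qed
  have gap_xs: "gap xs = 0" 
  proof -
    have "(g / 2 + 1) * xs = e" unfolding xs_def using pos by (simp add: field_simps)
    moreover have "gap xs = xs * (e - (g / 2 + 1) * xs)"
      unfolding gap_def using s by (simp add: power2_eq_square algebra_simps)
    ultimately show ?thesis by simp
  qed
  have upper_mono: "low x + gap x < low y + gap y" if "0 < x" "x < y" "y \<le> reach" for x y
  proof -
    have eq: "low x + gap x = g * (a * x - x * x / 2)" for x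
      unfolding low_def gap_def using s by (simp add: e_def power2_eq_square algebra_simps)
    have "a * (y - x) - (y * y - x * x) / 2 = (y - x) * (a - (x + y) / 2)" by (simp add: field_simps)
    also have "\<dots> > 0" using that reach by (intro mult_pos_pos) auto
    finally have "a * x - x * x / 2 < a * y - y * y / 2" by (simp add: algebra_simps diff_divide_distrib)
    then show ?thesis unfolding eq using pos by simp
  qed
  show ?thesis unfolding xs_def[symmetric]
  proof (intro equalityI subsetI)
    fix y assume "y \<in> \<phi> ` dom"
    then obtain x where x: "0 < x" "x < reach" "\<phi> x < a" "y = \<phi> x" unfolding dom_def using s by auto
    have "\<phi> x < low xs"
    proof (cases "xs \<le> a")
      case True
      have "\<phi> x < low x + gap x" using phi_up[OF x(1,2)] by simp
      also have "\<dots> < low xs + gap xs" using x reach True by (intro upper_mono) auto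
      finally show ?thesis using gap_xs by simp
    next
      case False
      then show ?thesis using low_ge[of xs] x(3) by simp
    qed
    then show "y \<in> {0<..<min a (low xs)}" using x phi_pos[OF x(1,2)] by simp
  next
    fix y assume y: "y \<in> {0<..<min a (low xs)}"
    have "y < low reach"
    proof (cases "xs \<le> a")
      case True
      then show ?thesis using y reach by (simp add: min_absorb2)
    next
      case False
      then show ?thesis using y reach low_ge[of a] by (simp add: min_absorb1)
    qed
    moreover have "(low \<longlongrightarrow> low reach) (at_left reach)"
      using DERIV_continuous[OF low_deriv] by (simp add: continuous_within)
    ultimately have "eventually (\<lambda>x. y < low x) (at_left reach)" by (rule order_tendstoD(1)[rotated])
    moreover have "eventually (\<lambda>x. 0 < x \<and> x < reach) (at_left reach)"
      unfolding eventually_at_left_field using reach_pos by auto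
    ultimately have "eventually (\<lambda>x. y < low x \<and> 0 < x \<and> x < reach) (at_left reach)" by eventually_elim auto
    then obtain x2 where x2: "y < low x2" "0 < x2" "x2 < reach"
      using eventually_happens[of _ "at_left reach"] trivial_limit_at_left_real by blast
    have "y < \<phi> x2" using x2 phi_minus_low_pos[of x2] by simp
    have "eventually (\<lambda>x. \<phi> x < y \<and> 0 < x \<and> x < x2) (at_right 0)"
    proof (intro eventually_conj order_tendstoD(2)[OF phi_lim])
      show "eventually (\<lambda>x. 0 < x) (at_right (0::real))"
        unfolding eventually_at_right_field by (intro exI[of _ 1]) simp
      show "eventually (\<lambda>x. x < x2) (at_right 0)"
        unfolding eventually_at_right_field using x2 by (intro exI[of _ x2]) simp
      show "0 < y" using y by simp
    qed
    then obtain x1 where x1: "\<phi> x1 < y" "0 < x1" "x1 < x2"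
      using eventually_happens[of _ "at_right (0::real)"] trivial_limit_at_right_real by blast
    have "continuous_on {x1..x2} \<phi>" by (rule continuous_on_subset[OF phi_cont]) (use x1 x2 in auto)
    then obtain x where "x1 \<le> x" "x \<le> x2" "\<phi> x = y"
      using IVT'[of \<phi> x1 y x2] x1 \<open>y < \<phi> x2\<close> by auto
    then have "x \<in> dom" unfolding dom_def using x1 x2 y by auto
    then have "\<phi> x \<in> \<phi> ` dom" by (rule imageI)
    then show "y \<in> \<phi> ` dom" unfolding \<open>\<phi> x = y\<close> .
  qed
qed

end

subsection \<open>Reduction to the planar system\<close>

lemma d_xi_eq: "(f has_real_derivative D) (at x within {0..}) \<Longrightarrow> x \<ge> 0 \<Longrightarrow> d_xi f x = D"
  using vector_derivative_within[OF at_within_halfline_neq_bot]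
  by (simp add: has_real_derivative_iff_has_vector_derivative)

lemma d_xi_works: "(f has_real_derivative D) (at x within {0..}) \<Longrightarrow> x \<ge> 0 \<Longrightarrow>
    (f has_real_derivative d_xi f x) (at x within {0..})"
  by (simp add: d_xi_eq)

lemma smooth_within_deriv:
  fixes f :: "real \<Rightarrow> real"
  assumes "smooth_within {0..} f" "x \<ge> 0"
  shows "(f has_real_derivative d_xi f x) (at x within {0..})"
proof -
  have "nderiv_within {0..} 0 f differentiable (at x within {0..})"
    using assms unfolding smooth_within_def by blast
  then show ?thesis
    by (simp add: vector_derivative_works has_real_derivative_iff_has_vector_derivative)
qed

lemma smooth_within_deriv2:
  fixes f :: "real \<Rightarrow> real"
  assumes "smooth_within {0..} f" "x \<ge> 0"
  shows "(d_xi f has_real_derivative d_xi (d_xi f) x) (at x within {0..})"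
proof -
  have "nderiv_within {0..} 1 f differentiable (at x within {0..})"
    using assms unfolding smooth_within_def by (metis atLeast_iff)
  then have "d_xi f differentiable (at x within {0..})" by simp
  then show ?thesis
    by (simp add: vector_derivative_works has_real_derivative_iff_has_vector_derivative)
qed

text \<open>The differential equations are imposed only for positive arguments, so the one-sided
  derivative at 0 is left unspecified and only continuity is used there.\<close>

lemma const_on_halfline:
  fixes f :: "real \<Rightarrow> real"
  assumes d: "\<And>t. t \<ge> 0 \<Longrightarrow> (f has_real_derivative f' t) (at t within {0..})"
    and z: "\<And>t. t > 0 \<Longrightarrow> f' t = 0" and "t \<ge> 0"
  shows "f t = f 0"
proof (cases "t = 0")
  case False
  then have t: "0 < t" using assms(3) by simp
  show ?thesis
  proof (rule DERIV_isconst_end[OF t])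
    show "continuous_on {0..t} f"
      by (rule continuous_on_subset[OF has_real_derivative_imp_continuous_on[where S="{0..}"]]) (use d in auto)
    fix x assume x: "0 < x" "x < t"
    show "(f has_real_derivative 0) (at x)"
      using has_real_derivative_interior[OF d[of x], of 0 "x + 1"] z[of x] x by auto
  qed
qed simp

locale gas =
  fixes R \<gamma> \<mu> \<kappa> vp up \<theta>p :: real
  assumes gas_pos: "R > 0" "\<gamma> > 1" "\<mu> > 0" "\<kappa> > 0" "vp > 0" "up > 0" "\<theta>p > 0"
begin

text \<open>These constants arise from measuring velocity in units of \<open>up\<close> and
  temperature in units of up^2/R. Then \<open>\<gamma> * aa\<close> is the reciprocal of the squared
  Mach number, and \<open>e\<close> becomes 1/M^2 - 1.\<close>

definition "mm = up / \<mu>"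
definition "nn = R * up / (\<kappa> * (\<gamma> - 1))"
definition "aa = R * \<theta>p / up\<^sup>2"
definition "gg = \<gamma> - 1"

sublocale planar_system mm nn aa gg
  by unfold_locales (use gas_pos in \<open>auto simp: mm_def nn_def aa_def gg_def\<close>)

abbreviation "BL vm um \<theta>m \<equiv> boundary_layer_solution R \<gamma> \<mu> \<kappa> (vm, um, \<theta>m) (vp, up, \<theta>p)"

definition XX :: "(real \<Rightarrow> real) \<Rightarrow> real \<Rightarrow> real" where "XX U t = U t / up - 1"
definition YY :: "(real \<Rightarrow> real) \<Rightarrow> real \<Rightarrow> real" where "YY \<Theta> t = R / up\<^sup>2 * \<Theta> t - aa"

text \<open>The left side has the form of the momentum integral after substitution of the scaled
  variables, so the identity serves both directions of the reduction.\<close>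

lemma flux_momentum:
  assumes "x > -1"
  shows "vp * (1 + x) * (up / vp * (up * (1 + x)) + R * (up\<^sup>2 / R * (aa + y)) / (vp * (1 + x)) - (up / vp * up + R * \<theta>p / vp)) / \<mu>
    = up * (mm * (y - nullF x))"
proof -
  have th: "R * \<theta>p = up\<^sup>2 * aa" using gas_pos by (simp add: aa_def)
  have x: "1 + x \<noteq> 0" using assms by simp
  have 1: "R * (up\<^sup>2 / R * (aa + y)) = up\<^sup>2 * (aa + y)" using gas_pos by simp
  have "vp * z * (up / vp * (up * z) + B / (vp * z) - (up / vp * up + C / vp)) = up\<^sup>2 * z\<^sup>2 + B - z * (up\<^sup>2 + C)"
    if "z \<noteq> 0" for z B C
    using that gas_pos by (simp add: field_simps power2_eq_square)
  from this[OF x] have "vp * (1 + x) * (up / vp * (up * (1 + x)) + up\<^sup>2 * (aa + y) / (vp * (1 + x)) - (up / vp * up + up\<^sup>2 * aa / vp))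
      = up\<^sup>2 * (1 + x)\<^sup>2 + up\<^sup>2 * (aa + y) - (1 + x) * (up\<^sup>2 + up\<^sup>2 * aa)" .
  also have "\<dots> = up\<^sup>2 * (y - nullF x)"
    by (simp add: nullF_def power2_eq_square algebra_simps)
  finally show ?thesis unfolding th 1 by (simp add: mm_def power2_eq_square)
qed

lemma flux_energy:
  assumes "x > -1"
  shows "(vp * (1 + x) * (up / vp * (R * (up\<^sup>2 / R * (aa + y)) / (\<gamma> - 1) + (up * (1 + x))\<^sup>2 / 2)
      + R * (up\<^sup>2 / R * (aa + y)) / (vp * (1 + x)) * (up * (1 + x))
      - (up / vp * (R * \<theta>p / (\<gamma> - 1) + up\<^sup>2 / 2) + R * \<theta>p / vp * up))
      - \<mu> * (up * (1 + x)) * (up * (mm * (y - nullF x)))) / \<kappa>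
    = up\<^sup>2 / R * (nn * (1 + x) * (y - nullG x))"
proof -
  have th: "R * \<theta>p = up\<^sup>2 * aa" using gas_pos by (simp add: aa_def)
  have x: "1 + x \<noteq> 0" using assms by simp
  have g: "\<gamma> - 1 \<noteq> 0" using gas_pos by simp
  define G where "G = \<gamma> - 1"
  have 1: "R * (up\<^sup>2 / R * (aa + y)) = up\<^sup>2 * (aa + y)" using gas_pos by simp
  have "vp * (1 + x) * (up / vp * (up\<^sup>2 * (aa + y) / G + (up * (1 + x))\<^sup>2 / 2)
      + up\<^sup>2 * (aa + y) / (vp * (1 + x)) * (up * (1 + x))
      - (up / vp * (up\<^sup>2 * aa / G + up\<^sup>2 / 2) + up\<^sup>2 * aa / vp * up))
      - \<mu> * (up * (1 + x)) * (up * (mm * (y - nullF x)))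
    = up ^ 3 * (1 + x) * (y / G - x\<^sup>2 / 2 + aa * x)"
  proof -
    have "vp * (1 + x) * (up / vp * (up\<^sup>2 * (aa + y) / G + (up * (1 + x))\<^sup>2 / 2)
        + up\<^sup>2 * (aa + y) / (vp * (1 + x)) * (up * (1 + x))
        - (up / vp * (up\<^sup>2 * aa / G + up\<^sup>2 / 2) + up\<^sup>2 * aa / vp * up))
      = up ^ 3 * (1 + x) * ((aa + y) / G + (1 + x)\<^sup>2 / 2 + (aa + y) - (aa / G + 1 / 2 + aa))"
    proof -
      have t2: "up\<^sup>2 * (aa + y) / (vp * (1 + x)) * (up * (1 + x)) = up ^ 3 * (aa + y) / vp"
        using x by (simp add: power2_eq_square power3_eq_cube)
      have abc: "vp * (1 + x) * (up / vp * A + up ^ 3 * B / vp - (up / vp * C + up\<^sup>2 * aa / vp * up))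
          = (1 + x) * (up * A + up ^ 3 * B - (up * C + up ^ 3 * aa))" for A B C
        using gas_pos by (simp add: field_simps power2_eq_square power3_eq_cube)
      show ?thesis unfolding t2 abc
        by (simp add: power2_eq_square power3_eq_cube algebra_simps add_divide_distrib)
    qed
    moreover have "\<mu> * (up * (1 + x)) * (up * (mm * (y - nullF x))) = up ^ 3 * (1 + x) * (y - nullF x)"
      using gas_pos by (simp add: mm_def power3_eq_cube)
    \<comment> \<open>Subtracting the viscous work removes \<open>nullF\<close>; what remains is the
      residual of the second nullcline divided by \<gamma> - 1.\<close>
    moreover have "((aa + y) / G + (1 + x)\<^sup>2 / 2 + (aa + y) - (aa / G + 1 / 2 + aa)) - (y - nullF x) = y / G - x\<^sup>2 / 2 + aa * x"
      by (simp add: nullF_def power2_eq_square add_divide_distrib algebra_simps)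
    ultimately show ?thesis by (simp only: right_diff_distrib[symmetric])
  qed
  moreover have "up ^ 3 * (1 + x) * (y / G - x\<^sup>2 / 2 + aa * x) / \<kappa> = up\<^sup>2 / R * (nn * (1 + x) * (y - nullG x))"
  proof -
    have "y / G - x\<^sup>2 / 2 + aa * x = (y - nullG x) / G"
      unfolding G_def nullG_def unfolding gg_def using g by (simp add: field_simps)
    moreover have "up ^ 3 * (1 + x) * (Z / G) / \<kappa> = up\<^sup>2 / R * (nn * (1 + x) * Z)" for Z
      using gas_pos g by (simp add: nn_def G_def power2_eq_square power3_eq_cube field_simps)
    ultimately show ?thesis by simp
  qed
  ultimately show ?thesis unfolding 1 th G_def[symmetric] by simp
qed

end

text \<open>The first integrals of the three conservation laws; their values are read off at infinity,
  where the derivatives of convergent profiles must vanish.\<close>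

lemma BL_first_integrals:
  assumes bl: "boundary_layer_solution R \<gamma> \<mu> \<kappa> (vm, um, \<theta>m) (vp, up, \<theta>p) V U \<Theta>"
    and pos: "\<mu> > 0" "\<kappa> > 0" "vm > 0" "um > 0" "vp > 0"
  shows "up > 0" "um / vm = up / vp" "\<And>t. t \<ge> 0 \<Longrightarrow> U t = up / vp * V t"
    "\<And>t. t \<ge> 0 \<Longrightarrow> (U has_real_derivative
        V t * (up / vp * U t + R * \<Theta> t / V t - (up / vp * up + R * \<theta>p / vp)) / \<mu>) (at t within {0..})"
    "\<And>t. t \<ge> 0 \<Longrightarrow> (\<Theta> has_real_derivative
        (V t * (up / vp * (R * \<Theta> t / (\<gamma> - 1) + (U t)\<^sup>2 / 2) + R * \<Theta> t / V t * U t
          - (up / vp * (R * \<theta>p / (\<gamma> - 1) + up\<^sup>2 / 2) + R * \<theta>p / vp * up)) - \<mu> * U t * d_xi U t) / \<kappa>) (at t within {0..})"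
proof -
  define s where "s = um / vm"
  have s: "s > 0" using pos by (simp add: s_def)
  define P where "P = (\<lambda>t. R * \<Theta> t / V t)"
  have smooth: "smooth_within {0..} V" "smooth_within {0..} U" "smooth_within {0..} \<Theta>"
    and Vpos: "\<And>t. t \<ge> 0 \<Longrightarrow> V t > 0"
    and mass: "\<And>t. t > 0 \<Longrightarrow> s * d_xi V t - d_xi U t = 0"
    and momentum: "\<And>t. t > 0 \<Longrightarrow> s * d_xi U t + d_xi P t = \<mu> * d_xi (\<lambda>x. d_xi U x / V x) t"
    and energy: "\<And>t. t > 0 \<Longrightarrow> s * d_xi (\<lambda>x. R * \<Theta> x / (\<gamma> - 1) + (U x)\<^sup>2 / 2) t + d_xi (\<lambda>x. P x * U x) t
        = \<kappa> * d_xi (\<lambda>x. d_xi \<Theta> x / V x) t + \<mu> * d_xi (\<lambda>x. U x * d_xi U x / V x) t"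
    and init: "V 0 = vm" "U 0 = um"
    and lim: "((\<lambda>\<xi>. (V \<xi>, U \<xi>, \<Theta> \<xi>)) \<longlongrightarrow> (vp, up, \<theta>p)) at_top"
    using bl unfolding boundary_layer_solution_def Let_def s_def P_def by auto
  have limV: "(V \<longlongrightarrow> vp) at_top" and limU: "(U \<longlongrightarrow> up) at_top" and lim\<Theta>: "(\<Theta> \<longlongrightarrow> \<theta>p) at_top"
    using tendsto_fst[OF lim] tendsto_fst[OF tendsto_snd[OF lim]] tendsto_snd[OF tendsto_snd[OF lim]] by simp_all
  note dV = smooth_within_deriv[OF smooth(1)] and dU = smooth_within_deriv[OF smooth(2)] and d\<Theta> = smooth_within_deriv[OF smooth(3)]
    and dU2 = smooth_within_deriv2[OF smooth(2)] and d\<Theta>2 = smooth_within_deriv2[OF smooth(3)]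
  \<comment> \<open>The constant of integration is 0 because \<open>s\<close> is the quotient of the
    left velocity and volume; in the limit the same quotient belongs to the right state.\<close>
  have UV: "U t = s * V t" if "t \<ge> 0" for t
  proof -
    have "s * V t - U t = s * V 0 - U 0"
      by (rule const_on_halfline[OF DERIV_diff[OF DERIV_cmult[OF dV] dU] mass that])
    then show ?thesis using init pos by (simp add: s_def)
  qed
  have "((\<lambda>t. s * V t) \<longlongrightarrow> s * vp) at_top" by (intro tendsto_mult_left limV)
  moreover have "\<forall>\<^sub>F t in at_top. s * V t = U t"
    using eventually_ge_at_top[of 0] by eventually_elim (simp add: UV)
  ultimately have "(U \<longlongrightarrow> s * vp) at_top" by (rule Lim_transform_eventually)
  then have up_eq: "up = s * vp"
    using tendsto_unique[OF trivial_limit_at_top_linorder limU] by blast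
  have s_eq: "s = up / vp" using up_eq pos by simp
  show "up > 0" using up_eq s pos by simp
  show "um / vm = up / vp" using s_eq by (simp add: s_def)
  show "U t = up / vp * V t" if "t \<ge> 0" for t using UV[OF that] s_eq by simp
  have Vne: "V t \<noteq> 0" if "t \<ge> 0" for t using Vpos[OF that] by simp
  have dP: "(P has_real_derivative d_xi P t) (at t within {0..})" if "t \<ge> 0" for t
    unfolding P_def by (rule d_xi_works[OF DERIV_divide[OF DERIV_cmult[OF d\<Theta>[OF that]] dV[OF that] Vne[OF that]] that])
  have dUV: "((\<lambda>x. d_xi U x / V x) has_real_derivative d_xi (\<lambda>x. d_xi U x / V x) t) (at t within {0..})" if "t \<ge> 0" for t
    by (rule d_xi_works[OF DERIV_divide[OF dU2[OF that] dV[OF that] Vne[OF that]] that])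
  have d\<Theta>V: "((\<lambda>x. d_xi \<Theta> x / V x) has_real_derivative d_xi (\<lambda>x. d_xi \<Theta> x / V x) t) (at t within {0..})" if "t \<ge> 0" for t
    by (rule d_xi_works[OF DERIV_divide[OF d\<Theta>2[OF that] dV[OF that] Vne[OF that]] that])
  have dUUV: "((\<lambda>x. U x * d_xi U x / V x) has_real_derivative d_xi (\<lambda>x. U x * d_xi U x / V x) t) (at t within {0..})" if "t \<ge> 0" for t
    by (rule d_xi_works[OF DERIV_divide[OF DERIV_mult[OF dU[OF that] dU2[OF that]] dV[OF that] Vne[OF that]] that])
  have dE: "((\<lambda>x. R * \<Theta> x / (\<gamma> - 1) + (U x)\<^sup>2 / 2) has_real_derivative d_xi (\<lambda>x. R * \<Theta> x / (\<gamma> - 1) + (U x)\<^sup>2 / 2) t) (at t within {0..})" if "t \<ge> 0" for t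
    by (rule d_xi_works[OF DERIV_add[OF DERIV_cdivide[OF DERIV_cmult[OF d\<Theta>[OF that]]] DERIV_cdivide[OF DERIV_power[OF dU[OF that]]]] that])
  have dPU: "((\<lambda>x. P x * U x) has_real_derivative d_xi (\<lambda>x. P x * U x) t) (at t within {0..})" if "t \<ge> 0" for t
    by (rule d_xi_works[OF DERIV_mult[OF dP[OF that] dU[OF that]] that])
  have limP: "(P \<longlongrightarrow> R * \<theta>p / vp) at_top"
    unfolding P_def using pos by (intro tendsto_intros lim\<Theta> limV) auto
  define E1 where "E1 = s * U 0 + P 0 - \<mu> * (d_xi U 0 / V 0)"
  have M: "s * U t + P t - \<mu> * (d_xi U t / V t) = E1" if "t \<ge> 0" for t
    unfolding E1_def
  proof (rule const_on_halfline[OF _ _ that, where f="\<lambda>t. s * U t + P t - \<mu> * (d_xi U t / V t)"])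
    show "((\<lambda>t. s * U t + P t - \<mu> * (d_xi U t / V t)) has_real_derivative
        s * d_xi U t + d_xi P t - \<mu> * d_xi (\<lambda>x. d_xi U x / V x) t) (at t within {0..})" if "t \<ge> 0" for t
      by (intro DERIV_diff DERIV_add DERIV_cmult dU dP dUV that)
    show "s * d_xi U t + d_xi P t - \<mu> * d_xi (\<lambda>x. d_xi U x / V x) t = 0" if "t > 0" for t
      using momentum[OF that] by simp
  qed
  have U': "d_xi U t = V t * (s * U t + P t - E1) / \<mu>" if "t \<ge> 0" for t
    using M[OF that] Vpos[OF that] pos by (simp add: field_simps)
  have "((\<lambda>t. V t * (s * U t + P t - E1) / \<mu>) \<longlongrightarrow> vp * (s * up + R * \<theta>p / vp - E1) / \<mu>) at_top"
    using pos by (intro tendsto_intros limU limV limP) auto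
  moreover have "\<forall>\<^sub>F t in at_top. V t * (s * U t + P t - E1) / \<mu> = d_xi U t"
    using eventually_ge_at_top[of 0] by eventually_elim (simp add: U')
  ultimately have limU'1: "(d_xi U \<longlongrightarrow> vp * (s * up + R * \<theta>p / vp - E1) / \<mu>) at_top"
    by (rule Lim_transform_eventually)
  have "vp * (s * up + R * \<theta>p / vp - E1) / \<mu> = 0"
    by (rule derivative_limit_zero[OF dU limU limU'1])
  then have E1: "E1 = s * up + R * \<theta>p / vp" and limU': "(d_xi U \<longlongrightarrow> 0) at_top"
    using pos limU'1 by auto
  show "(U has_real_derivative
      V t * (up / vp * U t + R * \<Theta> t / V t - (up / vp * up + R * \<theta>p / vp)) / \<mu>) (at t within {0..})" if "t \<ge> 0" for t
    using dU[OF that] unfolding U'[OF that] E1 s_eq P_def .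
  define K where "K = (\<lambda>t. s * (R * \<Theta> t / (\<gamma> - 1) + (U t)\<^sup>2 / 2) + P t * U t)"
  define E2 where "E2 = K 0 - \<kappa> * (d_xi \<Theta> 0 / V 0) - \<mu> * (U 0 * d_xi U 0 / V 0)"
  have N: "K t - \<kappa> * (d_xi \<Theta> t / V t) - \<mu> * (U t * d_xi U t / V t) = E2" if "t \<ge> 0" for t
    unfolding E2_def
  proof (rule const_on_halfline[OF _ _ that, where f="\<lambda>t. K t - \<kappa> * (d_xi \<Theta> t / V t) - \<mu> * (U t * d_xi U t / V t)"])
    show "((\<lambda>t. K t - \<kappa> * (d_xi \<Theta> t / V t) - \<mu> * (U t * d_xi U t / V t)) has_real_derivative
        s * d_xi (\<lambda>x. R * \<Theta> x / (\<gamma> - 1) + (U x)\<^sup>2 / 2) t + d_xi (\<lambda>x. P x * U x) t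
        - \<kappa> * d_xi (\<lambda>x. d_xi \<Theta> x / V x) t - \<mu> * d_xi (\<lambda>x. U x * d_xi U x / V x) t) (at t within {0..})" if "t \<ge> 0" for t
      unfolding K_def by (intro DERIV_diff DERIV_add DERIV_cmult dE dPU d\<Theta>V dUUV that)
    show "s * d_xi (\<lambda>x. R * \<Theta> x / (\<gamma> - 1) + (U x)\<^sup>2 / 2) t + d_xi (\<lambda>x. P x * U x) t
        - \<kappa> * d_xi (\<lambda>x. d_xi \<Theta> x / V x) t - \<mu> * d_xi (\<lambda>x. U x * d_xi U x / V x) t = 0" if "t > 0" for t
      using energy[OF that] by linarith
  qed
  have \<Theta>': "d_xi \<Theta> t = (V t * (K t - E2) - \<mu> * U t * d_xi U t) / \<kappa>" if "t \<ge> 0" for t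
  proof -
    have "K t - E2 = (\<kappa> * d_xi \<Theta> t + \<mu> * U t * d_xi U t) / V t"
      using N[OF that] by (simp add: add_divide_distrib)
    then have "V t * (K t - E2) = \<kappa> * d_xi \<Theta> t + \<mu> * U t * d_xi U t" using Vne[OF that] by simp
    then show ?thesis using pos by simp
  qed
  have limK: "(K \<longlongrightarrow> s * (R * \<theta>p / (\<gamma> - 1) + up\<^sup>2 / 2) + R * \<theta>p / vp * up) at_top"
    unfolding K_def divide_inverse[of _ "\<gamma> - 1"] by (intro tendsto_intros limU lim\<Theta> limP) auto
  have "((\<lambda>t. (V t * (K t - E2) - \<mu> * U t * d_xi U t) / \<kappa>) \<longlongrightarrow>
      (vp * (s * (R * \<theta>p / (\<gamma> - 1) + up\<^sup>2 / 2) + R * \<theta>p / vp * up - E2) - \<mu> * up * 0) / \<kappa>) at_top"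
    using pos by (intro tendsto_intros limU limV limK limU') auto
  moreover have "\<forall>\<^sub>F t in at_top. (V t * (K t - E2) - \<mu> * U t * d_xi U t) / \<kappa> = d_xi \<Theta> t"
    using eventually_ge_at_top[of 0] by eventually_elim (simp add: \<Theta>')
  ultimately have lim\<Theta>': "(d_xi \<Theta> \<longlongrightarrow> (vp * (s * (R * \<theta>p / (\<gamma> - 1) + up\<^sup>2 / 2) + R * \<theta>p / vp * up - E2) - \<mu> * up * 0) / \<kappa>) at_top"
    by (rule Lim_transform_eventually)
  have "(vp * (s * (R * \<theta>p / (\<gamma> - 1) + up\<^sup>2 / 2) + R * \<theta>p / vp * up - E2) - \<mu> * up * 0) / \<kappa> = 0"
    by (rule derivative_limit_zero[OF d\<Theta> lim\<Theta> lim\<Theta>'])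
  then have E2: "E2 = s * (R * \<theta>p / (\<gamma> - 1) + up\<^sup>2 / 2) + R * \<theta>p / vp * up" using pos by simp
  show "(\<Theta> has_real_derivative
        (V t * (up / vp * (R * \<Theta> t / (\<gamma> - 1) + (U t)\<^sup>2 / 2) + R * \<Theta> t / V t * U t
          - (up / vp * (R * \<theta>p / (\<gamma> - 1) + up\<^sup>2 / 2) + R * \<theta>p / vp * up)) - \<mu> * U t * d_xi U t) / \<kappa>) (at t within {0..})"
    if "t \<ge> 0" for t
    using d\<Theta>[OF that] unfolding \<Theta>'[OF that] E2 K_def s_eq P_def .
qed

context gas
begin

theorem BL_imp_orbit:
  assumes bl: "BL vm um \<theta>m V U \<Theta>" and left: "vm > 0" "um > 0"
  shows "um / vm = up / vp" "orbit (XX U) (YY \<Theta>)" "\<not> (\<forall>t\<ge>0. XX U t = 0 \<and> YY \<Theta> t = 0)"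
    "\<And>t. t \<ge> 0 \<Longrightarrow> V t = vp * (1 + XX U t)" "\<And>t. U t = up * (1 + XX U t)" "\<And>t. \<Theta> t = up\<^sup>2 / R * (aa + YY \<Theta> t)"
proof -
  note I = BL_first_integrals[OF bl gas_pos(3,4) left gas_pos(5)]
  show "um / vm = up / vp" by (rule I(2))
  have U: "U t = up * (1 + XX U t)" for t using gas_pos by (simp add: XX_def field_simps)
  have T: "\<Theta> t = up\<^sup>2 / R * (aa + YY \<Theta> t)" for t using gas_pos by (simp add: YY_def)
  have V: "V t = vp * (1 + XX U t)" if "t \<ge> 0" for t using I(3)[OF that] gas_pos by (simp add: XX_def)
  show "\<And>t. t \<ge> 0 \<Longrightarrow> V t = vp * (1 + XX U t)" "\<And>t. U t = up * (1 + XX U t)" "\<And>t. \<Theta> t = up\<^sup>2 / R * (aa + YY \<Theta> t)"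
    by (fact V U T)+
  have Upos: "U t > 0" and Tpos: "\<Theta> t > 0" if "t \<ge> 0" for t
    using bl that by (auto simp: boundary_layer_solution_def Let_def)
  have X: "XX U t > -1" if "t \<ge> 0" for t using Upos[OF that] gas_pos by (simp add: XX_def)
  have Y: "YY \<Theta> t > - aa" if "t \<ge> 0" for t using Tpos[OF that] gas_pos by (simp add: YY_def)
  have lim: "((\<lambda>\<xi>. (V \<xi>, U \<xi>, \<Theta> \<xi>)) \<longlongrightarrow> (vp, up, \<theta>p)) at_top"
    using bl by (simp add: boundary_layer_solution_def Let_def)
  have limU: "(U \<longlongrightarrow> up) at_top" and lim\<Theta>: "(\<Theta> \<longlongrightarrow> \<theta>p) at_top"
    using tendsto_fst[OF tendsto_snd[OF lim]] tendsto_snd[OF tendsto_snd[OF lim]] by simp_all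
  have dU: "(U has_real_derivative up * (mm * (YY \<Theta> t - nullF (XX U t)))) (at t within {0..})" if t: "t \<ge> 0" for t
    using I(4)[OF t] flux_momentum[OF X[OF t], of "YY \<Theta> t"] unfolding V[OF t] U[symmetric] T[symmetric] by simp
  have d\<Theta>: "(\<Theta> has_real_derivative up\<^sup>2 / R * (nn * (1 + XX U t) * (YY \<Theta> t - nullG (XX U t)))) (at t within {0..})" if t: "t \<ge> 0" for t
    using I(5)[OF t] flux_energy[OF X[OF t], of "YY \<Theta> t"] unfolding V[OF t] U[symmetric] T[symmetric] d_xi_eq[OF dU[OF t] t] by simp
  show "orbit (XX U) (YY \<Theta>)"
    unfolding orbit_def
  proof (intro conjI allI impI X Y)
    fix t :: real assume t: "t \<ge> 0"
    show "(XX U has_real_derivative mm * (YY \<Theta> t - nullF (XX U t))) (at t within {0..})"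
      using DERIV_diff[OF DERIV_cdivide[OF dU[OF t], of up] DERIV_const[of 1]] gas_pos by (simp add: XX_def[abs_def])
    show "(YY \<Theta> has_real_derivative nn * (1 + XX U t) * (YY \<Theta> t - nullG (XX U t))) (at t within {0..})"
      using DERIV_diff[OF DERIV_cmult[OF d\<Theta>[OF t], of "R / up\<^sup>2"] DERIV_const[of aa]] gas_pos by (simp add: YY_def[abs_def] mult.assoc)
  next
    have "((\<lambda>t. U t / up - 1) \<longlongrightarrow> up / up - 1) at_top" using gas_pos by (intro tendsto_intros limU) auto
    then show "(XX U \<longlongrightarrow> 0) at_top" using gas_pos by (simp add: XX_def[abs_def])
    have "((\<lambda>t. R / up\<^sup>2 * \<Theta> t - aa) \<longlongrightarrow> R / up\<^sup>2 * \<theta>p - aa) at_top" by (intro tendsto_intros lim\<Theta>)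
    then show "(YY \<Theta> \<longlongrightarrow> 0) at_top" by (simp add: YY_def[abs_def] aa_def)
  qed
  show "\<not> (\<forall>t\<ge>0. XX U t = 0 \<and> YY \<Theta> t = 0)"
  proof
    assume z: "\<forall>t\<ge>0. XX U t = 0 \<and> YY \<Theta> t = 0"
    have "(\<lambda>\<xi>. (V \<xi>, U \<xi>, \<Theta> \<xi>)) constant_on {0..}"
      unfolding constant_on_def using z V U T by (intro exI[of _ "(vp, up, up\<^sup>2 / R * aa)"]) (metis atLeast_iff add.right_neutral mult.right_neutral)
    then show False using bl by (simp add: boundary_layer_solution_def Let_def)
  qed
qed

text \<open>The planar system says pointwise that the viscous fluxes equal the inviscid ones minus
  their values at infinity (\<open>m1\<close>, \<open>m2\<close>); differentiating these identities
  gives the equations. The profile is nonconstant because the velocity starts away from its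
  limit.\<close>

theorem orbit_imp_BL:
  assumes orb: "orbit X Y" and nontrivial: "X 0 \<noteq> 0"
    and smooth: "smooth_within {0..} (\<lambda>t. vp * (1 + X t))" "smooth_within {0..} (\<lambda>t. up * (1 + X t))"
      "smooth_within {0..} (\<lambda>t. up\<^sup>2 / R * (aa + Y t))"
    and left: "vm = vp * (1 + X 0)" "um = up * (1 + X 0)" "\<theta>m = up\<^sup>2 / R * (aa + Y 0)"
  shows "BL vm um \<theta>m (\<lambda>t. vp * (1 + X t)) (\<lambda>t. up * (1 + X t)) (\<lambda>t. up\<^sup>2 / R * (aa + Y t))"
proof -
  define V U \<Theta> where "V = (\<lambda>t. vp * (1 + X t))" and "U = (\<lambda>t. up * (1 + X t))" and "\<Theta> = (\<lambda>t. up\<^sup>2 / R * (aa + Y t))"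
  define s where "s = up / vp"
  define P where "P = (\<lambda>t. R * \<Theta> t / V t)"
  define X' where "X' = (\<lambda>t. mm * (Y t - nullF (X t)))"
  define Y' where "Y' = (\<lambda>t. nn * (1 + X t) * (Y t - nullG (X t)))"
  have range: "X t > -1" "Y t > - aa" if "t \<ge> 0" for t using orb that by (auto simp: orbit_def)
  have dX: "(X has_real_derivative X' t) (at t within {0..})" and dY: "(Y has_real_derivative Y' t) (at t within {0..})"
    if "t \<ge> 0" for t using orb that by (auto simp: orbit_def X'_def Y'_def)
  have dV: "(V has_real_derivative vp * X' t) (at t within {0..})"
    and dU: "(U has_real_derivative up * X' t) (at t within {0..})"
    and d\<Theta>: "(\<Theta> has_real_derivative up\<^sup>2 / R * Y' t) (at t within {0..})" if "t \<ge> 0" for t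
    unfolding V_def U_def \<Theta>_def using dX[OF that] dY[OF that] gas_pos by (auto intro!: derivative_eq_intros)
  have um_vm: "um / vm = s" using left gas_pos range[of 0] by (simp add: s_def)
  have Vpos: "V t > 0" and Upos: "U t > 0" and Tpos: "\<Theta> t > 0" if "t \<ge> 0" for t
    using range[OF that] gas_pos by (auto simp: V_def U_def \<Theta>_def)
  have xiU: "d_xi U t = up * X' t" and xi\<Theta>: "d_xi \<Theta> t = up\<^sup>2 / R * Y' t" and xiV: "d_xi V t = vp * X' t" if "t \<ge> 0" for t
    using d_xi_eq[OF dU] d_xi_eq[OF d\<Theta>] d_xi_eq[OF dV] that by auto
  define E1 where "E1 = s * up + R * \<theta>p / vp"
  define E2 where "E2 = s * (R * \<theta>p / (\<gamma> - 1) + up\<^sup>2 / 2) + R * \<theta>p / vp * up"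
  define K where "K = (\<lambda>t. s * (R * \<Theta> t / (\<gamma> - 1) + (U t)\<^sup>2 / 2) + P t * U t)"
  have m1: "d_xi U t / V t = (s * U t + P t - E1) / \<mu>" if t: "t \<ge> 0" for t
  proof -
    have "V t * (s * U t + P t - E1) / \<mu> = up * X' t"
      unfolding V_def U_def \<Theta>_def P_def s_def E1_def X'_def by (rule flux_momentum[OF range(1)[OF t]])
    then have "d_xi U t = V t * (s * U t + P t - E1) / \<mu>" using xiU[OF t] by simp
    then show ?thesis using Vpos[OF t] by simp
  qed
  have m2: "d_xi \<Theta> t / V t = (K t - E2 - \<mu> * (U t * (d_xi U t / V t))) / \<kappa>" if t: "t \<ge> 0" for t
  proof -
    have "(V t * (K t - E2) - \<mu> * U t * (up * X' t)) / \<kappa> = up\<^sup>2 / R * Y' t"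
      unfolding V_def U_def \<Theta>_def P_def s_def E2_def K_def X'_def Y'_def by (rule flux_energy[OF range(1)[OF t]])
    then have "d_xi \<Theta> t = (V t * (K t - E2) - \<mu> * U t * d_xi U t) / \<kappa>"
      using xiU[OF t] xi\<Theta>[OF t] by simp
    then show ?thesis using Vpos[OF t] gas_pos by (simp add: field_simps)
  qed
  have Vne: "V t \<noteq> 0" if "t \<ge> 0" for t using Vpos[OF that] by simp
  have dP: "(P has_real_derivative d_xi P t) (at t within {0..})" if "t \<ge> 0" for t
    unfolding P_def by (rule d_xi_works[OF DERIV_divide[OF DERIV_cmult[OF d\<Theta>[OF that]] dV[OF that] Vne[OF that]] that])
  have dUxi: "(U has_real_derivative d_xi U t) (at t within {0..})" if "t \<ge> 0" for t
    by (rule d_xi_works[OF dU[OF that] that])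
  have dE: "((\<lambda>x. R * \<Theta> x / (\<gamma> - 1) + (U x)\<^sup>2 / 2) has_real_derivative d_xi (\<lambda>x. R * \<Theta> x / (\<gamma> - 1) + (U x)\<^sup>2 / 2) t) (at t within {0..})" if "t \<ge> 0" for t
    by (rule d_xi_works[OF DERIV_add[OF DERIV_cdivide[OF DERIV_cmult[OF d\<Theta>[OF that]]] DERIV_cdivide[OF DERIV_power[OF dU[OF that]]]] that])
  have dPU: "((\<lambda>x. P x * U x) has_real_derivative d_xi (\<lambda>x. P x * U x) t) (at t within {0..})" if "t \<ge> 0" for t
    by (rule d_xi_works[OF DERIV_mult[OF dP[OF that] dU[OF that]] that])
  have dm1: "((\<lambda>t. (s * U t + P t - E1) / \<mu>) has_real_derivative (s * d_xi U t + d_xi P t) / \<mu>) (at t within {0..})" if "t \<ge> 0" for t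
    using DERIV_cdivide[OF DERIV_diff[OF DERIV_add[OF DERIV_cmult[OF dUxi[OF that], of s] dP[OF that]] DERIV_const[of E1]], of \<mu>] by simp
  have xim1: "d_xi (\<lambda>x. d_xi U x / V x) t = (s * d_xi U t + d_xi P t) / \<mu>" if t: "t \<ge> 0" for t
  proof -
    have "d_xi (\<lambda>x. d_xi U x / V x) t = d_xi (\<lambda>t. (s * U t + P t - E1) / \<mu>) t"
      by (rule vector_derivative_within_cong) (use m1 t in auto)
    then show ?thesis using d_xi_eq[OF dm1[OF t] t] by simp
  qed
  have dUm: "((\<lambda>t. U t * ((s * U t + P t - E1) / \<mu>)) has_real_derivative d_xi (\<lambda>t. U t * ((s * U t + P t - E1) / \<mu>)) t) (at t within {0..})" if "t \<ge> 0" for t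
    by (rule d_xi_works[OF DERIV_mult[OF dUxi[OF that] dm1[OF that]] that])
  \<comment> \<open>The viscous work rewritten by the momentum integral in terms of undifferentiated
    profiles, so its differentiability follows from first derivatives.\<close>
  define J where "J = (\<lambda>t. U t * ((s * U t + P t - E1) / \<mu>))"
  have xiJ: "d_xi (\<lambda>x. U x * d_xi U x / V x) t = d_xi J t" if t: "t \<ge> 0" for t
    by (rule vector_derivative_within_cong) (use m1 t in \<open>auto simp: J_def times_divide_eq_right[symmetric] simp del: times_divide_eq_right\<close>)
  have dJ: "(J has_real_derivative d_xi J t) (at t within {0..})" if "t \<ge> 0" for t
    unfolding J_def by (rule dUm[OF that])
  have dm2: "((\<lambda>t. (K t - E2 - \<mu> * J t) / \<kappa>) has_real_derivative
      (s * d_xi (\<lambda>x. R * \<Theta> x / (\<gamma> - 1) + (U x)\<^sup>2 / 2) t + d_xi (\<lambda>x. P x * U x) t - \<mu> * d_xi J t) / \<kappa>) (at t within {0..})" if "t \<ge> 0" for t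
    unfolding K_def
    using DERIV_cdivide[OF DERIV_diff[OF DERIV_diff[OF DERIV_add[OF DERIV_cmult[OF dE[OF that], of s] dPU[OF that]] DERIV_const[of E2]] DERIV_cmult[OF dJ[OF that], of \<mu>]], of \<kappa>] by simp
  have xim2: "d_xi (\<lambda>x. d_xi \<Theta> x / V x) t =
      (s * d_xi (\<lambda>x. R * \<Theta> x / (\<gamma> - 1) + (U x)\<^sup>2 / 2) t + d_xi (\<lambda>x. P x * U x) t - \<mu> * d_xi J t) / \<kappa>" if t: "t \<ge> 0" for t
  proof -
    have "d_xi (\<lambda>x. d_xi \<Theta> x / V x) t = d_xi (\<lambda>t. (K t - E2 - \<mu> * J t) / \<kappa>) t"
      by (rule vector_derivative_within_cong) (use m1 m2 t in \<open>auto simp: J_def\<close>)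
    then show ?thesis using d_xi_eq[OF dm2[OF t] t] by simp
  qed
  have limX: "(X \<longlongrightarrow> 0) at_top" and limY: "(Y \<longlongrightarrow> 0) at_top" using orb by (auto simp: orbit_def)
  have "((\<lambda>\<xi>. (V \<xi>, U \<xi>, \<Theta> \<xi>)) \<longlongrightarrow> (vp * (1 + 0), up * (1 + 0), up\<^sup>2 / R * (aa + 0))) at_top"
    unfolding V_def U_def \<Theta>_def by (intro tendsto_intros limX limY)
  moreover have "up\<^sup>2 / R * aa = \<theta>p" using gas_pos by (simp add: aa_def)
  ultimately have lim: "((\<lambda>\<xi>. (V \<xi>, U \<xi>, \<Theta> \<xi>)) \<longlongrightarrow> (vp, up, \<theta>p)) at_top" by simp
  have nonconst: "\<not> (\<lambda>\<xi>. (V \<xi>, U \<xi>, \<Theta> \<xi>)) constant_on {0..}"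
  proof
    assume "(\<lambda>\<xi>. (V \<xi>, U \<xi>, \<Theta> \<xi>)) constant_on {0..}"
    then obtain c where c: "\<forall>t\<in>{0..}. (V t, U t, \<Theta> t) = c" by (auto simp: constant_on_def)
    have const: "U t = U 0" if "t \<ge> 0" for t
      using bspec[OF c, of t] bspec[OF c, of 0] that by auto
    have "\<forall>\<^sub>F t in at_top. U 0 = U t"
      unfolding eventually_at_top_linorder by (intro exI[of _ 0] allI impI sym[OF const])
    then have "(U \<longlongrightarrow> U 0) at_top" by (rule Lim_transform_eventually[OF tendsto_const])
    moreover have "(U \<longlongrightarrow> up) at_top" using tendsto_fst[OF tendsto_snd[OF lim]] by simp
    ultimately have "U 0 = up" by (rule tendsto_unique[OF trivial_limit_at_top_linorder])
    then show False using nontrivial gas_pos by (simp add: U_def)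
  qed
  have "BL vm um \<theta>m V U \<Theta>"
    unfolding boundary_layer_solution_def Let_def fst_conv snd_conv um_vm P_def[symmetric]
  proof (intro conjI allI impI nonconst lim)
    show "smooth_within {0..} V" "smooth_within {0..} U" "smooth_within {0..} \<Theta>"
      unfolding V_def U_def \<Theta>_def by (fact smooth)+
    show "(V 0, U 0, \<Theta> 0) = (vm, um, \<theta>m)" using left by (simp add: V_def U_def \<Theta>_def)
  next
    fix t :: real assume "t \<ge> 0"
    then show "V t > 0" "U t > 0" "\<Theta> t > 0" using Vpos Upos Tpos by auto
  next
    fix t :: real assume "t > 0"
    then have t: "t \<ge> 0" by simp
    show "- (- s) * d_xi V t - d_xi U t = 0" using xiV[OF t] xiU[OF t] gas_pos by (simp add: s_def)
    show "- (- s) * d_xi U t + d_xi P t = \<mu> * d_xi (\<lambda>x. d_xi U x / V x) t"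
      using xim1[OF t] gas_pos by simp
    show "- (- s) * d_xi (\<lambda>x. R * \<Theta> x / (\<gamma> - 1) + (U x)\<^sup>2 / 2) t + d_xi (\<lambda>x. P x * U x) t
        = \<kappa> * d_xi (\<lambda>x. d_xi \<Theta> x / V x) t + \<mu> * d_xi (\<lambda>x. U x * d_xi U x / V x) t"
      unfolding xim2[OF t] xiJ[OF t] using gas_pos by simp
  qed
  then show ?thesis unfolding V_def U_def \<Theta>_def .
qed

end

subsection \<open>Curves of admissible left states\<close>

lemma smooth_affine_if_decays:
  fixes f :: "real \<Rightarrow> real"
  assumes "decay_weight w" "\<And>N. decays w N 1 f" "\<And>j t. t \<ge> 0 \<Longrightarrow> w (1 + j) t \<le> w (0 + j) t"
  shows "smooth_within {0..} (\<lambda>t. c * (d + f t))"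
proof -
  interpret decay_weight w by fact
  have "decays w N 0 (\<lambda>t. c * (d + f t))" for N
    by (intro decays_cmult decays_add decays_const decays_weaken[OF assms(3) assms(2)])
  then show ?thesis by (rule smooth_within_if_decays)
qed

lemma line_as_range:
  fixes \<alpha> \<beta> d1 d2 u0 \<theta>0 :: real
  assumes "\<alpha> * d1 + \<beta> * d2 = 0" "d1 \<noteq> 0" "\<beta> \<noteq> 0"
  shows "{(u, \<theta>). \<alpha> * (u - u0) + \<beta> * (\<theta> - \<theta>0) = 0} = range (\<lambda>s. (u0, \<theta>0) + s *\<^sub>R (d1, d2))"
proof (intro equalityI subsetI)
  fix p assume "p \<in> {(u, \<theta>). \<alpha> * (u - u0) + \<beta> * (\<theta> - \<theta>0) = 0}"
  then obtain u \<theta> where p: "p = (u, \<theta>)" "\<alpha> * (u - u0) + \<beta> * (\<theta> - \<theta>0) = 0" by auto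
  define s where "s = (u - u0) / d1"
  have s: "u - u0 = s * d1" using assms by (simp add: s_def)
  have "\<beta> * (\<theta> - \<theta>0) = s * (- (\<alpha> * d1))" using p(2) s by (simp add: algebra_simps)
  also have "- (\<alpha> * d1) = \<beta> * d2" using assms(1) by simp
  finally have "\<beta> * (\<theta> - \<theta>0) = \<beta> * (s * d2)" by simp
  then have "\<theta> - \<theta>0 = s * d2" using assms(3) by simp
  then have "p = (u0, \<theta>0) + s *\<^sub>R (d1, d2)" using s p(1) by simp
  then show "p \<in> range (\<lambda>s. (u0, \<theta>0) + s *\<^sub>R (d1, d2))" by (rule range_eqI)
next
  fix p assume "p \<in> range (\<lambda>s. (u0, \<theta>0) + s *\<^sub>R (d1, d2))"
  then obtain s where p: "p = (u0 + s * d1, \<theta>0 + s * d2)" by auto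
  have "\<alpha> * (s * d1) + \<beta> * (s * d2) = s * (\<alpha> * d1 + \<beta> * d2)" by (simp add: algebra_simps)
  then show "p \<in> {(u, \<theta>). \<alpha> * (u - u0) + \<beta> * (\<theta> - \<theta>0) = 0}" using assms(1) p by simp
qed

text \<open>A monotone curve leaving \<open>p\<close> along a line of negative slope, on a known side of \<open>p\<close> in one
  coordinate, lies in a single open quadrant at \<open>p\<close>. This makes the pair of curves unique.\<close>

lemma tangent_quadrant:
  fixes \<alpha> \<beta> \<tau> u0 \<theta>0 :: real
  assumes tan: "tangent_at_endpoint (u0, \<theta>0) \<Gamma> {(u, \<theta>). \<alpha> * (u - u0) + \<beta> * (\<theta> - \<theta>0) = 0}"
    and ab: "\<alpha> > 0" "\<beta> > 0" and mono: "monotone_curve \<Gamma>" and \<tau>: "\<tau> = 1 \<or> \<tau> = -1"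
    and side: "(\<forall>q\<in>\<Gamma>. \<tau> * (u0 - fst q) > 0) \<or> (\<forall>q\<in>\<Gamma>. \<tau> * (snd q - \<theta>0) > 0)"
    and q: "q \<in> \<Gamma>"
  shows "\<tau> * (u0 - fst q) > 0 \<and> \<tau> * (snd q - \<theta>0) > 0"
proof -
  obtain g where g: "parametrizes_from g (u0, \<theta>0) \<Gamma>"
    and L: "{(u, \<theta>). \<alpha> * (u - u0) + \<beta> * (\<theta> - \<theta>0) = 0} = range (\<lambda>s. (u0, \<theta>0) + s *\<^sub>R vector_derivative g (at 0))"
    using tan unfolding tangent_at_endpoint_def by blast
  define d where "d = vector_derivative g (at 0)"
  obtain d1 d2 where d12: "d = (d1, d2)" by (cases d)
  have g0: "g 0 = (u0, \<theta>0)" and img: "g ` {0<..<1} = \<Gamma>" and C1: "g C1_differentiable_on {0..<1}"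
    and ne: "\<forall>t\<in>{0..<1}. vector_derivative g (at t) \<noteq> 0"
    using g unfolding parametrizes_from_def by auto
  have "d \<noteq> 0" using ne unfolding d_def by simp
  have "(u0, \<theta>0) + 1 *\<^sub>R d \<in> {(u, \<theta>). \<alpha> * (u - u0) + \<beta> * (\<theta> - \<theta>0) = 0}"
    unfolding L d_def by (rule range_eqI) (rule refl)
  then have lin: "\<alpha> * d1 + \<beta> * d2 = 0" by (simp add: d12)
  have d1: "d1 \<noteq> 0" using \<open>d \<noteq> 0\<close> lin ab by (auto simp: d12 zero_prod_def)
  have d2: "\<beta> * d2 = - (\<alpha> * d1)" using lin by simp
  have \<tau>d2: "\<beta> * (\<tau> * d2) = - (\<alpha> * (\<tau> * d1))"
  proof -
    have "\<beta> * (\<tau> * d2) = \<tau> * (\<beta> * d2)" by (rule mult.left_commute)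
    also have "\<dots> = \<tau> * (- (\<alpha> * d1))" by (simp only: d2)
    also have "\<dots> = - (\<alpha> * (\<tau> * d1))" by (simp add: mult.left_commute)
    finally show ?thesis .
  qed
  obtain D where "\<forall>x\<in>{0..<1}. (g has_vector_derivative D x) (at x)"
    using C1 unfolding C1_differentiable_on_def by blast
  then have "(g has_vector_derivative D 0) (at 0)" by simp
  then have gd: "(g has_vector_derivative d) (at 0)" using vector_derivative_at d_def by metis
  have gd': "(g has_derivative (\<lambda>h. h *\<^sub>R (d1, d2))) (at 0)" using gd by (simp add: has_vector_derivative_def d12)
  have f1: "((\<lambda>t. fst (g t)) has_real_derivative d1) (at 0)"
    using has_derivative_fst[OF gd'] by (simp add: has_field_derivative_def mult_commute_abs)
  have f2: "((\<lambda>t. snd (g t)) has_real_derivative d2) (at 0)"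
    using has_derivative_snd[OF gd'] by (simp add: has_field_derivative_def mult_commute_abs)
  have F1: "((\<lambda>t. \<tau> * (u0 - fst (g t))) has_real_derivative - (\<tau> * d1)) (at 0)"
    using f1 by (auto intro!: derivative_eq_intros)
  have F2: "((\<lambda>t. \<tau> * (snd (g t) - \<theta>0)) has_real_derivative \<tau> * d2) (at 0)"
    using f2 by (auto intro!: derivative_eq_intros)
  have in\<Gamma>: "g t \<in> \<Gamma>" if "0 < t" "t < 1" for t using img that by auto
  have neg: False if neg: "(f has_real_derivative l) (at 0)" "l < 0" "f 0 = 0" "\<And>t. 0 < t \<Longrightarrow> t < 1 \<Longrightarrow> f t > 0"
    for f :: "real \<Rightarrow> real" and l
  proof -
    obtain e where e: "e > 0" "\<And>h. h > 0 \<Longrightarrow> 0 + h \<in> UNIV \<Longrightarrow> h < e \<Longrightarrow> f (0 + h) < f 0"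
      using has_real_derivative_neg_dec_right[of f l 0 UNIV] neg(1,2) by auto
    define h where "h = min (e / 2) (1 / 2)"
    have "h > 0" "h < e" "h < 1" using e(1) by (auto simp: h_def)
    then show False using e(2)[of h] neg(3) neg(4)[of h] by simp
  qed
  \<comment> \<open>The tangent vector lies on a line of negative slope, so its two components have
    opposite signs; the known side in one coordinate then fixes both.\<close>
  have t1: "\<tau> * d1 < 0"
  proof (rule ccontr)
    assume "\<not> \<tau> * d1 < 0"
    then have p: "\<tau> * d1 > 0" using d1 \<tau> by auto
    have "\<beta> * (\<tau> * d2) = - (\<alpha> * (\<tau> * d1))" by (rule \<tau>d2)
    also have "\<dots> < 0" using ab p by simp
    finally have p2: "\<tau> * d2 < 0" using ab by (simp add: mult_less_0_iff)
    from side show False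
    proof
      assume a: "\<forall>q\<in>\<Gamma>. \<tau> * (u0 - fst q) > 0"
      show False by (rule neg[OF F1]) (use p a in\<Gamma> g0 in auto)
    next
      assume a: "\<forall>q\<in>\<Gamma>. \<tau> * (snd q - \<theta>0) > 0"
      show False by (rule neg[OF F2]) (use p2 a in\<Gamma> g0 in auto)
    qed
  qed
  have t2: "\<tau> * d2 > 0"
  proof -
    have "\<beta> * (\<tau> * d2) = - (\<alpha> * (\<tau> * d1))" by (rule \<tau>d2)
    also have "\<dots> > 0" using ab t1 by (simp add: mult_pos_neg)
    finally show ?thesis using ab by (simp add: zero_less_mult_iff)
  qed
  have approach: "\<exists>r\<in>\<Gamma>. 0 < \<tau> * (u0 - fst r) \<and> \<tau> * (u0 - fst r) < \<epsilon> \<and> 0 < \<tau> * (snd r - \<theta>0) \<and> \<tau> * (snd r - \<theta>0) < \<epsilon>"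
    if "\<epsilon> > 0" for \<epsilon>
  proof -
    have "((\<lambda>t. \<tau> * (u0 - fst (g t))) \<longlongrightarrow> \<tau> * (u0 - fst (g 0))) (at 0)"
      using DERIV_isCont[OF F1] unfolding isCont_def .
    then have c1: "((\<lambda>t. \<tau> * (u0 - fst (g t))) \<longlongrightarrow> 0) (at_right 0)"
      unfolding g0 fst_conv snd_conv diff_self mult_zero_right by (rule tendsto_within_subset) simp
    have "((\<lambda>t. \<tau> * (snd (g t) - \<theta>0)) \<longlongrightarrow> \<tau> * (snd (g 0) - \<theta>0)) (at 0)"
      using DERIV_isCont[OF F2] unfolding isCont_def .
    then have c2: "((\<lambda>t. \<tau> * (snd (g t) - \<theta>0)) \<longlongrightarrow> 0) (at_right 0)"
      unfolding g0 fst_conv snd_conv diff_self mult_zero_right by (rule tendsto_within_subset) simp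
    have e1: "eventually (\<lambda>t. \<tau> * (u0 - fst (g t)) < \<epsilon> \<and> \<tau> * (snd (g t) - \<theta>0) < \<epsilon>) (at_right 0)"
      using order_tendstoD(2)[OF c1 that] order_tendstoD(2)[OF c2 that] by eventually_elim simp
    obtain e where e: "e > 0" "\<And>h. h > 0 \<Longrightarrow> h < e \<Longrightarrow> 0 < \<tau> * (u0 - fst (g h))"
      using has_real_derivative_pos_inc_right[OF F1] t1 g0 by auto
    obtain e' where e': "e' > 0" "\<And>h. h > 0 \<Longrightarrow> h < e' \<Longrightarrow> 0 < \<tau> * (snd (g h) - \<theta>0)"
      using has_real_derivative_pos_inc_right[OF F2] t2 g0 by auto
    obtain b where b: "b > 0" "\<And>t. t > 0 \<Longrightarrow> t < b \<Longrightarrow> \<tau> * (u0 - fst (g t)) < \<epsilon> \<and> \<tau> * (snd (g t) - \<theta>0) < \<epsilon>"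
      using e1 unfolding eventually_at_right_field by blast
    define t where "t = min (min (e / 2) (e' / 2)) (min (b / 2) (1 / 2))"
    have t: "t > 0" "t < e" "t < e'" "t < b" "t < 1" using e(1) e'(1) b(1) by (auto simp: t_def)
    show ?thesis
      by (rule bexI[OF _ in\<Gamma>[OF t(1,5)]]) (use e(2)[OF t(1,2)] e'(2)[OF t(1,3)] b(2)[OF t(1,4)] in simp)
  qed
  \<comment> \<open>Two points of the quadrant, one closer to the endpoint in both coordinates,
    exclude the increasing alternative of monotonicity.\<close>
  have dec: "\<forall>p\<in>\<Gamma>. \<forall>q\<in>\<Gamma>. fst p < fst q \<longleftrightarrow> snd q < snd p"
  proof -
    obtain r where r: "r \<in> \<Gamma>" "0 < \<tau> * (u0 - fst r)" "0 < \<tau> * (snd r - \<theta>0)" using approach[of 1] by auto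
    obtain r' where r': "r' \<in> \<Gamma>" "\<tau> * (u0 - fst r') < min (\<tau> * (u0 - fst r)) (\<tau> * (snd r - \<theta>0))"
      "\<tau> * (snd r' - \<theta>0) < min (\<tau> * (u0 - fst r)) (\<tau> * (snd r - \<theta>0))"
      using approach[of "min (\<tau> * (u0 - fst r)) (\<tau> * (snd r - \<theta>0))"] r by auto
    have "\<not> (\<forall>p\<in>\<Gamma>. \<forall>q\<in>\<Gamma>. fst p < fst q \<longleftrightarrow> snd p < snd q)"
    proof
      assume a: "\<forall>p\<in>\<Gamma>. \<forall>q\<in>\<Gamma>. fst p < fst q \<longleftrightarrow> snd p < snd q"
      have "fst r < fst r' \<longleftrightarrow> snd r < snd r'" "fst r' < fst r \<longleftrightarrow> snd r' < snd r" using a r(1) r'(1) by auto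
      then show False using r' \<tau> by auto
    qed
    then show ?thesis using mono unfolding monotone_curve_def by blast
  qed
  \<comment> \<open>Compare \<open>q\<close> with a curve point \<open>r\<close> in the quadrant
    that is closer to the endpoint in the known coordinate: by monotonicity \<open>q\<close> is
    farther away than \<open>r\<close> in the other one, on the same side.\<close>
  from side show ?thesis
  proof
    assume "\<forall>q\<in>\<Gamma>. \<tau> * (u0 - fst q) > 0"
    then have qs: "\<tau> * (u0 - fst q) > 0" using q by blast
    obtain r where r: "r \<in> \<Gamma>" "\<tau> * (u0 - fst r) < \<tau> * (u0 - fst q)" "0 < \<tau> * (snd r - \<theta>0)" using approach[OF qs] by auto
    have "fst r < fst q \<longleftrightarrow> snd q < snd r" "fst q < fst r \<longleftrightarrow> snd r < snd q" using dec r(1) q by auto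
    then show ?thesis using qs r \<tau> by auto
  next
    assume "\<forall>q\<in>\<Gamma>. \<tau> * (snd q - \<theta>0) > 0"
    then have qs: "\<tau> * (snd q - \<theta>0) > 0" using q by blast
    obtain r where r: "r \<in> \<Gamma>" "\<tau> * (snd r - \<theta>0) < \<tau> * (snd q - \<theta>0)" "0 < \<tau> * (u0 - fst r)" using approach[OF qs] by auto
    have "fst r < fst q \<longleftrightarrow> snd q < snd r" "fst q < fst r \<longleftrightarrow> snd r < snd q" using dec r(1) q by auto
    then show ?thesis using qs r \<tau> by auto
  qed
qed

text \<open>A nonzero upper right entry makes (q, k - p) an explicit eigenvector at every root of
  the characteristic equation, and forces the first component of any eigenvector to be
  nonzero.\<close>

lemma eigenvalue_2x2:
  fixes p q r s k :: real
  assumes "q \<noteq> 0"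
  shows "eigenvalue (mat_of_rows_list 2 [[p, q], [r, s]]) k \<longleftrightarrow> (p - k) * (s - k) - q * r = 0"
proof -
  define A where "A = mat_of_rows_list 2 [[p, q], [r, s]]"
  have dims: "dim_row A = 2" "dim_col A = 2" by (simp_all add: A_def mat_of_rows_list_def)
  have less2: "i < 2 \<longleftrightarrow> i = 0 \<or> i = 1" for i :: nat by auto
  have mv: "vec_index (A *\<^sub>v v) 0 = p * vec_index v 0 + q * vec_index v 1"
      "vec_index (A *\<^sub>v v) 1 = r * vec_index v 0 + s * vec_index v 1" if "dim_vec v = 2" for v
  proof -
    have two: "{0..<2::nat} = {0, 1}" by auto
    have A: "A $$ (0, 0) = p" "A $$ (0, 1) = q" "A $$ (1, 0) = r" "A $$ (1, 1) = s"
      by (simp_all add: A_def mat_of_rows_list_def)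
    show "vec_index (A *\<^sub>v v) 0 = p * vec_index v 0 + q * vec_index v 1"
      "vec_index (A *\<^sub>v v) 1 = r * vec_index v 0 + s * vec_index v 1"
      using that A by (simp_all add: scalar_prod_def two dims del: One_nat_def)
  qed
  have iff: "eigenvector A v k \<longleftrightarrow> dim_vec v = 2 \<and> (vec_index v 0 \<noteq> 0 \<or> vec_index v 1 \<noteq> 0) \<and>
      p * vec_index v 0 + q * vec_index v 1 = k * vec_index v 0 \<and> r * vec_index v 0 + s * vec_index v 1 = k * vec_index v 1" for v
  proof (cases "dim_vec v = 2")
    case True
    have two: "x = y \<longleftrightarrow> vec_index x 0 = vec_index y 0 \<and> vec_index x 1 = vec_index y 1"
      if "dim_vec x = 2" "dim_vec y = 2" for x y :: "real Matrix.vec"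
      using that by (auto intro!: Matrix.eq_vecI simp: less2)
    have "dim_vec (0\<^sub>v 2 :: real Matrix.vec) = 2" by simp
    then have "v = 0\<^sub>v 2 \<longleftrightarrow> vec_index v 0 = vec_index (0\<^sub>v 2) 0 \<and> vec_index v 1 = vec_index (0\<^sub>v 2) 1"
      by (rule two[OF True])
    then have e1: "v \<noteq> 0\<^sub>v 2 \<longleftrightarrow> (vec_index v 0 \<noteq> 0 \<or> vec_index v 1 \<noteq> 0)" by simp
    have dv: "dim_vec (A *\<^sub>v v) = 2" "dim_vec (k \<cdot>\<^sub>v v) = 2" using dims True by simp_all
    have kv: "vec_index (k \<cdot>\<^sub>v v) 0 = k * vec_index v 0" "vec_index (k \<cdot>\<^sub>v v) 1 = k * vec_index v 1"
      using True by simp_all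
    have e2: "A *\<^sub>v v = k \<cdot>\<^sub>v v \<longleftrightarrow>
        p * vec_index v 0 + q * vec_index v 1 = k * vec_index v 0 \<and> r * vec_index v 0 + s * vec_index v 1 = k * vec_index v 1"
      unfolding two[OF dv] mv[OF True] kv by (rule refl)
    show ?thesis unfolding eigenvector_def dims e1 e2 carrier_vec_def mem_Collect_eq by (rule refl)
  next
    case False
    then show ?thesis unfolding eigenvector_def dims carrier_vec_def mem_Collect_eq by blast
  qed
  show ?thesis unfolding A_def[symmetric] eigenvalue_def
  proof
    assume "\<exists>v. eigenvector A v k"
    then obtain v where v: "vec_index v 0 \<noteq> 0 \<or> vec_index v 1 \<noteq> 0"
      "p * vec_index v 0 + q * vec_index v 1 = k * vec_index v 0" "r * vec_index v 0 + s * vec_index v 1 = k * vec_index v 1"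
      unfolding iff by auto
    define x y where "x = vec_index v 0" and "y = vec_index v 1"
    have e1: "q * y = (k - p) * x" and e2: "r * x = (k - s) * y"
      using v(2,3) by (simp_all add: x_def y_def algebra_simps)
    have "x \<noteq> 0"
    proof
      assume "x = 0"
      then have "y = 0" using e1 assms by simp
      then show False using v(1) \<open>x = 0\<close> by (simp add: x_def y_def)
    qed
    have "q * r * x = (k - s) * (q * y)" using e2 by (simp add: mult.assoc mult.left_commute)
    also have "\<dots> = ((p - k) * (s - k)) * x" unfolding e1 by (simp add: algebra_simps)
    finally show "(p - k) * (s - k) - q * r = 0" using \<open>x \<noteq> 0\<close> by simp
  next
    assume z: "(p - k) * (s - k) - q * r = 0"
    have "eigenvector A (Matrix.vec 2 (\<lambda>i. if i = 0 then q else k - p)) k"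
      unfolding iff using assms z by (simp add: algebra_simps)
    then show "\<exists>v. eigenvector A v k" by (rule exI)
  qed
qed

section \<open>Construction of the curves of admissible left states\<close>

context gas
begin

lemma mach_sq: "(mach R \<gamma> up \<theta>p)\<^sup>2 = 1 / (\<gamma> * aa)" and mach_pos: "mach R \<gamma> up \<theta>p > 0"
proof -
  have h: "R * \<gamma> * \<theta>p > 0" using gas_pos by simp
  have "(sqrt (R * \<gamma> * \<theta>p))\<^sup>2 = R * \<gamma> * \<theta>p" by (rule real_sqrt_pow2[OF less_imp_le[OF h]])
  then have "(mach R \<gamma> up \<theta>p)\<^sup>2 = up\<^sup>2 / (R * \<gamma> * \<theta>p)" unfolding mach_def power_divide by simp
  also have "\<dots> = 1 / (\<gamma> * aa)" unfolding aa_def using gas_pos by (simp add: field_simps)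
  finally show "(mach R \<gamma> up \<theta>p)\<^sup>2 = 1 / (\<gamma> * aa)" .
  show "mach R \<gamma> up \<theta>p > 0" unfolding mach_def using h gas_pos by (intro divide_pos_pos) auto
qed

lemma gamma_aa: "\<gamma> * aa = e + 1"
  unfolding e_def unfolding gg_def by simp

lemma mach_cases:
  "mach R \<gamma> up \<theta>p > 1 \<longleftrightarrow> e < 0" "mach R \<gamma> up \<theta>p = 1 \<longleftrightarrow> e = 0" "mach R \<gamma> up \<theta>p < 1 \<longleftrightarrow> e > 0"
proof -
  have ga: "\<gamma> * aa > 0" using gas_pos pos by simp
  have m: "mach R \<gamma> up \<theta>p > 0" by (rule mach_pos)
  have sq: "(mach R \<gamma> up \<theta>p)\<^sup>2 = 1 / (e + 1)" "e + 1 > 0" using mach_sq ga by (simp_all add: gamma_aa)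
  have "(mach R \<gamma> up \<theta>p)\<^sup>2 \<le> 1 \<longleftrightarrow> 1 \<le> e + 1" unfolding sq(1) by (rule divide_le_eq_1_pos[OF sq(2)])
  then have le: "mach R \<gamma> up \<theta>p \<le> 1 \<longleftrightarrow> 0 \<le> e" using m by (simp add: abs_square_le_1)
  have "(mach R \<gamma> up \<theta>p)\<^sup>2 < 1 \<longleftrightarrow> 1 < e + 1" unfolding sq(1) by (rule divide_less_eq_1_pos[OF sq(2)])
  then have lt: "mach R \<gamma> up \<theta>p < 1 \<longleftrightarrow> 0 < e" using m by (simp add: abs_square_less_1)
  show "mach R \<gamma> up \<theta>p > 1 \<longleftrightarrow> e < 0" "mach R \<gamma> up \<theta>p = 1 \<longleftrightarrow> e = 0" "mach R \<gamma> up \<theta>p < 1 \<longleftrightarrow> e > 0"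
    using le lt by auto
qed

lemma temp_eq: "up\<^sup>2 / R * aa = \<theta>p"
  using gas_pos by (simp add: aa_def)

text \<open>The sign pattern of the orbit classification; \<sigma> = -1 means that the velocity
  stays below that of the right state.\<close>

definition sideBL :: "real \<Rightarrow> (real \<Rightarrow> real) \<Rightarrow> (real \<Rightarrow> real) \<Rightarrow> bool" where
  "sideBL \<sigma> U \<Theta> \<longleftrightarrow> (\<forall>t\<ge>0. \<sigma> * XX U t > 0 \<and> \<sigma> * (YY \<Theta> t - nullF (XX U t)) < 0 \<and> \<sigma> * (YY \<Theta> t - nullG (XX U t)) > 0)"

lemma BL_side:
  assumes "BL vm um \<theta>m V U \<Theta>" "vm > 0" "um > 0"
  shows "e \<ge> 0" "\<exists>\<sigma>. (\<sigma> = -1 \<or> \<sigma> = 1 \<and> e > 0) \<and> sideBL \<sigma> U \<Theta>"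
proof -
  note O = BL_imp_orbit[OF assms]
  show "e \<ge> 0" by (rule orbit_classification[OF O(2,3)])
  show "\<exists>\<sigma>. (\<sigma> = -1 \<or> \<sigma> = 1 \<and> e > 0) \<and> sideBL \<sigma> U \<Theta>"
  proof (rule orbit_classification[OF O(2,3)])
    fix \<sigma>
    assume "\<sigma> = 1 \<or> \<sigma> = -1" "e \<ge> 0" "\<sigma> = 1 \<Longrightarrow> e > 0"
      "\<And>t. t \<ge> 0 \<Longrightarrow> \<sigma> * XX U t > 0" "\<And>t. t \<ge> 0 \<Longrightarrow> \<sigma> * (YY \<Theta> t - nullF (XX U t)) < 0"
      "\<And>t. t \<ge> 0 \<Longrightarrow> \<sigma> * (YY \<Theta> t - nullG (XX U t)) > 0"
    then show "\<exists>\<sigma>. (\<sigma> = -1 \<or> \<sigma> = 1 \<and> e > 0) \<and> sideBL \<sigma> U \<Theta>"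
      by (intro exI[of _ \<sigma>]) (auto simp: sideBL_def)
  qed
qed

text \<open>Bundles what both regimes share, for one side at a time, so that existence is proved
  once. The tangent direction is kept in terms of \<open>zc\<close> and compared with the line of
  each case later.\<close>

definition good_curve :: "real \<Rightarrow> (real \<times> real) set \<Rightarrow> bool" where
  "good_curve \<sigma> \<Gamma> \<longleftrightarrow>
     (\<exists>zc k. 0 < zc \<and> k \<noteq> 0 \<and> nn * (1 - zc) = mm * zc * (1 - aa + e * zc) \<and>
        (\<exists>G. parametrizes_from G (up, \<theta>p) \<Gamma> \<and> vector_derivative G (at 0) = (up * k, - (up\<^sup>2 / R * (k * (1 - aa + e * zc)))))) \<and>
     monotone_curve \<Gamma> \<and>
     (\<forall>q\<in>\<Gamma>. \<sigma> * (fst q - up) > 0 \<and> \<sigma> * (\<theta>p - snd q) > 0 \<and> fst q > 0 \<and> snd q > 0) \<and>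
     (\<sigma> = -1 \<longrightarrow> fst ` \<Gamma> = {0<..<up}) \<and>
     (\<sigma> = 1 \<longrightarrow> snd ` \<Gamma> = {max 0 (alpha2 \<gamma> (mach R \<gamma> up \<theta>p) * \<theta>p)<..<\<theta>p}) \<and>
     (\<forall>vm um \<theta>m. vm > 0 \<and> um / vm = up / vp \<and> (um, \<theta>m) \<in> \<Gamma> \<longrightarrow> (\<exists>V U \<Theta>. BL vm um \<theta>m V U \<Theta>)) \<and>
     (\<forall>vm um \<theta>m V U \<Theta>. vm > 0 \<and> um > 0 \<and> BL vm um \<theta>m V U \<Theta> \<and> sideBL \<sigma> U \<Theta> \<longrightarrow>
        (um, \<theta>m) \<in> \<Gamma> \<and>
        (\<forall>\<xi>\<ge>0. \<sigma> * d_xi V \<xi> < 0 \<and> \<sigma> * d_xi U \<xi> < 0 \<and> \<sigma> * d_xi \<Theta> \<xi> > 0) \<and>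
        (e > 0 \<longrightarrow> (\<exists>c>0. \<forall>n. \<exists>C>0. \<forall>\<xi>>0.
            norm (nderiv_within {0..} n (perturbation (vp, up, \<theta>p) V U \<Theta>) \<xi>) \<le> C * exp (- c * \<xi>))) \<and>
        (e = 0 \<longrightarrow> (\<forall>n. \<exists>C>0. \<forall>\<xi>>0.
            norm (nderiv_within {0..} n (perturbation (vp, up, \<theta>p) V U \<Theta>) \<xi>) \<le> C / (1 + \<xi>) ^ (n + 1))))"

text \<open>The right side is the physical temperature at the second equilibrium, X = 2e/(gg + 2)
  with Y = \<open>nullF X\<close>; this is where the formula for \<open>alpha2\<close> comes
  from.\<close>

lemma alpha2_eq: "alpha2 \<gamma> (mach R \<gamma> up \<theta>p) * \<theta>p
    = up\<^sup>2 / R * (aa - (2 * e / (gg + 2)) * (2 * e / (gg + 2) + (1 - aa)))"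
proof -
  define q where "q = (mach R \<gamma> up \<theta>p)\<^sup>2"
  have gg: "\<gamma> - 1 = gg" "\<gamma> + 1 = gg + 2" "gg + 2 > 0" using gas_pos by (simp_all add: gg_def)
  have q: "q > 0" "1 / q = \<gamma> * aa" "q * \<gamma> = 1 / aa"
    using gas_pos pos by (simp_all add: q_def mach_sq)
  have "(1 - q) / q = 1 / q - 1" using q(1) by (simp add: diff_divide_distrib)
  then have e: "(1 - q) / q = e" by (simp add: q(2) gamma_aa)
  have "alpha2 \<gamma> (mach R \<gamma> up \<theta>p) = 1 - 2 * ((1 - q) / q) * (q * \<gamma> + 1) * (\<gamma> - 1) / (\<gamma> + 1)\<^sup>2"
    unfolding alpha2_def q_def[symmetric] by simp
  then have a2: "alpha2 \<gamma> (mach R \<gamma> up \<theta>p) = 1 - 2 * e * (1 / aa + 1) * gg / (gg + 2)\<^sup>2"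
    unfolding e q(3) gg(1,2) .
  have x: "2 * e / (gg + 2) + (1 - aa) = gg * (1 + aa) / (gg + 2)"
    using gg(3) by (simp add: e_def field_simps)
  have "aa * (1 / aa + 1) = 1 + aa" using pos by (simp add: distrib_left)
  moreover have "a * (2 * E * q * g / d\<^sup>2) = (2 * E / d) * (g * (a * q) / d)" for a E q g d :: real
    by (simp add: power2_eq_square)
  ultimately have prod: "aa * (2 * e * (1 / aa + 1) * gg / (gg + 2)\<^sup>2) = (2 * e / (gg + 2)) * (gg * (1 + aa) / (gg + 2))"
    by (simp only:)
  have key: "aa * (1 - 2 * e * (1 / aa + 1) * gg / (gg + 2)\<^sup>2) = aa - (2 * e / (gg + 2)) * (2 * e / (gg + 2) + (1 - aa))"
    unfolding x right_diff_distrib[of aa] prod mult_1_right ..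
  have "(1 - 2 * e * (1 / aa + 1) * gg / (gg + 2)\<^sup>2) * \<theta>p
      = (1 - 2 * e * (1 / aa + 1) * gg / (gg + 2)\<^sup>2) * (up\<^sup>2 / R * aa)" by (simp only: temp_eq)
  also have "\<dots> = up\<^sup>2 / R * (aa * (1 - 2 * e * (1 / aa + 1) * gg / (gg + 2)\<^sup>2))" by (simp only: mult_ac)
  finally show ?thesis unfolding a2 key .
qed

theorem ex_good_curve:
  assumes "e \<ge> 0" "\<sigma> = -1 \<or> \<sigma> = 1 \<and> e > 0"
  shows "\<exists>\<Gamma>. good_curve \<sigma> \<Gamma>"
proof -
  interpret S: planar_side mm nn aa gg \<sigma> by unfold_locales (use assms in auto)
  obtain \<phi> \<eta> zc where br: "planar_branch mm nn aa gg \<sigma> \<phi> \<eta> zc" using S.ex_branch by blast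
  interpret B: planar_branch mm nn aa gg \<sigma> \<phi> \<eta> zc by (rule br)
  \<comment> \<open>Maps the branch coordinate back to physical velocity and temperature.\<close>
  define pt where "pt = (\<lambda>x. (up * (1 + \<sigma> * x), up\<^sup>2 / R * (aa - \<sigma> * \<phi> x)))"
  define \<Gamma> where "\<Gamma> = pt ` B.dom"
  have s2: "\<sigma> * \<sigma> = 1" "\<sigma> * (\<sigma> * x) = x" for x using assms(2) by auto
  have scal: "up\<^sup>2 / R > 0" using gas_pos by simp
  have domD: "0 < x" "x < S.reach" "\<sigma> = 1 \<Longrightarrow> \<phi> x < aa" if "x \<in> B.dom" for x using that unfolding B.dom_def by auto
  obtain r where r: "0 < r" "r \<le> S.reach" "B.dom = {0<..<r}" using B.dom_interval by blast
  define G where "G = (\<lambda>t. (up + (up * \<sigma> * r) * t, \<theta>p + (- (up\<^sup>2 / R * \<sigma>)) * B.height r t))"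
  have Gpt: "G t = pt (r * t)" if "0 < t" for t
  proof -
    have "B.height r t = \<phi> (r * t)" using that by (simp add: B.height_def[OF r(1,2)])
    moreover have "up + (up * \<sigma> * r) * t = up * (1 + \<sigma> * (r * t))" by (simp add: algebra_simps)
    moreover have "\<theta>p + (- (up\<^sup>2 / R * \<sigma>)) * y = up\<^sup>2 / R * (aa - \<sigma> * y)" for y
    proof -
      have "up\<^sup>2 / R * (aa - \<sigma> * y) = \<theta>p - up\<^sup>2 / R * (\<sigma> * y)" by (simp only: right_diff_distrib temp_eq)
      then show ?thesis by simp
    qed
    ultimately show ?thesis unfolding G_def pt_def by (simp only:)
  qed
  have "G ` {0<..<1} = \<Gamma>"
  proof -
    have "(\<lambda>t. r * t) ` {0<..<1} = {0<..<r}"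
    proof (intro equalityI subsetI)
      fix x assume "x \<in> {0<..<r}"
      then show "x \<in> (\<lambda>t. r * t) ` {0<..<1}" using r by (intro image_eqI[of _ _ "x / r"]) auto
    qed (use r in auto)
    then have "\<Gamma> = pt ` (\<lambda>t. r * t) ` {0<..<1}" by (simp add: \<Gamma>_def r(3))
    also have "\<dots> = G ` {0<..<1}" unfolding image_image by (rule image_cong) (simp_all add: Gpt)
    finally show ?thesis by simp
  qed
  moreover have "up * \<sigma> * r \<noteq> 0" using gas_pos r assms(2) by auto
  note P = B.parametrization[OF r(1,2) this, of up \<theta>p "- (up\<^sup>2 / R * \<sigma>)", folded G_def]
  ultimately have par: "parametrizes_from G (up, \<theta>p) \<Gamma>" using P(1) by simp
  have vd: "vector_derivative G (at 0) = (up * (\<sigma> * r), - (up\<^sup>2 / R * ((\<sigma> * r) * (1 - aa + e * zc))))"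
    using P(2) by (simp add: B.endpoint_slope_def mult.assoc)
  have zc: "nn * (1 - zc) = mm * zc * (1 - aa + e * zc)"
  proof -
    have "nn / mm * (1 / zc - 1) = 1 - aa + e * zc" using B.zc(3) by (simp add: S.rate_def)
    then have "mm * zc * (1 - aa + e * zc) = mm * zc * (nn / mm * (1 / zc - 1))" by simp
    also have "\<dots> = nn * (zc * (1 / zc - 1))" using pos by simp
    also have "zc * (1 / zc - 1) = 1 - zc" using B.zc(1) by (simp add: right_diff_distrib)
    finally show ?thesis by simp
  qed
  have mono: "monotone_curve \<Gamma>"
    unfolding monotone_curve_def
  proof (rule disjI2, intro ballI)
    fix p q assume "p \<in> \<Gamma>" "q \<in> \<Gamma>"
    then obtain x y where x: "x \<in> B.dom" "p = pt x" and y: "y \<in> B.dom" "q = pt y" by (auto simp: \<Gamma>_def)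
    have "fst p < fst q \<longleftrightarrow> \<sigma> * x < \<sigma> * y"
      unfolding x(2) y(2) pt_def fst_conv mult_less_cancel_left_pos[OF gas_pos(6)] by auto
    moreover have "snd q < snd p \<longleftrightarrow> \<sigma> * \<phi> x < \<sigma> * \<phi> y"
      unfolding x(2) y(2) pt_def snd_conv mult_less_cancel_left_pos[OF scal] by auto
    moreover have "x < y \<longleftrightarrow> \<phi> x < \<phi> y"
      using B.phi_strict_mono[of x y] B.phi_strict_mono[of y x] domD[OF x(1)] domD[OF y(1)]
      by (cases x y rule: linorder_cases) auto
    moreover have "y < x \<longleftrightarrow> \<phi> y < \<phi> x"
      using B.phi_strict_mono[of x y] B.phi_strict_mono[of y x] domD[OF x(1)] domD[OF y(1)]
      by (cases x y rule: linorder_cases) auto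
    ultimately show "fst p < fst q \<longleftrightarrow> snd q < snd p" using assms(2) by auto
  qed
  have quad: "\<forall>q\<in>\<Gamma>. \<sigma> * (fst q - up) > 0 \<and> \<sigma> * (\<theta>p - snd q) > 0 \<and> fst q > 0 \<and> snd q > 0"
  proof
    fix q assume "q \<in> \<Gamma>"
    then obtain x where x: "x \<in> B.dom" "q = pt x" by (auto simp: \<Gamma>_def)
    note d = domD[OF x(1)]
    have ph: "\<phi> x > 0" by (rule B.phi_pos[OF d(1,2)])
    have "\<sigma> * (fst q - up) = up * x" by (simp add: x pt_def s2 algebra_simps)
    moreover have "\<sigma> * (\<theta>p - snd q) = up\<^sup>2 / R * \<phi> x"
    proof -
      have sq: "snd q = \<theta>p - up\<^sup>2 / R * (\<sigma> * \<phi> x)"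
        unfolding x(2) pt_def snd_conv right_diff_distrib temp_eq by (rule refl)
      have "\<sigma> * (\<theta>p - snd q) = (\<sigma> * \<sigma>) * (up\<^sup>2 / R * \<phi> x)" unfolding sq by (simp add: mult_ac)
      then show ?thesis by (simp only: s2(1) mult_1_left)
    qed
    moreover have "1 + \<sigma> * x > 0 \<and> aa - \<sigma> * \<phi> x > 0"
      using assms(2)
    proof
      assume s: "\<sigma> = -1"
      then show ?thesis using d(2) ph pos unfolding S.reach_le_1[OF s] by simp
    qed (use d ph in auto)
    ultimately show "\<sigma> * (fst q - up) > 0 \<and> \<sigma> * (\<theta>p - snd q) > 0 \<and> fst q > 0 \<and> snd q > 0"
      using ph d gas_pos scal by (simp add: x pt_def)
  qed
  have fst_img: "fst ` \<Gamma> = {0<..<up}" if s: "\<sigma> = -1"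
  proof -
    have "B.dom = {0<..<1}" unfolding B.dom_def S.reach_le_1[OF s] using s by auto
    then have "fst ` \<Gamma> = (\<lambda>x. up * (1 - x)) ` {0<..<1}" unfolding \<Gamma>_def image_image pt_def using s by simp
    also have "\<dots> = {0<..<up}"
    proof (intro equalityI subsetI)
      fix u assume "u \<in> {0<..<up}"
      then show "u \<in> (\<lambda>x. up * (1 - x)) ` {0<..<1}" by (intro image_eqI[of _ _ "1 - u / up"]) auto
    next
      fix u assume "u \<in> (\<lambda>x. up * (1 - x)) ` {0<..<1}"
      then obtain x where x: "0 < x" "x < 1" "u = up * (1 - x)" by auto
      have "up * (1 - x) < up * 1" using x gas_pos by (intro mult_strict_left_mono) auto
      then show "u \<in> {0<..<up}" using x gas_pos by simp
    qed
    finally show ?thesis .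
  qed
  have snd_img: "snd ` \<Gamma> = {max 0 (alpha2 \<gamma> (mach R \<gamma> up \<theta>p) * \<theta>p)<..<\<theta>p}" if s: "\<sigma> = 1"
  proof -
    define lx where "lx = S.low (2 * e / (gg + 2))"
    have lx: "lx = (2 * e / (gg + 2)) * (2 * e / (gg + 2) + (1 - aa))"
      unfolding lx_def S.low_def using s by (simp add: power2_eq_square distrib_left mult.commute)
    have "snd ` \<Gamma> = (\<lambda>y. up\<^sup>2 / R * (aa - y)) ` (\<phi> ` B.dom)"
      unfolding \<Gamma>_def image_image pt_def using s by simp
    also have "\<phi> ` B.dom = {0<..<min aa lx}" unfolding lx_def by (rule B.phi_image[OF s])
    also have "(\<lambda>y. up\<^sup>2 / R * (aa - y)) ` {0<..<min aa lx} = {up\<^sup>2 / R * (aa - min aa lx)<..<up\<^sup>2 / R * aa}"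
    proof (intro equalityI subsetI)
      fix t assume t: "t \<in> {up\<^sup>2 / R * (aa - min aa lx)<..<up\<^sup>2 / R * aa}"
      define y where "y = aa - t / (up\<^sup>2 / R)"
      have cancel: "c \<noteq> 0 \<Longrightarrow> c * (aa - (aa - t / c)) = t" for c by simp
      have "up\<^sup>2 / R \<noteq> 0" by (rule less_imp_neq[OF scal, symmetric])
      then have ty: "t = up\<^sup>2 / R * (aa - y)" unfolding y_def by (rule cancel[symmetric])
      have 1: "up\<^sup>2 / R * (aa - min aa lx) < up\<^sup>2 / R * (aa - y)" "up\<^sup>2 / R * (aa - y) < up\<^sup>2 / R * aa"
        using t[unfolded ty] by (simp_all only: greaterThanLessThan_iff)
      have "aa - min aa lx < aa - y" by (rule mult_less_cancel_left_pos[OF scal, THEN iffD1, OF 1(1)])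
      moreover have "aa - y < aa" by (rule mult_less_cancel_left_pos[OF scal, THEN iffD1, OF 1(2)])
      ultimately have "y > 0" "y < min aa lx" by linarith+
      then show "t \<in> (\<lambda>y. up\<^sup>2 / R * (aa - y)) ` {0<..<min aa lx}" using ty by (intro image_eqI[of _ _ y]) auto
    next
      fix t assume "t \<in> (\<lambda>y. up\<^sup>2 / R * (aa - y)) ` {0<..<min aa lx}"
      then obtain y where y: "0 < y" "y < min aa lx" "t = up\<^sup>2 / R * (aa - y)" by auto
      have "up\<^sup>2 / R * (aa - min aa lx) < up\<^sup>2 / R * (aa - y)" "up\<^sup>2 / R * (aa - y) < up\<^sup>2 / R * aa"
        using y by (intro mult_strict_left_mono[OF _ scal]; simp)+
      then show "t \<in> {up\<^sup>2 / R * (aa - min aa lx)<..<up\<^sup>2 / R * aa}" using y(3) by simp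
    qed
    \<comment> \<open>The first entry of the minimum corresponds to vanishing temperature, the
      second to the second equilibrium.\<close>
    also have "up\<^sup>2 / R * (aa - min aa lx) = max 0 (up\<^sup>2 / R * (aa - lx))"
    proof (cases "aa \<le> lx")
      case True
      then have "up\<^sup>2 / R * (aa - lx) \<le> 0" using scal by (intro mult_nonneg_nonpos) auto
      then show ?thesis using True by simp
    next
      case False
      then have "up\<^sup>2 / R * (aa - lx) \<ge> 0" using scal by (intro mult_nonneg_nonneg) auto
      then show ?thesis using False by (simp add: max_def)
    qed
    finally show ?thesis unfolding temp_eq alpha2_eq lx .
  qed
  \<comment> \<open>Smoothness up to the boundary comes from the decay estimates, since these
    provide derivatives of every order on the closed half line.\<close>
  have smooth: "smooth_within {0..} (\<lambda>t. c * (d + X t)) \<and> smooth_within {0..} (\<lambda>t. c * (d + Y t))"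
    if oo: "orbit X Y" "B.on_branch X Y" for X Y c d
  proof (cases "e > 0")
    case True
    obtain k where k0: "k > 0" and kk: "\<forall>N. decays (\<lambda>j t. if j = 0 then 1 else exp (- k * t)) N 1 X \<and>
        decays (\<lambda>j t. if j = 0 then 1 else exp (- k * t)) N 1 Y"
      using B.exponential_decay[OF oo True] by blast
    note k = k0 kk[THEN spec, THEN conjunct1] kk[THEN spec, THEN conjunct2]
    have w: "decay_weight (\<lambda>j t. if j = 0 then 1 else exp (- k * t))" by (rule decay_weight_exp) (use k in simp)
    show ?thesis
      by (intro conjI smooth_affine_if_decays[OF w k(2)] smooth_affine_if_decays[OF w k(3)]) (use k(1) in auto)
  next
    case False
    then have e0: "e = 0" using assms by simp
    note k = B.algebraic_decay[OF oo e0]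
    show ?thesis
      by (intro conjI smooth_affine_if_decays[OF decay_weight_power conjunct1[OF k]]
          smooth_affine_if_decays[OF decay_weight_power conjunct2[OF k]])
        (intro divide_left_mono power_increasing mult_pos_pos zero_less_power; simp)+
  qed
  have exists: "\<exists>V U \<Theta>. BL vm um \<theta>m V U \<Theta>" if h: "vm > 0 \<and> um / vm = up / vp \<and> (um, \<theta>m) \<in> \<Gamma>" for vm um \<theta>m
  proof -
    obtain x where x: "x \<in> B.dom" "um = up * (1 + \<sigma> * x)" "\<theta>m = up\<^sup>2 / R * (aa - \<sigma> * \<phi> x)"
      using h by (auto simp: \<Gamma>_def pt_def)
    obtain X Y where XY: "orbit X Y" "B.on_branch X Y" "X 0 = \<sigma> * x" "Y 0 = - \<sigma> * \<phi> x"
      using B.ex_orbit_through[OF x(1)] by blast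
    have nz: "vm \<noteq> 0" "vp \<noteq> 0" and quot: "um / vm = up / vp" using h gas_pos by auto
    \<comment> \<open>The volume of the left state is determined by the common quotient of velocity
      and volume, so a point of the curve fixes the whole left state.\<close>
    have "um * vp = up * vm" using quot unfolding frac_eq_eq[OF nz] .
    then have "up * (vp * (1 + X 0)) = up * vm" unfolding x(2) XY(3) by (simp only: mult_ac)
    then have vm: "vm = vp * (1 + X 0)" by (metis gas_pos(6) less_irrefl mult_left_cancel)
    have X0: "X 0 \<noteq> 0"
    proof
      assume "X 0 = 0"
      then have "x = \<sigma> * 0" using s2(2)[of x] unfolding XY(3) by metis
      then show False using domD(1)[OF x(1)] by simp
    qed
    have m: "um = up * (1 + X 0)" "\<theta>m = up\<^sup>2 / R * (aa + Y 0)" unfolding x(2,3) XY(3,4) by simp_all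
    have "BL vm um \<theta>m (\<lambda>t. vp * (1 + X t)) (\<lambda>t. up * (1 + X t)) (\<lambda>t. up\<^sup>2 / R * (aa + Y t))"
    proof (rule orbit_imp_BL[OF XY(1) _ _ _ _ vm])
      show "X 0 \<noteq> 0" by (rule X0)
      show "um = up * (1 + X 0)" "\<theta>m = up\<^sup>2 / R * (aa + Y 0)" by (rule m)+
      show "smooth_within {0..} (\<lambda>t. vp * (1 + X t))" "smooth_within {0..} (\<lambda>t. up * (1 + X t))"
        by (rule smooth[OF XY(1,2), THEN conjunct1])+
      show "smooth_within {0..} (\<lambda>t. up\<^sup>2 / R * (aa + Y t))"
        by (rule smooth[OF XY(1,2), THEN conjunct2])
    qed
    then show ?thesis by (intro exI)
  qed
  have props: "(um, \<theta>m) \<in> \<Gamma> \<and>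
        (\<forall>\<xi>\<ge>0. \<sigma> * d_xi V \<xi> < 0 \<and> \<sigma> * d_xi U \<xi> < 0 \<and> \<sigma> * d_xi \<Theta> \<xi> > 0) \<and>
        (e > 0 \<longrightarrow> (\<exists>c>0. \<forall>n. \<exists>C>0. \<forall>\<xi>>0.
            norm (nderiv_within {0..} n (perturbation (vp, up, \<theta>p) V U \<Theta>) \<xi>) \<le> C * exp (- c * \<xi>))) \<and>
        (e = 0 \<longrightarrow> (\<forall>n. \<exists>C>0. \<forall>\<xi>>0.
            norm (nderiv_within {0..} n (perturbation (vp, up, \<theta>p) V U \<Theta>) \<xi>) \<le> C / (1 + \<xi>) ^ (n + 1)))"
    if h: "vm > 0 \<and> um > 0 \<and> BL vm um \<theta>m V U \<Theta> \<and> sideBL \<sigma> U \<Theta>" for vm um \<theta>m V U \<Theta>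
  proof -
    from h have bl: "BL vm um \<theta>m V U \<Theta>" and left: "vm > 0" "um > 0" and sd: "sideBL \<sigma> U \<Theta>" by auto
    define X Y where "X = XX U" and "Y = YY \<Theta>"
    note O = BL_imp_orbit[OF bl left, folded X_def Y_def]
    have sgn: "\<sigma> * X t > 0" "\<sigma> * (Y t - nullF (X t)) < 0" "\<sigma> * (Y t - nullG (X t)) > 0" if "t \<ge> 0" for t
      using sd that unfolding sideBL_def X_def Y_def by auto
    have ob: "B.on_branch X Y" by (rule B.orbit_on_branch[OF O(2) sgn])
    have init: "um = U 0" "\<theta>m = \<Theta> 0" using bl by (auto simp: boundary_layer_solution_def Let_def)
    have dm: "\<sigma> * X 0 \<in> B.dom" and y0: "- \<sigma> * Y 0 = \<phi> (\<sigma> * X 0)" using ob by (auto simp: B.on_branch_def)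
    have "\<sigma> * \<phi> (\<sigma> * X 0) = - Y 0" unfolding y0[symmetric] using s2(2)[of "Y 0"] by simp
    then have "(um, \<theta>m) = pt (\<sigma> * X 0)" unfolding init O(5)[of 0] O(6)[of 0] pt_def using s2(2)[of "X 0"] by simp
    then have mem: "(um, \<theta>m) \<in> \<Gamma>" unfolding \<Gamma>_def using imageI[OF dm, of pt] by simp
    have dX: "(X has_real_derivative mm * (Y t - nullF (X t))) (at t within {0..})"
      and dY: "(Y has_real_derivative nn * (1 + X t) * (Y t - nullG (X t))) (at t within {0..})" and X1: "X t > -1" if "t \<ge> 0" for t
      using O(2) that by (auto simp: orbit_def)
    have signs: "\<sigma> * d_xi V t < 0 \<and> \<sigma> * d_xi U t < 0 \<and> \<sigma> * d_xi \<Theta> t > 0" if t: "t \<ge> 0" for t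
    proof -
      have lin: "d_xi f t = c * D" if "\<And>t. t \<ge> 0 \<Longrightarrow> f t = c * (b + Z t)" "(Z has_real_derivative D) (at t within {0..})" for f Z c b D
      proof -
        have "d_xi f t = d_xi (\<lambda>t. c * (b + Z t)) t" by (rule vector_derivative_within_cong) (use that t in auto)
        also have "\<dots> = c * D" by (rule d_xi_eq[OF _ t]) (use that(2) in \<open>auto intro!: derivative_eq_intros\<close>)
        finally show ?thesis .
      qed
      have "\<sigma> * d_xi V t = vp * mm * (\<sigma> * (Y t - nullF (X t)))" using lin[OF O(4) dX[OF t]] by simp
      moreover have "\<sigma> * d_xi U t = up * mm * (\<sigma> * (Y t - nullF (X t)))" using lin[OF O(5) dX[OF t]] by simp
      moreover have "\<sigma> * d_xi \<Theta> t = up\<^sup>2 / R * nn * (1 + X t) * (\<sigma> * (Y t - nullG (X t)))" using lin[OF O(6) dY[OF t]] by simp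
      moreover have "up\<^sup>2 / R * nn * (1 + X t) > 0" using scal pos X1[OF t] by (intro mult_pos_pos) auto
      moreover have "vp * mm > 0" "up * mm > 0" using gas_pos pos by auto
      ultimately show ?thesis using sgn[OF t] by (simp only: mult_pos_neg mult_pos_pos)
    qed
    define pert where "pert = perturbation (vp, up, \<theta>p) V U \<Theta>"
    \<comment> \<open>The perturbation is a combination of two fixed vectors with coefficients
      \<open>X\<close> and \<open>Y\<close>, because volume and velocity are proportional.\<close>
    have pert_eq: "X t *\<^sub>R (vp, up, 0) + Y t *\<^sub>R (0, 0, up\<^sup>2 / R) = pert t" if "t \<ge> 0" for t
    proof -
      have "\<Theta> t = \<theta>p + up\<^sup>2 / R * Y t" unfolding O(6)[of t] by (simp only: distrib_left temp_eq)
      then show ?thesis unfolding pert_def perturbation_def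
        using O(4)[OF that] O(5)[of t] by (simp add: algebra_simps)
    qed
    have pert_decays: "decays w N 1 pert" if w: "decay_weight w" "decays w N 1 X" "decays w N 1 Y" for w N
    proof -
      interpret decay_weight w by fact
      have "decays w N (1 + 0) (\<lambda>t. X t *\<^sub>R (vp, up, 0::real))" "decays w N (1 + 0) (\<lambda>t. Y t *\<^sub>R (0::real, 0::real, up\<^sup>2 / R))"
        by (intro decays_scaleR w decays_const)+
      then have "decays w N 1 (\<lambda>t. X t *\<^sub>R (vp, up, 0) + Y t *\<^sub>R (0, 0, up\<^sup>2 / R))" by (intro decays_add) auto
      then show ?thesis by (rule decays_cong[rotated]) (rule pert_eq)
    qed
    have ex: "\<exists>c>0. \<forall>n. \<exists>C>0. \<forall>\<xi>>0. norm (nderiv_within {0..} n pert \<xi>) \<le> C * exp (- c * \<xi>)" if e: "e > 0"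
    proof -
      obtain k where k0: "k > 0" and kk: "\<forall>N. decays (\<lambda>j t. if j = 0 then 1 else exp (- k * t)) N 1 X \<and>
          decays (\<lambda>j t. if j = 0 then 1 else exp (- k * t)) N 1 Y"
        using B.exponential_decay[OF O(2) ob e] by blast
      note k = k0 kk[THEN spec, THEN conjunct1] kk[THEN spec, THEN conjunct2]
      interpret w: decay_weight "\<lambda>j t. if j = 0 then 1 else exp (- k * t)" by (rule decay_weight_exp) (use k in simp)
      have each: "\<exists>C>0. \<forall>\<xi>>0. norm (nderiv_within {0..} n pert \<xi>) \<le> C * exp (- k * \<xi>)" for n
      proof -
        obtain C where "C > 0" "\<forall>t\<ge>0. norm (nderiv_within {0..} n pert t) \<le> C * (if 1 + n = 0 then 1 else exp (- k * t))"
          using w.nderiv_within_if_decays[OF pert_decays[OF w.decay_weight_axioms k(2,3)]] by blast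
        then show ?thesis by (intro exI[of _ C]) auto
      qed
      show ?thesis by (rule exI[of _ k], rule conjI[OF k0], rule allI, rule each)
    qed
    have al: "\<exists>C>0. \<forall>\<xi>>0. norm (nderiv_within {0..} n pert \<xi>) \<le> C / (1 + \<xi>) ^ (n + 1)" if e: "e = 0" for n
    proof -
      note k = B.algebraic_decay[OF O(2) ob e]
      interpret w: decay_weight "\<lambda>k (t::real). 1 / (1 + t) ^ k" by (rule decay_weight_power)
      obtain C where "C > 0" "\<forall>t\<ge>0. norm (nderiv_within {0..} n pert t) \<le> C * (1 / (1 + t) ^ (1 + n))"
        using w.nderiv_within_if_decays[OF pert_decays[OF w.decay_weight_axioms conjunct1[OF k] conjunct2[OF k]]] by blast
      then show ?thesis by (intro exI[of _ C]) auto
    qed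
    show ?thesis unfolding pert_def[symmetric]
    proof (rule conjI[OF mem conjI[OF _ conjI]])
      show "\<forall>\<xi>\<ge>0. \<sigma> * d_xi V \<xi> < 0 \<and> \<sigma> * d_xi U \<xi> < 0 \<and> \<sigma> * d_xi \<Theta> \<xi> > 0"
        by (rule allI, rule impI, rule signs)
      show "e > 0 \<longrightarrow> (\<exists>c>0. \<forall>n. \<exists>C>0. \<forall>\<xi>>0. norm (nderiv_within {0..} n pert \<xi>) \<le> C * exp (- c * \<xi>))"
        by (rule impI, rule ex)
      show "e = 0 \<longrightarrow> (\<forall>n. \<exists>C>0. \<forall>\<xi>>0. norm (nderiv_within {0..} n pert \<xi>) \<le> C / (1 + \<xi>) ^ (n + 1))"
        by (rule impI, rule allI, rule al)
    qed
  qed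
  have "good_curve \<sigma> \<Gamma>"
    unfolding good_curve_def
  proof (intro conjI)
    show "\<exists>zc k. 0 < zc \<and> k \<noteq> 0 \<and> nn * (1 - zc) = mm * zc * (1 - aa + e * zc) \<and>
        (\<exists>G. parametrizes_from G (up, \<theta>p) \<Gamma> \<and> vector_derivative G (at 0) = (up * k, - (up\<^sup>2 / R * (k * (1 - aa + e * zc)))))"
      by (rule exI[of _ zc], rule exI[of _ "\<sigma> * r"], intro conjI exI[of _ G] par vd zc B.zc(1)) (use r assms(2) in auto)
    show "\<sigma> = -1 \<longrightarrow> fst ` \<Gamma> = {0<..<up}" using fst_img by blast
    show "\<sigma> = 1 \<longrightarrow> snd ` \<Gamma> = {max 0 (alpha2 \<gamma> (mach R \<gamma> up \<theta>p) * \<theta>p)<..<\<theta>p}" using snd_img by blast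
    show "\<forall>vm um \<theta>m. vm > 0 \<and> um / vm = up / vp \<and> (um, \<theta>m) \<in> \<Gamma> \<longrightarrow> (\<exists>V U \<Theta>. BL vm um \<theta>m V U \<Theta>)"
      by (rule allI, rule allI, rule allI, rule impI, rule exists)
    show "monotone_curve \<Gamma>" by (rule mono)
    show "\<forall>q\<in>\<Gamma>. \<sigma> * (fst q - up) > 0 \<and> \<sigma> * (\<theta>p - snd q) > 0 \<and> fst q > 0 \<and> snd q > 0" by (rule quad)
  qed (rule allI, rule allI, rule allI, rule allI, rule allI, rule allI, rule impI, rule props)
  then show ?thesis by blast
qed

end

section \<open>Tangent lines and uniqueness of the curves\<close>

context gas
begin

lemma good_curveD:
  assumes "good_curve \<sigma> \<Gamma>"
  shows "\<exists>zc k. 0 < zc \<and> k \<noteq> 0 \<and> nn * (1 - zc) = mm * zc * (1 - aa + e * zc) \<and>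
        (\<exists>G. parametrizes_from G (up, \<theta>p) \<Gamma> \<and> vector_derivative G (at 0) = (up * k, - (up\<^sup>2 / R * (k * (1 - aa + e * zc)))))"
    and "monotone_curve \<Gamma>"
    and "\<And>q. q \<in> \<Gamma> \<Longrightarrow> \<sigma> * (fst q - up) > 0 \<and> \<sigma> * (\<theta>p - snd q) > 0 \<and> fst q > 0 \<and> snd q > 0"
    and "\<sigma> = -1 \<Longrightarrow> fst ` \<Gamma> = {0<..<up}"
    and "\<sigma> = 1 \<Longrightarrow> snd ` \<Gamma> = {max 0 (alpha2 \<gamma> (mach R \<gamma> up \<theta>p) * \<theta>p)<..<\<theta>p}"
    and "\<And>vm um \<theta>m. vm > 0 \<Longrightarrow> um / vm = up / vp \<Longrightarrow> (um, \<theta>m) \<in> \<Gamma> \<Longrightarrow> \<exists>V U \<Theta>. BL vm um \<theta>m V U \<Theta>"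
    and "\<And>vm um \<theta>m V U \<Theta>. vm > 0 \<Longrightarrow> um > 0 \<Longrightarrow> BL vm um \<theta>m V U \<Theta> \<Longrightarrow> sideBL \<sigma> U \<Theta> \<Longrightarrow>
        (um, \<theta>m) \<in> \<Gamma> \<and>
        (\<forall>\<xi>\<ge>0. \<sigma> * d_xi V \<xi> < 0 \<and> \<sigma> * d_xi U \<xi> < 0 \<and> \<sigma> * d_xi \<Theta> \<xi> > 0) \<and>
        (e > 0 \<longrightarrow> (\<exists>c>0. \<forall>n. \<exists>C>0. \<forall>\<xi>>0.
            norm (nderiv_within {0..} n (perturbation (vp, up, \<theta>p) V U \<Theta>) \<xi>) \<le> C * exp (- c * \<xi>))) \<and>
        (e = 0 \<longrightarrow> (\<forall>n. \<exists>C>0. \<forall>\<xi>>0.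
            norm (nderiv_within {0..} n (perturbation (vp, up, \<theta>p) V U \<Theta>) \<xi>) \<le> C / (1 + \<xi>) ^ (n + 1)))"
  using assms unfolding good_curve_def by simp_all

text \<open>Every (u, \<theta>) with positive entries occurs with a volume satisfying the quotient
  condition, namely \<open>u * vp / up\<close>; so the existence predicate \<open>Q\<close>
  determines membership in the curve.\<close>

lemma curve_unique:
  fixes A B :: "(real \<times> real) set"
  assumes A: "\<And>vm um \<theta>m. vm > 0 \<Longrightarrow> um > 0 \<Longrightarrow> \<theta>m > 0 \<Longrightarrow> Q vm um \<theta>m \<longleftrightarrow> (um, \<theta>m) \<in> A \<and> um / vm = up / vp"
    and B: "\<And>vm um \<theta>m. vm > 0 \<Longrightarrow> um > 0 \<Longrightarrow> \<theta>m > 0 \<Longrightarrow> Q vm um \<theta>m \<longleftrightarrow> (um, \<theta>m) \<in> B \<and> um / vm = up / vp"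
    and posA: "\<And>q. q \<in> A \<Longrightarrow> fst q > 0 \<and> snd q > 0" and posB: "\<And>q. q \<in> B \<Longrightarrow> fst q > 0 \<and> snd q > 0"
  shows "A = B"
proof -
  have *: "(u, \<theta>) \<in> A \<longleftrightarrow> (u, \<theta>) \<in> B" if "u > 0" "\<theta> > 0" for u \<theta>
  proof -
    have v: "u * vp / up > 0" "u / (u * vp / up) = up / vp" using that gas_pos by auto
    show ?thesis using A[OF v(1) that] B[OF v(1) that] v(2) by blast
  qed
  show ?thesis
  proof (rule Set.set_eqI)
    fix q :: "real \<times> real"
    show "q \<in> A \<longleftrightarrow> q \<in> B" using *[of "fst q" "snd q"] posA[of q] posB[of q] by (metis prod.collapse)
  qed
qed

lemma tangent_if_good:
  assumes good: "good_curve \<sigma> \<Gamma>" and "\<beta> \<noteq> 0"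
    and dir: "\<And>zc. 0 < zc \<Longrightarrow> nn * (1 - zc) = mm * zc * (1 - aa + e * zc) \<Longrightarrow> \<alpha> * R = \<beta> * (up * (1 - aa + e * zc))"
  shows "smooth_curve_from (up, \<theta>p) \<Gamma>"
    "tangent_at_endpoint (up, \<theta>p) \<Gamma> {(u, \<theta>). \<alpha> * (u - up) + \<beta> * (\<theta> - \<theta>p) = 0}"
proof -
  obtain zc k G where z: "0 < zc" "k \<noteq> 0" "nn * (1 - zc) = mm * zc * (1 - aa + e * zc)"
    and G: "parametrizes_from G (up, \<theta>p) \<Gamma>" "vector_derivative G (at 0) = (up * k, - (up\<^sup>2 / R * (k * (1 - aa + e * zc))))"
    using good_curveD(1)[OF good] by blast
  show "smooth_curve_from (up, \<theta>p) \<Gamma>" using G(1) unfolding smooth_curve_from_def by blast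
  have "\<alpha> * (up * k) + \<beta> * - (up\<^sup>2 / R * (k * s)) = up * k / R * (\<alpha> * R - \<beta> * (up * s))" for s
    using gas_pos by (simp add: field_simps power2_eq_square)
  then have "\<alpha> * (up * k) + \<beta> * - (up\<^sup>2 / R * (k * (1 - aa + e * zc))) = 0" using dir[OF z(1,3)] by simp
  moreover have "up * k \<noteq> 0" using gas_pos z by simp
  ultimately have "{(u, \<theta>). \<alpha> * (u - up) + \<beta> * (\<theta> - \<theta>p) = 0} = range (\<lambda>s. (up, \<theta>p) + s *\<^sub>R vector_derivative G (at 0))"
    unfolding G(2) using assms(2) by (rule line_as_range)
  then show "tangent_at_endpoint (up, \<theta>p) \<Gamma> {(u, \<theta>). \<alpha> * (u - up) + \<beta> * (\<theta> - \<theta>p) = 0}"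
    unfolding tangent_at_endpoint_def using G(1) by blast
qed

text \<open>The matrix has the same trace and determinant as the linearised planar system. Under
  \<lambda> = - mm e zc its characteristic equation becomes the quadratic equation of
  \<open>zc\<close>; the second root \<open>l1\<close> is read off from the trace and is positive
  because the determinant is negative.\<close>

lemma lambda2_eq:
  assumes "e > 0" "0 < zc" "nn * (1 - zc) = mm * zc * (1 - aa + e * zc)"
  shows "lambda2 R \<gamma> \<mu> \<kappa> up \<theta>p = - (mm * e * zc)"
proof -
  define M2 where "M2 = (mach R \<gamma> up \<theta>p)\<^sup>2"
  have M2: "M2 * \<gamma> = 1 / aa" using gas_pos pos by (simp add: M2_def mach_sq)
  define l0 l1 where "l0 = - (mm * e * zc)" and "l1 = mm * (1 - aa) + nn + mm * e * zc"
  have prod: "l0 * l1 = - (mm * nn * e)"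
  proof -
    have "l0 * l1 = - (mm * e * (mm * zc * (1 - aa + e * zc) + nn * zc))" by (simp add: l0_def l1_def algebra_simps)
    also have "\<dots> = - (mm * e * nn)" unfolding assms(3)[symmetric] by (simp add: algebra_simps)
    finally show ?thesis by (simp add: mult_ac)
  qed
  have ev: "eigenvalue (matrix_A R \<gamma> \<mu> \<kappa> up \<theta>p) l \<longleftrightarrow> (l - l0) * (l - l1) = 0" for l
  proof -
    have p: "(M2 * \<gamma> - 1) * up / (M2 * \<gamma> * \<mu>) = mm * (1 - aa)"
      unfolding M2 mm_def using gas_pos pos by (simp add: field_simps)
    have r: "up\<^sup>2 / (M2 * \<gamma> * \<kappa>) = up\<^sup>2 * aa / \<kappa>" unfolding M2 using pos by simp
    have "eigenvalue (matrix_A R \<gamma> \<mu> \<kappa> up \<theta>p) l \<longleftrightarrow> (mm * (1 - aa) - l) * (nn - l) - R / \<mu> * (up\<^sup>2 * aa / \<kappa>) = 0"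
      unfolding matrix_A_def Let_def M2_def[symmetric] p r nn_def[symmetric]
      by (rule eigenvalue_2x2) (use gas_pos in simp)
    also have "R / \<mu> * (up\<^sup>2 * aa / \<kappa>) = mm * nn * (gg * aa)"
      using gas_pos by (simp add: mm_def nn_def gg_def power2_eq_square)
    also have "(mm * (1 - aa) - l) * (nn - l) - mm * nn * (gg * aa) = (l - l0) * (l - l1)"
    proof -
      have "(l - l0) * (l - l1) = l * l - l * (l0 + l1) + l0 * l1" by (simp add: algebra_simps)
      also have "l0 + l1 = mm * (1 - aa) + nn" by (simp add: l0_def l1_def)
      also have "l * l - l * (mm * (1 - aa) + nn) + l0 * l1 = (mm * (1 - aa) - l) * (nn - l) - mm * nn * (gg * aa)"
        unfolding prod by (simp add: e_def algebra_simps)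
      finally show ?thesis by simp
    qed
    finally show ?thesis .
  qed
  have l0: "l0 < 0" using assms pos by (simp add: l0_def)
  have "mm * nn * e > 0" using pos assms by simp
  then have "l0 * l1 < 0" using prod by simp
  then have l1: "l1 > 0" using l0 by (simp add: mult_less_0_iff)
  show ?thesis unfolding lambda2_def
  proof (rule the_equality)
    show "eigenvalue (matrix_A R \<gamma> \<mu> \<kappa> up \<theta>p) (- (mm * e * zc)) \<and> - (mm * e * zc) < 0"
      using ev[of l0] l0 by (simp add: l0_def)
    fix l assume "eigenvalue (matrix_A R \<gamma> \<mu> \<kappa> up \<theta>p) l \<and> l < 0"
    then have "(l - l0) * (l - l1) = 0" "l < 0" using ev by auto
    then show "l = - (mm * e * zc)" using l1 by (auto simp: l0_def)
  qed
qed

theorem transonic: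
  assumes e0: "e = 0"
  shows "\<exists>!\<Sigma>. smooth_curve_from (up, \<theta>p) \<Sigma> \<and>
          monotone_curve \<Sigma> \<and>
          (\<forall>(u, \<theta>)\<in>\<Sigma>. 0 < u \<and> u < up \<and> 0 < \<theta>p \<and> \<theta>p < \<theta>) \<and>
          tangent_at_endpoint (up, \<theta>p) \<Sigma>
            {(u, \<theta>). (\<gamma> - 1) * up * (u - up) + R * \<gamma> * (\<theta> - \<theta>p) = 0} \<and>
          (\<forall>v\<^sub>m>0. \<forall>u\<^sub>m>0. \<forall>\<theta>\<^sub>m>0.
             ((\<exists>V U \<Theta>. BL v\<^sub>m u\<^sub>m \<theta>\<^sub>m V U \<Theta>)
                \<longleftrightarrow> (u\<^sub>m, \<theta>\<^sub>m) \<in> \<Sigma> \<and> u\<^sub>m / v\<^sub>m = up / vp) \<and>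
             (\<forall>V U \<Theta>. BL v\<^sub>m u\<^sub>m \<theta>\<^sub>m V U \<Theta> \<longrightarrow>
                (\<forall>\<xi>\<ge>0. d_xi V \<xi> > 0 \<and> d_xi U \<xi> > 0 \<and> d_xi \<Theta> \<xi> < 0) \<and>
                (\<forall>n. \<exists>C>0. \<forall>\<xi>>0.
                   norm (nderiv_within {0..} n (perturbation (vp, up, \<theta>p) V U \<Theta>) \<xi>)
                     \<le> C / (1 + \<xi>) ^ (n + 1))))"
proof -
  obtain \<Gamma> where good: "good_curve (-1) \<Gamma>" using ex_good_curve[of "-1"] e0 by auto
  note D = good_curveD[OF good]
  have side: "sideBL (-1) U \<Theta>" if "BL vm um \<theta>m V U \<Theta>" "vm > 0" "um > 0" for vm um \<theta>m V U \<Theta>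
    using BL_side(2)[OF that] e0 by auto
  have iff: "(\<exists>V U \<Theta>. BL vm um \<theta>m V U \<Theta>) \<longleftrightarrow> (um, \<theta>m) \<in> \<Gamma> \<and> um / vm = up / vp" if v: "vm > 0" "um > 0" for vm um \<theta>m
  proof
    assume "\<exists>V U \<Theta>. BL vm um \<theta>m V U \<Theta>"
    then obtain V U \<Theta> where bl: "BL vm um \<theta>m V U \<Theta>" by (elim exE)
    show "(um, \<theta>m) \<in> \<Gamma> \<and> um / vm = up / vp"
      using D(7)[OF v bl side[OF bl v]] BL_imp_orbit(1)[OF bl v] by simp
  qed (use D(6)[OF v(1)] in simp)
  \<comment> \<open>For \<open>e = 0\<close> the endpoint slope reduces to \<open>1 - aa\<close>,
    independently of \<open>zc\<close>, and \<open>\<gamma> * aa\<close> equals 1.\<close>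
  have tang: "(\<gamma> - 1) * up * R = R * \<gamma> * (up * (1 - aa + e * zc))" for zc
  proof -
    have "\<gamma> * (1 - aa) = \<gamma> - 1" using gamma_aa e0 by (simp add: right_diff_distrib)
    then show ?thesis using e0 by (metis add.right_neutral mult.assoc mult.commute mult_zero_left)
  qed
  have "R * \<gamma> \<noteq> 0" using gas_pos by simp
  note T = tangent_if_good[OF good this tang]
  show ?thesis
  proof (rule ex1I[of _ \<Gamma>], intro conjI T D(2) allI impI)
    show "\<forall>(u, \<theta>)\<in>\<Gamma>. 0 < u \<and> u < up \<and> 0 < \<theta>p \<and> \<theta>p < \<theta>" using D(3) gas_pos by fastforce
  next
    fix vm um \<theta>m :: real assume "vm > 0" "um > 0"
    then show "(\<exists>V U \<Theta>. BL vm um \<theta>m V U \<Theta>) \<longleftrightarrow> (um, \<theta>m) \<in> \<Gamma> \<and> um / vm = up / vp" by (rule iff)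
  next
    fix vm um \<theta>m V U \<Theta> and \<xi> :: real
    assume "vm > 0" "um > 0" and bl: "BL vm um \<theta>m V U \<Theta>" and "\<xi> \<ge> 0"
    then show "d_xi V \<xi> > 0" "d_xi U \<xi> > 0" "d_xi \<Theta> \<xi> < 0"
      using D(7)[OF _ _ bl side[OF bl]] by auto
  next
    fix vm um \<theta>m V U \<Theta> and n :: nat
    assume "vm > 0" "um > 0" and bl: "BL vm um \<theta>m V U \<Theta>"
    then show "\<exists>C>0. \<forall>\<xi>>0. norm (nderiv_within {0..} n (perturbation (vp, up, \<theta>p) V U \<Theta>) \<xi>) \<le> C / (1 + \<xi>) ^ (n + 1)"
      using D(7)[OF _ _ bl side[OF bl]] e0 by simp
  next
    fix \<Sigma> assume P: "smooth_curve_from (up, \<theta>p) \<Sigma> \<and>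
          monotone_curve \<Sigma> \<and>
          (\<forall>(u, \<theta>)\<in>\<Sigma>. 0 < u \<and> u < up \<and> 0 < \<theta>p \<and> \<theta>p < \<theta>) \<and>
          tangent_at_endpoint (up, \<theta>p) \<Sigma>
            {(u, \<theta>). (\<gamma> - 1) * up * (u - up) + R * \<gamma> * (\<theta> - \<theta>p) = 0} \<and>
          (\<forall>v\<^sub>m>0. \<forall>u\<^sub>m>0. \<forall>\<theta>\<^sub>m>0.
             ((\<exists>V U \<Theta>. BL v\<^sub>m u\<^sub>m \<theta>\<^sub>m V U \<Theta>)
                \<longleftrightarrow> (u\<^sub>m, \<theta>\<^sub>m) \<in> \<Sigma> \<and> u\<^sub>m / v\<^sub>m = up / vp) \<and>
             (\<forall>V U \<Theta>. BL v\<^sub>m u\<^sub>m \<theta>\<^sub>m V U \<Theta> \<longrightarrow>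
                (\<forall>\<xi>\<ge>0. d_xi V \<xi> > 0 \<and> d_xi U \<xi> > 0 \<and> d_xi \<Theta> \<xi> < 0) \<and>
                (\<forall>n. \<exists>C>0. \<forall>\<xi>>0.
                   norm (nderiv_within {0..} n (perturbation (vp, up, \<theta>p) V U \<Theta>) \<xi>)
                     \<le> C / (1 + \<xi>) ^ (n + 1))))"
    show "\<Sigma> = \<Gamma>"
    proof (rule curve_unique[where Q="\<lambda>vm um \<theta>m. \<exists>V U \<Theta>. BL vm um \<theta>m V U \<Theta>"])
      show "(\<exists>V U \<Theta>. BL vm um \<theta>m V U \<Theta>) \<longleftrightarrow> (um, \<theta>m) \<in> \<Sigma> \<and> um / vm = up / vp"
        if "vm > 0" "um > 0" "\<theta>m > 0" for vm um \<theta>m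
        using P that by simp
      show "fst q > 0 \<and> snd q > 0" if "q \<in> \<Sigma>" for q
      proof -
        have "\<forall>(u, \<theta>)\<in>\<Sigma>. 0 < u \<and> u < up \<and> 0 < \<theta>p \<and> \<theta>p < \<theta>" using P by simp
        from bspec[OF this that] show ?thesis by (auto simp: case_prod_beta)
      qed
    qed (use iff D(3) in auto)
  qed
qed

theorem subsonic:
  assumes e: "e > 0"
  defines "M \<equiv> mach R \<gamma> up \<theta>p"
  defines "L \<equiv> {(u, \<theta>). up\<^sup>2 * (u - up)
                  + M\<^sup>2 * \<gamma> * \<kappa> * (R * up / (\<kappa> * (\<gamma> - 1)) - lambda2 R \<gamma> \<mu> \<kappa> up \<theta>p) * (\<theta> - \<theta>p) = 0}"
  shows "\<exists>!\<Gamma>. case \<Gamma> of (\<Gamma>\<^sub>1, \<Gamma>\<^sub>2) \<Rightarrow>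
          smooth_curve_from (up, \<theta>p) \<Gamma>\<^sub>1 \<and> smooth_curve_from (up, \<theta>p) \<Gamma>\<^sub>2 \<and>
          monotone_curve \<Gamma>\<^sub>1 \<and> monotone_curve \<Gamma>\<^sub>2 \<and>
          fst ` \<Gamma>\<^sub>1 = {0<..<up} \<and>
          snd ` \<Gamma>\<^sub>2 = {max 0 (alpha2 \<gamma> M * \<theta>p)<..<\<theta>p} \<and>
          tangent_at_endpoint (up, \<theta>p) \<Gamma>\<^sub>1 L \<and> tangent_at_endpoint (up, \<theta>p) \<Gamma>\<^sub>2 L \<and>
          (\<forall>v\<^sub>m>0. \<forall>u\<^sub>m>0. \<forall>\<theta>\<^sub>m>0.
             ((\<exists>V U \<Theta>. BL v\<^sub>m u\<^sub>m \<theta>\<^sub>m V U \<Theta>)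
                \<longleftrightarrow> (u\<^sub>m, \<theta>\<^sub>m) \<in> \<Gamma>\<^sub>1 \<union> \<Gamma>\<^sub>2 \<and> u\<^sub>m / v\<^sub>m = up / vp) \<and>
             (\<forall>V U \<Theta>. BL v\<^sub>m u\<^sub>m \<theta>\<^sub>m V U \<Theta> \<longrightarrow>
                ((u\<^sub>m, \<theta>\<^sub>m) \<in> \<Gamma>\<^sub>1 \<longrightarrow>
                   (\<forall>\<xi>\<ge>0. d_xi V \<xi> > 0 \<and> d_xi U \<xi> > 0 \<and> d_xi \<Theta> \<xi> < 0)) \<and>
                ((u\<^sub>m, \<theta>\<^sub>m) \<in> \<Gamma>\<^sub>2 \<longrightarrow>
                   (\<forall>\<xi>\<ge>0. d_xi V \<xi> < 0 \<and> d_xi U \<xi> < 0 \<and> d_xi \<Theta> \<xi> > 0)) \<and>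
                (\<exists>c>0. \<forall>n. \<exists>C>0. \<forall>\<xi>>0.
                   norm (nderiv_within {0..} n (perturbation (vp, up, \<theta>p) V U \<Theta>) \<xi>)
                     \<le> C * exp (- c * \<xi>))))"
    (is "\<exists>!\<Gamma>. case \<Gamma> of (\<Gamma>\<^sub>1, \<Gamma>\<^sub>2) \<Rightarrow> ?P \<Gamma>\<^sub>1 \<Gamma>\<^sub>2")
proof -
  obtain \<Gamma>1 where g1: "good_curve (-1) \<Gamma>1" using ex_good_curve[of "-1"] e by auto
  obtain \<Gamma>2 where g2: "good_curve 1 \<Gamma>2" using ex_good_curve[of 1] e by auto
  note D1 = good_curveD[OF g1] and D2 = good_curveD[OF g2]
  define \<beta> where "\<beta> = M\<^sup>2 * \<gamma> * \<kappa> * (R * up / (\<kappa> * (\<gamma> - 1)) - lambda2 R \<gamma> \<mu> \<kappa> up \<theta>p)"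
  have L: "L = {(u, \<theta>). up\<^sup>2 * (u - up) + \<beta> * (\<theta> - \<theta>p) = 0}" unfolding L_def \<beta>_def ..
  have M2: "M\<^sup>2 * \<gamma> = 1 / aa" using gas_pos pos by (simp add: M_def mach_sq)
  have \<beta>_eq: "\<beta> = \<kappa> / aa * (nn + mm * e * zc)" if "0 < zc" "nn * (1 - zc) = mm * zc * (1 - aa + e * zc)" for zc
    unfolding \<beta>_def M2 lambda2_eq[OF e that] nn_def[symmetric] by simp
  \<comment> \<open>Positivity means that the tangent line has negative slope, as needed later to
    place the curves in quadrants.\<close>
  have \<beta>_pos: "\<beta> > 0"
  proof -
    obtain zc where "0 < zc" "nn * (1 - zc) = mm * zc * (1 - aa + e * zc)" using D1(1) by blast
    then show ?thesis using \<beta>_eq[of zc] e pos gas_pos by (simp add: add_pos_pos)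
  qed
  \<comment> \<open>The equation for \<open>zc\<close> makes the product of
    \<open>nn + mm * e * zc\<close> and the endpoint slope equal to \<open>nn * (gg * aa)\<close>,
    in which \<open>zc\<close> no longer occurs.\<close>
  have dir: "up\<^sup>2 * R = \<beta> * (up * (1 - aa + e * zc))" if z: "0 < zc" "nn * (1 - zc) = mm * zc * (1 - aa + e * zc)" for zc
  proof -
    have "(nn + mm * e * zc) * (1 - aa + e * zc) = nn * (1 - aa + e * zc) + e * (mm * zc * (1 - aa + e * zc))"
      by (simp add: algebra_simps)
    also have "\<dots> = nn * (gg * aa)" unfolding z(2)[symmetric] by (simp add: e_def algebra_simps)
    finally have s: "(nn + mm * e * zc) * (1 - aa + e * zc) = nn * (gg * aa)" .
    have "\<beta> * (up * (1 - aa + e * zc)) = \<kappa> / aa * up * ((nn + mm * e * zc) * (1 - aa + e * zc))"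
      unfolding \<beta>_eq[OF z] by (simp only: mult_ac)
    also have "\<dots> = \<kappa> * up * (nn * gg)" unfolding s using pos by simp
    also have "\<dots> = up\<^sup>2 * R" using gas_pos by (simp add: nn_def gg_def power2_eq_square)
    finally show ?thesis by simp
  qed
  have \<beta>_ne: "\<beta> \<noteq> 0" using \<beta>_pos by simp
  note T1 = tangent_if_good[OF g1 \<beta>_ne dir, folded L] and T2 = tangent_if_good[OF g2 \<beta>_ne dir, folded L]
  have side: "sideBL (-1) U \<Theta> \<or> sideBL 1 U \<Theta>" if "BL vm um \<theta>m V U \<Theta>" "vm > 0" "um > 0" for vm um \<theta>m V U \<Theta>
    using BL_side(2)[OF that] by auto
  have iff: "(\<exists>V U \<Theta>. BL vm um \<theta>m V U \<Theta>) \<longleftrightarrow> (um, \<theta>m) \<in> \<Gamma>1 \<union> \<Gamma>2 \<and> um / vm = up / vp" if v: "vm > 0" "um > 0" for vm um \<theta>m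
  proof
    assume "\<exists>V U \<Theta>. BL vm um \<theta>m V U \<Theta>"
    then obtain V U \<Theta> where bl: "BL vm um \<theta>m V U \<Theta>" by (elim exE)
    from side[OF bl v] have "(um, \<theta>m) \<in> \<Gamma>1 \<union> \<Gamma>2"
      using D1(7)[OF v bl] D2(7)[OF v bl] by (elim disjE) simp_all
    then show "(um, \<theta>m) \<in> \<Gamma>1 \<union> \<Gamma>2 \<and> um / vm = up / vp" using BL_imp_orbit(1)[OF bl v] by simp
  next
    assume a: "(um, \<theta>m) \<in> \<Gamma>1 \<union> \<Gamma>2 \<and> um / vm = up / vp"
    then have "(um, \<theta>m) \<in> \<Gamma>1 \<or> (um, \<theta>m) \<in> \<Gamma>2" by simp
    then show "\<exists>V U \<Theta>. BL vm um \<theta>m V U \<Theta>"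
      by (elim disjE) (rule D1(6)[OF v(1)] D2(6)[OF v(1)]; use a in simp)+
  qed
  have q1: "fst q < up \<and> snd q > 0 \<and> fst q > 0" if "q \<in> \<Gamma>1" for q using D1(3)[OF that] by simp
  have q2: "fst q > up \<and> snd q > 0 \<and> fst q > 0" if "q \<in> \<Gamma>2" for q using D2(3)[OF that] by simp
  have fin: "((um, \<theta>m) \<in> \<Gamma>1 \<longrightarrow> (\<forall>\<xi>\<ge>0. d_xi V \<xi> > 0 \<and> d_xi U \<xi> > 0 \<and> d_xi \<Theta> \<xi> < 0)) \<and>
      ((um, \<theta>m) \<in> \<Gamma>2 \<longrightarrow> (\<forall>\<xi>\<ge>0. d_xi V \<xi> < 0 \<and> d_xi U \<xi> < 0 \<and> d_xi \<Theta> \<xi> > 0)) \<and>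
      (\<exists>c>0. \<forall>n. \<exists>C>0. \<forall>\<xi>>0. norm (nderiv_within {0..} n (perturbation (vp, up, \<theta>p) V U \<Theta>) \<xi>) \<le> C * exp (- c * \<xi>))"
    if v: "vm > 0" "um > 0" and bl: "BL vm um \<theta>m V U \<Theta>" for vm um \<theta>m V U \<Theta>
    using side[OF bl v]
  proof
    assume s: "sideBL (-1) U \<Theta>"
    note P = D1(7)[OF v bl s]
    have m: "(um, \<theta>m) \<in> \<Gamma>1" using P by simp
    then have "(um, \<theta>m) \<notin> \<Gamma>2" using q1[of "(um, \<theta>m)"] q2[of "(um, \<theta>m)"] by auto
    moreover have "\<forall>\<xi>\<ge>0. d_xi V \<xi> > 0 \<and> d_xi U \<xi> > 0 \<and> d_xi \<Theta> \<xi> < 0" using P by simp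
    moreover note P[THEN conjunct2, THEN conjunct2, THEN conjunct1, THEN mp, OF e]
    ultimately show ?thesis by simp
  next
    assume s: "sideBL 1 U \<Theta>"
    note P = D2(7)[OF v bl s]
    have m: "(um, \<theta>m) \<in> \<Gamma>2" using P by simp
    then have "(um, \<theta>m) \<notin> \<Gamma>1" using q1[of "(um, \<theta>m)"] q2[of "(um, \<theta>m)"] by auto
    moreover have "\<forall>\<xi>\<ge>0. d_xi V \<xi> < 0 \<and> d_xi U \<xi> < 0 \<and> d_xi \<Theta> \<xi> > 0" using P by simp
    moreover note P[THEN conjunct2, THEN conjunct2, THEN conjunct1, THEN mp, OF e]
    ultimately show ?thesis by simp
  qed
  have ex: "?P \<Gamma>1 \<Gamma>2"
    using T1 T2 D1(2) D2(2) D1(4) D2(5)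
    by (intro conjI allI impI iff fin) (simp_all add: M_def)
  \<comment> \<open>Existence of solutions determines only the union of the two curves; tangency and
    monotonicity are needed to tell which part is which.\<close>
  have uniq: "A1 = \<Gamma>1 \<and> A2 = \<Gamma>2" if P: "?P A1 A2" for A1 A2
  proof -
    have A: "monotone_curve A1" "monotone_curve A2" "fst ` A1 = {0<..<up}"
      "snd ` A2 = {max 0 (alpha2 \<gamma> M * \<theta>p)<..<\<theta>p}"
      "tangent_at_endpoint (up, \<theta>p) A1 L" "tangent_at_endpoint (up, \<theta>p) A2 L"
      using P by simp_all
    have iffA: "(\<exists>V U \<Theta>. BL vm um \<theta>m V U \<Theta>) \<longleftrightarrow> (um, \<theta>m) \<in> A1 \<union> A2 \<and> um / vm = up / vp"
      if "vm > 0" "um > 0" "\<theta>m > 0" for vm um \<theta>m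
    proof -
      note P[THEN conjunct2, THEN conjunct2, THEN conjunct2, THEN conjunct2, THEN conjunct2, THEN conjunct2,
          THEN conjunct2, THEN conjunct2]
      from this[rule_format, OF that] show ?thesis by (rule conjunct1)
    qed
    have up2: "up\<^sup>2 > 0" using gas_pos by simp
    have r1: "fst q \<in> {0<..<up}" if "q \<in> A1" for q using imageI[OF that, of fst] unfolding A(3) .
    have r2: "snd q \<in> {max 0 (alpha2 \<gamma> M * \<theta>p)<..<\<theta>p}" if "q \<in> A2" for q using imageI[OF that, of snd] unfolding A(4) .
    have h1: "\<forall>q\<in>A1. 1 * (up - fst q) > 0" using r1 by auto
    have h2: "\<forall>q\<in>A2. (-1) * (snd q - \<theta>p) > 0" using r2 by auto
    \<comment> \<open>The prescribed range gives the side of \<open>A1\<close> in velocity but that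
      of \<open>A2\<close> only in temperature; the quadrant argument supplies the other coordinate
      for each.\<close>
    have a1: "fst q < up \<and> fst q > 0 \<and> snd q > 0" if q: "q \<in> A1" for q
      using tangent_quadrant[OF A(5)[unfolded L] up2 \<beta>_pos A(1) _ disjI1[OF h1] q] r1[OF q] gas_pos by auto
    have a2: "fst q > up \<and> snd q > 0 \<and> fst q > 0" if q: "q \<in> A2" for q
      using tangent_quadrant[OF A(6)[unfolded L] up2 \<beta>_pos A(2) _ disjI2[OF h2] q] r2[OF q] gas_pos by auto
    have un: "A1 \<union> A2 = \<Gamma>1 \<union> \<Gamma>2"
    proof (rule curve_unique[where Q="\<lambda>vm um \<theta>m. \<exists>V U \<Theta>. BL vm um \<theta>m V U \<Theta>"])
      show "fst q > 0 \<and> snd q > 0" if "q \<in> A1 \<union> A2" for q using that a1[of q] a2[of q] by blast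
      show "fst q > 0 \<and> snd q > 0" if "q \<in> \<Gamma>1 \<union> \<Gamma>2" for q using that q1[of q] q2[of q] by blast
    qed (rule iffA iff; assumption)+
    \<comment> \<open>The velocity \<open>up\<close> separates the two curves of either pair, so the
      union splits in only one way.\<close>
    have "A1 = {q \<in> A1 \<union> A2. fst q < up}" using a1 a2 by force
    also have "\<dots> = \<Gamma>1" unfolding un using q1 q2 by force
    finally have "A1 = \<Gamma>1" .
    moreover have "A2 = {q \<in> A1 \<union> A2. fst q > up}" using a1 a2 by force
    then have "A2 = \<Gamma>2" unfolding un using q1 q2 by force
    ultimately show ?thesis by simp
  qed
  show ?thesis
  proof (rule ex1I[of _ "(\<Gamma>1, \<Gamma>2)"])
    show "case (\<Gamma>1, \<Gamma>2) of (\<Gamma>\<^sub>1, \<Gamma>\<^sub>2) \<Rightarrow> ?P \<Gamma>\<^sub>1 \<Gamma>\<^sub>2" unfolding prod.case by (rule ex)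
    fix A assume a: "case A of (\<Gamma>\<^sub>1, \<Gamma>\<^sub>2) \<Rightarrow> ?P \<Gamma>\<^sub>1 \<Gamma>\<^sub>2"
    obtain A1 A2 where A: "A = (A1, A2)" by (cases A)
    have "A1 = \<Gamma>1 \<and> A2 = \<Gamma>2" by (rule uniq[OF a[unfolded A prod.case]])
    then show "A = (\<Gamma>1, \<Gamma>2)" by (simp add: A)
  qed
qed

end

theorem theorem2p1:
  fixes R \<gamma> \<mu> \<kappa> v\<^sub>p u\<^sub>p \<theta>\<^sub>p :: real
  assumes "R > 0" and "\<gamma> > 1" and "\<mu> > 0" and "\<kappa> > 0"
    and "v\<^sub>p > 0" and "\<theta>\<^sub>p > 0"
  shows
    "(u\<^sub>p \<le> 0 \<longrightarrow>
       (\<forall>v\<^sub>m>0. \<forall>u\<^sub>m>0. \<forall>\<theta>\<^sub>m>0.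
          \<not> (\<exists>V U \<Theta>. boundary_layer_solution R \<gamma> \<mu> \<kappa> (v\<^sub>m, u\<^sub>m, \<theta>\<^sub>m) (v\<^sub>p, u\<^sub>p, \<theta>\<^sub>p) V U \<Theta>)))
     \<and>
     (u\<^sub>p > 0 \<and> mach R \<gamma> u\<^sub>p \<theta>\<^sub>p > 1 \<longrightarrow>
       (\<forall>v\<^sub>m>0. \<forall>u\<^sub>m>0. \<forall>\<theta>\<^sub>m>0.
          \<not> (\<exists>V U \<Theta>. boundary_layer_solution R \<gamma> \<mu> \<kappa> (v\<^sub>m, u\<^sub>m, \<theta>\<^sub>m) (v\<^sub>p, u\<^sub>p, \<theta>\<^sub>p) V U \<Theta>)))
     \<and>
     (u\<^sub>p > 0 \<and> mach R \<gamma> u\<^sub>p \<theta>\<^sub>p = 1 \<longrightarrow>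
       (\<exists>!\<Sigma>. smooth_curve_from (u\<^sub>p, \<theta>\<^sub>p) \<Sigma> \<and>
          monotone_curve \<Sigma> \<and>
          (\<forall>(u, \<theta>)\<in>\<Sigma>. 0 < u \<and> u < u\<^sub>p \<and> 0 < \<theta>\<^sub>p \<and> \<theta>\<^sub>p < \<theta>) \<and>
          tangent_at_endpoint (u\<^sub>p, \<theta>\<^sub>p) \<Sigma>
            {(u, \<theta>). (\<gamma> - 1) * u\<^sub>p * (u - u\<^sub>p) + R * \<gamma> * (\<theta> - \<theta>\<^sub>p) = 0} \<and>
          (\<forall>v\<^sub>m>0. \<forall>u\<^sub>m>0. \<forall>\<theta>\<^sub>m>0.
             ((\<exists>V U \<Theta>. boundary_layer_solution R \<gamma> \<mu> \<kappa> (v\<^sub>m, u\<^sub>m, \<theta>\<^sub>m) (v\<^sub>p, u\<^sub>p, \<theta>\<^sub>p) V U \<Theta>)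
                \<longleftrightarrow> (u\<^sub>m, \<theta>\<^sub>m) \<in> \<Sigma> \<and> u\<^sub>m / v\<^sub>m = u\<^sub>p / v\<^sub>p) \<and>
             (\<forall>V U \<Theta>. boundary_layer_solution R \<gamma> \<mu> \<kappa> (v\<^sub>m, u\<^sub>m, \<theta>\<^sub>m) (v\<^sub>p, u\<^sub>p, \<theta>\<^sub>p) V U \<Theta> \<longrightarrow>
                (\<forall>\<xi>\<ge>0. d_xi V \<xi> > 0 \<and> d_xi U \<xi> > 0 \<and> d_xi \<Theta> \<xi> < 0) \<and>
                (\<forall>n. \<exists>C>0. \<forall>\<xi>>0.
                   norm (nderiv_within {0..} n (perturbation (v\<^sub>p, u\<^sub>p, \<theta>\<^sub>p) V U \<Theta>) \<xi>)
                     \<le> C / (1 + \<xi>) ^ (n + 1))))))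
     \<and>
     (u\<^sub>p > 0 \<and> 0 < mach R \<gamma> u\<^sub>p \<theta>\<^sub>p \<and> mach R \<gamma> u\<^sub>p \<theta>\<^sub>p < 1 \<longrightarrow>
       (let M = mach R \<gamma> u\<^sub>p \<theta>\<^sub>p;
            L = {(u, \<theta>). u\<^sub>p\<^sup>2 * (u - u\<^sub>p)
                  + M\<^sup>2 * \<gamma> * \<kappa> * (R * u\<^sub>p / (\<kappa> * (\<gamma> - 1)) - lambda2 R \<gamma> \<mu> \<kappa> u\<^sub>p \<theta>\<^sub>p) * (\<theta> - \<theta>\<^sub>p) = 0}
        in \<exists>!\<Gamma>. case \<Gamma> of (\<Gamma>\<^sub>1, \<Gamma>\<^sub>2) \<Rightarrow>
          smooth_curve_from (u\<^sub>p, \<theta>\<^sub>p) \<Gamma>\<^sub>1 \<and> smooth_curve_from (u\<^sub>p, \<theta>\<^sub>p) \<Gamma>\<^sub>2 \<and>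
          monotone_curve \<Gamma>\<^sub>1 \<and> monotone_curve \<Gamma>\<^sub>2 \<and>
          fst ` \<Gamma>\<^sub>1 = {0<..<u\<^sub>p} \<and>
          snd ` \<Gamma>\<^sub>2 = {max 0 (alpha2 \<gamma> M * \<theta>\<^sub>p)<..<\<theta>\<^sub>p} \<and>
          tangent_at_endpoint (u\<^sub>p, \<theta>\<^sub>p) \<Gamma>\<^sub>1 L \<and> tangent_at_endpoint (u\<^sub>p, \<theta>\<^sub>p) \<Gamma>\<^sub>2 L \<and>
          (\<forall>v\<^sub>m>0. \<forall>u\<^sub>m>0. \<forall>\<theta>\<^sub>m>0.
             ((\<exists>V U \<Theta>. boundary_layer_solution R \<gamma> \<mu> \<kappa> (v\<^sub>m, u\<^sub>m, \<theta>\<^sub>m) (v\<^sub>p, u\<^sub>p, \<theta>\<^sub>p) V U \<Theta>)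
                \<longleftrightarrow> (u\<^sub>m, \<theta>\<^sub>m) \<in> \<Gamma>\<^sub>1 \<union> \<Gamma>\<^sub>2 \<and> u\<^sub>m / v\<^sub>m = u\<^sub>p / v\<^sub>p) \<and>
             (\<forall>V U \<Theta>. boundary_layer_solution R \<gamma> \<mu> \<kappa> (v\<^sub>m, u\<^sub>m, \<theta>\<^sub>m) (v\<^sub>p, u\<^sub>p, \<theta>\<^sub>p) V U \<Theta> \<longrightarrow>
                ((u\<^sub>m, \<theta>\<^sub>m) \<in> \<Gamma>\<^sub>1 \<longrightarrow>
                   (\<forall>\<xi>\<ge>0. d_xi V \<xi> > 0 \<and> d_xi U \<xi> > 0 \<and> d_xi \<Theta> \<xi> < 0)) \<and>
                ((u\<^sub>m, \<theta>\<^sub>m) \<in> \<Gamma>\<^sub>2 \<longrightarrow>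
                   (\<forall>\<xi>\<ge>0. d_xi V \<xi> < 0 \<and> d_xi U \<xi> < 0 \<and> d_xi \<Theta> \<xi> > 0)) \<and>
                (\<exists>c>0. \<forall>n. \<exists>C>0. \<forall>\<xi>>0.
                   norm (nderiv_within {0..} n (perturbation (v\<^sub>p, u\<^sub>p, \<theta>\<^sub>p) V U \<Theta>) \<xi>)
                     \<le> C * exp (- c * \<xi>))))))"
proof -
  have gas: "gas R \<gamma> \<mu> \<kappa> v\<^sub>p u\<^sub>p \<theta>\<^sub>p" if "u\<^sub>p > 0" by unfold_locales (use assms that in auto)
  show ?thesis
  proof (intro conjI impI)
    assume "u\<^sub>p \<le> 0"
    then show "\<forall>v\<^sub>m>0. \<forall>u\<^sub>m>0. \<forall>\<theta>\<^sub>m>0.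
          \<not> (\<exists>V U \<Theta>. boundary_layer_solution R \<gamma> \<mu> \<kappa> (v\<^sub>m, u\<^sub>m, \<theta>\<^sub>m) (v\<^sub>p, u\<^sub>p, \<theta>\<^sub>p) V U \<Theta>)"
      using BL_first_integrals(1)[OF _ assms(3,4) _ _ assms(5)] by fastforce
  next
    assume a: "u\<^sub>p > 0 \<and> mach R \<gamma> u\<^sub>p \<theta>\<^sub>p > 1"
    then interpret gas R \<gamma> \<mu> \<kappa> v\<^sub>p u\<^sub>p \<theta>\<^sub>p using gas by blast
    have "e < 0" using a mach_cases(1) by simp
    then show "\<forall>v\<^sub>m>0. \<forall>u\<^sub>m>0. \<forall>\<theta>\<^sub>m>0.
          \<not> (\<exists>V U \<Theta>. boundary_layer_solution R \<gamma> \<mu> \<kappa> (v\<^sub>m, u\<^sub>m, \<theta>\<^sub>m) (v\<^sub>p, u\<^sub>p, \<theta>\<^sub>p) V U \<Theta>)"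
      using BL_side(1) by fastforce
  next
    assume a: "u\<^sub>p > 0 \<and> mach R \<gamma> u\<^sub>p \<theta>\<^sub>p = 1"
    then interpret gas R \<gamma> \<mu> \<kappa> v\<^sub>p u\<^sub>p \<theta>\<^sub>p using gas by blast
    have e: "e = 0" using a mach_cases(2) by simp
    show "\<exists>!\<Sigma>. smooth_curve_from (u\<^sub>p, \<theta>\<^sub>p) \<Sigma> \<and>
          monotone_curve \<Sigma> \<and>
          (\<forall>(u, \<theta>)\<in>\<Sigma>. 0 < u \<and> u < u\<^sub>p \<and> 0 < \<theta>\<^sub>p \<and> \<theta>\<^sub>p < \<theta>) \<and>
          tangent_at_endpoint (u\<^sub>p, \<theta>\<^sub>p) \<Sigma>
            {(u, \<theta>). (\<gamma> - 1) * u\<^sub>p * (u - u\<^sub>p) + R * \<gamma> * (\<theta> - \<theta>\<^sub>p) = 0} \<and>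
          (\<forall>v\<^sub>m>0. \<forall>u\<^sub>m>0. \<forall>\<theta>\<^sub>m>0.
             ((\<exists>V U \<Theta>. boundary_layer_solution R \<gamma> \<mu> \<kappa> (v\<^sub>m, u\<^sub>m, \<theta>\<^sub>m) (v\<^sub>p, u\<^sub>p, \<theta>\<^sub>p) V U \<Theta>)
                \<longleftrightarrow> (u\<^sub>m, \<theta>\<^sub>m) \<in> \<Sigma> \<and> u\<^sub>m / v\<^sub>m = u\<^sub>p / v\<^sub>p) \<and>
             (\<forall>V U \<Theta>. boundary_layer_solution R \<gamma> \<mu> \<kappa> (v\<^sub>m, u\<^sub>m, \<theta>\<^sub>m) (v\<^sub>p, u\<^sub>p, \<theta>\<^sub>p) V U \<Theta> \<longrightarrow>
                (\<forall>\<xi>\<ge>0. d_xi V \<xi> > 0 \<and> d_xi U \<xi> > 0 \<and> d_xi \<Theta> \<xi> < 0) \<and>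
                (\<forall>n. \<exists>C>0. \<forall>\<xi>>0.
                   norm (nderiv_within {0..} n (perturbation (v\<^sub>p, u\<^sub>p, \<theta>\<^sub>p) V U \<Theta>) \<xi>)
                     \<le> C / (1 + \<xi>) ^ (n + 1))))"
      by (rule transonic[OF e])
  next
    assume a: "u\<^sub>p > 0 \<and> 0 < mach R \<gamma> u\<^sub>p \<theta>\<^sub>p \<and> mach R \<gamma> u\<^sub>p \<theta>\<^sub>p < 1"
    then interpret gas R \<gamma> \<mu> \<kappa> v\<^sub>p u\<^sub>p \<theta>\<^sub>p using gas by blast
    have e: "e > 0" using a mach_cases(3) by simp
    show "let M = mach R \<gamma> u\<^sub>p \<theta>\<^sub>p;
            L = {(u, \<theta>). u\<^sub>p\<^sup>2 * (u - u\<^sub>p)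
                  + M\<^sup>2 * \<gamma> * \<kappa> * (R * u\<^sub>p / (\<kappa> * (\<gamma> - 1)) - lambda2 R \<gamma> \<mu> \<kappa> u\<^sub>p \<theta>\<^sub>p) * (\<theta> - \<theta>\<^sub>p) = 0}
        in \<exists>!\<Gamma>. case \<Gamma> of (\<Gamma>\<^sub>1, \<Gamma>\<^sub>2) \<Rightarrow>
          smooth_curve_from (u\<^sub>p, \<theta>\<^sub>p) \<Gamma>\<^sub>1 \<and> smooth_curve_from (u\<^sub>p, \<theta>\<^sub>p) \<Gamma>\<^sub>2 \<and>
          monotone_curve \<Gamma>\<^sub>1 \<and> monotone_curve \<Gamma>\<^sub>2 \<and>
          fst ` \<Gamma>\<^sub>1 = {0<..<u\<^sub>p} \<and>
          snd ` \<Gamma>\<^sub>2 = {max 0 (alpha2 \<gamma> M * \<theta>\<^sub>p)<..<\<theta>\<^sub>p} \<and>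
          tangent_at_endpoint (u\<^sub>p, \<theta>\<^sub>p) \<Gamma>\<^sub>1 L \<and> tangent_at_endpoint (u\<^sub>p, \<theta>\<^sub>p) \<Gamma>\<^sub>2 L \<and>
          (\<forall>v\<^sub>m>0. \<forall>u\<^sub>m>0. \<forall>\<theta>\<^sub>m>0.
             ((\<exists>V U \<Theta>. boundary_layer_solution R \<gamma> \<mu> \<kappa> (v\<^sub>m, u\<^sub>m, \<theta>\<^sub>m) (v\<^sub>p, u\<^sub>p, \<theta>\<^sub>p) V U \<Theta>)
                \<longleftrightarrow> (u\<^sub>m, \<theta>\<^sub>m) \<in> \<Gamma>\<^sub>1 \<union> \<Gamma>\<^sub>2 \<and> u\<^sub>m / v\<^sub>m = u\<^sub>p / v\<^sub>p) \<and>
             (\<forall>V U \<Theta>. boundary_layer_solution R \<gamma> \<mu> \<kappa> (v\<^sub>m, u\<^sub>m, \<theta>\<^sub>m) (v\<^sub>p, u\<^sub>p, \<theta>\<^sub>p) V U \<Theta> \<longrightarrow>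
                ((u\<^sub>m, \<theta>\<^sub>m) \<in> \<Gamma>\<^sub>1 \<longrightarrow>
                   (\<forall>\<xi>\<ge>0. d_xi V \<xi> > 0 \<and> d_xi U \<xi> > 0 \<and> d_xi \<Theta> \<xi> < 0)) \<and>
                ((u\<^sub>m, \<theta>\<^sub>m) \<in> \<Gamma>\<^sub>2 \<longrightarrow>
                   (\<forall>\<xi>\<ge>0. d_xi V \<xi> < 0 \<and> d_xi U \<xi> < 0 \<and> d_xi \<Theta> \<xi> > 0)) \<and>
                (\<exists>c>0. \<forall>n. \<exists>C>0. \<forall>\<xi>>0.
                   norm (nderiv_within {0..} n (perturbation (v\<^sub>p, u\<^sub>p, \<theta>\<^sub>p) V U \<Theta>) \<xi>)
                     \<le> C * exp (- c * \<xi>))))"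
      unfolding Let_def by (rule subsonic[OF e])
  qed
qed

end
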